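(* Let $n \ge 0$ be an integer. There is a $\mathrm{GL}_n$-equivariant isomorphism of $\mathbb{Z}$-schemes from the homogeneous space $\mathrm{GL}_n/S_n$ to the étale locus $\mathfrak{B}_n^{\mathrm{et}}$.
   Context: All rings and algebras are commutative, associative, and with $1$. $\mathfrak{B}_n$ is the affine finite-type $\mathbb{Z}$-scheme representing the functor that sends a scheme $S$ to the set of isomorphism classes of pairs $(\mathcal{A},\phi)$ with $\mathcal{A}$ an $\mathcal{O}_S$-algebra and $\phi\colon \mathcal{A} \to \mathcal{O}_S^{\oplus n}$ an $\mathcal{O}_S$-module isomorphism (two pairs $(\mathcal{A},\phi)$, $(\mathcal{A}',\phi')$ are identified if there is an $\mathcal{O}_S$-algebra isomorphism $\alpha\colon\mathcal{A}\to\mathcal{A}'$ with $\phi'\circ\alpha=\phi$), and sends a morphism to pullback along it. $\mathrm{GL}_n$ is the general linear group scheme over $\mathbb{Z}$; it acts on the left on $\mathfrak{B}_n$ by letting $M \in \mathrm{GL}_n(S)=\mathrm{Aut}_{\mathcal{O}_S}(\mathcal{O}_S^{\oplus n})$ send $(\mathcal{A},\phi)$ to $(\mathcal{A}, M\circ\phi)$. Given $(\mathcal{A},\phi)\in\mathfrak{B}_n(S)$, let $\mathrm{Tr}\colon\mathcal{A}\to\mathcal{O}_S$ be the trace (the trace of the multiplication endomorphism), let $e_1,\dots,e_n$ be the standard basis of $\mathcal{O}_S^{\oplus n}$ and $b_i=\phi^{-1}(e_i)$. Define the regular function $\Delta\colon\mathfrak{B}_n\to\mathbb{A}^1$ by $\Delta(\mathcal{A},\phi)=\det(\mathrm{Tr}(b_ib_j))_{i,j}\in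 H^0(S,\mathcal{O}_S)$. The étale locus $\mathfrak{B}_n^{\mathrm{et}}$ is the open affine subscheme of $\mathfrak{B}_n$ that is the complement of $\{\Delta=0\}$; it is $\mathrm{GL}_n$-invariant. $S_n$ denotes the constant group scheme over $\mathbb{Z}$ corresponding to the symmetric group on $n$ letters, embedded in $\mathrm{GL}_n$ as the subgroup of permutation matrices, and $\mathrm{GL}_n/S_n$ is the quotient by right multiplication, with $\mathrm{GL}_n$ acting by left multiplication. *)

theory Defs
  imports
    "HOL-Algebra.Module"
    "HOL-Algebra.QuotRing"
    "HOL-Combinatorics.Permutations"
    "HOL-Library.Poly_Mapping"
begin

text \<open>
  Schemes over the integers are represented by their functors of points, restricted to
  commutative rings (an arbitrary scheme is determined by this restriction, and morphisms
  of schemes are exactly the natural transformations between the restrictions).  The type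
  \<open>'r\<close> is the universe: the functors are defined on all commutative rings (the zero ring
  included) whose carrier is a set of elements of \<open>'r\<close>.  Everything is polymorphic in \<open>'r\<close>.
  The schemes considered below are affine of finite type over the integers (or spectra of
  subrings of such coordinate rings), so they have countable coordinate rings, and every
  infinite \<open>'r\<close> is already a large enough universe for Yoneda's lemma.
\<close>

section \<open>Matrices over a ring\<close>

type_synonym 'r matrix = "nat \<times> nat \<Rightarrow> 'r"

definition mat_monoid :: "'r ring \<Rightarrow> nat \<Rightarrow> 'r matrix monoid" where
  "mat_monoid R n =
     \<lparr>carrier = ({..<n} \<times> {..<n}) \<rightarrow>\<^sub>E carrier R,
      monoid.mult = (\<lambda>M N. \<lambda>(i, j) \<in> {..<n} \<times> {..<n}. \<Oplus>\<^bsub>R\<^esub>k\<in>{..<n}. M (i, k) \<otimes>\<^bsub>R\<^esub> N (k, j)),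
      one = (\<lambda>(i, j) \<in> {..<n} \<times> {..<n}. if i = j then \<one>\<^bsub>R\<^esub> else \<zero>\<^bsub>R\<^esub>)\<rparr>"

definition GL :: "nat \<Rightarrow> 'r ring \<Rightarrow> 'r matrix monoid" where
  "GL n R = units_of (mat_monoid R n)"

definition mat_vec :: "'r ring \<Rightarrow> nat \<Rightarrow> 'r matrix \<Rightarrow> (nat \<Rightarrow> 'r) \<Rightarrow> (nat \<Rightarrow> 'r)" where
  "mat_vec R n M v = (\<lambda>i\<in>{..<n}. \<Oplus>\<^bsub>R\<^esub>j\<in>{..<n}. M (i, j) \<otimes>\<^bsub>R\<^esub> v j)"

definition mat_det :: "'r ring \<Rightarrow> nat \<Rightarrow> 'r matrix \<Rightarrow> 'r" where
  "mat_det R n M =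
     (\<Oplus>\<^bsub>R\<^esub>\<sigma>\<in>{\<sigma>. \<sigma> permutes {..<n}}.
        (if evenperm \<sigma> then \<one>\<^bsub>R\<^esub> else \<ominus>\<^bsub>R\<^esub> \<one>\<^bsub>R\<^esub>) \<otimes>\<^bsub>R\<^esub> (\<Otimes>\<^bsub>R\<^esub>i\<in>{..<n}. M (i, \<sigma> i)))"

text \<open>The convention is that the permutation matrix of \<open>\<sigma>\<close> sends \<open>e\<^sub>j\<close> to \<open>e\<^bsub>\<sigma> j\<^esub>\<close>.\<close>

definition perm_mat :: "'r ring \<Rightarrow> nat \<Rightarrow> (nat \<Rightarrow> nat) \<Rightarrow> 'r matrix" where
  "perm_mat R n \<sigma> = (\<lambda>(i, j) \<in> {..<n} \<times> {..<n}. if i = \<sigma> j then \<one>\<^bsub>R\<^esub> else \<zero>\<^bsub>R\<^esub>)"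


section \<open>Functors of points with an action of the general linear group\<close>

text \<open>
  \<open>pts X R\<close> is the set of \<open>R\<close>-points, \<open>tr X R S h\<close> is the map from \<open>R\<close>-points to \<open>S\<close>-points
  induced by a ring homomorphism \<open>h\<close> from \<open>R\<close> to \<open>S\<close>, and \<open>act X R M\<close> is the action of
  an \<open>R\<close>-point \<open>M\<close> of the general linear group.
\<close>

record ('r, 'x) gl_functor =
  pts :: "'r ring \<Rightarrow> 'x set"
  tr :: "'r ring \<Rightarrow> 'r ring \<Rightarrow> ('r \<Rightarrow> 'r) \<Rightarrow> 'x \<Rightarrow> 'x"
  act :: "'r ring \<Rightarrow> 'r matrix \<Rightarrow> 'x \<Rightarrow> 'x"

definition natural_iso ::
  "('r, 'x) gl_functor \<Rightarrow> ('r, 'y) gl_functor \<Rightarrow> ('r ring \<Rightarrow> 'x \<Rightarrow> 'y) \<Rightarrow> bool" where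
  "natural_iso X Y \<eta> \<longleftrightarrow>
     (\<forall>R. cring R \<longrightarrow> bij_betw (\<eta> R) (pts X R) (pts Y R)) \<and>
     (\<forall>R S h x. cring R \<longrightarrow> cring S \<longrightarrow> h \<in> ring_hom R S \<longrightarrow> x \<in> pts X R \<longrightarrow>
        \<eta> S (tr X R S h x) = tr Y R S h (\<eta> R x))"

definition equivariant ::
  "nat \<Rightarrow> ('r, 'x) gl_functor \<Rightarrow> ('r, 'y) gl_functor \<Rightarrow> ('r ring \<Rightarrow> 'x \<Rightarrow> 'y) \<Rightarrow> bool" where
  "equivariant n X Y \<eta> \<longleftrightarrow>
     (\<forall>R M x. cring R \<longrightarrow> M \<in> carrier (GL n R) \<longrightarrow> x \<in> pts X R \<longrightarrow>
        \<eta> R (act X R M x) = act Y R M (\<eta> R x))"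


section \<open>The moduli functor of based algebras\<close>

text \<open>\<open>R\<^sup>n\<close>; its multiplicative structure (that of the product algebra) is not used below.\<close>

definition free_mod :: "'r ring \<Rightarrow> nat \<Rightarrow> ('r, nat \<Rightarrow> 'r) module" where
  "free_mod R n =
     \<lparr>carrier = {..<n} \<rightarrow>\<^sub>E carrier R,
      monoid.mult = (\<lambda>v w. \<lambda>i\<in>{..<n}. v i \<otimes>\<^bsub>R\<^esub> w i),
      one = (\<lambda>i\<in>{..<n}. \<one>\<^bsub>R\<^esub>),
      zero = (\<lambda>i\<in>{..<n}. \<zero>\<^bsub>R\<^esub>),
      add = (\<lambda>v w. \<lambda>i\<in>{..<n}. v i \<oplus>\<^bsub>R\<^esub> w i),
      smult = (\<lambda>r v. \<lambda>i\<in>{..<n}. r \<otimes>\<^bsub>R\<^esub> v i)\<rparr>"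

definition std_basis :: "'r ring \<Rightarrow> nat \<Rightarrow> nat \<Rightarrow> (nat \<Rightarrow> 'r)" where
  "std_basis R n j = (\<lambda>i\<in>{..<n}. if i = j then \<one>\<^bsub>R\<^esub> else \<zero>\<^bsub>R\<^esub>)"

definition module_iso :: "'r ring \<Rightarrow> ('r, 'a) module \<Rightarrow> ('r, 'b) module \<Rightarrow> ('a \<Rightarrow> 'b) \<Rightarrow> bool" where
  "module_iso R M N \<phi> \<longleftrightarrow>
     bij_betw \<phi> (carrier M) (carrier N) \<and>
     (\<forall>x\<in>carrier M. \<forall>y\<in>carrier M. \<phi> (x \<oplus>\<^bsub>M\<^esub> y) = \<phi> x \<oplus>\<^bsub>N\<^esub> \<phi> y) \<and>
     (\<forall>r\<in>carrier R. \<forall>x\<in>carrier M. \<phi> (r \<odot>\<^bsub>M\<^esub> x) = r \<odot>\<^bsub>N\<^esub> \<phi> x)"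

definition algebra_iso :: "'r ring \<Rightarrow> ('r, 'a) module \<Rightarrow> ('r, 'b) module \<Rightarrow> ('a \<Rightarrow> 'b) \<Rightarrow> bool" where
  "algebra_iso R A A' \<alpha> \<longleftrightarrow>
     \<alpha> \<in> ring_iso A A' \<and>
     (\<forall>r\<in>carrier R. \<forall>a\<in>carrier A. \<alpha> (r \<odot>\<^bsub>A\<^esub> a) = r \<odot>\<^bsub>A'\<^esub> \<alpha> a)"

text \<open>
  An algebra that is isomorphic to \<open>R\<^sup>n\<close> as a module is in bijection with a set of elements
  of type \<open>nat \<Rightarrow> 'r\<close>, so restricting to algebras with carrier in this type loses no
  isomorphism class of pairs.  \<^locale>\<open>algebra\<close> already requires both rings to be commutative
  with unit.
\<close>

type_synonym 'r based_alg = "('r, nat \<Rightarrow> 'r) module \<times> ((nat \<Rightarrow> 'r) \<Rightarrow> (nat \<Rightarrow> 'r))"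

definition based_algs :: "nat \<Rightarrow> 'r ring \<Rightarrow> 'r based_alg set" where
  "based_algs n R = {(A, \<phi>). algebra R A \<and> module_iso R A (free_mod R n) \<phi>}"

definition based_iso :: "nat \<Rightarrow> 'r ring \<Rightarrow> ('r based_alg \<times> 'r based_alg) set" where
  "based_iso n R =
     {((A, \<phi>), (A', \<phi>')). (A, \<phi>) \<in> based_algs n R \<and> (A', \<phi>') \<in> based_algs n R \<and>
        (\<exists>\<alpha>. algebra_iso R A A' \<alpha> \<and> (\<forall>a\<in>carrier A. \<phi>' (\<alpha> a) = \<phi> a))}"

definition B_pts :: "nat \<Rightarrow> 'r ring \<Rightarrow> 'r based_alg set set" where
  "B_pts n R = based_algs n R // based_iso n R"

text \<open>
  \<open>(A', \<phi>')\<close> is a base change of \<open>(A, \<phi>)\<close> along \<open>h\<close> if there is a ring homomorphism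
  \<open>\<psi>\<close> from \<open>A\<close> to \<open>A'\<close>, semilinear over \<open>h\<close>, that is compatible with \<open>\<phi>\<close>, \<open>\<phi>'\<close> and the
  map \<open>h\<^sup>n\<close> from \<open>R\<^sup>n\<close> to \<open>S\<^sup>n\<close>.  Such a \<open>\<psi>\<close> carries the basis given by \<open>\<phi>\<close> to
  the basis given by \<open>\<phi>'\<close>, so the induced map from \<open>A \<otimes>\<^sub>R S\<close> to \<open>A'\<close> is an isomorphism.
\<close>

definition is_base_change ::
  "nat \<Rightarrow> 'r ring \<Rightarrow> 'r ring \<Rightarrow> ('r \<Rightarrow> 'r) \<Rightarrow> 'r based_alg \<Rightarrow> 'r based_alg \<Rightarrow> bool" where
  "is_base_change n R S h = (\<lambda>(A, \<phi>) (A', \<phi>').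
     \<exists>\<psi>. \<psi> \<in> ring_hom A A' \<and>
         (\<forall>r\<in>carrier R. \<forall>a\<in>carrier A. \<psi> (r \<odot>\<^bsub>A\<^esub> a) = h r \<odot>\<^bsub>A'\<^esub> \<psi> a) \<and>
         (\<forall>a\<in>carrier A. \<forall>i<n. \<phi>' (\<psi> a) i = h (\<phi> a i)))"

definition B_tr ::
  "nat \<Rightarrow> 'r ring \<Rightarrow> 'r ring \<Rightarrow> ('r \<Rightarrow> 'r) \<Rightarrow> 'r based_alg set \<Rightarrow> 'r based_alg set" where
  "B_tr n R S h c = {q \<in> based_algs n S. \<exists>p\<in>c. is_base_change n R S h p q}"

definition B_act :: "nat \<Rightarrow> 'r ring \<Rightarrow> 'r matrix \<Rightarrow> 'r based_alg set \<Rightarrow> 'r based_alg set" where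
  "B_act n R M c = (\<Union>(A, \<phi>)\<in>c. based_iso n R `` {(A, \<lambda>a. mat_vec R n M (\<phi> a))})"

definition basis_elt :: "nat \<Rightarrow> 'r ring \<Rightarrow> 'r based_alg \<Rightarrow> nat \<Rightarrow> (nat \<Rightarrow> 'r)" where
  "basis_elt n R = (\<lambda>(A, \<phi>) i. inv_into (carrier A) \<phi> (std_basis R n i))"

text \<open>The trace of multiplication by \<open>a\<close>, computed in the basis \<open>b\<^sub>i\<close>.\<close>

definition alg_trace :: "nat \<Rightarrow> 'r ring \<Rightarrow> 'r based_alg \<Rightarrow> (nat \<Rightarrow> 'r) \<Rightarrow> 'r" where
  "alg_trace n R = (\<lambda>(A, \<phi>) a. \<Oplus>\<^bsub>R\<^esub>i\<in>{..<n}. \<phi> (a \<otimes>\<^bsub>A\<^esub> basis_elt n R (A, \<phi>) i) i)"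

definition disc :: "nat \<Rightarrow> 'r ring \<Rightarrow> 'r based_alg \<Rightarrow> 'r" where
  "disc n R p =
     mat_det R n (\<lambda>(i, j) \<in> {..<n} \<times> {..<n}.
       alg_trace n R p (basis_elt n R p i \<otimes>\<^bsub>fst p\<^esub> basis_elt n R p j))"

text \<open>\<^const>\<open>disc\<close> is constant on isomorphism classes of pairs.\<close>

definition Delta :: "nat \<Rightarrow> 'r ring \<Rightarrow> 'r based_alg set \<Rightarrow> 'r" where
  "Delta n R c = the_elem (disc n R ` c)"

text \<open>
  The open subscheme complementary to \<open>\<Delta> = 0\<close>: its \<open>R\<close>-points are the \<open>R\<close>-points at which
  \<open>\<Delta>\<close> vanishes at no point of the spectrum of \<open>R\<close>, that is, is invertible in \<open>R\<close>.
\<close>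

definition B_et :: "nat \<Rightarrow> ('r, 'r based_alg set) gl_functor" where
  "B_et n =
     \<lparr>pts = (\<lambda>R. {c \<in> B_pts n R. Delta n R c \<in> Units R}),
      tr = B_tr n,
      act = B_act n\<rparr>"


section \<open>Coordinate rings of powers of the general linear group\<close>

text \<open>
  \<open>zpoly V\<close> is the ring of polynomials with integer coefficients in the variables \<open>V\<close>;
  a monomial is a finitely supported exponent function.
\<close>

type_synonym 'v int_mpoly = "('v \<Rightarrow>\<^sub>0 nat) \<Rightarrow>\<^sub>0 int"

definition mvar :: "'v \<Rightarrow> 'v int_mpoly" where
  "mvar v = Poly_Mapping.single (Poly_Mapping.single v 1) 1"

definition zpoly :: "'v set \<Rightarrow> 'v int_mpoly ring" where
  "zpoly V =
     \<lparr>carrier = {p. \<forall>m\<in>Poly_Mapping.keys p. Poly_Mapping.keys m \<subseteq> V},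
      monoid.mult = (*), one = 1, zero = 0, add = (+)\<rparr>"

definition peval :: "'r ring \<Rightarrow> ('v \<Rightarrow> 'r) \<Rightarrow> 'v int_mpoly \<Rightarrow> 'r" where
  "peval R val p =
     (\<Oplus>\<^bsub>R\<^esub>m\<in>Poly_Mapping.keys p.
        [Poly_Mapping.lookup p m] \<cdot>\<^bsub>R\<^esub>
          (\<Otimes>\<^bsub>R\<^esub>v\<in>Poly_Mapping.keys m. val v [^]\<^bsub>R\<^esub> Poly_Mapping.lookup m v))"

text \<open>
  \<open>O_GL k n\<close> is the coordinate ring of the \<open>k\<close>-fold product of the general linear group
  with itself.  The variable \<open>Ent l i j\<close> is the \<open>(i, j)\<close> entry of the \<open>l\<close>-th matrix, and
  \<open>Dinv l\<close> is the inverse of its determinant (\<open>l < k\<close>; all indices start from 0).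
\<close>

datatype gl_var = Ent nat nat nat | Dinv nat

definition gl_vars :: "nat \<Rightarrow> nat \<Rightarrow> gl_var set" where
  "gl_vars k n = {Ent l i j | l i j. l < k \<and> i < n \<and> j < n} \<union> {Dinv l | l. l < k}"

definition gl_ideal :: "nat \<Rightarrow> nat \<Rightarrow> gl_var int_mpoly set" where
  "gl_ideal k n =
     genideal (zpoly (gl_vars k n))
       {mvar (Dinv l) * mat_det (zpoly (gl_vars k n)) n (\<lambda>(i, j). mvar (Ent l i j)) - 1 | l. l < k}"

type_synonym gl_fun = "gl_var int_mpoly set"

definition O_GL :: "nat \<Rightarrow> nat \<Rightarrow> gl_fun ring" where
  "O_GL k n = zpoly (gl_vars k n) Quot gl_ideal k n"

definition univ_mat :: "nat \<Rightarrow> nat \<Rightarrow> nat \<Rightarrow> gl_fun matrix" where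
  "univ_mat k n l =
     (\<lambda>(i, j) \<in> {..<n} \<times> {..<n}. gl_ideal k n +>\<^bsub>zpoly (gl_vars k n)\<^esub> mvar (Ent l i j))"

text \<open>
  The ring homomorphism from \<open>O_GL k n\<close> to \<open>R\<close> that corresponds to the invertible matrices
  \<open>Ms 0, \<dots>, Ms (k - 1)\<close> over \<open>R\<close>.
\<close>

definition gl_eval :: "nat \<Rightarrow> 'r ring \<Rightarrow> (nat \<Rightarrow> 'r matrix) \<Rightarrow> gl_fun \<Rightarrow> 'r" where
  "gl_eval n R Ms g =
     the_elem (peval R (\<lambda>v. case v of Ent l i j \<Rightarrow> Ms l (i, j)
                                    | Dinv l \<Rightarrow> inv\<^bsub>R\<^esub> (mat_det R n (Ms l))) ` g)"


section \<open>The homogeneous space\<close>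

text \<open>
  The quotient of an affine scheme by a finite (constant) group is the spectrum of the ring of
  invariants.  Right multiplication by the permutation matrix of \<open>\<sigma>\<close> acts on coordinate
  functions by evaluation at the universal matrix times that permutation matrix.
\<close>

definition right_transl :: "nat \<Rightarrow> (nat \<Rightarrow> nat) \<Rightarrow> gl_fun \<Rightarrow> gl_fun" where
  "right_transl n \<sigma> =
     gl_eval n (O_GL 1 n)
       (\<lambda>_. univ_mat 1 n 0 \<otimes>\<^bsub>mat_monoid (O_GL 1 n) n\<^esub> perm_mat (O_GL 1 n) n \<sigma>)"

definition O_quot :: "nat \<Rightarrow> gl_fun ring" where
  "O_quot n =
     (O_GL 1 n)\<lparr>carrier :=
        {g \<in> carrier (O_GL 1 n). \<forall>\<sigma>. \<sigma> permutes {..<n} \<longrightarrow> right_transl n \<sigma> g = g}\<rparr>"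

text \<open>
  \<open>coaction_decomp n g K a c\<close> says that the comultiplication of the general linear group,
  that is, the function \<open>(Y, X) \<mapsto> g (Y X)\<close>, sends \<open>g\<close> to the sum of
  \<open>a k \<otimes> c k\<close> over \<open>k < K\<close>, where the \<open>c k\<close> are invariant functions.  Every invariant \<open>g\<close>
  has such decompositions: if \<open>g (Y X) * (det Y * det X)\<^sup>m\<close> is written as a sum of monomials in
  the entries of \<open>Y\<close> with coefficients depending on \<open>X\<close>, then these coefficients, divided by
  \<open>(det X)\<^sup>m\<close>, are invariant.
\<close>

definition coaction_decomp ::
  "nat \<Rightarrow> gl_fun \<Rightarrow> nat \<Rightarrow> (nat \<Rightarrow> gl_fun) \<Rightarrow> (nat \<Rightarrow> gl_fun) \<Rightarrow> bool" where
  "coaction_decomp n g K a c \<longleftrightarrow>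
     (\<forall>k<K. a k \<in> carrier (O_GL 1 n) \<and> c k \<in> carrier (O_quot n)) \<and>
     gl_eval n (O_GL 2 n) (\<lambda>_. univ_mat 2 n 0 \<otimes>\<^bsub>mat_monoid (O_GL 2 n) n\<^esub> univ_mat 2 n 1) g =
       (\<Oplus>\<^bsub>O_GL 2 n\<^esub>k\<in>{..<K}.
          gl_eval n (O_GL 2 n) (\<lambda>_. univ_mat 2 n 0) (a k) \<otimes>\<^bsub>O_GL 2 n\<^esub>
          gl_eval n (O_GL 2 n) (\<lambda>_. univ_mat 2 n 1) (c k))"

text \<open>
  The action on \<open>R\<close>-points of the quotient induced by left multiplication.  The point \<open>f\<close> is
  moved by \<open>M\<close> to the composite of the coaction, from \<open>O_quot n\<close> to
  \<open>O_GL 1 n \<otimes> O_quot n\<close>, with the homomorphism to \<open>R\<close> given by \<open>M\<close> and \<open>f\<close>.  The value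
  does not depend on the decomposition, since \<open>O_GL 1 n \<otimes> O_quot n\<close> is a subring of
  \<open>O_GL 1 n \<otimes> O_GL 1 n\<close> (\<open>O_GL 1 n\<close> is flat over the integers), which is \<open>O_GL 2 n\<close>.
\<close>

definition quot_act :: "nat \<Rightarrow> 'r ring \<Rightarrow> 'r matrix \<Rightarrow> (gl_fun \<Rightarrow> 'r) \<Rightarrow> (gl_fun \<Rightarrow> 'r)" where
  "quot_act n R M f =
     (\<lambda>g\<in>carrier (O_quot n). THE r. \<exists>K a c. coaction_decomp n g K a c \<and>
        r = (\<Oplus>\<^bsub>R\<^esub>k\<in>{..<K}. gl_eval n R (\<lambda>_. M) (a k) \<otimes>\<^bsub>R\<^esub> f (c k)))"

definition GL_mod_S :: "nat \<Rightarrow> ('r, gl_fun \<Rightarrow> 'r) gl_functor" where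
  "GL_mod_S n =
     \<lparr>pts = (\<lambda>R. ring_hom (O_quot n) R \<inter> extensional (carrier (O_quot n))),
      tr = (\<lambda>R S h f. compose (carrier (O_quot n)) h f),
      act = quot_act n\<rparr>"

end

theory Submission
  imports Defs "HOL-Algebra.Generated_Rings"
begin

text \<open>
  An invertible matrix \<open>X\<close> is a basis of the split algebra \<open>R\<^sup>n\<close>, and permuting the columns of \<open>X\<close>
  changes neither the structure constants nor the unit vector of the resulting based algebra.
  Conversely these functions and the entries of the inverse of the trace form generate the invariant
  functions of \<open>X\<close>: the invariant trace of \<open>(\<Prod>l. X\<^bsub>ll\<^esub>) / det X\<close> is \<open>1\<close>, so every invariant is an
  invariant trace, and the entries of \<open>X\<close> are combinations of those of its inverse with coefficients from the
  inverse trace form, while the invariant trace of a product of one entry from each row of \<open>X\<^sup>-\<^sup>1\<close> is a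
  mixed discriminant, hence a polynomial in the structure constants.  A point of the quotient is
  therefore determined by the structure constants and the unit vector of an algebra.

  For the existence of a point, an algebra \<open>A\<close> with invertible discriminant has to become split over an
  extension of \<open>R\<close>.  The quotient of the \<open>n\<close>-fold tensor power of \<open>A\<close> by the radical of the polarized
  norm form \<open>D\<close> is such an extension.  It contains \<open>R\<close> because the alternating sum over \<open>\<tau>\<close> of the
  values of \<open>D\<close> at the tensors with \<open>l\<close>-th factor \<open>b\<^sub>l b\<^bsub>\<tau> l\<^esub>\<close> is the discriminant.  The action is computed
  over the same extension, where it is multiplication of matrices.
\<close>

section \<open>Transfer of identities from integer polynomials to arbitrary commutative
  rings\<close>

section \<open>Evaluation of integer polynomials\<close>

text \<open>Invariants cannot be averaged, because n! is not invertible over the integers; a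
  function of invariant trace 1 takes the place of the division, and its trace is the Leibniz
  expansion of det X divided by det X. The second obstacle is an explicit splitting of an algebra
  \<open>A\<close> over an arbitrary ring. When \<open>A\<close> is split, \<open>D\<close> is a
  permanent, and its radical in the tensor power consists of the functions on n-tuples of points
  that vanish at all permutations. So the quotient is the algebra of orderings of the points of
  \<open>A\<close>, the torsor of S_n that has to occur. What makes it usable without any descent
  theory is that \<open>D\<close> vanishes in n + 1 arguments: in the quotient the sum of the n
  images of an element becomes its trace, and the inverse trace form then inverts the matrix of the
  n homomorphisms. The splitting ring lives in another type than \<open>R\<close>, which is harmless
  since it occurs only inside proofs. Identities about determinants and mixed discriminants are
  proved for rings given as types and carried to an arbitrary \<open>R\<close> by evaluating integer
  polynomials whose variables are the elements of \<open>R\<close>.\<close>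

lemma poly_mapping_diff_induct [case_names zero monom diff]:
  fixes p :: "'a \<Rightarrow>\<^sub>0 int"
  assumes "P 0" "\<And>m. P (Poly_Mapping.single m 1)" "\<And>a b. P a \<Longrightarrow> P b \<Longrightarrow> P (a - b)"
  shows "P p"
  by (rule frag_induction[of p UNIV P]) (use assms in auto)

lemma add_pow_int_zero: "[(0::int)] \<cdot>\<^bsub>R\<^esub> x = \<zero>\<^bsub>R\<^esub>"
  by (simp add: add_pow_def int_pow_def nat_pow_def)

text \<open>The additive extension is kept apart from the evaluation of monomials because it serves
  two weights: a multiplicative one, for which it is \<open>peval\<close>, and later
  \<open>split_weight\<close>, which is not multiplicative.\<close>

definition lin_ext :: "('r, 'x) ring_scheme \<Rightarrow> ('m \<Rightarrow> 'r) \<Rightarrow> ('m \<Rightarrow>\<^sub>0 int) \<Rightarrow> 'r" where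
  "lin_ext R w p = (\<Oplus>\<^bsub>R\<^esub>m\<in>Poly_Mapping.keys p. [Poly_Mapping.lookup p m] \<cdot>\<^bsub>R\<^esub> w m)"

text \<open>Stated for a \<open>ring_scheme\<close>, so that monomials can also be evaluated in an
  algebra, whose type is \<open>module\<close>.\<close>

definition mono_eval :: "('r, 'x) ring_scheme \<Rightarrow> ('v \<Rightarrow> 'r) \<Rightarrow> ('v \<Rightarrow>\<^sub>0 nat) \<Rightarrow> 'r" where
  "mono_eval R val m = (\<Otimes>\<^bsub>R\<^esub>v\<in>Poly_Mapping.keys m. val v [^]\<^bsub>R\<^esub> Poly_Mapping.lookup m v)"

lemma peval_lin_ext: "peval R val = lin_ext R (mono_eval R val)"
  by (simp add: fun_eq_iff peval_def lin_ext_def mono_eval_def)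

context
  fixes R :: "('r, 'x) ring_scheme" (structure)
  assumes R: "cring R"
begin

interpretation cring R by (rule R)

lemma lin_ext_superset:
  assumes "\<And>m. w m \<in> carrier R" "finite K" "Poly_Mapping.keys p \<subseteq> K"
  shows "lin_ext R w p = (\<Oplus>m\<in>K. [Poly_Mapping.lookup p m] \<cdot> w m)"
  unfolding lin_ext_def
  by (rule add.finprod_mono_neutral_cong_left)
    (use assms add_pow_int_zero in \<open>auto simp: in_keys_iff add.int_pow_closed\<close>)

lemma lin_ext_closed [simp]:
  assumes "\<And>m. w m \<in> carrier R" shows "lin_ext R w p \<in> carrier R"
  unfolding lin_ext_def using assms by (auto intro!: finsum_closed)

lemma lin_ext_zero [simp]: "lin_ext R w 0 = \<zero>"
  by (simp add: lin_ext_def)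

lemma lin_ext_monom [simp]:
  assumes "\<And>m. w m \<in> carrier R" shows "lin_ext R w (Poly_Mapping.single m 1) = w m"
  by (simp add: lin_ext_def assms)

lemma lin_ext_add:
  assumes w: "\<And>m. w m \<in> carrier R"
  shows "lin_ext R w (p + q) = lin_ext R w p \<oplus> lin_ext R w q"
proof -
  define K where "K = Poly_Mapping.keys p \<union> Poly_Mapping.keys q"
  have K: "finite K" "Poly_Mapping.keys p \<subseteq> K" "Poly_Mapping.keys q \<subseteq> K" "Poly_Mapping.keys (p + q) \<subseteq> K"
    using keys_add[of p q] by (auto simp: K_def)
  show ?thesis
    by (simp add: lin_ext_superset[OF w K(1)] K w lookup_add add.int_pow_mult Pi_def)
qed

lemma lin_ext_uminus:
  assumes w: "\<And>m. w m \<in> carrier R" shows "lin_ext R w (- p) = \<ominus> lin_ext R w p"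
proof -
  have "lin_ext R w (- p) \<oplus> lin_ext R w p = \<zero>"
    using lin_ext_add[OF w, where p = "- p" and q = p] by simp
  then show ?thesis by (simp add: add.inv_equality w)
qed

lemma lin_ext_diff:
  assumes w: "\<And>m. w m \<in> carrier R"
  shows "lin_ext R w (p - q) = lin_ext R w p \<ominus> lin_ext R w q"
  using lin_ext_add[OF w, where p = p and q = "- q"] lin_ext_uminus[OF w, where p = q] by (simp add: minus_eq)

lemma lin_ext_sum:
  assumes w: "\<And>m. w m \<in> carrier R"
  shows "lin_ext R w (\<Sum>i\<in>I. p i) = (\<Oplus>i\<in>I. lin_ext R w (p i))"
  by (induction I rule: infinite_finite_induct) (simp_all add: w lin_ext_add Pi_def)

text \<open>Both sides are additive in each factor, so monomials suffice; there the claim is the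
  assumption on \<open>w\<close>.\<close>

lemma lin_ext_mult:
  assumes w: "\<And>m. w m \<in> carrier R" and mult: "\<And>m m'. w (m + m') = w m \<otimes> w m'"
  shows "lin_ext R w (p * q) = lin_ext R w p \<otimes> lin_ext R w q"
proof (induction p rule: poly_mapping_diff_induct)
  case (monom m)
  show ?case
    by (induction q rule: poly_mapping_diff_induct)
      (simp_all add: w mult mult_single lin_ext_diff right_diff_distrib minus_eq r_distr r_minus)
qed (simp_all add: w left_diff_distrib lin_ext_diff minus_eq l_distr l_minus)

lemma mono_eval_superset:
  assumes "\<And>v. val v \<in> carrier R" "finite K" "Poly_Mapping.keys m \<subseteq> K"
  shows "mono_eval R val m = (\<Otimes>v\<in>K. val v [^] Poly_Mapping.lookup m v)"
  unfolding mono_eval_def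
  by (rule finprod_mono_neutral_cong_left) (use assms in \<open>auto simp: in_keys_iff\<close>)

lemma mono_eval_closed [simp]:
  assumes "\<And>v. val v \<in> carrier R" shows "mono_eval R val m \<in> carrier R"
  unfolding mono_eval_def using assms by (auto intro!: finprod_closed)

lemma mono_eval_zero [simp]: "mono_eval R val 0 = \<one>"
  by (simp add: mono_eval_def)

lemma mono_eval_single [simp]:
  assumes "\<And>v. val v \<in> carrier R" shows "mono_eval R val (Poly_Mapping.single v (Suc 0)) = val v"
  by (simp add: mono_eval_def assms)

lemma mono_eval_add:
  assumes w: "\<And>v. val v \<in> carrier R"
  shows "mono_eval R val (m + m') = mono_eval R val m \<otimes> mono_eval R val m'"
proof -
  define K where "K = Poly_Mapping.keys m \<union> Poly_Mapping.keys m'"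
  have K: "finite K" "Poly_Mapping.keys m \<subseteq> K" "Poly_Mapping.keys m' \<subseteq> K" "Poly_Mapping.keys (m + m') \<subseteq> K"
    using keys_add[of m m'] by (auto simp: K_def)
  show ?thesis
    by (simp add: mono_eval_superset[OF w K(1)] K w lookup_add nat_pow_mult[symmetric] Pi_def)
qed

end

section \<open>Ring homomorphisms from rings given as types\<close>

text \<open>A bridge between two kinds of rings. On the source, a ring given as a type,
  \<open>sum\<close>, \<open>prod\<close> and the ring laws apply without membership conditions; on
  the target every value lies in the carrier.\<close>

locale class_ring_hom = cring R for R :: "'r ring" (structure) +
  fixes h :: "'c::comm_ring_1 \<Rightarrow> 'r"
  assumes hom_closed [simp]: "h x \<in> carrier R"
    and hom_add: "h (x + y) = h x \<oplus> h y"
    and hom_mult: "h (x * y) = h x \<otimes> h y"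
    and hom_one: "h 1 = \<one>"
begin

lemma hom_zero: "h 0 = \<zero>"
  using hom_add[of 0 0] by (metis add_0 add.r_cancel_one' hom_closed)

lemma hom_uminus: "h (- x) = \<ominus> h x"
  using hom_add[of "- x" x] by (simp add: hom_zero add.inv_equality)

lemma hom_sum: "h (\<Sum>i\<in>I. f i) = (\<Oplus>i\<in>I. h (f i))"
  by (induction I rule: infinite_finite_induct) (simp_all add: hom_zero hom_add Pi_def)

lemma hom_prod: "h (\<Prod>i\<in>I. f i) = (\<Otimes>i\<in>I. h (f i))"
  by (induction I rule: infinite_finite_induct) (simp_all add: hom_one hom_mult Pi_def)

end

lemma peval_class_ring_hom:
  assumes "cring R" "\<And>v. val v \<in> carrier R"
  shows "class_ring_hom R (peval R val)"
proof -
  interpret cring R by fact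
  show ?thesis
    unfolding peval_lin_ext
  proof
    show "lin_ext R (mono_eval R val) 1 = \<one>\<^bsub>R\<^esub>"
      using lin_ext_monom[OF assms(1), of "mono_eval R val" 0]
      by (simp add: assms mono_eval_closed[OF assms(1)] mono_eval_zero[OF assms(1)])
  qed (auto simp: assms lin_ext_add lin_ext_mult mono_eval_add)
qed

lemma peval_mvar [simp]:
  assumes "cring R" "\<And>v. val v \<in> carrier R"
  shows "peval R val (mvar v) = val v"
  using assms by (simp add: peval_lin_ext mvar_def)

text \<open>Every ring with a carrier is the image of a polynomial ring whose variables are its
  elements, so a polynomial identity between elements follows from the same identity between
  variables. Values outside the carrier are replaced by zero, which makes the evaluation
  total.\<close>

lemma ex_class_ring_hom:
  fixes R :: "'r ring"
  assumes "cring R"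
  obtains h :: "'r int_mpoly \<Rightarrow> 'r" where "class_ring_hom R h" "\<And>r. r \<in> carrier R \<Longrightarrow> h (mvar r) = r"
proof
  interpret cring R by fact
  let ?val = "\<lambda>r. if r \<in> carrier R then r else \<zero>\<^bsub>R\<^esub>"
  show "class_ring_hom R (peval R ?val)"
    by (rule peval_class_ring_hom) (use assms in auto)
  show "peval R ?val (mvar r) = r" if "r \<in> carrier R" for r
    using peval_mvar[OF assms, where val = ?val and v = r] that by auto
qed

section \<open>Subrings of polynomials and their quotients\<close>

lemma zpoly_simps [simp]:
  "monoid.mult (zpoly V) = (*)" "\<one>\<^bsub>zpoly V\<^esub> = 1" "\<zero>\<^bsub>zpoly V\<^esub> = 0" "ring.add (zpoly V) = (+)"
  by (simp_all add: zpoly_def)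

lemma carrier_zpoly: "p \<in> carrier (zpoly V) \<longleftrightarrow> (\<forall>m\<in>Poly_Mapping.keys p. Poly_Mapping.keys m \<subseteq> V)"
  by (simp add: zpoly_def)

lemma mvar_zpoly: "v \<in> V \<Longrightarrow> mvar v \<in> carrier (zpoly V)"
  by (simp add: carrier_zpoly mvar_def)

lemma zpoly_cring: "cring (zpoly V)"
proof (rule cringI)
  show "abelian_group (zpoly V)"
  proof (rule abelian_groupI)
    fix x assume "x \<in> carrier (zpoly V)"
    then show "\<exists>y\<in>carrier (zpoly V). y \<oplus>\<^bsub>zpoly V\<^esub> x = \<zero>\<^bsub>zpoly V\<^esub>"
      by (intro bexI[of _ "- x"]) (auto simp: carrier_zpoly)
  next
    fix x y assume "x \<in> carrier (zpoly V)" "y \<in> carrier (zpoly V)"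
    then show "x \<oplus>\<^bsub>zpoly V\<^esub> y \<in> carrier (zpoly V)"
      using keys_add[of x y] by (auto simp: carrier_zpoly)
  qed (auto simp: carrier_zpoly algebra_simps)
  show "comm_monoid (zpoly V)"
  proof (rule comm_monoidI)
    fix x y assume xy: "x \<in> carrier (zpoly V)" "y \<in> carrier (zpoly V)"
    have "Poly_Mapping.keys m \<subseteq> V" if m: "m \<in> Poly_Mapping.keys (x * y)" for m
    proof -
      obtain a b where "m = a + b" "a \<in> Poly_Mapping.keys x" "b \<in> Poly_Mapping.keys y"
        using m keys_mult[of x y] by fast
      then show ?thesis using keys_add[of a b] xy by (auto simp: carrier_zpoly)
    qed
    then show "x \<otimes>\<^bsub>zpoly V\<^esub> y \<in> carrier (zpoly V)" by (auto simp: carrier_zpoly)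
  qed (auto simp: carrier_zpoly algebra_simps)
qed (auto simp: algebra_simps)

lemma zpoly_a_inv [simp]: "p \<in> carrier (zpoly V) \<Longrightarrow> \<ominus>\<^bsub>zpoly V\<^esub> p = - p"
proof -
  interpret cring "zpoly V" by (rule zpoly_cring)
  assume "p \<in> carrier (zpoly V)"
  then show ?thesis
    using add.inv_equality[of "- p" p] by (simp add: carrier_zpoly)
qed

lemma zpoly_finsum:
  assumes "\<And>i. i \<in> I \<Longrightarrow> f i \<in> carrier (zpoly V)"
  shows "(\<Oplus>\<^bsub>zpoly V\<^esub>i\<in>I. f i) = (\<Sum>i\<in>I. f i)"
proof -
  interpret cring "zpoly V" by (rule zpoly_cring)
  show ?thesis
    using assms by (induction I rule: infinite_finite_induct) (simp_all add: Pi_def)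
qed

lemma peval_cong:
  assumes "cring R" "\<And>v. v \<in> V \<Longrightarrow> val v = val' v" "p \<in> carrier (zpoly V)"
    "\<And>v. v \<in> V \<Longrightarrow> val v \<in> carrier R"
  shows "peval R val p = peval R val' p"
proof -
  interpret cring R by fact
  have keys: "val v = val' v \<and> val v \<in> carrier R"
    if "m \<in> Poly_Mapping.keys p" "v \<in> Poly_Mapping.keys m" for m v
  proof -
    have "v \<in> V" using that assms(3) by (auto simp: carrier_zpoly)
    then show ?thesis using assms(2,4) by metis
  qed
  have "(\<Otimes>\<^bsub>R\<^esub>v\<in>Poly_Mapping.keys m. val v [^]\<^bsub>R\<^esub> Poly_Mapping.lookup m v) =
      (\<Otimes>\<^bsub>R\<^esub>v\<in>Poly_Mapping.keys m. val' v [^]\<^bsub>R\<^esub> Poly_Mapping.lookup m v)"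
    "(\<Otimes>\<^bsub>R\<^esub>v\<in>Poly_Mapping.keys m. val' v [^]\<^bsub>R\<^esub> Poly_Mapping.lookup m v) \<in> carrier R"
    if "m \<in> Poly_Mapping.keys p" for m
  proof -
    have "val v [^]\<^bsub>R\<^esub> k \<in> carrier R" "val' v [^]\<^bsub>R\<^esub> k = val v [^]\<^bsub>R\<^esub> k"
      if "v \<in> Poly_Mapping.keys m" for v and k :: nat
      using keys[OF \<open>m \<in> Poly_Mapping.keys p\<close> that] by auto
    then show "(\<Otimes>\<^bsub>R\<^esub>v\<in>Poly_Mapping.keys m. val v [^]\<^bsub>R\<^esub> Poly_Mapping.lookup m v) =
      (\<Otimes>\<^bsub>R\<^esub>v\<in>Poly_Mapping.keys m. val' v [^]\<^bsub>R\<^esub> Poly_Mapping.lookup m v)"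
      "(\<Otimes>\<^bsub>R\<^esub>v\<in>Poly_Mapping.keys m. val' v [^]\<^bsub>R\<^esub> Poly_Mapping.lookup m v) \<in> carrier R"
      by (auto intro!: finprod_cong' finprod_closed)
  qed
  then show ?thesis
    unfolding peval_def by (intro finsum_cong') auto
qed

text \<open>The values outside \<open>V\<close> are arbitrary, whereas the homomorphism from the
  full polynomial ring needs all of them in \<open>R\<close>. Hence the detour through
  \<open>val'\<close>, which agrees with \<open>val\<close> on \<open>V\<close> and is zero
  elsewhere.\<close>

lemma peval_ring_hom:
  assumes R: "cring R" and val: "\<And>v. v \<in> V \<Longrightarrow> val v \<in> carrier R"
  shows "peval R val \<in> ring_hom (zpoly V) R"
    and "v \<in> V \<Longrightarrow> peval R val (mvar v) = val v"
proof -
  interpret cring R by fact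
  define val' where "val' v = (if v \<in> V then val v else \<zero>\<^bsub>R\<^esub>)" for v
  have val': "val' v \<in> carrier R" for v by (auto simp: val'_def val)
  interpret h: class_ring_hom R "peval R val'"
    by (rule peval_class_ring_hom) (simp_all add: R val')
  interpret Z: cring "zpoly V" by (rule zpoly_cring)
  have eq: "peval R val p = peval R val' p" if "p \<in> carrier (zpoly V)" for p
    by (rule peval_cong[OF R _ that]) (auto simp: val'_def val)
  show "peval R val \<in> ring_hom (zpoly V) R"
  proof (rule ring_hom_memI)
    fix x y assume xy: "x \<in> carrier (zpoly V)" "y \<in> carrier (zpoly V)"
    then show "peval R val (x \<otimes>\<^bsub>zpoly V\<^esub> y) = peval R val x \<otimes>\<^bsub>R\<^esub> peval R val y"
      using eq[OF Z.m_closed[OF xy]] by (simp add: eq h.hom_mult)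
    show "peval R val (x \<oplus>\<^bsub>zpoly V\<^esub> y) = peval R val x \<oplus>\<^bsub>R\<^esub> peval R val y"
      using eq[OF Z.a_closed[OF xy]] xy by (simp add: eq h.hom_add)
  qed (use eq[OF Z.one_closed] in \<open>auto simp: eq h.hom_one\<close>)
  show "peval R val (mvar v) = val v" if "v \<in> V"
    using that R val' by (subst eq) (auto simp: mvar_zpoly val'_def)
qed

text \<open>A monomial is a product of powers of variables, and a polynomial is obtained from
  monomials by subtraction.\<close>

lemma zpoly_generated: "carrier (zpoly V) \<subseteq> generate_ring (zpoly V) (mvar ` V)" (is "_ \<subseteq> ?G")
proof
  interpret cring "zpoly V" by (rule zpoly_cring)
  have sub: "mvar ` V \<subseteq> carrier (zpoly V)" by (auto simp: mvar_zpoly)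
  have G: "?G \<subseteq> carrier (zpoly V)" by (rule generate_ring_incl[OF sub])
  have monom: "Poly_Mapping.single m 1 \<in> ?G" if "Poly_Mapping.keys m \<subseteq> V" for m
  proof -
    have "m = (\<Sum>v\<in>Poly_Mapping.keys m. Poly_Mapping.single v (Poly_Mapping.lookup m v))"
      by (rule poly_mapping_eqI)
        (auto simp: lookup_sum lookup_single when_def in_keys_iff sum.delta')
    moreover have "Poly_Mapping.single (\<Sum>v\<in>K. Poly_Mapping.single v (f v :: nat)) 1 \<in> ?G"
      if "finite K" "K \<subseteq> V" for K f
      using that
    proof (induction K rule: finite_induct)
      case empty
      show ?case using generate_ring.one[of "zpoly V"] by simp
    next
      case (insert v K)
      have v: "mvar v \<in> ?G" using insert by (auto intro: generate_ring.incl)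
      have "Poly_Mapping.single (Poly_Mapping.single v e) 1 \<in> ?G" for e
      proof (induction e)
        case 0 show ?case using generate_ring.one[of "zpoly V"] by simp
      next
        case (Suc e)
        have "Poly_Mapping.single (Poly_Mapping.single v (Suc e)) (1::int) =
            mvar v * Poly_Mapping.single (Poly_Mapping.single v e) 1"
          by (simp add: mvar_def mult_single single_add[symmetric])
        then show ?case using generate_ring.eng_mult[OF v Suc] by simp
      qed
      from generate_ring.eng_mult[OF this[of "f v"] insert.IH] show ?case
        using insert by (simp add: mult_single)
    qed
    ultimately show ?thesis using that finite_keys by metis
  qed
  fix p :: "'a int_mpoly" assume "p \<in> carrier (zpoly V)"
  then have "Poly_Mapping.keys p \<subseteq> {m. Poly_Mapping.keys m \<subseteq> V}" by (auto simp: carrier_zpoly)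
  then show "p \<in> ?G"
  proof (induction p rule: frag_induction)
    case zero
    show ?case using zero_in_generate[of "mvar ` V"] by simp
  next
    case (one m)
    then show ?case by (simp add: monom)
  next
    case (diff a b)
    have "- b \<in> ?G" using generate_ring.a_inv[OF diff(2)] diff(2) G by auto
    from generate_ring.eng_add[OF diff(1) this] show ?case by simp
  qed
qed

text \<open>The homomorphism is constant on each coset of \<open>I\<close>, so the image of a coset
  is a singleton and \<open>the_elem\<close> extracts its value. The universal property takes this
  form because \<open>gl_eval\<close> is written with \<open>the_elem\<close>.\<close>

lemma quot_ring_hom:
  assumes S: "cring S" and R: "cring R" and I: "ideal I S" and h: "h \<in> ring_hom S R"
    and ker: "\<And>x. x \<in> I \<Longrightarrow> h x = \<zero>\<^bsub>R\<^esub>"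
  shows "x \<in> carrier S \<Longrightarrow> the_elem (h ` (I +>\<^bsub>S\<^esub> x)) = h x"
    and "(\<lambda>g. the_elem (h ` g)) \<in> ring_hom (S Quot I) R"
proof -
  interpret S: cring S by fact
  interpret R: cring R by fact
  interpret I: ideal I S by fact
  interpret h: ring_hom_cring S R h by unfold_locales (rule h)
  have coset: "h ` (I +>\<^bsub>S\<^esub> x) = {h x}" if "x \<in> carrier S" for x
  proof -
    have "h (i \<oplus>\<^bsub>S\<^esub> x) = h x" if "i \<in> I" for i
      using \<open>x \<in> carrier S\<close> that ker I.Icarr by simp
    moreover have "I \<noteq> {}" using I.zero_closed by blast
    ultimately show ?thesis by (auto simp: a_r_coset_def' image_UN image_image)
  qed
  show eq: "x \<in> carrier S \<Longrightarrow> the_elem (h ` (I +>\<^bsub>S\<^esub> x)) = h x" for x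
    by (simp add: coset)
  have carr: "g \<in> carrier (S Quot I) \<longleftrightarrow> (\<exists>x\<in>carrier S. g = I +>\<^bsub>S\<^esub> x)" for g
    by (auto simp: FactRing_def A_RCOSETS_def')
  have q: "(+>\<^bsub>S\<^esub>) I \<in> ring_hom S (S Quot I)" by (rule I.rcos_ring_hom)
  show "(\<lambda>g. the_elem (h ` g)) \<in> ring_hom (S Quot I) R"
  proof (rule ring_hom_memI)
    fix x y assume "x \<in> carrier (S Quot I)" "y \<in> carrier (S Quot I)"
    then obtain a b where ab: "a \<in> carrier S" "x = I +>\<^bsub>S\<^esub> a" "b \<in> carrier S" "y = I +>\<^bsub>S\<^esub> b"
      by (auto simp: carr)
    then show "the_elem (h ` (x \<otimes>\<^bsub>S Quot I\<^esub> y)) = the_elem (h ` x) \<otimes>\<^bsub>R\<^esub> the_elem (h ` y)"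
      by (simp add: ring_hom_mult[OF q, symmetric] eq)
    show "the_elem (h ` (x \<oplus>\<^bsub>S Quot I\<^esub> y)) = the_elem (h ` x) \<oplus>\<^bsub>R\<^esub> the_elem (h ` y)"
      using ab by (simp add: ring_hom_add[OF q, symmetric] eq)
  next
    show "the_elem (h ` \<one>\<^bsub>S Quot I\<^esub>) = \<one>\<^bsub>R\<^esub>"
      by (simp add: ring_hom_one[OF q, symmetric] eq)
  qed (auto simp: carr eq)
qed

lemma generate_ring_hom_image:
  assumes S: "ring S" and h: "h \<in> ring_hom S R" and R: "ring R" and H: "H \<subseteq> carrier S"
    and x: "x \<in> generate_ring S H"
  shows "h x \<in> generate_ring R (h ` H)"
proof -
  interpret h: ring_hom_ring S R h
    by (intro ring_hom_ring.intro ring_hom_ring_axioms.intro S R h)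
  show ?thesis
    using x
  proof (induction x)
    case (incl x) then show ?case by (auto intro: generate_ring.incl)
  qed (use h.R.generate_ring_in_carrier[OF H] in \<open>simp_all add: generate_ring.intros\<close>)
qed

lemma generate_ring_hom_eq:
  assumes S: "ring S" and R: "ring R" and h: "h \<in> ring_hom S R" and h': "h' \<in> ring_hom S R"
    and H: "H \<subseteq> carrier S" and eq: "\<And>x. x \<in> H \<Longrightarrow> h x = h' x" and x: "x \<in> generate_ring S H"
  shows "h x = h' x"
proof -
  interpret h: ring_hom_ring S R h
    by (intro ring_hom_ring.intro ring_hom_ring_axioms.intro S R h)
  interpret h': ring_hom_ring S R h'
    by (intro ring_hom_ring.intro ring_hom_ring_axioms.intro S R h')
  show ?thesis
    using x by (induction x) (use h.R.generate_ring_in_carrier[OF H] in \<open>simp_all add: eq\<close>)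
qed

section \<open>Determinants and mixed discriminants as polynomial identities\<close>

section \<open>Determinants over a ring given as a type\<close>

definition cdet :: "nat \<Rightarrow> (nat \<times> nat \<Rightarrow> 'c::comm_ring_1) \<Rightarrow> 'c" where
  "cdet n M = (\<Sum>\<sigma> | \<sigma> permutes {..<n}. of_int (sign \<sigma>) * (\<Prod>i<n. M (i, \<sigma> i)))"

lemma sign_mult_sign [simp]: "of_int (sign \<tau>) * (of_int (sign \<tau>) * x) = (x :: 'c::comm_ring_1)"
  by (cases \<tau> rule: sign_cases) simp_all

lemma cdet_cong: "(\<And>i j. i < n \<Longrightarrow> j < n \<Longrightarrow> M (i, j) = N (i, j)) \<Longrightarrow> cdet n M = cdet n N"
  unfolding cdet_def by (intro sum.cong prod.cong arg_cong2[of _ _ _ _ "(*)"])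
    (auto simp: permutes_in_image[of _ "{..<n}", simplified])

text \<open>Composition with the transposition pairs the even permutations with the odd ones, and
  the members of a pair contribute opposite terms. The index set and the function stay general:
  besides determinants, the terms of mixed discriminants and the expansion in
  \<open>alg_mix_disc\<close> cancel in this way.\<close>

lemma sum_permutes_antisym:
  fixes g :: "('a \<Rightarrow> 'a) \<Rightarrow> 'c::comm_ring_1"
  assumes S: "finite S" "k \<in> S" "l \<in> S" "k \<noteq> l"
    and g: "\<And>\<sigma>. \<sigma> permutes S \<Longrightarrow> g (\<sigma> \<circ> transpose k l) = g \<sigma>"
  shows "(\<Sum>\<sigma> | \<sigma> permutes S. of_int (sign \<sigma>) * g \<sigma>) = 0"
proof -
  let ?E = "{\<sigma>. \<sigma> permutes S \<and> evenperm \<sigma>}" and ?O = "{\<sigma>. \<sigma> permutes S \<and> \<not> evenperm \<sigma>}"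
  let ?t = "transpose k l"
  have t: "?t permutes S" using S by (intro permutes_swap_id)
  have even: "evenperm (\<sigma> \<circ> ?t) \<longleftrightarrow> \<not> evenperm \<sigma>" if "\<sigma> permutes S" for \<sigma>
    using S that t by (subst evenperm_comp) (auto simp: evenperm_swap permutation_permutes)
  have "(\<Sum>\<sigma>\<in>?E. g \<sigma>) = (\<Sum>\<sigma>\<in>?O. g \<sigma>)"
    by (rule sum.reindex_bij_witness[of _ "\<lambda>\<sigma>. \<sigma> \<circ> ?t" "\<lambda>\<sigma>. \<sigma> \<circ> ?t"])
      (auto simp: comp_assoc even g permutes_compose[OF t])
  moreover have "(\<Sum>\<sigma> | \<sigma> permutes S. of_int (sign \<sigma>) * g \<sigma>) = 
      (\<Sum>\<sigma>\<in>?E. of_int (sign \<sigma>) * g \<sigma>) + (\<Sum>\<sigma>\<in>?O. of_int (sign \<sigma>) * g \<sigma>)"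
    using finite_permutations[OF S(1)] by (subst sum.union_disjoint[symmetric]) (auto intro!: sum.cong)
  ultimately show ?thesis by (simp add: sign_def sum_negf)
qed

text \<open>Reindexing the product by the transposition exchanges the rows k and l, which are
  equal.\<close>

lemma cdet_same_rows:
  assumes "k < n" "l < n" "k \<noteq> l" and eq: "\<And>j. j < n \<Longrightarrow> M (k, j) = M (l, j)"
  shows "cdet n M = 0"
  unfolding cdet_def
proof (rule sum_permutes_antisym)
  fix \<sigma> :: "nat \<Rightarrow> nat" assume \<sigma>: "\<sigma> permutes {..<n}"
  let ?t = "transpose k l"
  have "(\<Prod>i<n. M (i, \<sigma> (?t i))) = (\<Prod>i<n. M (?t i, \<sigma> i))"
    by (rule prod.reindex_bij_witness[of _ ?t ?t]) (use assms in \<open>auto simp: transpose_def\<close>)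
  also have "\<dots> = (\<Prod>i<n. M (i, \<sigma> i))"
    using assms \<sigma> permutes_in_image[OF \<sigma>] by (intro prod.cong) (auto simp: transpose_def eq)
  finally show "(\<Prod>i<n. M (i, (\<sigma> \<circ> ?t) i)) = (\<Prod>i<n. M (i, \<sigma> i))" by simp
qed (use assms in auto)

lemma cdet_permute_rows:
  assumes \<tau>: "\<tau> permutes {..<n}"
  shows "cdet n (\<lambda>(i, j). M (\<tau> i, j)) = of_int (sign \<tau>) * cdet n M"
proof -
  have "cdet n M = (\<Sum>\<sigma> | \<sigma> permutes {..<n}. of_int (sign (\<sigma> \<circ> inv_into UNIV \<tau>)) * (\<Prod>i<n. M (i, (\<sigma> \<circ> inv_into UNIV \<tau>) i)))"
    unfolding cdet_def by (rule sum_permutations_compose_right[OF permutes_inv[OF \<tau>]])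
  also have "\<dots> = (\<Sum>\<sigma> | \<sigma> permutes {..<n}. of_int (sign \<tau> * sign \<sigma>) * (\<Prod>i<n. M (\<tau> i, \<sigma> i)))"
  proof (rule sum.cong[OF refl])
    fix \<sigma> assume \<sigma>: "\<sigma> \<in> {\<sigma>. \<sigma> permutes {..<n}}"
    have "sign (\<sigma> \<circ> inv_into UNIV \<tau>) = sign \<tau> * sign \<sigma>"
      using \<sigma> \<tau> permutes_inv[OF \<tau>]
      by (subst sign_compose) (auto simp: permutation_permutes sign_inverse[OF permutes_imp_permutation[OF finite_lessThan \<tau>]] mult.commute)
    moreover have "(\<Prod>i<n. M (i, (\<sigma> \<circ> inv_into UNIV \<tau>) i)) = (\<Prod>i<n. M (\<tau> i, \<sigma> i))"
      by (rule prod.reindex_bij_witness[of _ "\<tau>" "inv_into UNIV \<tau>"])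
        (use permutes_in_image[OF \<tau>] permutes_in_image[OF permutes_inv[OF \<tau>]] in \<open>auto simp: permutes_inverses[OF \<tau>]\<close>)
    ultimately show "of_int (sign (\<sigma> \<circ> inv_into UNIV \<tau>)) * (\<Prod>i<n. M (i, (\<sigma> \<circ> inv_into UNIV \<tau>) i)) =
      of_int (sign \<tau> * sign \<sigma>) * (\<Prod>i<n. M (\<tau> i, \<sigma> i))" by simp
  qed
  also have "\<dots> = of_int (sign \<tau>) * cdet n (\<lambda>(i, j). M (\<tau> i, j))"
    by (simp add: cdet_def sum_distrib_left mult.assoc)
  finally have "of_int (sign \<tau>) * cdet n M =
      of_int (sign \<tau> * sign \<tau>) * cdet n (\<lambda>(i, j). M (\<tau> i, j))" by (simp add: mult.assoc)
  then show ?thesis by simp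
qed

lemma cdet_permute_cols:
  assumes \<tau>: "\<tau> permutes {..<n}"
  shows "cdet n (\<lambda>(i, j). M (i, \<tau> j)) = of_int (sign \<tau>) * cdet n M"
proof -
  have "cdet n M = (\<Sum>\<sigma> | \<sigma> permutes {..<n}. of_int (sign (\<tau> \<circ> \<sigma>)) * (\<Prod>i<n. M (i, (\<tau> \<circ> \<sigma>) i)))"
    unfolding cdet_def by (rule setum_permutations_compose_left[OF \<tau>])
  also have "\<dots> = of_int (sign \<tau>) * cdet n (\<lambda>(i, j). M (i, \<tau> j))"
    unfolding cdet_def sum_distrib_left
    by (rule sum.cong) (use \<tau> in \<open>auto simp: sign_compose permutation_permutes mult.assoc\<close>,
      metis finite_lessThan mult.assoc of_int_mult permutation_permutes sign_compose)
  finally have "of_int (sign \<tau>) * cdet n M =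
      of_int (sign \<tau> * sign \<tau>) * cdet n (\<lambda>(i, j). M (i, \<tau> j))" by (simp add: mult.assoc)
  then show ?thesis by simp
qed

text \<open>An injective self-map of a finite set is bijective, and becomes a permutation when it is
  extended by the identity. Elements of \<open>PiE\<close> are \<open>undefined\<close> outside
  \<open>S\<close> while permutations are the identity there; hence the
  \<open>restrict\<close>.\<close>

lemma sum_PiE_inj:
  fixes F :: "('a \<Rightarrow> 'a) \<Rightarrow> 'c::comm_monoid_add"
  assumes S: "finite S"
    and zero: "\<And>\<kappa>. \<kappa> \<in> S \<rightarrow>\<^sub>E S \<Longrightarrow> \<not> inj_on \<kappa> S \<Longrightarrow> F \<kappa> = 0"
  shows "(\<Sum>\<kappa>\<in>S \<rightarrow>\<^sub>E S. F \<kappa>) = (\<Sum>\<tau> | \<tau> permutes S. F (restrict \<tau> S))"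
proof -
  have "(\<Sum>\<kappa>\<in>S \<rightarrow>\<^sub>E S. F \<kappa>) = (\<Sum>\<kappa>\<in>{\<kappa>\<in>S \<rightarrow>\<^sub>E S. inj_on \<kappa> S}. F \<kappa>)"
    using zero by (intro sum.mono_neutral_right) (auto intro: finite_PiE S)
  also have "\<dots> = (\<Sum>\<tau> | \<tau> permutes S. F (restrict \<tau> S))"
  proof (rule sum.reindex_bij_witness[of _ "\<lambda>\<tau>. restrict \<tau> S" "\<lambda>\<kappa> x. if x \<in> S then \<kappa> x else x"])
    fix \<kappa> assume "\<kappa> \<in> {\<kappa>\<in>S \<rightarrow>\<^sub>E S. inj_on \<kappa> S}"
    then have \<kappa>: "\<kappa> \<in> S \<rightarrow>\<^sub>E S" "bij_betw \<kappa> S S"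
      using endo_inj_surj[OF S, of \<kappa>] by (auto simp: bij_betw_def)
    show "(\<lambda>x. if x \<in> S then \<kappa> x else x) \<in> {\<tau>. \<tau> permutes S}"
      using \<kappa>(2) by (auto intro!: bij_imp_permutes simp: bij_betw_def inj_on_def)
    show eq: "restrict (\<lambda>x. if x \<in> S then \<kappa> x else x) S = \<kappa>"
      using \<kappa>(1) by (auto simp: PiE_def extensional_def restrict_def fun_eq_iff)
    show "F (restrict (\<lambda>x. if x \<in> S then \<kappa> x else x) S) = F \<kappa>" by (simp only: eq)
  next
    fix \<tau> assume \<tau>: "\<tau> \<in> {\<tau>. \<tau> permutes S}"
    then show "(\<lambda>x. if x \<in> S then restrict \<tau> S x else x) = \<tau>"
      by (auto simp: permutes_def fun_eq_iff)
    show "restrict \<tau> S \<in> {\<kappa>\<in>S \<rightarrow>\<^sub>E S. inj_on \<kappa> S}"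
      using \<tau> permutes_inj_on[of \<tau> S S] by (auto simp: permutes_in_image inj_on_restrict_eq)
  qed
  finally show ?thesis .
qed

text \<open>Expanding the entries of the product gives a sum over all maps from rows to rows. A map
  that is not injective repeats a row of \<open>B\<close> and contributes zero; a permutation
  contributes its sign times the determinant of \<open>B\<close>.\<close>

lemma cdet_mult:
  "cdet n (\<lambda>(i, j). \<Sum>k<n. A (i, k) * B (k, j)) = cdet n A * cdet n B"
proof -
  have "cdet n (\<lambda>(i, j). \<Sum>k<n. A (i, k) * B (k, j)) =
      (\<Sum>\<sigma> | \<sigma> permutes {..<n}. \<Sum>\<kappa>\<in>{..<n} \<rightarrow>\<^sub>E {..<n}.
        of_int (sign \<sigma>) * ((\<Prod>i<n. A (i, \<kappa> i)) * (\<Prod>i<n. B (\<kappa> i, \<sigma> i))))"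
    by (simp add: cdet_def prod_sum_PiE prod.distrib sum_distrib_left)
  also have "\<dots> = (\<Sum>\<kappa>\<in>{..<n} \<rightarrow>\<^sub>E {..<n}. (\<Prod>i<n. A (i, \<kappa> i)) * cdet n (\<lambda>(i, j). B (\<kappa> i, j)))"
    by (subst sum.swap) (simp add: cdet_def sum_distrib_left mult_ac)
  also have "\<dots> = (\<Sum>\<tau> | \<tau> permutes {..<n}.
      (\<Prod>i<n. A (i, \<tau> i)) * cdet n (\<lambda>(i, j). B (\<tau> i, j)))"
  proof (subst sum_PiE_inj)
    fix \<kappa> :: "nat \<Rightarrow> nat" assume "\<not> inj_on \<kappa> {..<n}"
    then obtain k l where "k < n" "l < n" "k \<noteq> l" "\<kappa> k = \<kappa> l" by (auto simp: inj_on_def)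
    then show "(\<Prod>i<n. A (i, \<kappa> i)) * cdet n (\<lambda>(i, j). B (\<kappa> i, j)) = 0"
      by (simp add: cdet_same_rows[of k n l])
  qed (auto intro!: sum.cong arg_cong2[of _ _ _ _ "(*)"] cdet_cong)
  also have "\<dots> = (\<Sum>\<tau> | \<tau> permutes {..<n}. (\<Prod>i<n. A (i, \<tau> i)) * (of_int (sign \<tau>) * cdet n B))"
    by (simp add: cdet_permute_rows)
  also have "\<dots> = cdet n A * cdet n B"
    by (simp add: cdet_def sum_distrib_right mult_ac)
  finally show ?thesis .
qed

lemma cdet_row_linear:
  fixes M :: "nat \<times> nat \<Rightarrow> 'c::comm_ring_1"
  assumes "i < n" "finite J"
  shows "(\<Sum>j\<in>J. a j * cdet n (\<lambda>(r, c). if r = i then x j c else M (r, c))) =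
    cdet n (\<lambda>(r, c). if r = i then \<Sum>j\<in>J. a j * x j c else M (r, c))"
proof -
  have split: "(\<Prod>r<n. if r = i then f r else g r) = f i * (\<Prod>r\<in>{..<n} - {i}. g r)"
    for f g :: "nat \<Rightarrow> 'c"
    using assms(1) by (subst prod.remove[of _ i]) (auto intro!: arg_cong2[of _ _ _ _ "(*)"] prod.cong)
  show ?thesis
    by (simp add: cdet_def split sum_distrib_left sum_distrib_right)
      (subst sum.swap, simp add: mult_ac)
qed

text \<open>Each cofactor is a full determinant in which one row is replaced by a unit vector, so no
  rows or columns have to be deleted and renumbered.\<close>

definition cadj :: "nat \<Rightarrow> (nat \<times> nat \<Rightarrow> 'c::comm_ring_1) \<Rightarrow> nat \<times> nat \<Rightarrow> 'c" where
  "cadj n M = (\<lambda>(j, i). cdet n (\<lambda>(r, c). if r = i then (if c = j then 1 else 0) else M (r, c)))"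

text \<open>By linearity in row i the sum is the determinant of \<open>M\<close> with row i replaced
  by row i'. Unless i' = i, this matrix has two equal rows.\<close>

lemma cadj_mult:
  assumes "i < n" "i' < n"
  shows "(\<Sum>j<n. M (i', j) * cadj n M (j, i)) = (if i' = i then cdet n M else 0)"
proof -
  have "(\<Sum>j<n. M (i', j) * cadj n M (j, i)) =
      cdet n (\<lambda>(r, c). if r = i then \<Sum>j<n. M (i', j) * (if c = j then 1 else 0) else M (r, c))"
    using assms cdet_row_linear[of i n "{..<n}" "\<lambda>j. M (i', j)" "\<lambda>j c. if c = j then 1 else 0" M]
    by (simp add: cadj_def)
  also have "\<dots> = cdet n (\<lambda>(r, c). if r = i then M (i', c) else M (r, c))"
    by (rule cdet_cong) (auto simp: if_distrib cong: if_cong)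
  also have "\<dots> = (if i' = i then cdet n M else 0)"
    using assms by (auto intro: cdet_cong cdet_same_rows[of i n i'])
  finally show ?thesis .
qed

section \<open>Mixed discriminants over a ring given as a type\<close>

text \<open>
  Up to reindexing, \<open>cmix {..<n} n a\<close> is the coefficient of \<open>x\<^sub>0 \<dots> x\<^bsub>n-1\<^esub>\<close> in the determinant of
  \<open>\<Sum>s. x\<^sub>s a\<^sub>s\<close>.  The version with an arbitrary index set is the alternating sum over \<open>\<sigma>\<close> of the
  products, over the cycles of \<open>\<sigma>\<close>, of the traces of the products of the matrices along the cycle.
\<close>

definition cmix :: "'s set \<Rightarrow> nat \<Rightarrow> ('s \<Rightarrow> nat \<times> nat \<Rightarrow> 'c::comm_ring_1) \<Rightarrow> 'c" where
  "cmix S n a = (\<Sum>\<sigma> | \<sigma> permutes S. of_int (sign \<sigma>) *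
     (\<Sum>\<iota>\<in>S \<rightarrow>\<^sub>E {..<n}. \<Prod>s\<in>S. a s (\<iota> s, \<iota> (\<sigma> s))))"

lemma sum_PiE_insert:
  assumes "x \<notin> S"
  shows "(\<Sum>g\<in>insert x S \<rightarrow>\<^sub>E T. F g) = (\<Sum>y\<in>T. \<Sum>g\<in>S \<rightarrow>\<^sub>E T. F (g(x := y)))"
proof -
  have "(\<Sum>g\<in>insert x S \<rightarrow>\<^sub>E T. F g) = (\<Sum>(y, g)\<in>T \<times> (S \<rightarrow>\<^sub>E T). F (g(x := y)))"
    unfolding PiE_insert_eq
    by (subst sum.reindex[OF inj_combinator[OF assms, of "\<lambda>_. T"]]) (simp add: case_prod_unfold)
  then show ?thesis by (simp add: sum.cartesian_product)
qed

text \<open>Inversion of permutations preserves the sign and turns composition on the left into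
  composition on the right.\<close>

lemma sum_permutes_antisym_left:
  fixes g :: "('a \<Rightarrow> 'a) \<Rightarrow> 'c::comm_ring_1"
  assumes S: "finite S" "k \<in> S" "l \<in> S" "k \<noteq> l"
    and g: "\<And>\<sigma>. \<sigma> permutes S \<Longrightarrow> g (transpose k l \<circ> \<sigma>) = g \<sigma>"
  shows "(\<Sum>\<sigma> | \<sigma> permutes S. of_int (sign \<sigma>) * g \<sigma>) = 0"
proof -
  have t: "transpose k l permutes S" using S by (intro permutes_swap_id)
  have "(\<Sum>\<sigma> | \<sigma> permutes S. of_int (sign \<sigma>) * g \<sigma>) =
      (\<Sum>\<sigma> | \<sigma> permutes S. of_int (sign (inv_into UNIV \<sigma>)) * g (inv_into UNIV \<sigma>))"
    by (rule sum_permutations_inverse)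
  also have "\<dots> = (\<Sum>\<sigma> | \<sigma> permutes S. of_int (sign \<sigma>) * g (inv_into UNIV \<sigma>))"
    using S(1) by (intro sum.cong) (auto simp: sign_inverse permutes_imp_permutation)
  also have "\<dots> = 0"
  proof (rule sum_permutes_antisym[OF S])
    fix \<sigma> assume \<sigma>: "\<sigma> permutes S"
    have "inv_into UNIV (\<sigma> \<circ> transpose k l) = transpose k l \<circ> inv_into UNIV \<sigma>"
      by (subst o_inv_distrib) (auto simp: permutes_bij[OF \<sigma>])
    then show "g (inv_into UNIV (\<sigma> \<circ> transpose k l)) = g (inv_into UNIV \<sigma>)"
      using g[OF permutes_inv[OF \<sigma>]] by simp
  qed
  finally show ?thesis .
qed

text \<open>A permutation of \<open>insert x S\<close> comes from a unique permutation q of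
  \<open>S\<close> in one of two ways. Either x is a fixed point, which splits off the trace of the
  matrix at x; or x is inserted into a cycle of q directly after some s, which flips the sign and
  multiplies the matrix at s by the one at x. Together with \<open>cmix_eq_zero\<close> this
  recursion is a polarized form of the theorem of Cayley and Hamilton.\<close>

lemma cmix_insert:
  assumes S: "finite S" and x: "x \<notin> S"
  shows "cmix (insert x S) n a = (\<Sum>i<n. a x (i, i)) * cmix S n a -
    (\<Sum>s\<in>S. cmix S n (a(s := \<lambda>(i, j). \<Sum>k<n. a s (i, k) * a x (k, j))))"
proof -
  define F where "F \<sigma> = of_int (sign \<sigma>) *
     (\<Sum>\<iota>\<in>insert x S \<rightarrow>\<^sub>E {..<n}. \<Prod>s\<in>insert x S. a s (\<iota> s, \<iota> (\<sigma> s)))" for \<sigma>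
  define G where "G s0 q = of_int (sign q) * (\<Sum>\<iota>\<in>S \<rightarrow>\<^sub>E {..<n}.
      \<Prod>s\<in>S. (a(s0 := \<lambda>(i, j). \<Sum>k<n. a s0 (i, k) * a x (k, j))) s (\<iota> s, \<iota> (q s)))" for s0 q
  have fixed: "F q = (\<Sum>i<n. a x (i, i)) *
      (of_int (sign q) * (\<Sum>\<iota>\<in>S \<rightarrow>\<^sub>E {..<n}. \<Prod>s\<in>S. a s (\<iota> s, \<iota> (q s))))"
    if q: "q permutes S" for q
  proof -
    have qx: "q x = x" using q x by (simp add: permutes_not_in)
    have prod: "(\<Prod>s\<in>insert x S. a s ((\<iota>(x := y)) s, (\<iota>(x := y)) (q s))) =
        a x (y, y) * (\<Prod>s\<in>S. a s (\<iota> s, \<iota> (q s)))" for \<iota> y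
    proof -
      have "(\<Prod>s\<in>S. a s ((\<iota>(x := y)) s, (\<iota>(x := y)) (q s))) = (\<Prod>s\<in>S. a s (\<iota> s, \<iota> (q s)))"
        using x permutes_in_image[OF q] by (intro prod.cong) auto
      then show ?thesis using S x qx by simp
    qed
    show ?thesis
      by (simp only: F_def sum_PiE_insert[OF x] prod sum_product[symmetric] mult.left_commute)
  qed
  \<comment> \<open>The new permutation sends s0 to x and x to \<open>q s0\<close>; summing over the
    index y at x produces the matrix product at s0.\<close>
  have moved: "F (transpose x (q s0) \<circ> q) = - G s0 q" if q: "q permutes S" and s0: "s0 \<in> S" for q s0
  proof -
    have qs0: "q s0 \<in> S" using permutes_in_image[OF q] s0 by simp
    have qx: "q x = x" using q x by (simp add: permutes_not_in)
    have inS: "q s \<in> S" if "s \<in> S" for s using permutes_in_image[OF q] that by simp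
    have "transpose x (q s0) permutes insert x S" using qs0 by (intro permutes_swap_id) auto
    then have sign: "sign (transpose x (q s0) \<circ> q) = - sign q"
      using S q x qs0 permutes_subset[OF q, of "insert x S"]
      by (subst sign_compose) (auto simp: sign_swap_id intro!: permutes_imp_permutation[of "insert x S"])
    have other: "q s \<noteq> q s0" if "s \<noteq> s0" for s
      using permutes_inj[OF q] that by (auto simp: inj_def)
    have prod: "(\<Prod>s\<in>insert x S. a s ((\<iota>(x := y)) s, (\<iota>(x := y)) ((transpose x (q s0) \<circ> q) s))) =
        a s0 (\<iota> s0, y) * a x (y, \<iota> (q s0)) * (\<Prod>s\<in>S - {s0}. a s (\<iota> s, \<iota> (q s)))" for \<iota> y
    proof -
      have "(\<Prod>s\<in>insert x S. a s ((\<iota>(x := y)) s, (\<iota>(x := y)) ((transpose x (q s0) \<circ> q) s))) =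
        a x (y, \<iota> (q s0)) *
        (\<Prod>s\<in>S. a s ((\<iota>(x := y)) s, (\<iota>(x := y)) ((transpose x (q s0) \<circ> q) s)))"
        using S x qx qs0 by (subst prod.insert) auto
      also have "(\<Prod>s\<in>S. a s ((\<iota>(x := y)) s, (\<iota>(x := y)) ((transpose x (q s0) \<circ> q) s))) =
        a s0 (\<iota> s0, y) * (\<Prod>s\<in>S - {s0}. a s ((\<iota>(x := y)) s, (\<iota>(x := y)) ((transpose x (q s0) \<circ> q) s)))"
        using S s0 x by (subst prod.remove[of _ s0]) auto
      also have "(\<Prod>s\<in>S - {s0}. a s ((\<iota>(x := y)) s, (\<iota>(x := y)) ((transpose x (q s0) \<circ> q) s))) =
        (\<Prod>s\<in>S - {s0}. a s (\<iota> s, \<iota> (q s)))"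
        using x other inS by (intro prod.cong) (auto simp: transpose_def)
      finally show ?thesis by (simp add: mult_ac)
    qed
    have "(\<Prod>s\<in>S. (a(s0 := \<lambda>(i, j). \<Sum>k<n. a s0 (i, k) * a x (k, j))) s (\<iota> s, \<iota> (q s))) =
        (\<Sum>k<n. a s0 (\<iota> s0, k) * a x (k, \<iota> (q s0))) * (\<Prod>s\<in>S - {s0}. a s (\<iota> s, \<iota> (q s)))" for \<iota>
      using S s0 by (subst prod.remove[of _ s0]) (auto intro!: arg_cong2[of _ _ _ _ "(*)"] prod.cong)
    then have "(\<Sum>\<iota>\<in>insert x S \<rightarrow>\<^sub>E {..<n}.
        \<Prod>s\<in>insert x S. a s (\<iota> s, \<iota> ((transpose x (q s0) \<circ> q) s))) =
        (\<Sum>\<iota>\<in>S \<rightarrow>\<^sub>E {..<n}.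
          \<Prod>s\<in>S. (a(s0 := \<lambda>(i, j). \<Sum>k<n. a s0 (i, k) * a x (k, j))) s (\<iota> s, \<iota> (q s)))"
      unfolding sum_PiE_insert[OF x] prod by (subst sum.swap) (simp add: sum_distrib_right)
    then show ?thesis by (simp only: F_def G_def sign) simp
  qed
  have "cmix (insert x S) n a = (\<Sum>b\<in>insert x S. \<Sum>q | q permutes S. F (transpose x b \<circ> q))"
    unfolding cmix_def F_def[symmetric] by (rule sum_over_permutations_insert[OF S x])
  also have "\<dots> = (\<Sum>q | q permutes S. F q) + (\<Sum>q | q permutes S. \<Sum>b\<in>S. F (transpose x b \<circ> q))"
    using S x by (simp add: sum.swap[of _ S])
  also have "(\<Sum>q | q permutes S. F q) = (\<Sum>i<n. a x (i, i)) * cmix S n a"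
    by (simp add: fixed cmix_def sum_distrib_left)
  also have "(\<Sum>q | q permutes S. \<Sum>b\<in>S. F (transpose x b \<circ> q)) = (\<Sum>q | q permutes S. \<Sum>s\<in>S. - G s q)"
  proof (rule sum.cong[OF refl])
    fix q assume "q \<in> {q. q permutes S}"
    then have q: "q permutes S" by simp
    \<comment> \<open>The point b before which x is inserted is renamed to \<open>q s\<close>, so
      that the sum runs over the point s after which x is inserted.\<close>
    have "(\<Sum>b\<in>S. F (transpose x b \<circ> q)) = (\<Sum>s\<in>S. F (transpose x (q s) \<circ> q))"
      using sum.permute[OF q, of "\<lambda>b. F (transpose x b \<circ> q)"] by (simp add: o_def)
    then show "(\<Sum>b\<in>S. F (transpose x b \<circ> q)) = (\<Sum>s\<in>S. - G s q)"
      by (simp add: moved[OF q])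
  qed
  also have "\<dots> = - (\<Sum>s\<in>S. \<Sum>q | q permutes S. G s q)"
    by (subst sum.swap) (simp add: sum_negf)
  also have "\<dots> = - (\<Sum>s\<in>S. cmix S n (a(s := \<lambda>(i, j). \<Sum>k<n. a s (i, k) * a x (k, j))))"
    by (simp only: G_def cmix_def)
  finally show ?thesis by simp
qed

lemma cmix_swap:
  "cmix S n a = (\<Sum>\<iota>\<in>S \<rightarrow>\<^sub>E {..<n}. \<Sum>\<sigma> | \<sigma> permutes S.
     of_int (sign \<sigma>) * (\<Prod>s\<in>S. a s (\<iota> s, \<iota> (\<sigma> s))))"
  unfolding cmix_def sum_distrib_left by (rule sum.swap)

text \<open>If the index map takes the same value at k and l, then exchanging the values k and l of
  the permutation changes nothing but its sign.\<close>

lemma cmix_term_not_inj: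
  assumes S: "finite S" and "\<not> inj_on \<iota> S"
  shows "(\<Sum>\<sigma> | \<sigma> permutes S. of_int (sign \<sigma>) * (\<Prod>s\<in>S. a s (\<iota> s, \<iota> (\<sigma> s)))) = (0 :: 'c::comm_ring_1)"
proof -
  obtain k l where kl: "k \<in> S" "l \<in> S" "k \<noteq> l" "\<iota> k = \<iota> l"
    using assms by (auto simp: inj_on_def)
  have "\<iota> (transpose k l s) = \<iota> s" for s using kl by (auto simp: transpose_def)
  then show ?thesis by (intro sum_permutes_antisym_left[OF S kl(1-3)]) auto
qed

text \<open>There are more positions than indices, so no index map is injective.\<close>

lemma cmix_eq_zero:
  assumes S: "finite S" "n < card S"
  shows "cmix S n a = 0"
proof -
  have "\<not> inj_on \<iota> S" if "\<iota> \<in> S \<rightarrow>\<^sub>E {..<n}" for \<iota>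
    using that S card_inj_on_le[of \<iota> S "{..<n}"] by auto
  then show ?thesis by (simp add: cmix_swap cmix_term_not_inj[OF S(1)])
qed

lemma cmix_linear:
  assumes S: "finite S" "s \<in> S"
  shows "cmix S n (a(s := \<lambda>ij. \<Sum>j\<in>J. c j * x j ij)) = (\<Sum>j\<in>J. c j * cmix S n (a(s := x j)))"
proof -
  have prod: "(\<Prod>t\<in>S. (a(s := y)) t (\<iota> t, \<iota> (\<sigma> t))) =
      y (\<iota> s, \<iota> (\<sigma> s)) * (\<Prod>t\<in>S - {s}. a t (\<iota> t, \<iota> (\<sigma> t)))" for y \<iota> \<sigma>
    using S by (subst prod.remove[of _ s]) (auto intro!: arg_cong2[of _ _ _ _ "(*)"] prod.cong)
  define Z where "Z = {\<sigma>. \<sigma> permutes S} \<times> (S \<rightarrow>\<^sub>E {..<n})"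
  define f where "f z = (snd z s, snd z (fst z s))" for z :: "('a \<Rightarrow> 'a) \<times> ('a \<Rightarrow> nat)"
  define W where "W z = of_int (sign (fst z)) * (\<Prod>t\<in>S - {s}. a t (snd z t, snd z (fst z t)))" for z
  have "cmix S n (a(s := y)) = (\<Sum>z\<in>Z. y (f z) * W z)" for y
    unfolding cmix_def prod Z_def f_def W_def sum_distrib_left sum.cartesian_product
    by (simp add: case_prod_unfold mult_ac)
  then show ?thesis
    by (simp add: sum_distrib_left sum_distrib_right mult.assoc) (rule sum.swap)
qed

text \<open>Along each cycle the factors are regrouped cyclically: the factor Y at s meets the
  factor X at the next position \<open>\<sigma> s\<close>. This is the invariance of a trace under
  cyclic rotation, for all cycles at once.\<close>

lemma cmix_conj:
  fixes d :: "'s \<Rightarrow> nat \<Rightarrow> 'c::comm_ring_1"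
  assumes S: "finite S"
  shows "cmix S n (\<lambda>s (i, j). \<Sum>p<n. X (i, p) * d s p * Y (p, j)) =
    cmix S n (\<lambda>s (p, q). d s p * (\<Sum>i<n. Y (p, i) * X (i, q)))"
proof -
  let ?I = "S \<rightarrow>\<^sub>E {..<n}"
  have eq: "(\<Sum>\<iota>\<in>?I. \<Prod>s\<in>S. \<Sum>p<n. X (\<iota> s, p) * d s p * Y (p, \<iota> (\<sigma> s))) =
    (\<Sum>\<pi>\<in>?I. \<Prod>s\<in>S. d s (\<pi> s) * (\<Sum>i<n. Y (\<pi> s, i) * X (i, \<pi> (\<sigma> s))))"
    if \<sigma>: "\<sigma> permutes S" for \<sigma>
  proof -
  have perm: "(\<Prod>s\<in>S. f (\<sigma> s)) = (\<Prod>s\<in>S. f s)" for f :: "'s \<Rightarrow> 'c"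
    using prod.permute[OF \<sigma>, of f] by (simp add: o_def)
  have inv: "inv_into UNIV \<sigma> (\<sigma> s) = s" for s by (rule permutes_inverses[OF \<sigma>])
  have "(\<Sum>\<iota>\<in>?I. \<Prod>s\<in>S. \<Sum>p<n. X (\<iota> s, p) * d s p * Y (p, \<iota> (\<sigma> s))) =
      (\<Sum>\<iota>\<in>?I. \<Sum>\<pi>\<in>?I. (\<Prod>s\<in>S. X (\<iota> s, \<pi> s)) * ((\<Prod>s\<in>S. d s (\<pi> s)) * (\<Prod>s\<in>S. Y (\<pi> s, \<iota> (\<sigma> s)))))"
    by (simp add: prod_sum_PiE S prod.distrib mult.assoc)
  \<comment> \<open>Writing s as the preimage of \<open>\<sigma> s\<close> makes the factors Y a
    function of \<open>\<sigma> s\<close>, so that their product can be reindexed by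
    \<open>\<sigma>\<close>.\<close>
  also have "\<dots> = (\<Sum>\<pi>\<in>?I. \<Sum>\<iota>\<in>?I. (\<Prod>s\<in>S. d s (\<pi> s)) *
      ((\<Prod>s\<in>S. Y (\<pi> (inv_into UNIV \<sigma> (\<sigma> s)), \<iota> (\<sigma> s))) * (\<Prod>s\<in>S. X (\<iota> s, \<pi> s))))"
    by (subst sum.swap) (simp add: inv mult_ac)
  also have "\<dots> = (\<Sum>\<pi>\<in>?I. (\<Prod>s\<in>S. d s (\<pi> s)) *
      (\<Sum>\<iota>\<in>?I. \<Prod>s\<in>S. Y (\<pi> (inv_into UNIV \<sigma> s), \<iota> s) * X (\<iota> s, \<pi> s)))"
    by (simp add: perm[of "\<lambda>s. Y (\<pi> (inv_into UNIV \<sigma> s), \<iota> s)" for \<pi> \<iota>] prod.distrib sum_distrib_left)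
  also have "\<dots> = (\<Sum>\<pi>\<in>?I. (\<Prod>s\<in>S. d s (\<pi> s)) *
      (\<Prod>s\<in>S. \<Sum>i<n. Y (\<pi> (inv_into UNIV \<sigma> s), i) * X (i, \<pi> s)))"
    by (simp add: prod_sum_PiE S)
  also have "\<dots> = (\<Sum>\<pi>\<in>?I. (\<Prod>s\<in>S. d s (\<pi> s)) *
      (\<Prod>s\<in>S. \<Sum>i<n. Y (\<pi> s, i) * X (i, \<pi> (\<sigma> s))))"
    by (simp add: perm[of "\<lambda>s. \<Sum>i<n. Y (\<pi> (inv_into UNIV \<sigma> s), i) * X (i, \<pi> s)" for \<pi>, symmetric] inv)
  finally show ?thesis by (simp add: prod.distrib)
  qed
  show ?thesis unfolding cmix_def by (intro sum.cong) (simp_all add: eq)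
qed

text \<open>For diagonal matrices the mixed discriminant is a permanent: the index map has to be a
  permutation, and then the Kronecker symbols leave only the identity for
  \<open>\<sigma>\<close>.\<close>

lemma cmix_diag:
  "cmix {..<n} n (\<lambda>s (p, q). d s p * (if p = q then 1 else 0)) =
    (\<Sum>\<rho> | \<rho> permutes {..<n}. \<Prod>s<n. d s (\<rho> s))"
proof -
  let ?S = "{..<n}"
  define F where "F \<pi> = (\<Sum>\<sigma> | \<sigma> permutes ?S. of_int (sign \<sigma>) *
      (\<Prod>s\<in>?S. d s (\<pi> s) * (if \<pi> s = \<pi> (\<sigma> s) then 1 else 0)))" for \<pi>
  have "cmix ?S n (\<lambda>s (p, q). d s p * (if p = q then 1 else 0)) = (\<Sum>\<pi>\<in>?S \<rightarrow>\<^sub>E ?S. F \<pi>)"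
    by (simp add: cmix_swap F_def)
  also have "\<dots> = (\<Sum>\<rho> | \<rho> permutes ?S. F (restrict \<rho> ?S))"
  proof (rule sum_PiE_inj)
    fix \<pi> :: "nat \<Rightarrow> nat" assume "\<not> inj_on \<pi> ?S"
    from cmix_term_not_inj[OF _ this, of "\<lambda>s (p, q). d s p * (if p = q then 1 else 0)"]
    show "F \<pi> = 0" by (simp add: F_def)
  qed simp
  also have "\<dots> = (\<Sum>\<rho> | \<rho> permutes {..<n}. \<Prod>s<n. d s (\<rho> s))"
  proof (rule sum.cong[OF refl])
    fix \<rho> assume "\<rho> \<in> {\<rho>. \<rho> permutes ?S}"
    then have \<rho>: "\<rho> permutes ?S" by simp
    have "(\<Prod>s\<in>?S. d s (restrict \<rho> ?S s) * (if restrict \<rho> ?S s = restrict \<rho> ?S (\<sigma> s) then 1 else 0)) =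
        (if \<sigma> = id then \<Prod>s<n. d s (\<rho> s) else 0)" if \<sigma>: "\<sigma> permutes ?S" for \<sigma>
    proof (cases "\<sigma> = id")
      case False
      then obtain s where s: "\<sigma> s \<noteq> s" by (auto simp: fun_eq_iff)
      then have "s \<in> ?S" using \<sigma> by (metis permutes_not_in)
      moreover have "\<sigma> s \<in> ?S" using \<open>s \<in> ?S\<close> permutes_in_image[OF \<sigma>] by simp
      moreover have "\<rho> s \<noteq> \<rho> (\<sigma> s)" using permutes_inj[OF \<rho>] s by (metis injD)
      ultimately show ?thesis using False by (auto intro!: prod_zero)
    qed simp
    then have "F (restrict \<rho> ?S) =
        (\<Sum>\<sigma> | \<sigma> permutes ?S. of_int (sign \<sigma>) * (if \<sigma> = id then \<Prod>s<n. d s (\<rho> s) else 0))"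
      unfolding F_def by (intro sum.cong) auto
    also have "\<dots> = (\<Prod>s<n. d s (\<rho> s))"
      by (simp add: if_distrib permutes_id finite_permutations cong: if_cong)
    finally show "F (restrict \<rho> ?S) = (\<Prod>s<n. d s (\<rho> s))" .
  qed
  finally show ?thesis .
qed

section \<open>Invertible matrices over a commutative ring and their base change\<close>

section \<open>Matrices over a commutative ring\<close>

lemma ring_hom_finsum:
  assumes "cring R" "cring S" "h \<in> ring_hom R S" "\<And>i. i \<in> A \<Longrightarrow> f i \<in> carrier R"
  shows "h (\<Oplus>\<^bsub>R\<^esub>i\<in>A. f i) = (\<Oplus>\<^bsub>S\<^esub>i\<in>A. h (f i))"
proof -
  interpret ring_hom_cring R S h
    by (intro ring_hom_cring.intro ring_hom_cring_axioms.intro assms)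
  show ?thesis using assms hom_finsum[of f A] by (simp add: o_def Pi_def)
qed

lemma ring_hom_finprod:
  assumes "cring R" "cring S" "h \<in> ring_hom R S" "\<And>i. i \<in> A \<Longrightarrow> f i \<in> carrier R"
  shows "h (\<Otimes>\<^bsub>R\<^esub>i\<in>A. f i) = (\<Otimes>\<^bsub>S\<^esub>i\<in>A. h (f i))"
proof -
  interpret ring_hom_cring R S h
    by (intro ring_hom_cring.intro ring_hom_cring_axioms.intro assms)
  show ?thesis using assms hom_finprod[of f A] by (simp add: o_def Pi_def)
qed

lemma ring_hom_zero_cring:
  assumes "cring R" "cring S" "h \<in> ring_hom R S"
  shows "h \<zero>\<^bsub>R\<^esub> = \<zero>\<^bsub>S\<^esub>"
  using assms by (simp add: cring.axioms(1) ring_hom_zero)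

lemma ring_hom_a_inv_cring:
  assumes "cring R" "cring S" "h \<in> ring_hom R S" "x \<in> carrier R"
  shows "h (\<ominus>\<^bsub>R\<^esub> x) = \<ominus>\<^bsub>S\<^esub> h x"
proof -
  interpret ring_hom_cring R S h
    by (intro ring_hom_cring.intro ring_hom_cring_axioms.intro assms)
  show ?thesis using assms by simp
qed

lemma ring_hom_Units:
  assumes "cring R" "cring S" "h \<in> ring_hom R S" "x \<in> Units R"
  shows "h x \<in> Units S" "h (inv\<^bsub>R\<^esub> x) = inv\<^bsub>S\<^esub> (h x)"
proof -
  interpret R: cring R by fact
  interpret S: cring S by fact
  have x: "x \<in> carrier R" "inv\<^bsub>R\<^esub> x \<in> carrier R" "x \<otimes>\<^bsub>R\<^esub> inv\<^bsub>R\<^esub> x = \<one>\<^bsub>R\<^esub>" using assms by auto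
  have eq: "h x \<otimes>\<^bsub>S\<^esub> h (inv\<^bsub>R\<^esub> x) = \<one>\<^bsub>S\<^esub>"
    using ring_hom_mult[OF assms(3) x(1,2)] x ring_hom_one[OF assms(3)] by simp
  have c: "h x \<in> carrier S" "h (inv\<^bsub>R\<^esub> x) \<in> carrier S"
    using x ring_hom_closed[OF assms(3)] by auto
  show "h x \<in> Units S" using eq c S.m_comm[OF c] by (auto simp: Units_def)
  show "h (inv\<^bsub>R\<^esub> x) = inv\<^bsub>S\<^esub> (h x)" using eq c S.comm_inv_char by metis
qed

definition mat_mix :: "'r ring \<Rightarrow> 's set \<Rightarrow> nat \<Rightarrow> ('s \<Rightarrow> 'r matrix) \<Rightarrow> 'r" where
  "mat_mix R S n a = (\<Oplus>\<^bsub>R\<^esub>\<sigma>\<in>{\<sigma>. \<sigma> permutes S}.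
     (if evenperm \<sigma> then \<one>\<^bsub>R\<^esub> else \<ominus>\<^bsub>R\<^esub> \<one>\<^bsub>R\<^esub>) \<otimes>\<^bsub>R\<^esub>
     (\<Oplus>\<^bsub>R\<^esub>\<iota>\<in>S \<rightarrow>\<^sub>E {..<n}. \<Otimes>\<^bsub>R\<^esub>s\<in>S. a s (\<iota> s, \<iota> (\<sigma> s))))"

context class_ring_hom
begin

lemma hom_sign: "h (of_int (sign \<sigma>)) = (if evenperm \<sigma> then \<one> else \<ominus> \<one>)"
  by (simp add: sign_def hom_one hom_uminus)

lemma mat_det_hom: "mat_det R n (\<lambda>ij. h (M ij)) = h (cdet n M)"
  by (simp add: mat_det_def cdet_def hom_sum hom_mult hom_prod hom_sign)

lemma mat_mix_hom: "mat_mix R S n (\<lambda>s ij. h (a s ij)) = h (cmix S n a)"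
  by (simp add: mat_mix_def cmix_def hom_sum hom_mult hom_prod hom_sign)

end

context
  fixes R :: "'r ring" (structure)
  assumes R: "cring R"
begin

interpretation cring R by (rule R)

text \<open>The claim is pulled back to the variables \<open>mvar (f i j)\<close>, where it is the
  exchange of two sums in a ring given as a type. The later transfers follow this pattern.\<close>

lemma finsum_swap:
  assumes "\<And>i j. i \<in> I \<Longrightarrow> j \<in> J \<Longrightarrow> f i j \<in> carrier R"
  shows "(\<Oplus>i\<in>I. \<Oplus>j\<in>J. f i j) = (\<Oplus>j\<in>J. \<Oplus>i\<in>I. f i j)"
proof -
  obtain h :: "'r int_mpoly \<Rightarrow> 'r" where "class_ring_hom R h" and h: "\<And>r. r \<in> carrier R \<Longrightarrow> h (mvar r) = r"
    by (rule ex_class_ring_hom[OF R]) blast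
  then interpret h: class_ring_hom R h by simp
  have "(\<Oplus>i\<in>I. \<Oplus>j\<in>J. f i j) = h (\<Sum>i\<in>I. \<Sum>j\<in>J. mvar (f i j))"
    unfolding h.hom_sum by (intro finsum_cong') (auto simp: assms h)
  also have "\<dots> = h (\<Sum>j\<in>J. \<Sum>i\<in>I. mvar (f i j))"
    by (subst sum.swap) simp
  also have "\<dots> = (\<Oplus>j\<in>J. \<Oplus>i\<in>I. f i j)"
    unfolding h.hom_sum by (intro finsum_cong') (auto simp: assms h)
  finally show ?thesis .
qed

lemma finsum_delta:
  assumes "finite A" "i \<in> A" "\<And>j. j \<in> A \<Longrightarrow> f j \<in> carrier R"
  shows "(\<Oplus>j\<in>A. (if i = j then \<one> else \<zero>) \<otimes> f j) = f i"
    "(\<Oplus>j\<in>A. (if j = i then \<one> else \<zero>) \<otimes> f j) = f i"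
    "(\<Oplus>j\<in>A. f j \<otimes> (if i = j then \<one> else \<zero>)) = f i"
    "(\<Oplus>j\<in>A. f j \<otimes> (if j = i then \<one> else \<zero>)) = f i"
proof -
  have "(\<Oplus>j\<in>A. if i = j then f j else \<zero>) = f i"
    using assms by (intro finsum_singleton) auto
  moreover have "(\<Oplus>j\<in>A. (if i = j then \<one> else \<zero>) \<otimes> f j) = (\<Oplus>j\<in>A. if i = j then f j else \<zero>)"
    "(\<Oplus>j\<in>A. (if j = i then \<one> else \<zero>) \<otimes> f j) = (\<Oplus>j\<in>A. if i = j then f j else \<zero>)"
    "(\<Oplus>j\<in>A. f j \<otimes> (if i = j then \<one> else \<zero>)) = (\<Oplus>j\<in>A. if i = j then f j else \<zero>)"
    "(\<Oplus>j\<in>A. f j \<otimes> (if j = i then \<one> else \<zero>)) = (\<Oplus>j\<in>A. if i = j then f j else \<zero>)"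
    using assms by (auto intro!: finsum_cong')
  ultimately show "(\<Oplus>j\<in>A. (if i = j then \<one> else \<zero>) \<otimes> f j) = f i"
    "(\<Oplus>j\<in>A. (if j = i then \<one> else \<zero>) \<otimes> f j) = f i"
    "(\<Oplus>j\<in>A. f j \<otimes> (if i = j then \<one> else \<zero>)) = f i"
    "(\<Oplus>j\<in>A. f j \<otimes> (if j = i then \<one> else \<zero>)) = f i" by auto
qed

lemma mat_closed [simp]: "M \<in> carrier (mat_monoid R n) \<Longrightarrow> i < n \<Longrightarrow> j < n \<Longrightarrow> M (i, j) \<in> carrier R"
  by (auto simp: mat_monoid_def)

lemma mat_eqI:
  assumes "M \<in> carrier (mat_monoid R n)" "N \<in> carrier (mat_monoid R n)"
    "\<And>i j. i < n \<Longrightarrow> j < n \<Longrightarrow> M (i, j) = N (i, j)"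
  shows "M = N"
  using assms by (intro PiE_ext[of M "{..<n} \<times> {..<n}" "\<lambda>_. carrier R"]) (auto simp: mat_monoid_def)

lemma mat_mult_entry [simp]:
  "i < n \<Longrightarrow> j < n \<Longrightarrow> (M \<otimes>\<^bsub>mat_monoid R n\<^esub> N) (i, j) = (\<Oplus>k\<in>{..<n}. M (i, k) \<otimes> N (k, j))"
  by (simp add: mat_monoid_def)

lemma mat_one_entry [simp]: "i < n \<Longrightarrow> j < n \<Longrightarrow> \<one>\<^bsub>mat_monoid R n\<^esub> (i, j) = (if i = j then \<one> else \<zero>)"
  by (simp add: mat_monoid_def)

lemma mat_carrierI:
  assumes "\<And>i j. i < n \<Longrightarrow> j < n \<Longrightarrow> f i j \<in> carrier R"
  shows "(\<lambda>(i, j)\<in>{..<n} \<times> {..<n}. f i j) \<in> carrier (mat_monoid R n)"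
  using assms by (auto simp: mat_monoid_def)

lemma mat_mult_closed:
  assumes "M \<in> carrier (mat_monoid R n)" "N \<in> carrier (mat_monoid R n)"
  shows "M \<otimes>\<^bsub>mat_monoid R n\<^esub> N \<in> carrier (mat_monoid R n)"
  unfolding mat_monoid_def monoid.simps
  by (rule mat_carrierI[unfolded mat_monoid_def]) (use assms in auto)

lemma mat_one_closed: "\<one>\<^bsub>mat_monoid R n\<^esub> \<in> carrier (mat_monoid R n)"
  by (auto simp: mat_monoid_def)

text \<open>This is associativity for a row, a matrix and a column; most rearrangements of double
  sums below are instances of it.\<close>

lemma finsum_mult_assoc:
  assumes "\<And>k. k \<in> K \<Longrightarrow> a k \<in> carrier R" "\<And>k l. k \<in> K \<Longrightarrow> l \<in> L \<Longrightarrow> b k l \<in> carrier R"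
    "\<And>l. l \<in> L \<Longrightarrow> c l \<in> carrier R"
  shows "(\<Oplus>l\<in>L. (\<Oplus>k\<in>K. a k \<otimes> b k l) \<otimes> c l) = (\<Oplus>k\<in>K. a k \<otimes> (\<Oplus>l\<in>L. b k l \<otimes> c l))"
proof -
  have "(\<Oplus>l\<in>L. (\<Oplus>k\<in>K. a k \<otimes> b k l) \<otimes> c l) = (\<Oplus>l\<in>L. \<Oplus>k\<in>K. a k \<otimes> (b k l \<otimes> c l))"
    if "finite K"
    using that assms by (intro finsum_cong') (auto simp: finsum_ldistr Pi_def m_assoc intro!: finsum_cong')
  moreover have "(\<Oplus>k\<in>K. a k \<otimes> (\<Oplus>l\<in>L. b k l \<otimes> c l)) = (\<Oplus>k\<in>K. \<Oplus>l\<in>L. a k \<otimes> (b k l \<otimes> c l))"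
    if "finite L"
    using that assms by (intro finsum_cong') (auto simp: finsum_rdistr Pi_def)
  moreover have "(\<Oplus>l\<in>L. \<Oplus>k\<in>K. a k \<otimes> (b k l \<otimes> c l)) = (\<Oplus>k\<in>K. \<Oplus>l\<in>L. a k \<otimes> (b k l \<otimes> c l))"
    using assms by (intro finsum_swap) auto
  moreover have "(\<Oplus>l\<in>L. (\<Oplus>k\<in>K. a k \<otimes> b k l) \<otimes> c l) = \<zero>" if "infinite K"
    using that assms by (intro add.finprod_one_eqI) auto
  moreover have "(\<Oplus>k\<in>K. a k \<otimes> (\<Oplus>l\<in>L. b k l \<otimes> c l)) = \<zero>" if "infinite L"
    using that assms by (intro add.finprod_one_eqI) auto
  ultimately show ?thesis
    by (cases "finite K"; cases "finite L") auto
qed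

lemma mat_monoid_monoid: "monoid (mat_monoid R n)"
proof (rule monoidI)
  fix L M N assume LMN: "L \<in> carrier (mat_monoid R n)" "M \<in> carrier (mat_monoid R n)" "N \<in> carrier (mat_monoid R n)"
  show "L \<otimes>\<^bsub>mat_monoid R n\<^esub> M \<otimes>\<^bsub>mat_monoid R n\<^esub> N = L \<otimes>\<^bsub>mat_monoid R n\<^esub> (M \<otimes>\<^bsub>mat_monoid R n\<^esub> N)"
  proof (rule mat_eqI)
    fix i j assume ij: "i < n" "j < n"
    have "(\<Oplus>l\<in>{..<n}. (L \<otimes>\<^bsub>mat_monoid R n\<^esub> M) (i, l) \<otimes> N (l, j)) =
        (\<Oplus>l\<in>{..<n}. (\<Oplus>k\<in>{..<n}. L (i, k) \<otimes> M (k, l)) \<otimes> N (l, j))"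
      using ij LMN by (intro finsum_cong') auto
    also have "\<dots> = (\<Oplus>k\<in>{..<n}. L (i, k) \<otimes> (\<Oplus>l\<in>{..<n}. M (k, l) \<otimes> N (l, j)))"
      using ij LMN by (intro finsum_mult_assoc) auto
    also have "\<dots> = (\<Oplus>k\<in>{..<n}. L (i, k) \<otimes> (M \<otimes>\<^bsub>mat_monoid R n\<^esub> N) (k, j))"
      using ij LMN by (intro finsum_cong') auto
    finally show "(L \<otimes>\<^bsub>mat_monoid R n\<^esub> M \<otimes>\<^bsub>mat_monoid R n\<^esub> N) (i, j) =
        (L \<otimes>\<^bsub>mat_monoid R n\<^esub> (M \<otimes>\<^bsub>mat_monoid R n\<^esub> N)) (i, j)"
      using ij by simp
  qed (simp_all add: LMN mat_mult_closed)
next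
  fix M assume M: "M \<in> carrier (mat_monoid R n)"
  note one = mat_one_closed
  show "\<one>\<^bsub>mat_monoid R n\<^esub> \<otimes>\<^bsub>mat_monoid R n\<^esub> M = M" "M \<otimes>\<^bsub>mat_monoid R n\<^esub> \<one>\<^bsub>mat_monoid R n\<^esub> = M"
  proof -
    have "(\<Oplus>k\<in>{..<n}. \<one>\<^bsub>mat_monoid R n\<^esub> (i, k) \<otimes> M (k, j)) = M (i, j)"
      "(\<Oplus>k\<in>{..<n}. M (i, k) \<otimes> \<one>\<^bsub>mat_monoid R n\<^esub> (k, j)) = M (i, j)"
      if "i < n" "j < n" for i j
    proof -
      have "(\<Oplus>k\<in>{..<n}. \<one>\<^bsub>mat_monoid R n\<^esub> (i, k) \<otimes> M (k, j)) =
          (\<Oplus>k\<in>{..<n}. (if i = k then \<one> else \<zero>) \<otimes> M (k, j))"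
        "(\<Oplus>k\<in>{..<n}. M (i, k) \<otimes> \<one>\<^bsub>mat_monoid R n\<^esub> (k, j)) =
          (\<Oplus>k\<in>{..<n}. M (i, k) \<otimes> (if k = j then \<one> else \<zero>))"
        using that M by (auto intro!: finsum_cong')
      then show "(\<Oplus>k\<in>{..<n}. \<one>\<^bsub>mat_monoid R n\<^esub> (i, k) \<otimes> M (k, j)) = M (i, j)"
        "(\<Oplus>k\<in>{..<n}. M (i, k) \<otimes> \<one>\<^bsub>mat_monoid R n\<^esub> (k, j)) = M (i, j)"
        using that M finsum_delta(1)[of "{..<n}" i "\<lambda>k. M (k, j)"]
          finsum_delta(4)[of "{..<n}" j "\<lambda>k. M (i, k)"] by auto
    qed
    note entries = this
    show "\<one>\<^bsub>mat_monoid R n\<^esub> \<otimes>\<^bsub>mat_monoid R n\<^esub> M = M"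
      by (rule mat_eqI[OF mat_mult_closed[OF one M] M]) (simp add: entries)
    show "M \<otimes>\<^bsub>mat_monoid R n\<^esub> \<one>\<^bsub>mat_monoid R n\<^esub> = M"
      by (rule mat_eqI[OF mat_mult_closed[OF M one] M]) (simp add: entries)
  qed
qed (simp_all add: mat_mult_closed mat_one_closed)

lemma mat_det_cong:
  assumes "\<And>i j. i < n \<Longrightarrow> j < n \<Longrightarrow> M (i, j) = N (i, j)" "\<And>i j. i < n \<Longrightarrow> j < n \<Longrightarrow> N (i, j) \<in> carrier R"
  shows "mat_det R n M = mat_det R n N"
  unfolding mat_det_def
proof (intro finsum_cong' refl)
  fix \<sigma> assume "\<sigma> \<in> {\<sigma>. \<sigma> permutes {..<n}}"
  then have \<sigma>: "\<sigma> i < n" if "i < n" for i using that permutes_in_image[of \<sigma> "{..<n}" i] by simp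
  have "(\<Otimes>i\<in>{..<n}. M (i, \<sigma> i)) = (\<Otimes>i\<in>{..<n}. N (i, \<sigma> i))"
    using assms \<sigma> by (intro finprod_cong') auto
  then show "(if evenperm \<sigma> then \<one> else \<ominus> \<one>) \<otimes> (\<Otimes>i\<in>{..<n}. M (i, \<sigma> i)) =
    (if evenperm \<sigma> then \<one> else \<ominus> \<one>) \<otimes> (\<Otimes>i\<in>{..<n}. N (i, \<sigma> i))" by simp
next
  show "(\<lambda>\<sigma>. (if evenperm \<sigma> then \<one> else \<ominus> \<one>) \<otimes> (\<Otimes>i\<in>{..<n}. N (i, \<sigma> i))) \<in> {\<sigma>. \<sigma> permutes {..<n}} \<rightarrow> carrier R"
    using assms(2) permutes_in_image[of _ "{..<n}", simplified] by (auto intro!: m_closed finprod_closed)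
qed

lemma mat_mix_cong:
  assumes "\<And>s i j. s \<in> S \<Longrightarrow> i < n \<Longrightarrow> j < n \<Longrightarrow> a s (i, j) = b s (i, j)"
    "\<And>s i j. s \<in> S \<Longrightarrow> i < n \<Longrightarrow> j < n \<Longrightarrow> b s (i, j) \<in> carrier R"
  shows "mat_mix R S n a = mat_mix R S n b"
proof -
  have \<sigma>: "\<iota> s < n \<and> \<iota> (\<sigma> s) < n" if "\<sigma> permutes S" "\<iota> \<in> S \<rightarrow>\<^sub>E {..<n}" "s \<in> S" for \<sigma> \<iota> s
    using that permutes_in_image[of \<sigma> S s] by auto
  have "(\<Otimes>s\<in>S. a s (\<iota> s, \<iota> (\<sigma> s))) = (\<Otimes>s\<in>S. b s (\<iota> s, \<iota> (\<sigma> s)))"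
    "(\<Otimes>s\<in>S. b s (\<iota> s, \<iota> (\<sigma> s))) \<in> carrier R"
    if "\<sigma> permutes S" "\<iota> \<in> S \<rightarrow>\<^sub>E {..<n}" for \<sigma> \<iota>
    using assms \<sigma>[OF that] by (auto intro!: finprod_cong' finprod_closed)
  then show ?thesis
    unfolding mat_mix_def
    by (intro finsum_cong' arg_cong2[of _ _ _ _ "(\<otimes>)"] refl)
      (auto intro!: m_closed finsum_closed)
qed

end

text \<open>
  Identities for matrices over a carrier are transferred from the polynomial ring whose
  variables are the elements of the carrier.
\<close>

lemma mat_lift:
  fixes R :: "'r ring"
  assumes "cring R"
  obtains h :: "'r int_mpoly \<Rightarrow> 'r"
  where "class_ring_hom R h" "\<And>r. r \<in> carrier R \<Longrightarrow> h (mvar r) = r"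
    "\<And>n M. (\<And>i j. i < n \<Longrightarrow> j < n \<Longrightarrow> M (i, j) \<in> carrier R) \<Longrightarrow>
      mat_det R n M = h (cdet n (\<lambda>ij. mvar (M ij)))"
proof -
  obtain h :: "'r int_mpoly \<Rightarrow> 'r" where h: "class_ring_hom R h" "\<And>r. r \<in> carrier R \<Longrightarrow> h (mvar r) = r"
    by (rule ex_class_ring_hom[OF assms]) blast
  have "mat_det R n M = h (cdet n (\<lambda>ij. mvar (M ij)))"
    if "\<And>i j. i < n \<Longrightarrow> j < n \<Longrightarrow> M (i, j) \<in> carrier R" for n M
    unfolding class_ring_hom.mat_det_hom[OF h(1), symmetric]
    by (rule mat_det_cong[OF assms]) (use that h class_ring_hom.hom_closed in auto)
  with h show ?thesis by (rule that)
qed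

context
  fixes R :: "'r ring" (structure) and n :: nat
  assumes R: "cring R"
begin

interpretation cring R by (rule R)
interpretation M: monoid "mat_monoid R n" by (rule mat_monoid_monoid[OF R])

lemma mat_det_closed:
  assumes "\<And>i j. i < n \<Longrightarrow> j < n \<Longrightarrow> M (i, j) \<in> carrier R"
  shows "mat_det R n M \<in> carrier R"
proof -
  obtain h :: "'r int_mpoly \<Rightarrow> 'r" where "class_ring_hom R h"
    "\<And>n M. (\<And>i j. i < n \<Longrightarrow> j < n \<Longrightarrow> M (i, j) \<in> carrier R) \<Longrightarrow>
        mat_det R n M = h (cdet n (\<lambda>ij. mvar (M ij)))"
    by (rule mat_lift[OF R]) blast
  then show ?thesis using class_ring_hom.hom_closed[of R h] assms by metis
qed

lemma mat_det_mult:
  assumes "M \<in> carrier (mat_monoid R n)" "N \<in> carrier (mat_monoid R n)"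
  shows "mat_det R n (M \<otimes>\<^bsub>mat_monoid R n\<^esub> N) = mat_det R n M \<otimes> mat_det R n N"
proof -
  obtain h :: "'r int_mpoly \<Rightarrow> 'r" where "class_ring_hom R h"
    and h: "\<And>r. r \<in> carrier R \<Longrightarrow> h (mvar r) = r"
      "\<And>n M. (\<And>i j. i < n \<Longrightarrow> j < n \<Longrightarrow> M (i, j) \<in> carrier R) \<Longrightarrow>
        mat_det R n M = h (cdet n (\<lambda>ij. mvar (M ij)))"
    by (rule mat_lift[OF R]) blast
  then interpret h: class_ring_hom R h by simp
  have "mat_det R n (M \<otimes>\<^bsub>mat_monoid R n\<^esub> N) =
      mat_det R n (\<lambda>ij. h (case ij of (i, j) \<Rightarrow> \<Sum>k<n. mvar (M (i, k)) * mvar (N (k, j))))"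
    using assms by (intro mat_det_cong[OF R])
      (auto simp: h h.hom_sum h.hom_mult R mat_closed[OF R] intro!: finsum_cong')
  also have "\<dots> = mat_det R n M \<otimes> mat_det R n N"
    using assms cdet_mult[of n "\<lambda>ij. mvar (M ij)" "\<lambda>ij. mvar (N ij)"]
    by (simp only: h.mat_det_hom) (simp add: h(2) mat_closed[OF R] h.hom_mult)
  finally show ?thesis .
qed

lemma mat_det_one: "mat_det R n \<one>\<^bsub>mat_monoid R n\<^esub> = \<one>"
proof -
  obtain h :: "'r int_mpoly \<Rightarrow> 'r" where "class_ring_hom R h"
    by (rule ex_class_ring_hom[OF R]) blast
  then interpret h: class_ring_hom R h .
  have "cdet n (\<lambda>(i, j). if i = j then 1 else 0 :: 'r int_mpoly) = 1"
  proof -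
    have "(\<Prod>i<n. if i = \<sigma> i then 1 else 0) = (if \<sigma> = id then 1 else 0 :: 'r int_mpoly)" if "\<sigma> permutes {..<n}" for \<sigma>
    proof (cases "\<sigma> = id")
      case False
      then obtain s where s: "\<sigma> s \<noteq> s" by (auto simp: fun_eq_iff)
      then have "s < n" using that by (metis permutes_not_in lessThan_iff)
      then show ?thesis using False s by (auto intro!: prod_zero bexI[of _ s] dest: sym)
    qed simp
    then have "cdet n (\<lambda>(i, j). if i = j then 1 else 0 :: 'r int_mpoly) =
        (\<Sum>\<sigma> | \<sigma> permutes {..<n}. of_int (sign \<sigma>) * (if \<sigma> = id then 1 else 0))"
      unfolding cdet_def by (intro sum.cong) auto
    also have "\<dots> = 1" by (simp add: if_distrib permutes_id finite_permutations cong: if_cong)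
    finally show ?thesis .
  qed
  moreover have "mat_det R n \<one>\<^bsub>mat_monoid R n\<^esub> =
      mat_det R n (\<lambda>ij. h (case ij of (i, j) \<Rightarrow> if i = j then 1 else 0))"
    by (rule mat_det_cong[OF R]) (auto simp: h.hom_one h.hom_zero mat_one_entry[OF R])
  ultimately show ?thesis by (simp only: h.mat_det_hom) (simp add: h.hom_one)
qed

text \<open>The inverse is the transferred adjugate divided by the determinant.\<close>

lemma mat_right_inverse:
  assumes M: "M \<in> carrier (mat_monoid R n)" and det: "mat_det R n M \<in> Units R"
  obtains K where "K \<in> carrier (mat_monoid R n)" "M \<otimes>\<^bsub>mat_monoid R n\<^esub> K = \<one>\<^bsub>mat_monoid R n\<^esub>"
proof -
  obtain h :: "'r int_mpoly \<Rightarrow> 'r" where "class_ring_hom R h"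
    and h: "\<And>r. r \<in> carrier R \<Longrightarrow> h (mvar r) = r"
      "\<And>n M. (\<And>i j. i < n \<Longrightarrow> j < n \<Longrightarrow> M (i, j) \<in> carrier R) \<Longrightarrow>
        mat_det R n M = h (cdet n (\<lambda>ij. mvar (M ij)))"
    by (rule mat_lift[OF R]) blast
  then interpret h: class_ring_hom R h by simp
  let ?M = "\<lambda>ij. mvar (M ij)"
  let ?d = "inv (mat_det R n M)"
  define K where "K = (\<lambda>(j, i)\<in>{..<n} \<times> {..<n}. h (cadj n ?M (j, i)) \<otimes> ?d)"
  have K: "K \<in> carrier (mat_monoid R n)"
    unfolding K_def using det by (intro mat_carrierI[OF R]) auto
  moreover have "M \<otimes>\<^bsub>mat_monoid R n\<^esub> K = \<one>\<^bsub>mat_monoid R n\<^esub>"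
  proof (rule mat_eqI[OF R])
    fix i' i assume i: "i' < n" "i < n"
    have "(M \<otimes>\<^bsub>mat_monoid R n\<^esub> K) (i', i) = (\<Oplus>j\<in>{..<n}. h (?M (i', j) * cadj n ?M (j, i)) \<otimes> ?d)"
      using i M det K
      by (simp add: mat_mult_entry[OF R])
        (auto intro!: finsum_cong' simp: K_def h h.hom_mult mat_closed[OF R] m_assoc)
    also have "\<dots> = (\<Oplus>j\<in>{..<n}. h (?M (i', j) * cadj n ?M (j, i))) \<otimes> ?d"
      using det by (subst finsum_ldistr) auto
    also have "(\<Oplus>j\<in>{..<n}. h (?M (i', j) * cadj n ?M (j, i))) = h (if i' = i then cdet n ?M else 0)"
      using cadj_mult[OF i(2,1), of ?M] by (simp only: h.hom_sum[symmetric])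
    also have "\<dots> \<otimes> ?d = (if i' = i then \<one> else \<zero>)"
      using det M by (auto simp: h.hom_zero h(2)[symmetric] mat_closed[OF R])
    finally show "(M \<otimes>\<^bsub>mat_monoid R n\<^esub> K) (i', i) = \<one>\<^bsub>mat_monoid R n\<^esub> (i', i)"
      using i by (simp add: mat_one_entry[OF R])
  qed (use M K in auto)
  ultimately show thesis by (rule that)
qed

text \<open>The adjugate provides right inverses only. But the right inverse \<open>K\<close> has
  invertible determinant as well, hence a right inverse \<open>L\<close> of its own, and then
  \<open>M = L\<close>; so \<open>K\<close> is a two-sided inverse.\<close>

lemma mat_Units_iff:
  "M \<in> Units (mat_monoid R n) \<longleftrightarrow> M \<in> carrier (mat_monoid R n) \<and> mat_det R n M \<in> Units R"
proof safe
  assume M: "M \<in> Units (mat_monoid R n)"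
  then show carr: "M \<in> carrier (mat_monoid R n)" by (rule M.Units_closed)
  have "mat_det R n M \<otimes> mat_det R n (inv\<^bsub>mat_monoid R n\<^esub> M) = \<one>"
    using M carr by (simp add: mat_det_mult[symmetric] mat_det_one)
  moreover have "mat_det R n M \<in> carrier R" "mat_det R n (inv\<^bsub>mat_monoid R n\<^esub> M) \<in> carrier R"
    using M carr by (auto intro!: mat_det_closed mat_closed[OF R])
  ultimately show "mat_det R n M \<in> Units R"
    using m_comm[of "mat_det R n M" "mat_det R n (inv\<^bsub>mat_monoid R n\<^esub> M)"] by (auto simp: Units_def)
next
  assume M: "M \<in> carrier (mat_monoid R n)" and det: "mat_det R n M \<in> Units R"
  obtain K where K: "K \<in> carrier (mat_monoid R n)" "M \<otimes>\<^bsub>mat_monoid R n\<^esub> K = \<one>\<^bsub>mat_monoid R n\<^esub>"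
    by (rule mat_right_inverse[OF M det])
  have "mat_det R n M \<otimes> mat_det R n K = \<one>"
    using mat_det_mult[OF M K(1)] K(2) mat_det_one by simp
  then have "mat_det R n K \<in> Units R"
    using M K(1) mat_det_closed[of M] mat_det_closed[of K] m_comm[of "mat_det R n M" "mat_det R n K"]
    by (auto simp: Units_def mat_closed[OF R])
  then obtain L where L: "L \<in> carrier (mat_monoid R n)" "K \<otimes>\<^bsub>mat_monoid R n\<^esub> L = \<one>\<^bsub>mat_monoid R n\<^esub>"
    by (rule mat_right_inverse[OF K(1)])
  have "M = L" using M.inv_unique[OF K(2) L(2)] M K L by simp
  then show "M \<in> Units (mat_monoid R n)" using M K L by (auto simp: Units_def)
qed

text \<open>A right inverse is enough, because multiplicativity makes the determinant of
  \<open>M\<close> a unit.\<close>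

lemma mat_UnitsI:
  assumes "M \<in> carrier (mat_monoid R n)" "N \<in> carrier (mat_monoid R n)"
    "M \<otimes>\<^bsub>mat_monoid R n\<^esub> N = \<one>\<^bsub>mat_monoid R n\<^esub>"
  shows "M \<in> Units (mat_monoid R n)" "inv\<^bsub>mat_monoid R n\<^esub> M = N"
proof -
  have "mat_det R n M \<otimes> mat_det R n N = \<one>"
    using mat_det_mult[OF assms(1,2)] assms(3) mat_det_one by simp
  then have "mat_det R n M \<in> Units R"
    using assms mat_det_closed[of M] mat_det_closed[of N]
    by (auto simp: Units_def m_comm mat_closed[OF R] intro!: bexI[of _ "mat_det R n N"])
  then show M: "M \<in> Units (mat_monoid R n)" using assms by (simp add: mat_Units_iff)
  have "inv\<^bsub>mat_monoid R n\<^esub> M = inv\<^bsub>mat_monoid R n\<^esub> M \<otimes>\<^bsub>mat_monoid R n\<^esub> (M \<otimes>\<^bsub>mat_monoid R n\<^esub> N)"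
    using assms M by simp
  also have "\<dots> = N" using assms(1,2) M by (subst M.m_assoc[symmetric]) auto
  finally show "inv\<^bsub>mat_monoid R n\<^esub> M = N" .
qed

end

section \<open>Base change of matrices\<close>

text \<open>The two rings may have elements of different types, since the splitting ring of an
  algebra over \<open>R\<close> is built on a type other than that of \<open>R\<close>.\<close>

definition mat_map :: "nat \<Rightarrow> ('r \<Rightarrow> 's) \<Rightarrow> 'r matrix \<Rightarrow> 's matrix" where
  "mat_map n h M = (\<lambda>(i, j)\<in>{..<n} \<times> {..<n}. h (M (i, j)))"

lemma mat_map_entry [simp]: "i < n \<Longrightarrow> j < n \<Longrightarrow> mat_map n h M (i, j) = h (M (i, j))"
  by (simp add: mat_map_def)

context
  fixes R :: "'r ring" and S :: "'s ring" and h :: "'r \<Rightarrow> 's"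
  assumes R: "cring R" and S: "cring S" and h: "h \<in> ring_hom R S"
begin

interpretation R: cring R by (rule R)
interpretation S: cring S by (rule S)

lemma mat_map_closed:
  "M \<in> carrier (mat_monoid R n) \<Longrightarrow> mat_map n h M \<in> carrier (mat_monoid S n)"
  unfolding mat_map_def by (intro mat_carrierI[OF S] ring_hom_closed[OF h]) (simp add: mat_closed[OF R])

lemma mat_map_mult:
  assumes "M \<in> carrier (mat_monoid R n)" "N \<in> carrier (mat_monoid R n)"
  shows "mat_map n h (M \<otimes>\<^bsub>mat_monoid R n\<^esub> N) = mat_map n h M \<otimes>\<^bsub>mat_monoid S n\<^esub> mat_map n h N"
proof (rule mat_eqI[OF S])
  fix i j assume ij: "i < n" "j < n"
  have "h (\<Oplus>\<^bsub>R\<^esub>k\<in>{..<n}. M (i, k) \<otimes>\<^bsub>R\<^esub> N (k, j)) = (\<Oplus>\<^bsub>S\<^esub>k\<in>{..<n}. h (M (i, k) \<otimes>\<^bsub>R\<^esub> N (k, j)))"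
    using ij assms by (intro ring_hom_finsum[OF R S h]) (auto simp: mat_closed[OF R])
  also have "\<dots> = (\<Oplus>\<^bsub>S\<^esub>k\<in>{..<n}. mat_map n h M (i, k) \<otimes>\<^bsub>S\<^esub> mat_map n h N (k, j))"
    using ij assms by (intro S.finsum_cong')
      (auto simp: ring_hom_mult[OF h] mat_closed[OF R] ring_hom_closed[OF h])
  finally show "mat_map n h (M \<otimes>\<^bsub>mat_monoid R n\<^esub> N) (i, j) =
      (mat_map n h M \<otimes>\<^bsub>mat_monoid S n\<^esub> mat_map n h N) (i, j)"
    using ij by (simp add: mat_mult_entry[OF R] mat_mult_entry[OF S])
qed (intro mat_map_closed mat_mult_closed[OF R] mat_mult_closed[OF S] assms)+

lemma mat_map_one: "mat_map n h \<one>\<^bsub>mat_monoid R n\<^esub> = \<one>\<^bsub>mat_monoid S n\<^esub>"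
  by (rule mat_eqI[OF S mat_map_closed[OF mat_one_closed[OF R]] mat_one_closed[OF S]])
    (simp add: mat_one_entry[OF R] mat_one_entry[OF S] ring_hom_one[OF h] ring_hom_zero_cring[OF R S h])

lemma mat_map_Units:
  assumes "M \<in> Units (mat_monoid R n)"
  shows "mat_map n h M \<in> Units (mat_monoid S n)"
    "inv\<^bsub>mat_monoid S n\<^esub> (mat_map n h M) = mat_map n h (inv\<^bsub>mat_monoid R n\<^esub> M)"
proof -
  interpret monoid "mat_monoid R n" by (rule mat_monoid_monoid[OF R])
  have M: "M \<in> carrier (mat_monoid R n)" "inv\<^bsub>mat_monoid R n\<^esub> M \<in> carrier (mat_monoid R n)"
    using assms by auto
  have "mat_map n h M \<otimes>\<^bsub>mat_monoid S n\<^esub> mat_map n h (inv\<^bsub>mat_monoid R n\<^esub> M) = \<one>\<^bsub>mat_monoid S n\<^esub>"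
    using assms by (simp add: mat_map_mult[OF M, symmetric] mat_map_one)
  from mat_UnitsI[OF S mat_map_closed[OF M(1)] mat_map_closed[OF M(2)] this]
  show "mat_map n h M \<in> Units (mat_monoid S n)"
    "inv\<^bsub>mat_monoid S n\<^esub> (mat_map n h M) = mat_map n h (inv\<^bsub>mat_monoid R n\<^esub> M)" .
qed

lemma mat_det_map:
  assumes M: "\<And>i j. i < n \<Longrightarrow> j < n \<Longrightarrow> M (i, j) \<in> carrier R"
  shows "h (mat_det R n M) = mat_det S n (\<lambda>ij. h (M ij))"
proof -
  have \<sigma>: "\<sigma> i < n" if "\<sigma> permutes {..<n}" "i < n" for \<sigma> i
    using that permutes_in_image[of \<sigma> "{..<n}" i] by simp
  have prod: "h (\<Otimes>\<^bsub>R\<^esub>i\<in>{..<n}. M (i, \<sigma> i)) = (\<Otimes>\<^bsub>S\<^esub>i\<in>{..<n}. h (M (i, \<sigma> i)))"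
    "(\<Otimes>\<^bsub>R\<^esub>i\<in>{..<n}. M (i, \<sigma> i)) \<in> carrier R"
    if "\<sigma> permutes {..<n}" for \<sigma>
    using M \<sigma>[OF that] by (auto intro!: ring_hom_finprod[OF R S h] R.finprod_closed)
  have sign: "h (if evenperm \<sigma> then \<one>\<^bsub>R\<^esub> else \<ominus>\<^bsub>R\<^esub> \<one>\<^bsub>R\<^esub>) = (if evenperm \<sigma> then \<one>\<^bsub>S\<^esub> else \<ominus>\<^bsub>S\<^esub> \<one>\<^bsub>S\<^esub>)" for \<sigma> :: "nat \<Rightarrow> nat"
    by (simp add: ring_hom_one[OF h] ring_hom_a_inv_cring[OF R S h])
  have "h (mat_det R n M) = (\<Oplus>\<^bsub>S\<^esub>\<sigma>\<in>{\<sigma>. \<sigma> permutes {..<n}}.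
      h ((if evenperm \<sigma> then \<one>\<^bsub>R\<^esub> else \<ominus>\<^bsub>R\<^esub> \<one>\<^bsub>R\<^esub>) \<otimes>\<^bsub>R\<^esub> (\<Otimes>\<^bsub>R\<^esub>i\<in>{..<n}. M (i, \<sigma> i))))"
    unfolding mat_det_def using prod(2) by (intro ring_hom_finsum[OF R S h]) auto
  also have "\<dots> = mat_det S n (\<lambda>ij. h (M ij))"
    unfolding mat_det_def
  proof (intro S.finsum_cong' refl)
    fix \<sigma> assume "\<sigma> \<in> {\<sigma>. \<sigma> permutes {..<n}}"
    then have p: "\<sigma> permutes {..<n}" by simp
    show "h ((if evenperm \<sigma> then \<one>\<^bsub>R\<^esub> else \<ominus>\<^bsub>R\<^esub> \<one>\<^bsub>R\<^esub>) \<otimes>\<^bsub>R\<^esub> (\<Otimes>\<^bsub>R\<^esub>i\<in>{..<n}. M (i, \<sigma> i))) =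
      (if evenperm \<sigma> then \<one>\<^bsub>S\<^esub> else \<ominus>\<^bsub>S\<^esub> \<one>\<^bsub>S\<^esub>) \<otimes>\<^bsub>S\<^esub> (\<Otimes>\<^bsub>S\<^esub>i\<in>{..<n}. h (M (i, \<sigma> i)))"
      by (subst ring_hom_mult[OF h _ prod(2)[OF p]]) (simp_all only: sign prod(1)[OF p] R.one_closed R.a_inv_closed split: if_split, simp_all)
  next
    show "(\<lambda>\<sigma>. (if evenperm \<sigma> then \<one>\<^bsub>S\<^esub> else \<ominus>\<^bsub>S\<^esub> \<one>\<^bsub>S\<^esub>) \<otimes>\<^bsub>S\<^esub> (\<Otimes>\<^bsub>S\<^esub>i\<in>{..<n}. h (M (i, \<sigma> i))))
        \<in> {\<sigma>. \<sigma> permutes {..<n}} \<rightarrow> carrier S"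
      using M \<sigma> by (auto intro!: S.m_closed S.finprod_closed ring_hom_closed[OF h])
  qed
  finally show ?thesis .
qed

end

lemma generate_ring_mono:
  assumes "H \<subseteq> K" shows "generate_ring R H \<subseteq> generate_ring R K"
proof
  fix x assume "x \<in> generate_ring R H"
  then show "x \<in> generate_ring R K"
    using assms by (induction x) (auto intro: generate_ring.intros)
qed

section \<open>Representability of powers of the general linear group\<close>

section \<open>The universal property of the coordinate ring\<close>

definition gl_cls :: "nat \<Rightarrow> nat \<Rightarrow> gl_var int_mpoly \<Rightarrow> gl_fun" where
  "gl_cls k n p = gl_ideal k n +>\<^bsub>zpoly (gl_vars k n)\<^esub> p"

lemma gl_vars_simps [simp]:
  "Ent l i j \<in> gl_vars k n \<longleftrightarrow> l < k \<and> i < n \<and> j < n" "Dinv l \<in> gl_vars k n \<longleftrightarrow> l < k"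
  by (auto simp: gl_vars_def)

lemma gl_gens_closed:
  assumes "l < k"
  shows "mat_det (zpoly (gl_vars k n)) n (\<lambda>(i, j). mvar (Ent l i j)) \<in> carrier (zpoly (gl_vars k n))"
    "mvar (Dinv l) * mat_det (zpoly (gl_vars k n)) n (\<lambda>(i, j). mvar (Ent l i j)) - 1 \<in> carrier (zpoly (gl_vars k n))"
proof -
  interpret cring "zpoly (gl_vars k n)" by (rule zpoly_cring)
  let ?d = "mat_det (zpoly (gl_vars k n)) n (\<lambda>(i, j). mvar (Ent l i j))"
  show d: "?d \<in> carrier (zpoly (gl_vars k n))"
    using assms by (intro mat_det_closed[OF zpoly_cring]) (auto intro: mvar_zpoly)
  have "mvar (Dinv l) \<otimes>\<^bsub>zpoly (gl_vars k n)\<^esub> ?d \<ominus>\<^bsub>zpoly (gl_vars k n)\<^esub> \<one>\<^bsub>zpoly (gl_vars k n)\<^esub> \<in> carrier (zpoly (gl_vars k n))"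
    using assms by (intro minus_closed m_closed d one_closed mvar_zpoly) auto
  then show "mvar (Dinv l) * ?d - 1 \<in> carrier (zpoly (gl_vars k n))"
    using one_closed by (simp add: a_minus_def)
qed

lemma gl_ideal_ideal: "ideal (gl_ideal k n) (zpoly (gl_vars k n))"
proof -
  interpret cring "zpoly (gl_vars k n)" by (rule zpoly_cring)
  show ?thesis unfolding gl_ideal_def using gl_gens_closed by (intro genideal_ideal) auto
qed

lemma O_GL_cring: "cring (O_GL k n)"
  unfolding O_GL_def by (rule ideal.quotient_is_cring[OF gl_ideal_ideal zpoly_cring])

lemma gl_cls_hom: "gl_cls k n \<in> ring_hom (zpoly (gl_vars k n)) (O_GL k n)"
  unfolding O_GL_def gl_cls_def[abs_def] by (rule ideal.rcos_ring_hom[OF gl_ideal_ideal])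

lemma carrier_O_GL: "carrier (O_GL k n) = gl_cls k n ` carrier (zpoly (gl_vars k n))"
  by (auto simp: O_GL_def FactRing_def A_RCOSETS_def' gl_cls_def)

lemma univ_mat_entry:
  "i < n \<Longrightarrow> j < n \<Longrightarrow> univ_mat k n l (i, j) = gl_cls k n (mvar (Ent l i j))"
  by (simp add: univ_mat_def gl_cls_def)

lemma univ_mat_closed: "l < k \<Longrightarrow> univ_mat k n l \<in> carrier (mat_monoid (O_GL k n) n)"
proof -
  assume "l < k"
  then have "gl_cls k n (mvar (Ent l i j)) \<in> carrier (O_GL k n)" if "i < n" "j < n" for i j
    using that by (intro ring_hom_closed[OF gl_cls_hom] mvar_zpoly) auto
  then show ?thesis
    unfolding univ_mat_def gl_cls_def[symmetric] by (intro mat_carrierI[OF O_GL_cring])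
qed

text \<open>This is the defining relation of the ideal, read in the quotient; it makes the class of
  \<open>Dinv l\<close> the inverse determinant of the universal matrix.\<close>

lemma univ_mat_det:
  assumes l: "l < k"
  shows "gl_cls k n (mvar (Dinv l)) \<otimes>\<^bsub>O_GL k n\<^esub> mat_det (O_GL k n) n (univ_mat k n l) = \<one>\<^bsub>O_GL k n\<^esub>"
    "gl_cls k n (mvar (Dinv l)) \<in> carrier (O_GL k n)"
proof -
  let ?Z = "zpoly (gl_vars k n)"
  interpret Z: cring ?Z by (rule zpoly_cring)
  interpret O: cring "O_GL k n" by (rule O_GL_cring)
  interpret I: ideal "gl_ideal k n" ?Z by (rule gl_ideal_ideal)
  let ?d = "mat_det ?Z n (\<lambda>(i, j). mvar (Ent l i j))"
  have D: "mvar (Dinv l) \<in> carrier ?Z" using l by (intro mvar_zpoly) simp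
  then show c: "gl_cls k n (mvar (Dinv l)) \<in> carrier (O_GL k n)" by (rule ring_hom_closed[OF gl_cls_hom])
  have "mvar (Dinv l) * ?d - 1 \<in> gl_ideal k n"
  proof -
    have "{mvar (Dinv l) * mat_det ?Z n (\<lambda>(i, j). mvar (Ent l i j)) - 1 | l. l < k} \<subseteq> gl_ideal k n"
      unfolding gl_ideal_def using gl_gens_closed by (intro Z.genideal_self) auto
    then show ?thesis using l by blast
  qed
  then have "gl_cls k n (mvar (Dinv l) * ?d) = gl_cls k n 1"
    unfolding gl_cls_def
    using Z.quotient_eq_iff_same_a_r_cos[OF gl_ideal_ideal, of "mvar (Dinv l) * ?d" 1]
      Z.m_closed[OF D gl_gens_closed(1)[OF l]] Z.one_closed
    by (simp add: a_minus_def)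
  then have "gl_cls k n (mvar (Dinv l)) \<otimes>\<^bsub>O_GL k n\<^esub> gl_cls k n ?d = \<one>\<^bsub>O_GL k n\<^esub>"
    using ring_hom_mult[OF gl_cls_hom D gl_gens_closed(1)[OF l]] ring_hom_one[OF gl_cls_hom, of k n] by simp
  moreover have "gl_cls k n ?d = mat_det (O_GL k n) n (univ_mat k n l)"
  proof -
    have ent: "mvar (Ent l i j) \<in> carrier ?Z" if "i < n" "j < n" for i j
      using l that by (intro mvar_zpoly) simp
    have "gl_cls k n ?d = mat_det (O_GL k n) n (\<lambda>ij. gl_cls k n (case ij of (i, j) \<Rightarrow> mvar (Ent l i j)))"
      by (rule mat_det_map[OF zpoly_cring O_GL_cring gl_cls_hom]) (simp add: ent)
    also have "\<dots> = mat_det (O_GL k n) n (univ_mat k n l)"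
      by (rule mat_det_cong[OF O_GL_cring])
        (simp_all add: univ_mat_entry ring_hom_closed[OF gl_cls_hom] ent)
    finally show ?thesis .
  qed
  ultimately show "gl_cls k n (mvar (Dinv l)) \<otimes>\<^bsub>O_GL k n\<^esub> mat_det (O_GL k n) n (univ_mat k n l) = \<one>\<^bsub>O_GL k n\<^esub>"
    by simp
qed

lemma univ_mat_Units:
  assumes "l < k"
  shows "univ_mat k n l \<in> Units (mat_monoid (O_GL k n) n)"
    "inv\<^bsub>O_GL k n\<^esub> (mat_det (O_GL k n) n (univ_mat k n l)) = gl_cls k n (mvar (Dinv l))"
proof -
  interpret O: cring "O_GL k n" by (rule O_GL_cring)
  let ?d = "mat_det (O_GL k n) n (univ_mat k n l)" and ?D = "gl_cls k n (mvar (Dinv l))"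
  have c: "?d \<in> carrier (O_GL k n)" "?D \<in> carrier (O_GL k n)"
    using assms univ_mat_det(2)
    by (auto intro!: mat_det_closed[OF O_GL_cring] mat_closed[OF O_GL_cring] univ_mat_closed)
  have eq: "?D \<otimes>\<^bsub>O_GL k n\<^esub> ?d = \<one>\<^bsub>O_GL k n\<^esub>" "?d \<otimes>\<^bsub>O_GL k n\<^esub> ?D = \<one>\<^bsub>O_GL k n\<^esub>"
    using univ_mat_det(1)[OF assms] O.m_comm[OF c] by auto
  then have "?d \<in> Units (O_GL k n)" using c by (auto simp: Units_def)
  then show "univ_mat k n l \<in> Units (mat_monoid (O_GL k n) n)"
    by (simp add: mat_Units_iff[OF O_GL_cring] univ_mat_closed assms)
  show "inv\<^bsub>O_GL k n\<^esub> ?d = ?D" using O.inv_char[OF c eq(2,1)] .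
qed

text \<open>Since \<open>Dinv l\<close> is evaluated at the inverse determinant of
  \<open>Ms l\<close>, the generators of \<open>gl_ideal\<close> are sent to zero and the evaluation
  descends to the quotient.\<close>

lemma gl_eval_hom:
  fixes R :: "'r ring"
  assumes R: "cring R" and Ms: "\<And>l. l < k \<Longrightarrow> Ms l \<in> Units (mat_monoid R n)"
  shows "gl_eval n R Ms \<in> ring_hom (O_GL k n) R"
    "\<And>l i j. l < k \<Longrightarrow> i < n \<Longrightarrow> j < n \<Longrightarrow> gl_eval n R Ms (univ_mat k n l (i, j)) = Ms l (i, j)"
proof -
  let ?Z = "zpoly (gl_vars k n)"
  let ?val = "\<lambda>v. case v of Ent l i j \<Rightarrow> Ms l (i, j) | Dinv l \<Rightarrow> inv\<^bsub>R\<^esub> (mat_det R n (Ms l))"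
  let ?h = "peval R ?val"
  interpret Z: cring ?Z by (rule zpoly_cring)
  interpret R: cring R by (rule R)
  have Ms': "Ms l \<in> carrier (mat_monoid R n)" "mat_det R n (Ms l) \<in> Units R" if "l < k" for l
    using Ms[OF that] by (auto simp: mat_Units_iff[OF R])
  have val: "?val v \<in> carrier R" if "v \<in> gl_vars k n" for v
    using that mat_closed[OF R Ms'(1)] Ms'(2) by (auto split: gl_var.split)
  have h: "?h \<in> ring_hom ?Z R" by (rule peval_ring_hom(1)[OF R val])
  have hv: "?h (mvar v) = ?val v" if "v \<in> gl_vars k n" for v
    by (rule peval_ring_hom(2)[OF R val that])
  interpret h: ring_hom_cring ?Z R ?h by unfold_locales (rule h)
  have gen: "?h (mvar (Dinv l) * mat_det ?Z n (\<lambda>(i, j). mvar (Ent l i j)) - 1) = \<zero>\<^bsub>R\<^esub>" if l: "l < k" for l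
  proof -
    let ?d = "mat_det ?Z n (\<lambda>(i, j). mvar (Ent l i j))"
    have D: "mvar (Dinv l) \<in> carrier ?Z" using l by (intro mvar_zpoly) simp
    have ent: "mvar (Ent l i j) \<in> carrier ?Z" if "i < n" "j < n" for i j
      using l that by (intro mvar_zpoly) simp
    have "?h ?d = mat_det R n (\<lambda>ij. ?h (case ij of (i, j) \<Rightarrow> mvar (Ent l i j)))"
      by (rule mat_det_map[OF zpoly_cring R h]) (simp add: ent)
    also have "\<dots> = mat_det R n (Ms l)"
      by (rule mat_det_cong[OF R]) (simp_all add: hv l mat_closed[OF R Ms'(1)])
    finally have "?h (mvar (Dinv l) \<otimes>\<^bsub>?Z\<^esub> ?d) = \<one>\<^bsub>R\<^esub>"
      using D gl_gens_closed(1)[OF l] Ms'(2)[OF l] by (simp only: h.hom_mult) (simp add: hv l)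
    moreover have "mvar (Dinv l) * ?d - 1 = mvar (Dinv l) \<otimes>\<^bsub>?Z\<^esub> ?d \<ominus>\<^bsub>?Z\<^esub> \<one>\<^bsub>?Z\<^esub>"
      using Z.one_closed by (simp add: a_minus_def)
    ultimately show ?thesis
      using Z.m_closed[OF D gl_gens_closed(1)[OF l]] Z.one_closed
      by (simp only: a_minus_def h.hom_add Z.a_inv_closed h.hom_a_inv h.hom_one R.r_neg R.one_closed)
  qed
  have hr: "ring_hom_ring ?Z R ?h"
    by (intro ring_hom_ring.intro ring_hom_ring_axioms.intro Z.ring_axioms R.ring_axioms h)
  have "gl_ideal k n \<subseteq> a_kernel ?Z R ?h"
    unfolding gl_ideal_def
  proof (rule Z.genideal_minimal[OF ring_hom_ring.kernel_is_ideal[OF hr]], safe)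
    fix l assume "l < k"
    from gl_gens_closed(2)[OF this] gen[OF this]
    show "mvar (Dinv l) * mat_det ?Z n (\<lambda>(i, j). mvar (Ent l i j)) - 1 \<in> a_kernel ?Z R ?h"
      unfolding a_kernel_def' by blast
  qed
  then have ker: "?h x = \<zero>\<^bsub>R\<^esub>" if "x \<in> gl_ideal k n" for x
    using that unfolding a_kernel_def' by blast
  note quot = quot_ring_hom[OF zpoly_cring R gl_ideal_ideal h ker]
  show "gl_eval n R Ms \<in> ring_hom (O_GL k n) R"
    using quot(2) unfolding gl_eval_def[abs_def] O_GL_def by simp
  show "gl_eval n R Ms (univ_mat k n l (i, j)) = Ms l (i, j)" if "l < k" "i < n" "j < n" for l i j
    using that quot(1)[OF _ mvar_zpoly[of "Ent l i j" "gl_vars k n"]]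
    by (simp add: gl_eval_def univ_mat_entry gl_cls_def hv)
qed

lemma gl_eval_mat_map:
  fixes R :: "'r ring"
  assumes "cring R" "\<And>l. l < k \<Longrightarrow> Ms l \<in> Units (mat_monoid R n)" "l < k"
  shows "mat_map n (gl_eval n R Ms) (univ_mat k n l) = Ms l"
proof (rule mat_eqI[OF assms(1)])
  show "mat_map n (gl_eval n R Ms) (univ_mat k n l) \<in> carrier (mat_monoid R n)"
    by (rule mat_map_closed[OF O_GL_cring assms(1) gl_eval_hom(1)[OF assms(1,2)] univ_mat_closed[OF assms(3)]])
  show "Ms l \<in> carrier (mat_monoid R n)" using assms mat_Units_iff[OF assms(1)] by blast
qed (use assms in \<open>simp add: gl_eval_hom(2)\<close>)

lemma O_GL_generated:
  "carrier (O_GL k n) \<subseteq> generate_ring (O_GL k n)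
    ({univ_mat k n l (i, j) | l i j. l < k \<and> i < n \<and> j < n} \<union>
     {inv\<^bsub>O_GL k n\<^esub> (mat_det (O_GL k n) n (univ_mat k n l)) | l. l < k})" (is "_ \<subseteq> generate_ring _ ?G")
proof
  fix g assume "g \<in> carrier (O_GL k n)"
  then obtain p where p: "p \<in> carrier (zpoly (gl_vars k n))" "g = gl_cls k n p"
    by (auto simp: carrier_O_GL)
  have sub: "mvar ` gl_vars k n \<subseteq> carrier (zpoly (gl_vars k n))" by (auto intro: mvar_zpoly)
  have "g \<in> generate_ring (O_GL k n) (gl_cls k n ` mvar ` gl_vars k n)"
    unfolding p(2) using p(1) zpoly_generated sub
    by (intro generate_ring_hom_image[OF _ gl_cls_hom] cring.axioms(1) zpoly_cring O_GL_cring) auto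
  moreover have "gl_cls k n ` mvar ` gl_vars k n \<subseteq> ?G"
  proof
    fix x assume "x \<in> gl_cls k n ` mvar ` gl_vars k n"
    then obtain v where v: "v \<in> gl_vars k n" "x = gl_cls k n (mvar v)" by blast
    show "x \<in> ?G"
    proof (cases v)
      case (Ent l i j)
      then have "x = univ_mat k n l (i, j) \<and> l < k \<and> i < n \<and> j < n"
        using v by (simp add: univ_mat_entry)
      then show ?thesis by blast
    next
      case (Dinv l)
      then have "x = inv\<^bsub>O_GL k n\<^esub> (mat_det (O_GL k n) n (univ_mat k n l)) \<and> l < k"
        using v by (simp add: univ_mat_Units)
      then show ?thesis by blast
    qed
  qed
  ultimately show "g \<in> generate_ring (O_GL k n) ?G" using generate_ring_mono by blast
qed

text \<open>The ring is generated by the entries and the inverse determinants, and homomorphisms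
  that agree on entries agree on determinants and on their inverses.\<close>

lemma O_GL_hom_eqI:
  fixes R :: "'r ring"
  assumes R: "cring R" and h: "h \<in> ring_hom (O_GL k n) R" and h': "h' \<in> ring_hom (O_GL k n) R"
    and eq: "\<And>l. l < k \<Longrightarrow> mat_map n h (univ_mat k n l) = mat_map n h' (univ_mat k n l)"
    and g: "g \<in> carrier (O_GL k n)"
  shows "h g = h' g"
proof (rule generate_ring_hom_eq[OF _ _ h h' _ _ subsetD[OF O_GL_generated g]])
  have entries: "h (univ_mat k n l (i, j)) = h' (univ_mat k n l (i, j))" if "l < k" "i < n" "j < n" for l i j
    using arg_cong[OF eq[OF that(1)], of "\<lambda>M. M (i, j)"] that by simp
  have closed: "univ_mat k n l (i, j) \<in> carrier (O_GL k n)" if "l < k" "i < n" "j < n" for l i j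
    by (rule mat_closed[OF O_GL_cring univ_mat_closed[OF that(1)] that(2,3)])
  have det: "mat_det (O_GL k n) n (univ_mat k n l) \<in> Units (O_GL k n)" if "l < k" for l
    using univ_mat_Units(1)[OF that] by (simp add: mat_Units_iff[OF O_GL_cring])
  have deteq: "h (mat_det (O_GL k n) n (univ_mat k n l)) = h' (mat_det (O_GL k n) n (univ_mat k n l))" if "l < k" for l
    using that closed entries
    by (simp add: mat_det_map[OF O_GL_cring R h] mat_det_map[OF O_GL_cring R h'])
      (intro mat_det_cong[OF R] ring_hom_closed[OF h'], auto)
  show "h x = h' x" if "x \<in> {univ_mat k n l (i, j) | l i j. l < k \<and> i < n \<and> j < n} \<union>
     {inv\<^bsub>O_GL k n\<^esub> (mat_det (O_GL k n) n (univ_mat k n l)) | l. l < k}" for x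
    using that det deteq entries
    by (auto simp: ring_hom_Units(2)[OF O_GL_cring R h] ring_hom_Units(2)[OF O_GL_cring R h'])
  interpret O: cring "O_GL k n" by (rule O_GL_cring)
  show "{univ_mat k n l (i, j) | l i j. l < k \<and> i < n \<and> j < n} \<union>
     {inv\<^bsub>O_GL k n\<^esub> (mat_det (O_GL k n) n (univ_mat k n l)) | l. l < k} \<subseteq> carrier (O_GL k n)"
    using closed det by auto
qed (use R O_GL_cring in \<open>auto intro: cring.axioms(1)\<close>)

section \<open>The split algebra in a varying basis\<close>

section \<open>Structure constants of the split algebra\<close>

text \<open>
  The structure constants of the product algebra \<open>R\<^sup>n\<close> with the basis given by the invertible
  matrix \<open>M\<close>, that is, by the columns of the inverse of \<open>M\<close>; \<open>split_gram\<close> is the inverse of the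
  matrix of the trace form.
\<close>

definition split_mult :: "nat \<Rightarrow> 'r ring \<Rightarrow> 'r matrix \<Rightarrow> nat \<Rightarrow> nat \<Rightarrow> nat \<Rightarrow> 'r" where
  "split_mult n R M i j k = (\<Oplus>\<^bsub>R\<^esub>l\<in>{..<n}. M (k, l) \<otimes>\<^bsub>R\<^esub>
     ((inv\<^bsub>mat_monoid R n\<^esub> M) (l, i) \<otimes>\<^bsub>R\<^esub> (inv\<^bsub>mat_monoid R n\<^esub> M) (l, j)))"

definition split_unit :: "nat \<Rightarrow> 'r ring \<Rightarrow> 'r matrix \<Rightarrow> nat \<Rightarrow> 'r" where
  "split_unit n R M k = (\<Oplus>\<^bsub>R\<^esub>l\<in>{..<n}. M (k, l))"

definition split_gram :: "nat \<Rightarrow> 'r ring \<Rightarrow> 'r matrix \<Rightarrow> nat \<Rightarrow> nat \<Rightarrow> 'r" where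
  "split_gram n R M k j = (\<Oplus>\<^bsub>R\<^esub>l\<in>{..<n}. M (k, l) \<otimes>\<^bsub>R\<^esub> M (j, l))"

lemma subring_finsum:
  assumes R: "cring R" and K: "subring K R" and f: "\<And>i. i \<in> A \<Longrightarrow> f i \<in> K"
  shows "(\<Oplus>\<^bsub>R\<^esub>i\<in>A. f i) \<in> K"
proof -
  interpret cring R by (rule R)
  show ?thesis
    using f
  proof (induction A rule: infinite_finite_induct)
    case (insert x A)
    then have "f \<in> A \<rightarrow> carrier R" "f x \<in> carrier R" using subringE(1)[OF K] by auto
    with insert show ?case using subringE(7)[OF K] by simp
  qed (use subringE(2)[OF K] in simp_all)
qed

lemma subring_finprod:
  assumes R: "cring R" and K: "subring K R" and f: "\<And>i. i \<in> A \<Longrightarrow> f i \<in> K"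
  shows "(\<Otimes>\<^bsub>R\<^esub>i\<in>A. f i) \<in> K"
proof -
  interpret cring R by (rule R)
  show ?thesis
    using f
  proof (induction A rule: infinite_finite_induct)
    case (insert x A)
    then have "f \<in> A \<rightarrow> carrier R" "f x \<in> carrier R" using subringE(1)[OF K] by auto
    with insert show ?case using subringE(6)[OF K] by simp
  qed (use subringE(3)[OF K] in simp_all)
qed

lemma subring_sign:
  "subring K R \<Longrightarrow> (if b then \<one>\<^bsub>R\<^esub> else \<ominus>\<^bsub>R\<^esub> \<one>\<^bsub>R\<^esub>) \<in> K"
  using subringE(3,5)[of K R] by auto

lemma subring_mat_mix:
  assumes R: "cring R" and K: "subring K R"
    and a: "\<And>s i j. s \<in> S \<Longrightarrow> i < n \<Longrightarrow> j < n \<Longrightarrow> a s (i, j) \<in> K"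
  shows "mat_mix R S n a \<in> K"
  unfolding mat_mix_def
proof (intro subring_finsum[OF R K] subringE(6)[OF K] subring_sign[OF K] subring_finprod[OF R K])
  fix \<sigma> \<iota> s assume "\<sigma> \<in> {\<sigma>. \<sigma> permutes S}" "\<iota> \<in> S \<rightarrow>\<^sub>E {..<n}" "s \<in> S"
  then have "s \<in> S" "\<iota> s < n" "\<iota> (\<sigma> s) < n" using permutes_in_image[of \<sigma> S s] by (auto simp: PiE_iff)
  then show "a s (\<iota> s, \<iota> (\<sigma> s)) \<in> K" by (rule a)
qed

lemma subring_mat_det:
  assumes R: "cring R" and K: "subring K R"
    and M: "\<And>i j. i < n \<Longrightarrow> j < n \<Longrightarrow> M (i, j) \<in> K"
  shows "mat_det R n M \<in> K"
  unfolding mat_det_def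
proof (intro subring_finsum[OF R K] subringE(6)[OF K] subring_sign[OF K] subring_finprod[OF R K])
  fix \<sigma> i assume "\<sigma> \<in> {\<sigma>. \<sigma> permutes {..<n}}" "i \<in> {..<n}"
  then show "M (i, \<sigma> i) \<in> K" using M permutes_in_image[of \<sigma> "{..<n}" i] by auto
qed

lemma finprod_finsum_PiE:
  fixes R :: "'r ring"
  assumes R: "cring R" and fin: "finite A" "finite B"
    and f: "\<And>x y. x \<in> A \<Longrightarrow> y \<in> B \<Longrightarrow> f x y \<in> carrier R"
  shows "(\<Otimes>\<^bsub>R\<^esub>x\<in>A. \<Oplus>\<^bsub>R\<^esub>y\<in>B. f x y) = (\<Oplus>\<^bsub>R\<^esub>g\<in>A \<rightarrow>\<^sub>E B. \<Otimes>\<^bsub>R\<^esub>x\<in>A. f x (g x))"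
proof -
  interpret cring R by (rule R)
  obtain h :: "'r int_mpoly \<Rightarrow> 'r" where "class_ring_hom R h" and h: "\<And>r. r \<in> carrier R \<Longrightarrow> h (mvar r) = r"
    by (rule ex_class_ring_hom[OF R]) blast
  then interpret h: class_ring_hom R h by simp
  have "(\<Oplus>\<^bsub>R\<^esub>y\<in>B. f x y) = (\<Oplus>\<^bsub>R\<^esub>y\<in>B. h (mvar (f x y)))" if "x \<in> A" for x
    using that f by (intro finsum_cong') (auto simp: h)
  then have "(\<Otimes>\<^bsub>R\<^esub>x\<in>A. \<Oplus>\<^bsub>R\<^esub>y\<in>B. f x y) = h (\<Prod>x\<in>A. \<Sum>y\<in>B. mvar (f x y))"
    by (simp only: h.hom_prod h.hom_sum) (intro finprod_cong', auto)
  also have "\<dots> = h (\<Sum>g\<in>A \<rightarrow>\<^sub>E B. \<Prod>x\<in>A. mvar (f x (g x)))"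
    by (simp add: prod_sum_PiE fin)
  also have "\<dots> = (\<Oplus>\<^bsub>R\<^esub>g\<in>A \<rightarrow>\<^sub>E B. \<Otimes>\<^bsub>R\<^esub>x\<in>A. f x (g x))"
    unfolding h.hom_sum h.hom_prod
  proof (intro finsum_cong' refl)
    have fg: "f x (g x) \<in> carrier R" if "g \<in> A \<rightarrow>\<^sub>E B" "x \<in> A" for g x
      using that f by auto
    then show "(\<lambda>g. \<Otimes>\<^bsub>R\<^esub>x\<in>A. f x (g x)) \<in> (A \<rightarrow>\<^sub>E B) \<rightarrow> carrier R" by auto
    fix g assume "g \<in> A \<rightarrow>\<^sub>E B"
    then show "(\<Otimes>\<^bsub>R\<^esub>x\<in>A. h (mvar (f x (g x)))) = (\<Otimes>\<^bsub>R\<^esub>x\<in>A. f x (g x))"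
      using fg by (intro finprod_cong') (auto simp: h)
  qed
  finally show ?thesis .
qed

context
  fixes R :: "'r ring" (structure) and n :: nat and M N :: "'r matrix"
  assumes R: "cring R" and M: "M \<in> Units (mat_monoid R n)"
  defines "N \<equiv> inv\<^bsub>mat_monoid R n\<^esub> M"
begin

interpretation cring R by (rule R)
interpretation MM: monoid "mat_monoid R n" by (rule mat_monoid_monoid[OF R])

lemma mat_Units_entries:
  "i < n \<Longrightarrow> j < n \<Longrightarrow> M (i, j) \<in> carrier R" "i < n \<Longrightarrow> j < n \<Longrightarrow> N (i, j) \<in> carrier R"
  using M by (auto intro!: mat_closed[OF R, of _ n] simp: N_def)

lemma mat_Units_cancel:
  assumes l: "l < n" and v: "\<And>m. m < n \<Longrightarrow> v m \<in> carrier R"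
  shows "(\<Oplus>k\<in>{..<n}. N (l, k) \<otimes> (\<Oplus>m\<in>{..<n}. M (k, m) \<otimes> v m)) = v l"
    "(\<Oplus>k\<in>{..<n}. M (l, k) \<otimes> (\<Oplus>m\<in>{..<n}. N (k, m) \<otimes> v m)) = v l"
proof -
  have "(\<Oplus>m\<in>{..<n}. (\<Oplus>k\<in>{..<n}. A (l, k) \<otimes> B (k, m)) \<otimes> v m) = v l"
    if "A \<otimes>\<^bsub>mat_monoid R n\<^esub> B = \<one>\<^bsub>mat_monoid R n\<^esub>" for A B
  proof -
    have "(\<Oplus>k\<in>{..<n}. A (l, k) \<otimes> B (k, m)) = (if l = m then \<one> else \<zero>)" if "m < n" for m
      using arg_cong[OF \<open>A \<otimes>\<^bsub>mat_monoid R n\<^esub> B = \<one>\<^bsub>mat_monoid R n\<^esub>\<close>, of "\<lambda>C. C (l, m)"] that l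
      by (simp add: mat_mult_entry[OF R] mat_one_entry[OF R])
    then have "(\<Oplus>m\<in>{..<n}. (\<Oplus>k\<in>{..<n}. A (l, k) \<otimes> B (k, m)) \<otimes> v m) =
        (\<Oplus>m\<in>{..<n}. (if l = m then \<one> else \<zero>) \<otimes> v m)"
      using v by (intro finsum_cong') auto
    also have "\<dots> = v l" using l v by (intro finsum_delta[OF R]) auto
    finally show ?thesis .
  qed
  moreover have "N \<otimes>\<^bsub>mat_monoid R n\<^esub> M = \<one>\<^bsub>mat_monoid R n\<^esub>" "M \<otimes>\<^bsub>mat_monoid R n\<^esub> N = \<one>\<^bsub>mat_monoid R n\<^esub>"
    using M by (auto simp: N_def)
  moreover have "(\<Oplus>m\<in>{..<n}. (\<Oplus>k\<in>{..<n}. N (l, k) \<otimes> M (k, m)) \<otimes> v m) =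
      (\<Oplus>k\<in>{..<n}. N (l, k) \<otimes> (\<Oplus>m\<in>{..<n}. M (k, m) \<otimes> v m))"
    "(\<Oplus>m\<in>{..<n}. (\<Oplus>k\<in>{..<n}. M (l, k) \<otimes> N (k, m)) \<otimes> v m) =
      (\<Oplus>k\<in>{..<n}. M (l, k) \<otimes> (\<Oplus>m\<in>{..<n}. N (k, m) \<otimes> v m))"
    using l v mat_Units_entries by (auto intro!: finsum_mult_assoc[OF R])
  ultimately show "(\<Oplus>k\<in>{..<n}. N (l, k) \<otimes> (\<Oplus>m\<in>{..<n}. M (k, m) \<otimes> v m)) = v l"
    "(\<Oplus>k\<in>{..<n}. M (l, k) \<otimes> (\<Oplus>m\<in>{..<n}. N (k, m) \<otimes> v m)) = v l"
    by simp_all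
qed

lemma split_closed:
  "i < n \<Longrightarrow> j < n \<Longrightarrow> k < n \<Longrightarrow> split_mult n R M i j k \<in> carrier R"
  "k < n \<Longrightarrow> split_unit n R M k \<in> carrier R"
  "k < n \<Longrightarrow> j < n \<Longrightarrow> split_gram n R M k j \<in> carrier R"
  unfolding split_mult_def split_unit_def split_gram_def N_def[symmetric]
  by (auto intro!: finsum_closed mat_Units_entries)

text \<open>Row l of \<open>N\<close> lists the values of the l-th projection of the split algebra
  at the basis elements; the identity says that this projection is multiplicative.\<close>

lemma split_mult_inverse:
  assumes "i < n" "j < n" "l < n"
  shows "(\<Oplus>k\<in>{..<n}. split_mult n R M i j k \<otimes> N (l, k)) = N (l, i) \<otimes> N (l, j)"
proof -
  have "(\<Oplus>k\<in>{..<n}. split_mult n R M i j k \<otimes> N (l, k)) =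
      (\<Oplus>k\<in>{..<n}. N (l, k) \<otimes> (\<Oplus>m\<in>{..<n}. M (k, m) \<otimes> (N (m, i) \<otimes> N (m, j))))"
    using assms split_closed(1)[of i j] unfolding split_mult_def N_def[symmetric]
    by (intro finsum_cong') (auto intro!: m_comm mat_Units_entries)
  also have "\<dots> = N (l, i) \<otimes> N (l, j)"
    using assms by (intro mat_Units_cancel(1)) (auto intro!: mat_Units_entries)
  finally show ?thesis .
qed

text \<open>The same projection sends the unit to 1.\<close>

lemma split_unit_inverse:
  assumes "l < n" shows "(\<Oplus>k\<in>{..<n}. split_unit n R M k \<otimes> N (l, k)) = \<one>"
proof -
  have "split_unit n R M k = (\<Oplus>m\<in>{..<n}. M (k, m) \<otimes> \<one>)" if "k < n" for k
    unfolding split_unit_def using that by (intro finsum_cong') (auto simp: mat_Units_entries)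
  then have "(\<Oplus>k\<in>{..<n}. split_unit n R M k \<otimes> N (l, k)) =
      (\<Oplus>k\<in>{..<n}. N (l, k) \<otimes> (\<Oplus>m\<in>{..<n}. M (k, m) \<otimes> \<one>))"
    using assms split_closed(2)
    by (intro finsum_cong') (auto intro!: m_comm mat_Units_entries m_closed)
  also have "\<dots> = \<one>" using assms by (intro mat_Units_cancel(1)) auto
  finally show ?thesis .
qed

text \<open>The product of \<open>M\<close>, its transpose and the transpose of \<open>N\<close> is
  \<open>M\<close>. This expresses the entries of \<open>M\<close> through those of its inverse,
  with coefficients that do not change when the columns of \<open>M\<close> are permuted.\<close>

lemma split_gram_inverse:
  assumes "k < n" "l < n" shows "(\<Oplus>j\<in>{..<n}. split_gram n R M k j \<otimes> N (l, j)) = M (k, l)"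
proof -
  have "(\<Oplus>j\<in>{..<n}. split_gram n R M k j \<otimes> N (l, j)) =
      (\<Oplus>j\<in>{..<n}. N (l, j) \<otimes> (\<Oplus>m\<in>{..<n}. M (j, m) \<otimes> M (k, m)))"
  proof (intro finsum_cong' refl)
    fix j assume j: "j \<in> {..<n}"
    have "split_gram n R M k j = (\<Oplus>m\<in>{..<n}. M (j, m) \<otimes> M (k, m))"
      unfolding split_gram_def using j assms
      by (intro finsum_cong') (auto intro!: m_comm mat_Units_entries)
    then show "split_gram n R M k j \<otimes> N (l, j) = N (l, j) \<otimes> (\<Oplus>m\<in>{..<n}. M (j, m) \<otimes> M (k, m))"
      using j assms split_closed(3)[of k j] by (auto intro!: m_comm mat_Units_entries)
  qed (use assms in \<open>auto intro!: mat_Units_entries m_closed finsum_closed\<close>)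
  also have "\<dots> = M (k, l)"
    using assms by (intro mat_Units_cancel(1)) (auto intro!: mat_Units_entries)
  finally show ?thesis .
qed

text \<open>The matrices are diagonal in a common basis, so their mixed discriminant is the
  permanent of the array of eigenvalues d.\<close>

lemma mat_mix_conj:
  assumes d: "\<And>s p. s < n \<Longrightarrow> p < n \<Longrightarrow> d s p \<in> carrier R"
  shows "mat_mix R {..<n} n (\<lambda>s (i, j). \<Oplus>p\<in>{..<n}. M (i, p) \<otimes> (d s p \<otimes> N (p, j))) =
    (\<Oplus>\<rho>\<in>{\<rho>. \<rho> permutes {..<n}}. \<Otimes>s\<in>{..<n}. d s (\<rho> s))"
proof -
  obtain h :: "'r int_mpoly \<Rightarrow> 'r" where "class_ring_hom R h" and h: "\<And>r. r \<in> carrier R \<Longrightarrow> h (mvar r) = r"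
    by (rule ex_class_ring_hom[OF R]) blast
  then interpret h: class_ring_hom R h by simp
  let ?M = "\<lambda>ij. mvar (M ij)" and ?N = "\<lambda>ij. mvar (N ij)" and ?d = "\<lambda>s p. mvar (d s p)"
  note [simp] = mat_Units_entries h d
  have NM: "(\<Oplus>i\<in>{..<n}. N (p, i) \<otimes> M (i, q)) = (if p = q then \<one> else \<zero>)" if "p < n" "q < n" for p q
  proof -
    have "N \<otimes>\<^bsub>mat_monoid R n\<^esub> M = \<one>\<^bsub>mat_monoid R n\<^esub>" using M by (simp add: N_def)
    from arg_cong[OF this, of "\<lambda>C. C (p, q)"] that show ?thesis
      by (simp add: mat_mult_entry[OF R] mat_one_entry[OF R])
  qed
  have "mat_mix R {..<n} n (\<lambda>s (i, j). \<Oplus>p\<in>{..<n}. M (i, p) \<otimes> (d s p \<otimes> N (p, j))) =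
      mat_mix R {..<n} n (\<lambda>s ij. h (case ij of (i, j) \<Rightarrow> \<Sum>p<n. ?M (i, p) * ?d s p * ?N (p, j)))"
    by (rule mat_mix_cong[OF R]) (auto simp: h.hom_sum h.hom_mult m_assoc intro!: finsum_cong')
  also have "\<dots> = mat_mix R {..<n} n (\<lambda>s ij. h (case ij of (p, q) \<Rightarrow> ?d s p * (\<Sum>i<n. ?N (p, i) * ?M (i, q))))"
    unfolding h.mat_mix_hom using cmix_conj[of "{..<n}" n ?M ?d ?N] by simp
  also have "\<dots> = mat_mix R {..<n} n (\<lambda>s ij. h (case ij of (p, q) \<Rightarrow> ?d s p * (if p = q then 1 else 0)))"
  proof (rule mat_mix_cong[OF R])
    fix s p q assume "s \<in> {..<n}" "p < n" "q < n"
    moreover from this have "h (\<Sum>i<n. ?N (p, i) * ?M (i, q)) = (\<Oplus>i\<in>{..<n}. N (p, i) \<otimes> M (i, q))"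
      unfolding h.hom_sum by (intro finsum_cong') (auto simp: h.hom_mult)
    ultimately show "h (case (p, q) of (p, q) \<Rightarrow> ?d s p * (\<Sum>i<n. ?N (p, i) * ?M (i, q))) =
        h (case (p, q) of (p, q) \<Rightarrow> ?d s p * (if p = q then 1 else 0))"
      by (simp add: h.hom_mult NM h.hom_one h.hom_zero)
  qed simp
  also have "\<dots> = h (\<Sum>\<rho> | \<rho> permutes {..<n}. \<Prod>s<n. ?d s (\<rho> s))"
    unfolding h.mat_mix_hom by (simp only: cmix_diag)
  also have "\<dots> = (\<Oplus>\<rho>\<in>{\<rho>. \<rho> permutes {..<n}}. \<Otimes>s\<in>{..<n}. d s (\<rho> s))"
    unfolding h.hom_sum h.hom_prod
  proof (intro finsum_cong' refl)
    have d\<rho>: "d s (\<rho> s) \<in> carrier R" if "\<rho> permutes {..<n}" "s < n" for \<rho> s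
      using that permutes_in_image[of \<rho> "{..<n}" s] by simp
    then show "(\<lambda>\<rho>. \<Otimes>s\<in>{..<n}. d s (\<rho> s)) \<in> {\<rho>. \<rho> permutes {..<n}} \<rightarrow> carrier R" by auto
    fix \<rho> assume "\<rho> \<in> {\<rho>. \<rho> permutes {..<n}}"
    then show "(\<Otimes>s\<in>{..<n}. h (mvar (d s (\<rho> s)))) = (\<Otimes>s\<in>{..<n}. d s (\<rho> s))"
      using d\<rho> by (intro finprod_cong') auto
  qed
  finally show ?thesis .
qed

lemma mat_perm_entry:
  assumes "\<sigma> permutes {..<n}" "i < n" "j < n"
  shows "(M \<otimes>\<^bsub>mat_monoid R n\<^esub> perm_mat R n \<sigma>) (i, j) = M (i, \<sigma> j)"
proof -
  have \<sigma>: "\<sigma> j < n" using assms permutes_in_image[of \<sigma> "{..<n}" j] by simp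
  have "(M \<otimes>\<^bsub>mat_monoid R n\<^esub> perm_mat R n \<sigma>) (i, j) = (\<Oplus>k\<in>{..<n}. M (i, k) \<otimes> (if k = \<sigma> j then \<one> else \<zero>))"
    using assms by (simp add: mat_mult_entry[OF R]) (auto intro!: finsum_cong' simp: perm_mat_def mat_Units_entries)
  also have "\<dots> = M (i, \<sigma> j)"
    using \<sigma> assms by (intro finsum_delta(4)[OF R]) (auto simp: mat_Units_entries)
  finally show ?thesis .
qed

lemma finsum_permute:
  assumes "\<sigma> permutes {..<n}" "\<And>i. i < n \<Longrightarrow> f i \<in> carrier R"
  shows "(\<Oplus>l\<in>{..<n}. f (\<sigma> l)) = (\<Oplus>l\<in>{..<n}. f l)"
  using finsum_reindex[of f \<sigma> "{..<n}"] assms permutes_image[OF assms(1)] permutes_inj_on[OF assms(1)]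
  by (simp add: Pi_iff)

lemma mat_perm_Units:
  assumes \<sigma>: "\<sigma> permutes {..<n}"
  shows "M \<otimes>\<^bsub>mat_monoid R n\<^esub> perm_mat R n \<sigma> \<in> Units (mat_monoid R n)"
    "i < n \<Longrightarrow> j < n \<Longrightarrow> (inv\<^bsub>mat_monoid R n\<^esub> (M \<otimes>\<^bsub>mat_monoid R n\<^esub> perm_mat R n \<sigma>)) (i, j) = N (\<sigma> i, j)"
proof -
  let ?MP = "M \<otimes>\<^bsub>mat_monoid R n\<^esub> perm_mat R n \<sigma>"
  define K where "K = (\<lambda>(i, j)\<in>{..<n} \<times> {..<n}. N (\<sigma> i, j))"
  have \<sigma>n: "\<sigma> j < n" if "j < n" for j using that permutes_in_image[OF \<sigma>, of j] by simp
  have "perm_mat R n \<sigma> \<in> carrier (mat_monoid R n)"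
    unfolding perm_mat_def by (rule mat_carrierI[OF R]) simp
  then have c: "?MP \<in> carrier (mat_monoid R n)" using M by (intro mat_mult_closed[OF R]) auto
  have K: "K \<in> carrier (mat_monoid R n)"
    unfolding K_def by (rule mat_carrierI[OF R]) (simp add: \<sigma>n mat_Units_entries)
  have "?MP \<otimes>\<^bsub>mat_monoid R n\<^esub> K = \<one>\<^bsub>mat_monoid R n\<^esub>"
  proof (rule mat_eqI[OF R mat_mult_closed[OF R c K] mat_one_closed[OF R]])
    fix i j assume ij: "i < n" "j < n"
    have "(?MP \<otimes>\<^bsub>mat_monoid R n\<^esub> K) (i, j) = (\<Oplus>k\<in>{..<n}. M (i, \<sigma> k) \<otimes> N (\<sigma> k, j))"
      using ij \<sigma> by (simp only: mat_mult_entry[OF R ij, of ?MP])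
        (auto intro!: finsum_cong' simp: mat_perm_entry K_def \<sigma>n mat_Units_entries)
    also have "\<dots> = (M \<otimes>\<^bsub>mat_monoid R n\<^esub> N) (i, j)"
      using ij finsum_permute[OF \<sigma>, of "\<lambda>k. M (i, k) \<otimes> N (k, j)"]
      by (simp add: mat_mult_entry[OF R] mat_Units_entries)
    also have "\<dots> = \<one>\<^bsub>mat_monoid R n\<^esub> (i, j)" using M by (simp add: N_def)
    finally show "(?MP \<otimes>\<^bsub>mat_monoid R n\<^esub> K) (i, j) = \<one>\<^bsub>mat_monoid R n\<^esub> (i, j)" .
  qed
  from mat_UnitsI[OF R c K this]
  show "?MP \<in> Units (mat_monoid R n)" "i < n \<Longrightarrow> j < n \<Longrightarrow> (inv\<^bsub>mat_monoid R n\<^esub> ?MP) (i, j) = N (\<sigma> i, j)"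
    by (simp_all add: K_def)
qed

text \<open>Each of the three functions is a sum over l of expressions in column l of
  \<open>M\<close> and row l of its inverse; permuting the columns permutes the summands.\<close>

lemma split_perm:
  assumes \<sigma>: "\<sigma> permutes {..<n}"
  shows "i < n \<Longrightarrow> j < n \<Longrightarrow> k < n \<Longrightarrow>
      split_mult n R (M \<otimes>\<^bsub>mat_monoid R n\<^esub> perm_mat R n \<sigma>) i j k = split_mult n R M i j k"
    "k < n \<Longrightarrow> split_unit n R (M \<otimes>\<^bsub>mat_monoid R n\<^esub> perm_mat R n \<sigma>) k = split_unit n R M k"
    "k < n \<Longrightarrow> j < n \<Longrightarrow> split_gram n R (M \<otimes>\<^bsub>mat_monoid R n\<^esub> perm_mat R n \<sigma>) k j = split_gram n R M k j"
proof -
  have \<sigma>n: "\<sigma> j < n" if "j < n" for j using that permutes_in_image[OF \<sigma>, of j] by simp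
  note [simp] = mat_perm_entry[OF \<sigma>] mat_perm_Units(2)[OF \<sigma>] mat_Units_entries \<sigma>n
  assume k: "k < n"
  {
    assume ij: "i < n" "j < n"
    have "split_mult n R (M \<otimes>\<^bsub>mat_monoid R n\<^esub> perm_mat R n \<sigma>) i j k =
        (\<Oplus>l\<in>{..<n}. M (k, \<sigma> l) \<otimes> (N (\<sigma> l, i) \<otimes> N (\<sigma> l, j)))"
      unfolding split_mult_def using ij k by (intro finsum_cong') auto
    also have "\<dots> = split_mult n R M i j k"
      using finsum_permute[OF \<sigma>, of "\<lambda>l. M (k, l) \<otimes> (N (l, i) \<otimes> N (l, j))"] ij k
      by (simp add: split_mult_def N_def[symmetric])
    finally show "split_mult n R (M \<otimes>\<^bsub>mat_monoid R n\<^esub> perm_mat R n \<sigma>) i j k = split_mult n R M i j k" .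
  }
  have "split_unit n R (M \<otimes>\<^bsub>mat_monoid R n\<^esub> perm_mat R n \<sigma>) k = (\<Oplus>l\<in>{..<n}. M (k, \<sigma> l))"
    unfolding split_unit_def using k by (intro finsum_cong') auto
  also have "\<dots> = split_unit n R M k"
    using finsum_permute[OF \<sigma>, of "\<lambda>l. M (k, l)"] k by (simp add: split_unit_def)
  finally show "split_unit n R (M \<otimes>\<^bsub>mat_monoid R n\<^esub> perm_mat R n \<sigma>) k = split_unit n R M k" .
  {
    assume j: "j < n"
    have "split_gram n R (M \<otimes>\<^bsub>mat_monoid R n\<^esub> perm_mat R n \<sigma>) k j = (\<Oplus>l\<in>{..<n}. M (k, \<sigma> l) \<otimes> M (j, \<sigma> l))"
      unfolding split_gram_def using j k by (intro finsum_cong') auto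
    also have "\<dots> = split_gram n R M k j"
      using finsum_permute[OF \<sigma>, of "\<lambda>l. M (k, l) \<otimes> M (j, l)"] j k by (simp add: split_gram_def)
    finally show "split_gram n R (M \<otimes>\<^bsub>mat_monoid R n\<^esub> perm_mat R n \<sigma>) k j = split_gram n R M k j" .
  }
qed

lemma mat_perm_det:
  assumes \<sigma>: "\<sigma> permutes {..<n}"
  shows "mat_det R n (M \<otimes>\<^bsub>mat_monoid R n\<^esub> perm_mat R n \<sigma>) =
    (if evenperm \<sigma> then \<one> else \<ominus> \<one>) \<otimes> mat_det R n M"
proof -
  have \<sigma>n: "\<sigma> j < n" if "j < n" for j using that permutes_in_image[OF \<sigma>, of j] by simp
  obtain h :: "'r int_mpoly \<Rightarrow> 'r" where "class_ring_hom R h"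
    and h: "\<And>r. r \<in> carrier R \<Longrightarrow> h (mvar r) = r"
      "\<And>n M. (\<And>i j. i < n \<Longrightarrow> j < n \<Longrightarrow> M (i, j) \<in> carrier R) \<Longrightarrow>
        mat_det R n M = h (cdet n (\<lambda>ij. mvar (M ij)))"
    by (rule mat_lift[OF R]) blast
  then interpret h: class_ring_hom R h by simp
  have "mat_det R n (M \<otimes>\<^bsub>mat_monoid R n\<^esub> perm_mat R n \<sigma>) = mat_det R n (\<lambda>ij. h (case ij of (i, j) \<Rightarrow> mvar (M (i, \<sigma> j))))"
    by (rule mat_det_cong[OF R]) (simp_all add: mat_perm_entry[OF \<sigma>] h mat_Units_entries \<sigma>n)
  also have "\<dots> = h (of_int (sign \<sigma>)) \<otimes> h (cdet n (\<lambda>ij. mvar (M ij)))"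
    unfolding h.mat_det_hom h.hom_mult[symmetric]
    using cdet_permute_cols[OF \<sigma>, of "\<lambda>ij. mvar (M ij)"] by simp
  finally show ?thesis by (simp add: h(2) mat_Units_entries h.hom_sign)
qed

end

lemma split_hom:
  fixes R :: "'r ring" and S :: "'s ring"
  assumes R: "cring R" and S: "cring S" and h: "h \<in> ring_hom R S" and M: "M \<in> Units (mat_monoid R n)"
  shows "i < n \<Longrightarrow> j < n \<Longrightarrow> k < n \<Longrightarrow> h (split_mult n R M i j k) = split_mult n S (mat_map n h M) i j k"
    "k < n \<Longrightarrow> h (split_unit n R M k) = split_unit n S (mat_map n h M) k"
    "k < n \<Longrightarrow> j < n \<Longrightarrow> h (split_gram n R M k j) = split_gram n S (mat_map n h M) k j"
proof -
  interpret R: cring R by (rule R)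
  interpret S: cring S by (rule S)
  note [simp] = mat_Units_entries[OF R M] ring_hom_closed[OF h] ring_hom_mult[OF h]
    mat_map_Units(2)[OF R S h M]
  show "h (split_mult n R M i j k) = split_mult n S (mat_map n h M) i j k" if "i < n" "j < n" "k < n"
    unfolding split_mult_def using that
    by (subst ring_hom_finsum[OF R S h]) (auto intro!: S.finsum_cong')
  show "h (split_unit n R M k) = split_unit n S (mat_map n h M) k" if "k < n"
    unfolding split_unit_def using that
    by (subst ring_hom_finsum[OF R S h]) (auto intro!: S.finsum_cong')
  show "h (split_gram n R M k j) = split_gram n S (mat_map n h M) k j" if "k < n" "j < n"
    unfolding split_gram_def using that
    by (subst ring_hom_finsum[OF R S h]) (auto intro!: S.finsum_cong')
qed

section \<open>Invariants of the symmetric group acting by permutation of columns\<close>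

section \<open>Generators of the ring of invariants\<close>

text \<open>Otherwise the simplifier rewrites \<open>O_GL 1 n\<close> to \<open>O_GL (Suc 0) n\<close>.\<close>

declare One_nat_def [simp del]

lemma (in cring) sign_mult:
  assumes "a \<in> carrier R" "b \<in> carrier R"
  shows "((if P then \<one> else \<ominus> \<one>) \<otimes> a) \<otimes> ((if P then \<one> else \<ominus> \<one>) \<otimes> b) = a \<otimes> b"
    "a \<otimes> ((if P then \<one> else \<ominus> \<one>) \<otimes> b) = ((if P then \<one> else \<ominus> \<one>) \<otimes> a) \<otimes> b"
  using assms by (simp_all add: l_minus r_minus)

lemma (in cring) sign_mult_closed:
  "a \<in> carrier R \<Longrightarrow> (if P then \<one> else \<ominus> \<one>) \<otimes> a \<in> carrier R"
  by simp

definition quot_gens :: "nat \<Rightarrow> gl_fun set" where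
  "quot_gens n =
    {split_mult n (O_GL 1 n) (univ_mat 1 n 0) i j k | i j k. i < n \<and> j < n \<and> k < n} \<union>
    {split_unit n (O_GL 1 n) (univ_mat 1 n 0) k | k. k < n} \<union>
    {split_gram n (O_GL 1 n) (univ_mat 1 n 0) k j | k j. k < n \<and> j < n}"

definition inv_trace :: "nat \<Rightarrow> gl_fun \<Rightarrow> gl_fun" where
  "inv_trace n p = (\<Oplus>\<^bsub>O_GL 1 n\<^esub>\<sigma>\<in>{\<sigma>. \<sigma> permutes {..<n}}. right_transl n \<sigma> p)"

context
  fixes n :: nat
begin

private abbreviation (input) P where "P \<equiv> O_GL 1 n"
private abbreviation (input) X where "X \<equiv> univ_mat 1 n 0"
private abbreviation (input) Y where "Y \<equiv> inv\<^bsub>mat_monoid P n\<^esub> X"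

interpretation P: cring P by (rule O_GL_cring)

lemma X_Units: "X \<in> Units (mat_monoid P n)"
  by (rule univ_mat_Units) simp

lemmas X_entries = mat_Units_entries[OF O_GL_cring X_Units]

lemma right_transl_hom:
  assumes "\<sigma> permutes {..<n}"
  shows "right_transl n \<sigma> \<in> ring_hom P P"
    "mat_map n (right_transl n \<sigma>) X = X \<otimes>\<^bsub>mat_monoid P n\<^esub> perm_mat P n \<sigma>"
  unfolding right_transl_def
  using mat_perm_Units(1)[OF O_GL_cring X_Units assms]
  by (auto intro!: gl_eval_hom(1)[OF O_GL_cring] gl_eval_mat_map[OF O_GL_cring])

lemma right_transl_closed:
  "\<sigma> permutes {..<n} \<Longrightarrow> p \<in> carrier P \<Longrightarrow> right_transl n \<sigma> p \<in> carrier P"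
  by (rule ring_hom_closed[OF right_transl_hom(1)])

lemma right_transl_X:
  assumes "\<sigma> permutes {..<n}" "i < n" "j < n"
  shows "right_transl n \<sigma> (X (i, j)) = X (i, \<sigma> j)"
    "right_transl n \<sigma> (Y (i, j)) = Y (\<sigma> i, j)"
proof -
  show "right_transl n \<sigma> (X (i, j)) = X (i, \<sigma> j)"
    using arg_cong[OF right_transl_hom(2)[OF assms(1)], of "\<lambda>M. M (i, j)"] assms
      mat_perm_entry[OF O_GL_cring X_Units assms] by simp
  have "mat_map n (right_transl n \<sigma>) Y = inv\<^bsub>mat_monoid P n\<^esub> (X \<otimes>\<^bsub>mat_monoid P n\<^esub> perm_mat P n \<sigma>)"
    unfolding right_transl_hom(2)[OF assms(1), symmetric]
    by (rule mat_map_Units(2)[OF O_GL_cring O_GL_cring right_transl_hom(1)[OF assms(1)] X_Units, symmetric])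
  from arg_cong[OF this, of "\<lambda>M. M (i, j)"]
  show "right_transl n \<sigma> (Y (i, j)) = Y (\<sigma> i, j)"
    using assms mat_perm_Units(2)[OF O_GL_cring X_Units assms] by simp
qed

lemma O_quot_simps:
  "carrier (O_quot n) = {g \<in> carrier P. \<forall>\<sigma>. \<sigma> permutes {..<n} \<longrightarrow> right_transl n \<sigma> g = g}"
  "monoid.mult (O_quot n) = monoid.mult P" "ring.add (O_quot n) = ring.add P"
  "\<one>\<^bsub>O_quot n\<^esub> = \<one>\<^bsub>P\<^esub>" "\<zero>\<^bsub>O_quot n\<^esub> = \<zero>\<^bsub>P\<^esub>"
  by (simp_all add: O_quot_def)

lemma O_quot_subring: "subring (carrier (O_quot n)) P"
proof (rule P.subringI)
  fix g assume "g \<in> carrier (O_quot n)"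
  then show "\<ominus>\<^bsub>P\<^esub> g \<in> carrier (O_quot n)"
    by (auto simp: O_quot_simps ring_hom_a_inv_cring[OF O_GL_cring O_GL_cring right_transl_hom(1)])
qed (auto simp: O_quot_simps ring_hom_one[OF right_transl_hom(1)] ring_hom_mult[OF right_transl_hom(1)]
    ring_hom_add[OF right_transl_hom(1)])

lemma O_quot_cring: "cring (O_quot n)"
proof -
  have "subcring (carrier (O_quot n)) P" by (rule P.subcringI'[OF O_quot_subring])
  then have "cring (P\<lparr>carrier := carrier (O_quot n)\<rparr>)"
    using P.subcring_iff[OF subringE(1)[OF O_quot_subring]] by simp
  moreover have "P\<lparr>carrier := carrier (O_quot n)\<rparr> = O_quot n" by (simp add: O_quot_def)
  ultimately show ?thesis by simp
qed

lemma O_quot_incl: "id \<in> ring_hom (O_quot n) P"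
  by (rule ring_hom_memI) (auto simp: O_quot_simps)

lemma quot_gens_invariant: "quot_gens n \<subseteq> carrier (O_quot n)"
proof -
  note hom = split_hom[OF O_GL_cring O_GL_cring right_transl_hom(1) X_Units]
  note perm = split_perm[OF O_GL_cring X_Units]
  note closed = split_closed[OF O_GL_cring X_Units]
  show ?thesis
    unfolding quot_gens_def O_quot_simps
    by (auto simp: hom right_transl_hom(2) perm closed)
qed

text \<open>Translations fix the coefficients b k, so the trace is linear over the invariants. The
  cases of one and of two summands give \<open>inv_trace_mult\<close> and
  \<open>inv_trace_add\<close>.\<close>

lemma inv_trace_lincomb:
  assumes b: "\<And>k. k \<in> A \<Longrightarrow> b k \<in> carrier (O_quot n)" and y: "\<And>k. k \<in> A \<Longrightarrow> y k \<in> carrier P"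
  shows "inv_trace n (\<Oplus>\<^bsub>P\<^esub>k\<in>A. b k \<otimes>\<^bsub>P\<^esub> y k) = (\<Oplus>\<^bsub>P\<^esub>k\<in>A. b k \<otimes>\<^bsub>P\<^esub> inv_trace n (y k))"
proof -
  let ?S = "{\<sigma>. \<sigma> permutes {..<n}}"
  have fin: "finite ?S" by (simp add: finite_permutations)
  have b': "b k \<in> carrier P" "\<sigma> permutes {..<n} \<Longrightarrow> right_transl n \<sigma> (b k) = b k" if "k \<in> A" for k \<sigma>
    using b[OF that] by (auto simp: O_quot_simps)
  have "inv_trace n (\<Oplus>\<^bsub>P\<^esub>k\<in>A. b k \<otimes>\<^bsub>P\<^esub> y k) = (\<Oplus>\<^bsub>P\<^esub>\<sigma>\<in>?S. \<Oplus>\<^bsub>P\<^esub>k\<in>A. b k \<otimes>\<^bsub>P\<^esub> right_transl n \<sigma> (y k))"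
    unfolding inv_trace_def
  proof (intro P.finsum_cong' refl)
    fix \<sigma> assume "\<sigma> \<in> ?S"
    then have \<sigma>: "\<sigma> permutes {..<n}" by simp
    have "right_transl n \<sigma> (\<Oplus>\<^bsub>P\<^esub>k\<in>A. b k \<otimes>\<^bsub>P\<^esub> y k) = (\<Oplus>\<^bsub>P\<^esub>k\<in>A. right_transl n \<sigma> (b k \<otimes>\<^bsub>P\<^esub> y k))"
      using b' y by (intro ring_hom_finsum[OF O_GL_cring O_GL_cring right_transl_hom(1)[OF \<sigma>]]) auto
    also have "\<dots> = (\<Oplus>\<^bsub>P\<^esub>k\<in>A. b k \<otimes>\<^bsub>P\<^esub> right_transl n \<sigma> (y k))"
      using b' y \<sigma> by (intro P.finsum_cong')
        (auto simp: ring_hom_mult[OF right_transl_hom(1)[OF \<sigma>]] right_transl_closed)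
    finally show "right_transl n \<sigma> (\<Oplus>\<^bsub>P\<^esub>k\<in>A. b k \<otimes>\<^bsub>P\<^esub> y k) = (\<Oplus>\<^bsub>P\<^esub>k\<in>A. b k \<otimes>\<^bsub>P\<^esub> right_transl n \<sigma> (y k))" .
  qed (use b' y right_transl_closed in auto)
  also have "\<dots> = (\<Oplus>\<^bsub>P\<^esub>k\<in>A. \<Oplus>\<^bsub>P\<^esub>\<sigma>\<in>?S. b k \<otimes>\<^bsub>P\<^esub> right_transl n \<sigma> (y k))"
    using b' y right_transl_closed by (intro finsum_swap[OF O_GL_cring]) auto
  also have "\<dots> = (\<Oplus>\<^bsub>P\<^esub>k\<in>A. b k \<otimes>\<^bsub>P\<^esub> inv_trace n (y k))"
    unfolding inv_trace_def using b' y right_transl_closed fin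
    by (intro P.finsum_cong') (auto simp: P.finsum_rdistr Pi_def)
  finally show ?thesis .
qed

lemma inv_trace_closed: "p \<in> carrier P \<Longrightarrow> inv_trace n p \<in> carrier P"
  unfolding inv_trace_def by (auto intro!: P.finsum_closed right_transl_closed)

lemma inv_trace_mult:
  assumes "b \<in> carrier (O_quot n)" "y \<in> carrier P"
  shows "inv_trace n (b \<otimes>\<^bsub>P\<^esub> y) = b \<otimes>\<^bsub>P\<^esub> inv_trace n y"
proof -
  have "b \<in> carrier P" using assms by (simp add: O_quot_simps)
  then show ?thesis
    using inv_trace_lincomb[of "{0::nat}" "\<lambda>_. b" "\<lambda>_. y"] assms inv_trace_closed by simp
qed

lemma inv_trace_add:
  assumes "x \<in> carrier P" "y \<in> carrier P"
  shows "inv_trace n (x \<oplus>\<^bsub>P\<^esub> y) = inv_trace n x \<oplus>\<^bsub>P\<^esub> inv_trace n y"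
proof -
  have one: "\<one>\<^bsub>P\<^esub> \<in> carrier (O_quot n)" using subringE(3)[OF O_quot_subring] .
  show ?thesis
    using inv_trace_lincomb[of "{0, 1::nat}" "\<lambda>_. \<one>\<^bsub>P\<^esub>" "\<lambda>k. if k = 0 then x else y"] assms one inv_trace_closed by simp
qed

text \<open>The translate by \<open>\<sigma>\<close> of the diagonal product is the product
  belonging to \<open>\<sigma>\<close> in the Leibniz formula, and the inverse determinant picks up
  the sign of \<open>\<sigma>\<close>. The translates therefore add up to the determinant times its
  inverse.\<close>

lemma inv_trace_eq_one:
  "inv_trace n ((\<Otimes>\<^bsub>P\<^esub>l\<in>{..<n}. X (l, l)) \<otimes>\<^bsub>P\<^esub> inv\<^bsub>P\<^esub> (mat_det P n X)) = \<one>\<^bsub>P\<^esub>"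
proof -
  let ?S = "{\<sigma>. \<sigma> permutes {..<n}}" and ?d = "mat_det P n X"
  have d: "?d \<in> Units P" using X_Units by (simp add: mat_Units_iff[OF O_GL_cring])
  let ?sgn = "\<lambda>\<sigma>. if evenperm \<sigma> then \<one>\<^bsub>P\<^esub> else \<ominus>\<^bsub>P\<^esub> \<one>\<^bsub>P\<^esub>"
  have trm: "right_transl n \<sigma> ((\<Otimes>\<^bsub>P\<^esub>l\<in>{..<n}. X (l, l)) \<otimes>\<^bsub>P\<^esub> inv\<^bsub>P\<^esub> ?d) =
      (?sgn \<sigma> \<otimes>\<^bsub>P\<^esub> (\<Otimes>\<^bsub>P\<^esub>l\<in>{..<n}. X (l, \<sigma> l))) \<otimes>\<^bsub>P\<^esub> inv\<^bsub>P\<^esub> ?d"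
    and closed: "(\<Otimes>\<^bsub>P\<^esub>l\<in>{..<n}. X (l, \<sigma> l)) \<in> carrier P"
    if \<sigma>: "\<sigma> permutes {..<n}" for \<sigma>
  proof -
    note h = right_transl_hom(1)[OF \<sigma>]
    have \<sigma>n: "\<sigma> l < n" if "l < n" for l using that permutes_in_image[OF \<sigma>, of l] by simp
    show c: "(\<Otimes>\<^bsub>P\<^esub>l\<in>{..<n}. X (l, \<sigma> l)) \<in> carrier P"
      by (auto intro!: P.finprod_closed X_entries \<sigma>n)
    have prod: "right_transl n \<sigma> (\<Otimes>\<^bsub>P\<^esub>l\<in>{..<n}. X (l, l)) = (\<Otimes>\<^bsub>P\<^esub>l\<in>{..<n}. X (l, \<sigma> l))"
    proof (subst ring_hom_finprod[OF O_GL_cring O_GL_cring h])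
      show "(\<Otimes>\<^bsub>P\<^esub>l\<in>{..<n}. right_transl n \<sigma> (X (l, l))) = (\<Otimes>\<^bsub>P\<^esub>l\<in>{..<n}. X (l, \<sigma> l))"
        by (intro P.finprod_cong' refl) (use \<sigma> in \<open>simp_all add: right_transl_X X_entries \<sigma>n Pi_iff\<close>)
    qed (simp add: X_entries)
    have "right_transl n \<sigma> ?d = mat_det P n (\<lambda>ij. right_transl n \<sigma> (X ij))"
      by (rule mat_det_map[OF O_GL_cring O_GL_cring h]) (rule X_entries)
    also have "\<dots> = mat_det P n (X \<otimes>\<^bsub>mat_monoid P n\<^esub> perm_mat P n \<sigma>)"
      by (rule mat_det_cong[OF O_GL_cring])
        (simp_all add: right_transl_X(1)[OF \<sigma>] mat_perm_entry[OF O_GL_cring X_Units \<sigma>] X_entries \<sigma>n)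
    also have "\<dots> = ?sgn \<sigma> \<otimes>\<^bsub>P\<^esub> ?d" by (rule mat_perm_det[OF O_GL_cring X_Units \<sigma>])
    finally have det: "right_transl n \<sigma> ?d = ?sgn \<sigma> \<otimes>\<^bsub>P\<^esub> ?d" .
    have "(?sgn \<sigma> \<otimes>\<^bsub>P\<^esub> ?d) \<otimes>\<^bsub>P\<^esub> (?sgn \<sigma> \<otimes>\<^bsub>P\<^esub> inv\<^bsub>P\<^esub> ?d) = \<one>\<^bsub>P\<^esub>"
      using d by (simp only: P.sign_mult(1) P.Units_closed P.Units_inv_closed P.Units_r_inv)
    then have "inv\<^bsub>P\<^esub> (?sgn \<sigma> \<otimes>\<^bsub>P\<^esub> ?d) = ?sgn \<sigma> \<otimes>\<^bsub>P\<^esub> inv\<^bsub>P\<^esub> ?d"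
      using d by (intro P.comm_inv_char P.sign_mult_closed P.Units_closed[OF d] P.Units_inv_closed)
    then have inv: "right_transl n \<sigma> (inv\<^bsub>P\<^esub> ?d) = ?sgn \<sigma> \<otimes>\<^bsub>P\<^esub> inv\<^bsub>P\<^esub> ?d"
      using ring_hom_Units(2)[OF O_GL_cring O_GL_cring h d] det by simp
    have "right_transl n \<sigma> ((\<Otimes>\<^bsub>P\<^esub>l\<in>{..<n}. X (l, l)) \<otimes>\<^bsub>P\<^esub> inv\<^bsub>P\<^esub> ?d) =
        (\<Otimes>\<^bsub>P\<^esub>l\<in>{..<n}. X (l, \<sigma> l)) \<otimes>\<^bsub>P\<^esub> (?sgn \<sigma> \<otimes>\<^bsub>P\<^esub> inv\<^bsub>P\<^esub> ?d)"
      using d by (subst ring_hom_mult[OF h]) (simp_all add: prod inv X_entries Pi_iff)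
    also have "\<dots> = (?sgn \<sigma> \<otimes>\<^bsub>P\<^esub> (\<Otimes>\<^bsub>P\<^esub>l\<in>{..<n}. X (l, \<sigma> l))) \<otimes>\<^bsub>P\<^esub> inv\<^bsub>P\<^esub> ?d"
      using c d by (intro P.sign_mult(2)) simp_all
    finally show "right_transl n \<sigma> ((\<Otimes>\<^bsub>P\<^esub>l\<in>{..<n}. X (l, l)) \<otimes>\<^bsub>P\<^esub> inv\<^bsub>P\<^esub> ?d) =
        (?sgn \<sigma> \<otimes>\<^bsub>P\<^esub> (\<Otimes>\<^bsub>P\<^esub>l\<in>{..<n}. X (l, \<sigma> l))) \<otimes>\<^bsub>P\<^esub> inv\<^bsub>P\<^esub> ?d" .
  qed
  have "inv_trace n ((\<Otimes>\<^bsub>P\<^esub>l\<in>{..<n}. X (l, l)) \<otimes>\<^bsub>P\<^esub> inv\<^bsub>P\<^esub> ?d) =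
      (\<Oplus>\<^bsub>P\<^esub>\<sigma>\<in>?S. (?sgn \<sigma> \<otimes>\<^bsub>P\<^esub> (\<Otimes>\<^bsub>P\<^esub>l\<in>{..<n}. X (l, \<sigma> l))) \<otimes>\<^bsub>P\<^esub> inv\<^bsub>P\<^esub> ?d)"
    unfolding inv_trace_def using d closed by (intro P.finsum_cong') (auto simp: trm)
  also have "\<dots> = ?d \<otimes>\<^bsub>P\<^esub> inv\<^bsub>P\<^esub> ?d"
    unfolding mat_det_def using d closed
    by (subst P.finsum_ldistr) (auto simp: finite_permutations mat_det_def[symmetric])
  finally show ?thesis using d by simp
qed

text \<open>The products \<open>x \<kappa>\<close> of one entry from each row of \<open>Y\<close>
  are the images of pure tensors of basis elements. It is easier to control the traces of p times
  \<open>x \<kappa>\<close> for all \<open>\<kappa>\<close> at once: multiplication by an entry of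
  \<open>Y\<close> changes \<open>\<kappa>\<close> in one place at the cost of a structure constant,
  so the condition on p is stable under multiplication by generators of \<open>P\<close>.\<close>

lemma inv_trace_generated:
  assumes p: "p \<in> carrier P"
  shows "inv_trace n p \<in> generate_ring P (quot_gens n)"
proof -
  let ?B = "generate_ring P (quot_gens n)" and ?I = "{..<n}"
  have gens: "quot_gens n \<subseteq> carrier P"
    using quot_gens_invariant subringE(1)[OF O_quot_subring] by blast
  have B: "subring ?B P" by (rule P.generate_ring_is_subring[OF gens])
  have BQ: "?B \<subseteq> carrier (O_quot n)"
    by (rule P.generate_ring_min_subring1[OF gens O_quot_subring quot_gens_invariant])
  have BP: "?B \<subseteq> carrier P" by (rule subringE(1)[OF B])
  have multB: "split_mult n P X i j k \<in> ?B" if "i < n" "j < n" "k < n" for i j k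
    using that unfolding quot_gens_def by (intro generate_ring.incl) blast
  have unitB: "split_unit n P X k \<in> ?B" if "k < n" for k
    using that unfolding quot_gens_def by (intro generate_ring.incl) blast
  have gramB: "split_gram n P X k j \<in> ?B" if "k < n" "j < n" for k j
    using that unfolding quot_gens_def by (intro generate_ring.incl) blast
  define x where "x \<kappa> = (\<Otimes>\<^bsub>P\<^esub>l\<in>?I. Y (l, \<kappa> l))" for \<kappa>
  have x_closed: "x \<kappa> \<in> carrier P" if "\<forall>l<n. \<kappa> l < n" for \<kappa>
    unfolding x_def using that by (auto intro!: P.finprod_closed X_entries)
  \<comment> \<open>Quantifying over all \<open>\<kappa>\<close> is what makes \<open>G\<close>
    stable under multiplication by the entries of \<open>Y\<close>.\<close>
  define G where "G = {p \<in> carrier P. \<forall>\<kappa>. (\<forall>l<n. \<kappa> l < n) \<longrightarrow> inv_trace n (p \<otimes>\<^bsub>P\<^esub> x \<kappa>) \<in> ?B}"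
  have GP: "p \<in> carrier P" if "p \<in> G" for p using that by (simp add: G_def)
  have G_add: "p \<oplus>\<^bsub>P\<^esub> q \<in> G" if "p \<in> G" "q \<in> G" for p q
    using that subringE(7)[OF B]
    by (auto simp: G_def P.l_distr x_closed inv_trace_add)
  have G_scale: "b \<otimes>\<^bsub>P\<^esub> p \<in> G" if "b \<in> ?B" "p \<in> G" for b p
    using that subringE(6)[OF B] subsetD[OF BP] subsetD[OF BQ]
    by (auto simp: G_def P.m_assoc x_closed inv_trace_mult)
  \<comment> \<open>The multipliers of \<open>G\<close> form a subring, so it suffices to find the
    generators of \<open>P\<close> among them; once 1 lies in \<open>G\<close>, every function
    does.\<close>
  define Z where "Z = {z \<in> carrier P. \<forall>p\<in>G. z \<otimes>\<^bsub>P\<^esub> p \<in> G}"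
  have Z: "subring Z P"
  proof (rule P.subringI)
    fix z assume z: "z \<in> Z"
    have "\<ominus>\<^bsub>P\<^esub> z \<otimes>\<^bsub>P\<^esub> p \<in> G" if "p \<in> G" for p
    proof -
      have "z \<otimes>\<^bsub>P\<^esub> p \<in> G" using z that by (simp add: Z_def)
      from G_scale[OF subringE(5)[OF B subringE(3)[OF B]] this] show ?thesis using z that GP[OF that] by (simp add: Z_def P.l_minus)
    qed
    then show "\<ominus>\<^bsub>P\<^esub> z \<in> Z" using z by (simp add: Z_def)
  qed (auto simp: Z_def P.m_assoc P.l_distr GP intro!: G_add)
  have BZ: "?B \<subseteq> Z" using BP G_scale by (auto simp: Z_def)
  \<comment> \<open>By \<open>split_mult_inverse\<close>, the product of two entries of row l of
    \<open>Y\<close> is a combination of entries of row l. Applied to the factor of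
    \<open>x \<kappa>\<close> in row l, this gives a combination of the products for
    \<open>\<kappa>(l := k)\<close>.\<close>
  have YZ: "Y (l, i) \<in> Z" if l: "l < n" and i: "i < n" for l i
  proof -
    have "Y (l, i) \<otimes>\<^bsub>P\<^esub> p \<in> G" if p: "p \<in> G" for p
      unfolding G_def
    proof (safe intro!: P.m_closed X_entries l i GP[OF p])
      fix \<kappa> :: "nat \<Rightarrow> nat" assume \<kappa>: "\<forall>l<n. \<kappa> l < n"
      define y where "y = (\<Otimes>\<^bsub>P\<^esub>m\<in>?I - {l}. Y (m, \<kappa> m))"
      have y: "y \<in> carrier P" unfolding y_def using \<kappa> by (auto intro!: P.finprod_closed X_entries)
      have xk: "x (\<kappa>(l := k)) = Y (l, k) \<otimes>\<^bsub>P\<^esub> y" if "k < n" for k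
      proof -
        have "x (\<kappa>(l := k)) = (\<Otimes>\<^bsub>P\<^esub>m\<in>insert l (?I - {l}). Y (m, (\<kappa>(l := k)) m))"
          using l by (simp add: x_def insert_absorb)
        also have "\<dots> = Y (l, k) \<otimes>\<^bsub>P\<^esub> (\<Otimes>\<^bsub>P\<^esub>m\<in>?I - {l}. Y (m, (\<kappa>(l := k)) m))"
          using l that \<kappa> by (subst P.finprod_insert) (auto simp: X_entries)
        also have "(\<Otimes>\<^bsub>P\<^esub>m\<in>?I - {l}. Y (m, (\<kappa>(l := k)) m)) = y"
          unfolding y_def using \<kappa> by (intro P.finprod_cong') (auto simp: X_entries)
        finally show ?thesis .
      qed
      note [simp] = X_entries(2) y GP[OF p] l i
      have \<kappa>l: "\<kappa> l < n" using \<kappa> l by simp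
      have c: "split_mult n P X i (\<kappa> l) k \<in> carrier P" if "k < n" for k
        using multB[OF i \<kappa>l that] BP by blast
      have "(Y (l, i) \<otimes>\<^bsub>P\<^esub> p) \<otimes>\<^bsub>P\<^esub> x \<kappa> = (Y (l, i) \<otimes>\<^bsub>P\<^esub> Y (l, \<kappa> l)) \<otimes>\<^bsub>P\<^esub> (p \<otimes>\<^bsub>P\<^esub> y)"
        using xk[OF \<kappa>l] \<kappa>l by (simp add: P.m_ac)
      also have "\<dots> = (\<Oplus>\<^bsub>P\<^esub>k\<in>?I. split_mult n P X i (\<kappa> l) k \<otimes>\<^bsub>P\<^esub> Y (l, k)) \<otimes>\<^bsub>P\<^esub> (p \<otimes>\<^bsub>P\<^esub> y)"
        by (simp only: split_mult_inverse[OF O_GL_cring X_Units i \<kappa>l l])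
      also have "\<dots> = (\<Oplus>\<^bsub>P\<^esub>k\<in>?I. split_mult n P X i (\<kappa> l) k \<otimes>\<^bsub>P\<^esub> Y (l, k) \<otimes>\<^bsub>P\<^esub> (p \<otimes>\<^bsub>P\<^esub> y))"
        using c by (intro P.finsum_ldistr) auto
      also have "\<dots> = (\<Oplus>\<^bsub>P\<^esub>k\<in>?I. split_mult n P X i (\<kappa> l) k \<otimes>\<^bsub>P\<^esub> (p \<otimes>\<^bsub>P\<^esub> x (\<kappa>(l := k))))"
        using c by (intro P.finsum_cong') (auto simp: xk P.m_ac)
      finally have eq: "(Y (l, i) \<otimes>\<^bsub>P\<^esub> p) \<otimes>\<^bsub>P\<^esub> x \<kappa> =
          (\<Oplus>\<^bsub>P\<^esub>k\<in>?I. split_mult n P X i (\<kappa> l) k \<otimes>\<^bsub>P\<^esub> (p \<otimes>\<^bsub>P\<^esub> x (\<kappa>(l := k))))" .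
      have "inv_trace n ((Y (l, i) \<otimes>\<^bsub>P\<^esub> p) \<otimes>\<^bsub>P\<^esub> x \<kappa>) =
          (\<Oplus>\<^bsub>P\<^esub>k\<in>?I. split_mult n P X i (\<kappa> l) k \<otimes>\<^bsub>P\<^esub> inv_trace n (p \<otimes>\<^bsub>P\<^esub> x (\<kappa>(l := k))))"
        unfolding eq using \<kappa>
        by (intro inv_trace_lincomb subsetD[OF BQ multB[OF i \<kappa>l]]) (simp_all add: x_closed)
      also have "\<dots> \<in> ?B"
        using multB[OF i \<kappa>l] p \<kappa>
        by (intro subring_finsum[OF O_GL_cring B] subringE(6)[OF B]) (auto simp: G_def)
      finally show "inv_trace n (Y (l, i) \<otimes>\<^bsub>P\<^esub> p \<otimes>\<^bsub>P\<^esub> x \<kappa>) \<in> ?B" .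
    qed
    then show ?thesis using l i by (simp add: Z_def X_entries)
  qed
  \<comment> \<open>The entries of \<open>X\<close> are combinations of the entries of
    \<open>Y\<close> with coefficients among the generators.\<close>
  have XZ: "X (k, l) \<in> Z" if "k < n" "l < n" for k l
    unfolding split_gram_inverse[OF O_GL_cring X_Units that, symmetric]
    using that by (intro subring_finsum[OF O_GL_cring Z] subringE(6)[OF Z] YZ subsetD[OF BZ gramB]) auto
  \<comment> \<open>The inverse determinant is a polynomial in the entries of
    \<open>Y\<close>.\<close>
  have "inv\<^bsub>P\<^esub> (mat_det P n X) = mat_det P n Y"
  proof -
    interpret M: monoid "mat_monoid P n" by (rule mat_monoid_monoid[OF O_GL_cring])
    have c: "X \<in> carrier (mat_monoid P n)" "Y \<in> carrier (mat_monoid P n)" using X_Units by auto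
    have "mat_det P n X \<otimes>\<^bsub>P\<^esub> mat_det P n Y = \<one>\<^bsub>P\<^esub>"
      using mat_det_mult[OF O_GL_cring c] mat_det_one[OF O_GL_cring] X_Units by simp
    then show ?thesis
      by (intro P.comm_inv_char mat_det_closed[OF O_GL_cring] X_entries)
  qed
  then have DZ: "inv\<^bsub>P\<^esub> (mat_det P n X) \<in> Z"
    using subring_mat_det[OF O_GL_cring Z, where M = Y and n = n] YZ by simp
  have "carrier P \<subseteq> Z"
  proof -
    have "generate_ring P ({univ_mat 1 n l (i, j) | l i j. l < 1 \<and> i < n \<and> j < n} \<union>
        {inv\<^bsub>P\<^esub> (mat_det P n (univ_mat 1 n l)) | l. l < 1}) \<subseteq> Z"
      using XZ DZ subringE(1)[OF Z] by (intro P.generate_ring_min_subring1 Z) auto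
    then show ?thesis using O_GL_generated[of 1 n] by blast
  qed
  \<comment> \<open>The translates of \<open>x \<kappa>\<close> add up to a permanent in the entries
    of \<open>Y\<close>. By \<open>mat_mix_conj\<close> it is the mixed discriminant of the
    operators of multiplication by the basis elements with indices \<open>\<kappa> s\<close>, whose
    matrix entries are structure constants.\<close>
  moreover have "\<one>\<^bsub>P\<^esub> \<in> G"
  proof -
    have "inv_trace n (x \<kappa>) \<in> ?B" if \<kappa>: "\<forall>l<n. \<kappa> l < n" for \<kappa>
    proof -
      have "inv_trace n (x \<kappa>) = (\<Oplus>\<^bsub>P\<^esub>\<rho>\<in>{\<rho>. \<rho> permutes ?I}. \<Otimes>\<^bsub>P\<^esub>s\<in>?I. Y (\<rho> s, \<kappa> s))"
        unfolding inv_trace_def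
      proof (intro P.finsum_cong' refl)
        have \<rho>n: "\<rho> l < n" if "\<rho> permutes ?I" "l < n" for \<rho> l
          using that permutes_in_image[OF that(1), of l] by simp
        then show "(\<lambda>\<rho>. \<Otimes>\<^bsub>P\<^esub>s\<in>?I. Y (\<rho> s, \<kappa> s)) \<in> {\<rho>. \<rho> permutes ?I} \<rightarrow> carrier P"
          using \<kappa> by (auto intro!: P.finprod_closed X_entries)
        fix \<rho> assume "\<rho> \<in> {\<rho>. \<rho> permutes ?I}"
        then have \<rho>: "\<rho> permutes ?I" by simp
        show "right_transl n \<rho> (x \<kappa>) = (\<Otimes>\<^bsub>P\<^esub>s\<in>?I. Y (\<rho> s, \<kappa> s))"
          unfolding x_def
        proof (subst ring_hom_finprod[OF O_GL_cring O_GL_cring right_transl_hom(1)[OF \<rho>]])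
          show "(\<Otimes>\<^bsub>P\<^esub>s\<in>?I. right_transl n \<rho> (Y (s, \<kappa> s))) = (\<Otimes>\<^bsub>P\<^esub>s\<in>?I. Y (\<rho> s, \<kappa> s))"
            using \<kappa> \<rho>n[OF \<rho>] \<rho>
            by (intro P.finprod_cong' refl) (simp_all add: right_transl_X X_entries Pi_iff)
        qed (use \<kappa> in \<open>simp add: X_entries\<close>)
      qed
      also have "\<dots> = mat_mix P ?I n (\<lambda>s (i, j). split_mult n P X (\<kappa> s) j i)"
        unfolding split_mult_def using \<kappa>
        by (subst mat_mix_conj[OF O_GL_cring X_Units, where d = "\<lambda>s p. Y (p, \<kappa> s)"]) (auto simp: X_entries)
      also have "\<dots> \<in> ?B"
        using \<kappa> by (intro subring_mat_mix[OF O_GL_cring B]) (auto simp: multB)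
      finally show ?thesis .
    qed
    then show ?thesis by (auto simp: G_def x_closed)
  qed
  ultimately have pG: "p \<in> G" using p by (fastforce simp: Z_def)
  have cl: "split_unit n P X i \<in> carrier P" if "i < n" for i using unitB[OF that] BP by blast
  have PiE: "\<forall>l<n. \<kappa> l < n" if "\<kappa> \<in> ?I \<rightarrow>\<^sub>E ?I" for \<kappa> using that by auto
  \<comment> \<open>In each row l, the expansion of the unit gives 1 as a combination of the entries
    of \<open>Y\<close>. The product over all rows, multiplied out, writes 1 as a combination of the
    \<open>x \<kappa>\<close> with coefficients in the generated ring, which removes the factor
    \<open>x \<kappa>\<close> from the traces.\<close>
  have "\<one>\<^bsub>P\<^esub> = (\<Otimes>\<^bsub>P\<^esub>l\<in>?I. \<Oplus>\<^bsub>P\<^esub>i\<in>?I. split_unit n P X i \<otimes>\<^bsub>P\<^esub> Y (l, i))"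
    by (rule P.finprod_one_eqI[symmetric]) (simp add: split_unit_inverse[OF O_GL_cring X_Units])
  also have "\<dots> = (\<Oplus>\<^bsub>P\<^esub>\<kappa>\<in>?I \<rightarrow>\<^sub>E ?I. \<Otimes>\<^bsub>P\<^esub>l\<in>?I. split_unit n P X (\<kappa> l) \<otimes>\<^bsub>P\<^esub> Y (l, \<kappa> l))"
    by (rule finprod_finsum_PiE[OF O_GL_cring]) (auto simp: cl X_entries)
  also have "\<dots> = (\<Oplus>\<^bsub>P\<^esub>\<kappa>\<in>?I \<rightarrow>\<^sub>E ?I. (\<Otimes>\<^bsub>P\<^esub>l\<in>?I. split_unit n P X (\<kappa> l)) \<otimes>\<^bsub>P\<^esub> x \<kappa>)"
    unfolding x_def using PiE
    by (intro P.finsum_cong') (auto simp: P.finprod_multf cl X_entries Pi_def intro!: P.m_closed P.finprod_closed)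
  finally have one: "\<one>\<^bsub>P\<^esub> = (\<Oplus>\<^bsub>P\<^esub>\<kappa>\<in>?I \<rightarrow>\<^sub>E ?I. (\<Otimes>\<^bsub>P\<^esub>l\<in>?I. split_unit n P X (\<kappa> l)) \<otimes>\<^bsub>P\<^esub> x \<kappa>)" .
  have b: "(\<Otimes>\<^bsub>P\<^esub>l\<in>?I. split_unit n P X (\<kappa> l)) \<in> ?B" if "\<kappa> \<in> ?I \<rightarrow>\<^sub>E ?I" for \<kappa>
    using PiE[OF that] by (intro subring_finprod[OF O_GL_cring B] unitB) auto
  note bP = subsetD[OF BP b]
  have "p = p \<otimes>\<^bsub>P\<^esub> \<one>\<^bsub>P\<^esub>" using p by simp
  also have "\<dots> = (\<Oplus>\<^bsub>P\<^esub>\<kappa>\<in>?I \<rightarrow>\<^sub>E ?I. p \<otimes>\<^bsub>P\<^esub> ((\<Otimes>\<^bsub>P\<^esub>l\<in>?I. split_unit n P X (\<kappa> l)) \<otimes>\<^bsub>P\<^esub> x \<kappa>))"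
    unfolding one using p bP x_closed[OF PiE] by (intro P.finsum_rdistr) (auto intro: finite_PiE)
  also have "\<dots> = (\<Oplus>\<^bsub>P\<^esub>\<kappa>\<in>?I \<rightarrow>\<^sub>E ?I. (\<Otimes>\<^bsub>P\<^esub>l\<in>?I. split_unit n P X (\<kappa> l)) \<otimes>\<^bsub>P\<^esub> (p \<otimes>\<^bsub>P\<^esub> x \<kappa>))"
    using p bP x_closed[OF PiE] by (intro P.finsum_cong' refl P.m_lcomm) auto
  finally have "inv_trace n p = (\<Oplus>\<^bsub>P\<^esub>\<kappa>\<in>?I \<rightarrow>\<^sub>E ?I.
      (\<Otimes>\<^bsub>P\<^esub>l\<in>?I. split_unit n P X (\<kappa> l)) \<otimes>\<^bsub>P\<^esub> inv_trace n (p \<otimes>\<^bsub>P\<^esub> x \<kappa>))"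
    using p subsetD[OF BQ b] x_closed[OF PiE] inv_trace_lincomb[of "?I \<rightarrow>\<^sub>E ?I"
      "\<lambda>\<kappa>. \<Otimes>\<^bsub>P\<^esub>l\<in>?I. split_unit n P X (\<kappa> l)" "\<lambda>\<kappa>. p \<otimes>\<^bsub>P\<^esub> x \<kappa>"] by simp
  also have "\<dots> \<in> ?B"
    using pG PiE b by (intro subring_finsum[OF O_GL_cring B] subringE(6)[OF B]) (auto simp: G_def)
  finally show ?thesis .
qed

theorem O_quot_generated: "carrier (O_quot n) = generate_ring P (quot_gens n)"
proof
  let ?t = "(\<Otimes>\<^bsub>P\<^esub>l\<in>{..<n}. X (l, l)) \<otimes>\<^bsub>P\<^esub> inv\<^bsub>P\<^esub> (mat_det P n X)"
  have "mat_det P n X \<in> Units P" using X_Units by (simp add: mat_Units_iff[OF O_GL_cring])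
  then have t: "?t \<in> carrier P" by (auto intro!: P.m_closed P.finprod_closed X_entries)
  show "carrier (O_quot n) \<subseteq> generate_ring P (quot_gens n)"
  proof
    fix g assume g: "g \<in> carrier (O_quot n)"
    then have gP: "g \<in> carrier P" using subringE(1)[OF O_quot_subring] by blast
    have "inv_trace n (g \<otimes>\<^bsub>P\<^esub> ?t) = g"
      using inv_trace_mult[OF g t] inv_trace_eq_one gP by simp
    then show "g \<in> generate_ring P (quot_gens n)"
      using inv_trace_generated[of "g \<otimes>\<^bsub>P\<^esub> ?t"] gP t by simp
  qed
  show "generate_ring P (quot_gens n) \<subseteq> carrier (O_quot n)"
    using quot_gens_invariant subringE(1)[OF O_quot_subring]
    by (intro P.generate_ring_min_subring1 O_quot_subring) auto
qed

end

section \<open>Based algebras described by structure constants\<close>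

section \<open>Based algebras and structure constants\<close>

definition str_mult :: "nat \<Rightarrow> 'r ring \<Rightarrow> 'r based_alg \<Rightarrow> nat \<Rightarrow> nat \<Rightarrow> nat \<Rightarrow> 'r" where
  "str_mult n R p i j k = snd p (basis_elt n R p i \<otimes>\<^bsub>fst p\<^esub> basis_elt n R p j) k"

definition str_unit :: "nat \<Rightarrow> 'r ring \<Rightarrow> 'r based_alg \<Rightarrow> nat \<Rightarrow> 'r" where
  "str_unit n R p k = snd p \<one>\<^bsub>fst p\<^esub> k"

text \<open>These are the equations of the moduli scheme of based algebras in the affine space with
  coordinates c and u: commutativity, associativity on triples of basis elements and the left unit
  law.\<close>

definition str_rel :: "nat \<Rightarrow> 'r ring \<Rightarrow> (nat \<Rightarrow> nat \<Rightarrow> nat \<Rightarrow> 'r) \<Rightarrow> (nat \<Rightarrow> 'r) \<Rightarrow> bool" where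
  "str_rel n R c u \<longleftrightarrow>
     (\<forall>i<n. \<forall>j<n. \<forall>k<n. c i j k \<in> carrier R \<and> c i j k = c j i k) \<and>
     (\<forall>k<n. u k \<in> carrier R) \<and>
     (\<forall>i<n. \<forall>j<n. \<forall>l<n. \<forall>m<n.
       (\<Oplus>\<^bsub>R\<^esub>k\<in>{..<n}. c i j k \<otimes>\<^bsub>R\<^esub> c k l m) = (\<Oplus>\<^bsub>R\<^esub>k\<in>{..<n}. c j l k \<otimes>\<^bsub>R\<^esub> c i k m)) \<and>
     (\<forall>j<n. \<forall>k<n. (\<Oplus>\<^bsub>R\<^esub>i\<in>{..<n}. u i \<otimes>\<^bsub>R\<^esub> c i j k) = (if j = k then \<one>\<^bsub>R\<^esub> else \<zero>\<^bsub>R\<^esub>))"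

lemma str_relD:
  assumes "str_rel n R c u"
  shows "i < n \<Longrightarrow> j < n \<Longrightarrow> k < n \<Longrightarrow> c i j k \<in> carrier R"
    "i < n \<Longrightarrow> j < n \<Longrightarrow> k < n \<Longrightarrow> c i j k = c j i k"
    "k < n \<Longrightarrow> u k \<in> carrier R"
    "i < n \<Longrightarrow> j < n \<Longrightarrow> l < n \<Longrightarrow> m < n \<Longrightarrow>
      (\<Oplus>\<^bsub>R\<^esub>k\<in>{..<n}. c i j k \<otimes>\<^bsub>R\<^esub> c k l m) = (\<Oplus>\<^bsub>R\<^esub>k\<in>{..<n}. c j l k \<otimes>\<^bsub>R\<^esub> c i k m)"
    "j < n \<Longrightarrow> k < n \<Longrightarrow> (\<Oplus>\<^bsub>R\<^esub>i\<in>{..<n}. u i \<otimes>\<^bsub>R\<^esub> c i j k) = (if j = k then \<one>\<^bsub>R\<^esub> else \<zero>\<^bsub>R\<^esub>)"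
proof -
  note rel = assms[unfolded str_rel_def]
  note rel[THEN conjunct1, rule_format]
    and rel[THEN conjunct2, THEN conjunct1, rule_format]
    and rel[THEN conjunct2, THEN conjunct2, THEN conjunct1, rule_format]
    and rel[THEN conjunct2, THEN conjunct2, THEN conjunct2, rule_format]
  note facts = this
  show "i < n \<Longrightarrow> j < n \<Longrightarrow> k < n \<Longrightarrow> c i j k \<in> carrier R"
    "i < n \<Longrightarrow> j < n \<Longrightarrow> k < n \<Longrightarrow> c i j k = c j i k"
    using facts(1) by simp_all
  show "k < n \<Longrightarrow> u k \<in> carrier R" by (rule facts(2))
  show "i < n \<Longrightarrow> j < n \<Longrightarrow> l < n \<Longrightarrow> m < n \<Longrightarrow>
      (\<Oplus>\<^bsub>R\<^esub>k\<in>{..<n}. c i j k \<otimes>\<^bsub>R\<^esub> c k l m) = (\<Oplus>\<^bsub>R\<^esub>k\<in>{..<n}. c j l k \<otimes>\<^bsub>R\<^esub> c i k m)"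
    by (rule facts(3))
  show "j < n \<Longrightarrow> k < n \<Longrightarrow> (\<Oplus>\<^bsub>R\<^esub>i\<in>{..<n}. u i \<otimes>\<^bsub>R\<^esub> c i j k) = (if j = k then \<one>\<^bsub>R\<^esub> else \<zero>\<^bsub>R\<^esub>)"
    by (rule facts(4))
qed

definition std_alg :: "nat \<Rightarrow> 'r ring \<Rightarrow> (nat \<Rightarrow> nat \<Rightarrow> nat \<Rightarrow> 'r) \<Rightarrow> (nat \<Rightarrow> 'r) \<Rightarrow> ('r, nat \<Rightarrow> 'r) module" where
  "std_alg n R c u = (free_mod R n)
     \<lparr>monoid.mult := (\<lambda>v w. \<lambda>k\<in>{..<n}.
        \<Oplus>\<^bsub>R\<^esub>i\<in>{..<n}. v i \<otimes>\<^bsub>R\<^esub> (\<Oplus>\<^bsub>R\<^esub>j\<in>{..<n}. w j \<otimes>\<^bsub>R\<^esub> c i j k)),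
      one := (\<lambda>k\<in>{..<n}. u k)\<rparr>"

context
  fixes R :: "'r ring" (structure) and n :: nat
  assumes R: "cring R"
begin

interpretation cring R by (rule R)

lemma finsum_mult_lcomm:
  assumes "\<And>k. k \<in> K \<Longrightarrow> a k \<in> carrier R" "\<And>k l. k \<in> K \<Longrightarrow> l \<in> L \<Longrightarrow> b k l \<in> carrier R"
    "\<And>l. l \<in> L \<Longrightarrow> x l \<in> carrier R" "finite K" "finite L"
  shows "(\<Oplus>k\<in>K. a k \<otimes> (\<Oplus>l\<in>L. x l \<otimes> b k l)) = (\<Oplus>l\<in>L. x l \<otimes> (\<Oplus>k\<in>K. a k \<otimes> b k l))"
proof -
  have "(\<Oplus>k\<in>K. a k \<otimes> (\<Oplus>l\<in>L. x l \<otimes> b k l)) = (\<Oplus>k\<in>K. \<Oplus>l\<in>L. a k \<otimes> (x l \<otimes> b k l))"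
    using assms by (intro finsum_cong') (auto simp: finsum_rdistr Pi_def)
  also have "\<dots> = (\<Oplus>l\<in>L. \<Oplus>k\<in>K. a k \<otimes> (x l \<otimes> b k l))"
    using assms by (intro finsum_swap[OF R]) auto
  also have "\<dots> = (\<Oplus>l\<in>L. x l \<otimes> (\<Oplus>k\<in>K. a k \<otimes> b k l))"
    using assms by (intro finsum_cong') (auto simp: finsum_rdistr Pi_def m_lcomm intro!: finsum_cong')
  finally show ?thesis .
qed

lemma free_mod_simps:
  "carrier (free_mod R n) = {..<n} \<rightarrow>\<^sub>E carrier R"
  "v \<oplus>\<^bsub>free_mod R n\<^esub> w = (\<lambda>i\<in>{..<n}. v i \<oplus> w i)"
  "r \<odot>\<^bsub>free_mod R n\<^esub> v = (\<lambda>i\<in>{..<n}. r \<otimes> v i)"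
  by (simp_all add: free_mod_def)

lemma std_alg_simps:
  "carrier (std_alg n R c u) = {..<n} \<rightarrow>\<^sub>E carrier R"
  "v \<oplus>\<^bsub>std_alg n R c u\<^esub> w = (\<lambda>i\<in>{..<n}. v i \<oplus> w i)"
  "\<zero>\<^bsub>std_alg n R c u\<^esub> = (\<lambda>i\<in>{..<n}. \<zero>)"
  "r \<odot>\<^bsub>std_alg n R c u\<^esub> v = (\<lambda>i\<in>{..<n}. r \<otimes> v i)"
  "v \<otimes>\<^bsub>std_alg n R c u\<^esub> w = (\<lambda>k\<in>{..<n}. \<Oplus>i\<in>{..<n}. v i \<otimes> (\<Oplus>j\<in>{..<n}. w j \<otimes> c i j k))"
  "\<one>\<^bsub>std_alg n R c u\<^esub> = (\<lambda>k\<in>{..<n}. u k)"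
  by (simp_all add: std_alg_def free_mod_def)

lemma vec_eqI:
  assumes "v \<in> {..<n} \<rightarrow>\<^sub>E carrier R" "w \<in> {..<n} \<rightarrow>\<^sub>E carrier R" "\<And>i. i < n \<Longrightarrow> v i = w i"
  shows "v = w"
  using assms by (intro PiE_ext[of v "{..<n}" "\<lambda>_. carrier R"]) auto

lemma vec_entry: "v \<in> {..<n} \<rightarrow>\<^sub>E carrier R \<Longrightarrow> i < n \<Longrightarrow> v i \<in> carrier R"
  by auto

lemma std_basis_closed: "std_basis R n i \<in> {..<n} \<rightarrow>\<^sub>E carrier R"
  by (auto simp: std_basis_def)

text \<open>The product is bilinear, so the relations between basis vectors extend to all vectors.
  The work lies in moving the coordinates out of the nested sums.\<close>

lemma std_alg_cring:
  assumes rel: "str_rel n R c u"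
  shows "cring (std_alg n R c u)"
proof -
  let ?A = "std_alg n R c u"
  have c: "c i j k \<in> carrier R" "c i j k = c j i k" if "i < n" "j < n" "k < n" for i j k
    using str_relD(1,2)[OF rel that] .
  have u: "u k \<in> carrier R" if "k < n" for k using str_relD(3)[OF rel that] .
  have assoc: "(\<Oplus>k\<in>{..<n}. c i j k \<otimes> c k l m) = (\<Oplus>k\<in>{..<n}. c j l k \<otimes> c i k m)"
    if "i < n" "j < n" "l < n" "m < n" for i j l m
    using str_relD(4)[OF rel that] .
  have unit: "(\<Oplus>i\<in>{..<n}. u i \<otimes> c i j k) = (if j = k then \<one> else \<zero>)" if "j < n" "k < n" for j k
    using str_relD(5)[OF rel that] .
  note [simp] = vec_entry c(1) u
  have m_entry: "(v \<otimes>\<^bsub>?A\<^esub> w) k = (\<Oplus>i\<in>{..<n}. v i \<otimes> (\<Oplus>j\<in>{..<n}. w j \<otimes> c i j k))" if "k < n" for v w k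
    using that by (simp add: std_alg_simps)
  have v_closed: "v \<otimes>\<^bsub>?A\<^esub> w \<in> {..<n} \<rightarrow>\<^sub>E carrier R"
    if "v \<in> {..<n} \<rightarrow>\<^sub>E carrier R" "w \<in> {..<n} \<rightarrow>\<^sub>E carrier R" for v w
    using that by (auto simp: std_alg_simps intro!: finsum_closed m_closed)
  show ?thesis
  proof (rule cringI)
    show "abelian_group ?A"
    proof (rule abelian_groupI)
      fix x y z assume "x \<in> carrier ?A" "y \<in> carrier ?A" "z \<in> carrier ?A"
      note xyz = this[unfolded std_alg_simps]
      show "x \<oplus>\<^bsub>?A\<^esub> y \<in> carrier ?A"
        using xyz by (simp add: std_alg_simps restrict_PiE_iff)
      show "x \<oplus>\<^bsub>?A\<^esub> y \<oplus>\<^bsub>?A\<^esub> z = x \<oplus>\<^bsub>?A\<^esub> (y \<oplus>\<^bsub>?A\<^esub> z)"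
        by (rule vec_eqI) (use xyz in \<open>simp_all add: std_alg_simps restrict_PiE_iff a_assoc\<close>)
      show "x \<oplus>\<^bsub>?A\<^esub> y = y \<oplus>\<^bsub>?A\<^esub> x"
        by (rule vec_eqI) (use xyz in \<open>simp_all add: std_alg_simps restrict_PiE_iff a_comm\<close>)
      show "\<zero>\<^bsub>?A\<^esub> \<oplus>\<^bsub>?A\<^esub> x = x"
        by (rule vec_eqI) (use xyz in \<open>simp_all add: std_alg_simps restrict_PiE_iff\<close>)
      show "\<exists>y\<in>carrier ?A. y \<oplus>\<^bsub>?A\<^esub> x = \<zero>\<^bsub>?A\<^esub>"
      proof (rule bexI)
        show "(\<lambda>i\<in>{..<n}. \<ominus> x i) \<oplus>\<^bsub>?A\<^esub> x = \<zero>\<^bsub>?A\<^esub>"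
          by (rule vec_eqI) (use xyz in \<open>simp_all add: std_alg_simps restrict_PiE_iff l_neg\<close>)
        show "(\<lambda>i\<in>{..<n}. \<ominus> x i) \<in> carrier ?A"
          using xyz by (simp add: std_alg_simps restrict_PiE_iff)
      qed
    qed (simp add: std_alg_simps restrict_PiE_iff)
    have m_comm: "v \<otimes>\<^bsub>?A\<^esub> w = w \<otimes>\<^bsub>?A\<^esub> v" if v: "v \<in> carrier ?A" and w: "w \<in> carrier ?A" for v w
    proof (rule vec_eqI)
      note vw = v[unfolded std_alg_simps] w[unfolded std_alg_simps]
      show "v \<otimes>\<^bsub>?A\<^esub> w \<in> {..<n} \<rightarrow>\<^sub>E carrier R" "w \<otimes>\<^bsub>?A\<^esub> v \<in> {..<n} \<rightarrow>\<^sub>E carrier R"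
        using vw by (auto intro!: v_closed)
      fix k assume k: "k < n"
      have "(v \<otimes>\<^bsub>?A\<^esub> w) k = (\<Oplus>j\<in>{..<n}. w j \<otimes> (\<Oplus>i\<in>{..<n}. v i \<otimes> c i j k))"
        using vw k by (simp add: m_entry) (intro finsum_mult_lcomm, auto)
      also have "\<dots> = (w \<otimes>\<^bsub>?A\<^esub> v) k"
        using vw k c(2) by (simp add: m_entry) (intro finsum_cong' arg_cong2[of _ _ _ _ "(\<otimes>)"] refl, auto)
      finally show "(v \<otimes>\<^bsub>?A\<^esub> w) k = (w \<otimes>\<^bsub>?A\<^esub> v) k" .
    qed
    show "comm_monoid ?A"
    proof (rule comm_monoidI)
      fix v w x assume "v \<in> carrier ?A" "w \<in> carrier ?A" "x \<in> carrier ?A"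
      note vwx = this[unfolded std_alg_simps]
      show "v \<otimes>\<^bsub>?A\<^esub> w \<otimes>\<^bsub>?A\<^esub> x = v \<otimes>\<^bsub>?A\<^esub> (w \<otimes>\<^bsub>?A\<^esub> x)"
      proof (rule vec_eqI)
        show "v \<otimes>\<^bsub>?A\<^esub> w \<otimes>\<^bsub>?A\<^esub> x \<in> {..<n} \<rightarrow>\<^sub>E carrier R" "v \<otimes>\<^bsub>?A\<^esub> (w \<otimes>\<^bsub>?A\<^esub> x) \<in> {..<n} \<rightarrow>\<^sub>E carrier R"
          using vwx by (auto intro!: v_closed)
        fix m assume m: "m < n"
        \<comment> \<open>\<open>X k\<close> is the m-th coordinate of the product of the k-th basis
          vector with x.\<close>
        define X where "X k = (\<Oplus>l\<in>{..<n}. x l \<otimes> c k l m)" for k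
        have X: "X k \<in> carrier R" if "k < n" for k
          unfolding X_def using vwx m that by (auto intro!: finsum_closed)
        have inner: "(\<Oplus>k\<in>{..<n}. c i j k \<otimes> X k) = (\<Oplus>k\<in>{..<n}. (\<Oplus>l\<in>{..<n}. x l \<otimes> c j l k) \<otimes> c i k m)"
          if i: "i < n" and j: "j < n" for i j
        proof -
          have "(\<Oplus>k\<in>{..<n}. c i j k \<otimes> X k) = (\<Oplus>l\<in>{..<n}. x l \<otimes> (\<Oplus>k\<in>{..<n}. c i j k \<otimes> c k l m))"
            unfolding X_def using vwx i j m by (intro finsum_mult_lcomm) auto
          also have "\<dots> = (\<Oplus>l\<in>{..<n}. x l \<otimes> (\<Oplus>k\<in>{..<n}. c j l k \<otimes> c i k m))"
            by (rule finsum_cong') (use vwx i j m in \<open>auto simp: assoc intro!: finsum_closed m_closed\<close>)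
          also have "\<dots> = (\<Oplus>k\<in>{..<n}. (\<Oplus>l\<in>{..<n}. x l \<otimes> c j l k) \<otimes> c i k m)"
            using vwx i j m by (intro finsum_mult_assoc[OF R, symmetric]) auto
          finally show ?thesis .
        qed
        have middle: "(\<Oplus>k\<in>{..<n}. (\<Oplus>j\<in>{..<n}. w j \<otimes> c i j k) \<otimes> X k) =
            (\<Oplus>k\<in>{..<n}. (\<Oplus>j\<in>{..<n}. w j \<otimes> (\<Oplus>l\<in>{..<n}. x l \<otimes> c j l k)) \<otimes> c i k m)"
          if i: "i < n" for i
        proof -
          have "(\<Oplus>k\<in>{..<n}. (\<Oplus>j\<in>{..<n}. w j \<otimes> c i j k) \<otimes> X k) = (\<Oplus>j\<in>{..<n}. w j \<otimes> (\<Oplus>k\<in>{..<n}. c i j k \<otimes> X k))"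
            using vwx X i by (intro finsum_mult_assoc[OF R]) auto
          also have "\<dots> = (\<Oplus>j\<in>{..<n}. w j \<otimes> (\<Oplus>k\<in>{..<n}. (\<Oplus>l\<in>{..<n}. x l \<otimes> c j l k) \<otimes> c i k m))"
            by (rule finsum_cong') (use vwx i m in \<open>auto simp: inner intro!: finsum_closed m_closed\<close>)
          also have "\<dots> = (\<Oplus>k\<in>{..<n}. (\<Oplus>j\<in>{..<n}. w j \<otimes> (\<Oplus>l\<in>{..<n}. x l \<otimes> c j l k)) \<otimes> c i k m)"
            using vwx i m by (intro finsum_mult_assoc[OF R, symmetric]) (auto intro!: finsum_closed)
          finally show ?thesis .
        qed
        have "(v \<otimes>\<^bsub>?A\<^esub> w \<otimes>\<^bsub>?A\<^esub> x) m = (\<Oplus>k\<in>{..<n}. (\<Oplus>i\<in>{..<n}. v i \<otimes> (\<Oplus>j\<in>{..<n}. w j \<otimes> c i j k)) \<otimes> X k)"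
          unfolding m_entry[OF m] using vwx X by (intro finsum_cong') (auto simp: m_entry X_def intro!: finsum_closed)
        also have "\<dots> = (\<Oplus>i\<in>{..<n}. v i \<otimes> (\<Oplus>k\<in>{..<n}. (\<Oplus>j\<in>{..<n}. w j \<otimes> c i j k) \<otimes> X k))"
          using vwx X by (intro finsum_mult_assoc[OF R]) (auto intro!: finsum_closed)
        also have "\<dots> = (\<Oplus>i\<in>{..<n}. v i \<otimes> (\<Oplus>k\<in>{..<n}. (\<Oplus>j\<in>{..<n}. w j \<otimes> (\<Oplus>l\<in>{..<n}. x l \<otimes> c j l k)) \<otimes> c i k m))"
          by (rule finsum_cong') (use vwx m in \<open>auto simp: middle intro!: finsum_closed m_closed\<close>)
        also have "\<dots> = (v \<otimes>\<^bsub>?A\<^esub> (w \<otimes>\<^bsub>?A\<^esub> x)) m"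
          unfolding m_entry[OF m] using vwx m
          by (intro finsum_cong' arg_cong2[of _ _ _ _ "(\<otimes>)"] refl)
            (auto simp: m_entry intro!: finsum_closed finsum_cong')
        finally show "(v \<otimes>\<^bsub>?A\<^esub> w \<otimes>\<^bsub>?A\<^esub> x) m = (v \<otimes>\<^bsub>?A\<^esub> (w \<otimes>\<^bsub>?A\<^esub> x)) m" .
      qed
    next
      fix v assume "v \<in> carrier ?A"
      note v = this[unfolded std_alg_simps]
      show "\<one>\<^bsub>?A\<^esub> \<otimes>\<^bsub>?A\<^esub> v = v"
      proof (rule vec_eqI)
        show "\<one>\<^bsub>?A\<^esub> \<otimes>\<^bsub>?A\<^esub> v \<in> {..<n} \<rightarrow>\<^sub>E carrier R"
          using v by (intro v_closed) (auto simp: std_alg_simps)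
        fix k assume k: "k < n"
        have "(\<one>\<^bsub>?A\<^esub> \<otimes>\<^bsub>?A\<^esub> v) k = (\<Oplus>i\<in>{..<n}. u i \<otimes> (\<Oplus>j\<in>{..<n}. v j \<otimes> c i j k))"
          unfolding m_entry[OF k] using v k by (intro finsum_cong') (auto simp: std_alg_simps intro!: finsum_closed)
        also have "\<dots> = (\<Oplus>j\<in>{..<n}. v j \<otimes> (\<Oplus>i\<in>{..<n}. u i \<otimes> c i j k))"
          using v k by (intro finsum_mult_lcomm) auto
        also have "\<dots> = (\<Oplus>j\<in>{..<n}. v j \<otimes> (if j = k then \<one> else \<zero>))"
          using v k by (intro finsum_cong') (auto simp: unit)
        also have "\<dots> = v k" using v k by (intro finsum_delta(4)[OF R]) auto
        finally show "(\<one>\<^bsub>?A\<^esub> \<otimes>\<^bsub>?A\<^esub> v) k = v k" .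
      qed (rule v)
    qed (use m_comm v_closed in \<open>simp_all add: std_alg_simps(1,6) restrict_PiE_iff\<close>)
    fix x y z assume "x \<in> carrier ?A" "y \<in> carrier ?A" "z \<in> carrier ?A"
    note xyz = this[unfolded std_alg_simps]
    show "(x \<oplus>\<^bsub>?A\<^esub> y) \<otimes>\<^bsub>?A\<^esub> z = x \<otimes>\<^bsub>?A\<^esub> z \<oplus>\<^bsub>?A\<^esub> y \<otimes>\<^bsub>?A\<^esub> z"
    proof (rule vec_eqI)
      show "(x \<oplus>\<^bsub>?A\<^esub> y) \<otimes>\<^bsub>?A\<^esub> z \<in> {..<n} \<rightarrow>\<^sub>E carrier R" "x \<otimes>\<^bsub>?A\<^esub> z \<oplus>\<^bsub>?A\<^esub> y \<otimes>\<^bsub>?A\<^esub> z \<in> {..<n} \<rightarrow>\<^sub>E carrier R"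
        using xyz vec_entry[OF v_closed[of x z]] vec_entry[OF v_closed[of y z]]
        by (simp_all add: std_alg_simps(2) restrict_PiE_iff v_closed)
      fix k assume k: "k < n"
      define Z where "Z i = (\<Oplus>j\<in>{..<n}. z j \<otimes> c i j k)" for i
      have Z: "Z i \<in> carrier R" if "i < n" for i
        unfolding Z_def using xyz k that by (auto intro!: finsum_closed)
      have "((x \<oplus>\<^bsub>?A\<^esub> y) \<otimes>\<^bsub>?A\<^esub> z) k = (\<Oplus>i\<in>{..<n}. x i \<otimes> Z i \<oplus> y i \<otimes> Z i)"
        unfolding m_entry[OF k] Z_def[symmetric] using xyz Z
        by (intro finsum_cong') (auto simp: std_alg_simps(2) l_distr)
      also have "\<dots> = (x \<otimes>\<^bsub>?A\<^esub> z \<oplus>\<^bsub>?A\<^esub> y \<otimes>\<^bsub>?A\<^esub> z) k"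
        using k xyz Z by (simp add: std_alg_simps(2) m_entry Z_def[symmetric] Pi_def)
      finally show "((x \<oplus>\<^bsub>?A\<^esub> y) \<otimes>\<^bsub>?A\<^esub> z) k = (x \<otimes>\<^bsub>?A\<^esub> z \<oplus>\<^bsub>?A\<^esub> y \<otimes>\<^bsub>?A\<^esub> z) k" .
    qed
  qed
qed

lemma std_alg_based:
  assumes rel: "str_rel n R c u"
  shows "(std_alg n R c u, \<lambda>x. x) \<in> based_algs n R"
    "i < n \<Longrightarrow> j < n \<Longrightarrow> k < n \<Longrightarrow> str_mult n R (std_alg n R c u, \<lambda>x. x) i j k = c i j k"
    "k < n \<Longrightarrow> str_unit n R (std_alg n R c u, \<lambda>x. x) k = u k"
proof -
  let ?A = "std_alg n R c u"
  have c: "c i j k \<in> carrier R" if "i < n" "j < n" "k < n" for i j k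
    using str_relD(1)[OF rel that] .
  note [simp] = vec_entry c
  have "algebra R ?A"
  proof (rule algebraI[OF R std_alg_cring[OF rel]])
    fix a x y assume a: "a \<in> carrier R" and "x \<in> carrier ?A" "y \<in> carrier ?A"
    note xy = this(2,3)[unfolded std_alg_simps]
    show "a \<odot>\<^bsub>?A\<^esub> x \<otimes>\<^bsub>?A\<^esub> y = a \<odot>\<^bsub>?A\<^esub> (x \<otimes>\<^bsub>?A\<^esub> y)"
    proof (rule vec_eqI)
      fix k assume k: "k < n"
      have "(a \<odot>\<^bsub>?A\<^esub> x \<otimes>\<^bsub>?A\<^esub> y) k = (\<Oplus>i\<in>{..<n}. a \<otimes> (x i \<otimes> (\<Oplus>j\<in>{..<n}. y j \<otimes> c i j k)))"
        using k a xy by (simp add: std_alg_simps) (intro finsum_cong', auto simp: m_assoc intro!: finsum_closed m_closed)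
      also have "\<dots> = (a \<odot>\<^bsub>?A\<^esub> (x \<otimes>\<^bsub>?A\<^esub> y)) k"
        using k a xy by (simp add: std_alg_simps) (intro finsum_rdistr[symmetric], auto)
      finally show "(a \<odot>\<^bsub>?A\<^esub> x \<otimes>\<^bsub>?A\<^esub> y) k = (a \<odot>\<^bsub>?A\<^esub> (x \<otimes>\<^bsub>?A\<^esub> y)) k" .
    qed (use a xy in \<open>auto simp: std_alg_simps intro!: finsum_closed m_closed\<close>)
  qed (rule vec_eqI | simp add: std_alg_simps restrict_PiE_iff vec_entry l_distr r_distr m_assoc)+
  moreover have "module_iso R ?A (free_mod R n) (\<lambda>x. x)"
    by (auto simp: module_iso_def std_alg_simps free_mod_simps bij_betw_def)
  ultimately show "(?A, \<lambda>x. x) \<in> based_algs n R" by (simp add: based_algs_def)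
  have b: "basis_elt n R (?A, \<lambda>x. x) i = std_basis R n i" for i
    unfolding basis_elt_def prod.case
    by (rule inv_into_f_f) (simp_all add: std_alg_simps std_basis_closed)
  show "str_mult n R (?A, \<lambda>x. x) i j k = c i j k" if ijk: "i < n" "j < n" "k < n"
  proof -
    have "str_mult n R (?A, \<lambda>x. x) i j k =
        (\<Oplus>i'\<in>{..<n}. (if i' = i then \<one> else \<zero>) \<otimes> (\<Oplus>j'\<in>{..<n}. (if j' = j then \<one> else \<zero>) \<otimes> c i' j' k))"
      using ijk by (simp add: str_mult_def b std_alg_simps)
        (intro finsum_cong' arg_cong2[of _ _ _ _ "(\<otimes>)"], auto simp: std_basis_def intro!: finsum_closed m_closed finsum_cong')
    also have "\<dots> = (\<Oplus>j'\<in>{..<n}. (if j' = j then \<one> else \<zero>) \<otimes> c i j' k)"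
      using ijk finsum_delta(2)[OF R, of "{..<n}" i "\<lambda>i'. \<Oplus>j'\<in>{..<n}. (if j' = j then \<one> else \<zero>) \<otimes> c i' j' k"]
      by (auto intro!: finsum_closed m_closed)
    also have "\<dots> = c i j k"
      using ijk finsum_delta(2)[OF R, of "{..<n}" j "\<lambda>j'. c i j' k"] by auto
    finally show ?thesis .
  qed
  show "k < n \<Longrightarrow> str_unit n R (?A, \<lambda>x. x) k = u k"
    by (simp add: str_unit_def std_alg_simps)
qed

end

context
  fixes R :: "'r ring" and A :: "('r, nat \<Rightarrow> 'r) module" and \<phi> :: "(nat \<Rightarrow> 'r) \<Rightarrow> (nat \<Rightarrow> 'r)" and n :: nat
  assumes based: "(A, \<phi>) \<in> based_algs n R"
begin

lemma based_algebra: "algebra R A"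
  using based by (simp add: based_algs_def)

lemma based_R_cring: "cring R"
  by (rule algebra.R_cring[OF based_algebra])

lemma based_A_cring: "cring A"
  by (rule algebra.M_cring[OF based_algebra])

interpretation R: cring R by (rule based_R_cring)
interpretation A: cring A by (rule based_A_cring)
interpretation alg: algebra R A by (rule based_algebra)

private abbreviation (input) b where "b \<equiv> basis_elt n R (A, \<phi>)"
private abbreviation (input) c where "c \<equiv> str_mult n R (A, \<phi>)"
private abbreviation (input) u where "u \<equiv> str_unit n R (A, \<phi>)"

lemma coord_iso: "bij_betw \<phi> (carrier A) ({..<n} \<rightarrow>\<^sub>E carrier R)"
  using based by (simp add: based_algs_def module_iso_def free_mod_simps[OF based_R_cring])

lemma coord_vec: "a \<in> carrier A \<Longrightarrow> \<phi> a \<in> {..<n} \<rightarrow>\<^sub>E carrier R"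
  using coord_iso by (auto simp: bij_betw_def)

lemma coord_closed [simp]: "a \<in> carrier A \<Longrightarrow> i < n \<Longrightarrow> \<phi> a i \<in> carrier R"
  using coord_vec by blast

lemma coord_add:
  "a \<in> carrier A \<Longrightarrow> a' \<in> carrier A \<Longrightarrow> i < n \<Longrightarrow> \<phi> (a \<oplus>\<^bsub>A\<^esub> a') i = \<phi> a i \<oplus>\<^bsub>R\<^esub> \<phi> a' i"
  using based by (simp add: based_algs_def module_iso_def free_mod_simps[OF based_R_cring])

lemma coord_smult:
  "r \<in> carrier R \<Longrightarrow> a \<in> carrier A \<Longrightarrow> i < n \<Longrightarrow> \<phi> (r \<odot>\<^bsub>A\<^esub> a) i = r \<otimes>\<^bsub>R\<^esub> \<phi> a i"
  using based by (simp add: based_algs_def module_iso_def free_mod_simps[OF based_R_cring])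

lemma coord_zero: "i < n \<Longrightarrow> \<phi> \<zero>\<^bsub>A\<^esub> i = \<zero>\<^bsub>R\<^esub>"
  using coord_smult[OF R.zero_closed A.zero_closed] by simp

lemma coord_lincomb:
  assumes "\<And>k. k \<in> K \<Longrightarrow> r k \<in> carrier R" "\<And>k. k \<in> K \<Longrightarrow> a k \<in> carrier A" "i < n"
  shows "\<phi> (\<Oplus>\<^bsub>A\<^esub>k\<in>K. r k \<odot>\<^bsub>A\<^esub> a k) i = (\<Oplus>\<^bsub>R\<^esub>k\<in>K. r k \<otimes>\<^bsub>R\<^esub> \<phi> (a k) i)"
  using assms
proof (induction K rule: infinite_finite_induct)
  case (insert x K)
  have "(\<lambda>k. r k \<odot>\<^bsub>A\<^esub> a k) \<in> K \<rightarrow> carrier A" "(\<lambda>k. r k \<otimes>\<^bsub>R\<^esub> \<phi> (a k) i) \<in> K \<rightarrow> carrier R"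
    using insert.prems by auto
  with insert show ?case by (simp add: coord_add coord_smult)
qed (simp_all add: coord_zero)

lemma coord_eqI:
  assumes "a \<in> carrier A" "a' \<in> carrier A" "\<And>i. i < n \<Longrightarrow> \<phi> a i = \<phi> a' i"
  shows "a = a'"
proof -
  have "\<phi> a = \<phi> a'" by (rule vec_eqI[OF based_R_cring coord_vec coord_vec]) (use assms in auto)
  then show ?thesis using coord_iso assms(1,2) by (auto simp: bij_betw_def inj_on_def)
qed

lemma ex_coord:
  assumes "v \<in> {..<n} \<rightarrow>\<^sub>E carrier R"
  shows "inv_into (carrier A) \<phi> v \<in> carrier A" "\<phi> (inv_into (carrier A) \<phi> v) = v"
proof -
  have "v \<in> \<phi> ` carrier A" using coord_iso assms by (simp add: bij_betw_def)
  then show "inv_into (carrier A) \<phi> v \<in> carrier A" "\<phi> (inv_into (carrier A) \<phi> v) = v"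
    by (rule inv_into_into, rule f_inv_into_f)
qed

lemma basis_closed [simp]: "b i \<in> carrier A"
  unfolding basis_elt_def prod.case by (rule ex_coord(1)[OF std_basis_closed[OF based_R_cring]])

lemma coord_basis: "i < n \<Longrightarrow> \<phi> (b j) i = (if i = j then \<one>\<^bsub>R\<^esub> else \<zero>\<^bsub>R\<^esub>)"
  unfolding basis_elt_def prod.case ex_coord(2)[OF std_basis_closed[OF based_R_cring]]
  by (simp add: std_basis_def)

lemma basis_eqI: "a \<in> carrier A \<Longrightarrow> (\<And>i. i < n \<Longrightarrow> \<phi> a i = (if i = j then \<one>\<^bsub>R\<^esub> else \<zero>\<^bsub>R\<^esub>)) \<Longrightarrow> b j = a"
  by (rule coord_eqI) (simp_all add: coord_basis)

lemma basis_expansion: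
  assumes "a \<in> carrier A"
  shows "a = (\<Oplus>\<^bsub>A\<^esub>i\<in>{..<n}. \<phi> a i \<odot>\<^bsub>A\<^esub> b i)"
proof (rule coord_eqI)
  fix k assume k: "k < n"
  have "\<phi> (\<Oplus>\<^bsub>A\<^esub>i\<in>{..<n}. \<phi> a i \<odot>\<^bsub>A\<^esub> b i) k = (\<Oplus>\<^bsub>R\<^esub>i\<in>{..<n}. \<phi> a i \<otimes>\<^bsub>R\<^esub> (if k = i then \<one>\<^bsub>R\<^esub> else \<zero>\<^bsub>R\<^esub>))"
    using assms k by (subst coord_lincomb) (auto simp: coord_basis intro!: R.finsum_cong')
  also have "\<dots> = \<phi> a k" using assms k by (intro finsum_delta(3)[OF based_R_cring]) auto
  finally show "\<phi> a k = \<phi> (\<Oplus>\<^bsub>A\<^esub>i\<in>{..<n}. \<phi> a i \<odot>\<^bsub>A\<^esub> b i) k" by simp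
qed (use assms in \<open>auto intro!: A.finsum_closed\<close>)

lemma lincomb_mult:
  assumes "finite K" "\<And>k. k \<in> K \<Longrightarrow> r k \<in> carrier R" "\<And>k. k \<in> K \<Longrightarrow> a k \<in> carrier A" "x \<in> carrier A"
  shows "(\<Oplus>\<^bsub>A\<^esub>k\<in>K. r k \<odot>\<^bsub>A\<^esub> a k) \<otimes>\<^bsub>A\<^esub> x = (\<Oplus>\<^bsub>A\<^esub>k\<in>K. r k \<odot>\<^bsub>A\<^esub> (a k \<otimes>\<^bsub>A\<^esub> x))"
  using assms by (subst A.finsum_ldistr) (auto simp: alg.smult_assoc2 intro!: A.finsum_cong')

lemma str_closed [simp]:
  "k < n \<Longrightarrow> c i j k \<in> carrier R" "k < n \<Longrightarrow> u k \<in> carrier R"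
  by (simp_all add: str_mult_def str_unit_def)

lemma coord_mult_basis:
  assumes a: "a \<in> carrier A" and k: "k < n"
  shows "\<phi> (a \<otimes>\<^bsub>A\<^esub> b l) k = (\<Oplus>\<^bsub>R\<^esub>i\<in>{..<n}. \<phi> a i \<otimes>\<^bsub>R\<^esub> c i l k)"
proof -
  have "a \<otimes>\<^bsub>A\<^esub> b l = (\<Oplus>\<^bsub>A\<^esub>i\<in>{..<n}. \<phi> a i \<odot>\<^bsub>A\<^esub> (b i \<otimes>\<^bsub>A\<^esub> b l))"
    by (rule trans[OF arg_cong[of _ _ "\<lambda>x. x \<otimes>\<^bsub>A\<^esub> b l", OF basis_expansion[OF a]] lincomb_mult])
      (use a in auto)
  then have "\<phi> (a \<otimes>\<^bsub>A\<^esub> b l) k = (\<Oplus>\<^bsub>R\<^esub>i\<in>{..<n}. \<phi> a i \<otimes>\<^bsub>R\<^esub> \<phi> (b i \<otimes>\<^bsub>A\<^esub> b l) k)"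
    using a k coord_lincomb[of "{..<n}" "\<phi> a" "\<lambda>i. b i \<otimes>\<^bsub>A\<^esub> b l" k] by simp
  then show ?thesis by (simp add: str_mult_def)
qed

lemma coord_mult:
  assumes a: "a \<in> carrier A" "a' \<in> carrier A" and k: "k < n"
  shows "\<phi> (a \<otimes>\<^bsub>A\<^esub> a') k = (\<Oplus>\<^bsub>R\<^esub>i\<in>{..<n}. \<phi> a i \<otimes>\<^bsub>R\<^esub> (\<Oplus>\<^bsub>R\<^esub>j\<in>{..<n}. \<phi> a' j \<otimes>\<^bsub>R\<^esub> c i j k))"
proof -
  have "a \<otimes>\<^bsub>A\<^esub> a' = (\<Oplus>\<^bsub>A\<^esub>i\<in>{..<n}. \<phi> a i \<odot>\<^bsub>A\<^esub> (b i \<otimes>\<^bsub>A\<^esub> a'))"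
    by (rule trans[OF arg_cong[of _ _ "\<lambda>x. x \<otimes>\<^bsub>A\<^esub> a'", OF basis_expansion[OF a(1)]] lincomb_mult])
      (use a in auto)
  then have "\<phi> (a \<otimes>\<^bsub>A\<^esub> a') k = (\<Oplus>\<^bsub>R\<^esub>i\<in>{..<n}. \<phi> a i \<otimes>\<^bsub>R\<^esub> \<phi> (b i \<otimes>\<^bsub>A\<^esub> a') k)"
    using a k coord_lincomb[of "{..<n}" "\<phi> a" "\<lambda>i. b i \<otimes>\<^bsub>A\<^esub> a'" k] by simp
  moreover have "\<phi> (b i \<otimes>\<^bsub>A\<^esub> a') k = (\<Oplus>\<^bsub>R\<^esub>j\<in>{..<n}. \<phi> a' j \<otimes>\<^bsub>R\<^esub> c i j k)" for i
  proof -
    have "\<phi> (b i \<otimes>\<^bsub>A\<^esub> a') k = (\<Oplus>\<^bsub>R\<^esub>j\<in>{..<n}. \<phi> a' j \<otimes>\<^bsub>R\<^esub> c j i k)"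
      using coord_mult_basis[OF a(2) k, of i] a A.m_comm[of "b i" a'] by simp
    moreover have "c j i k = c i j k" for j
      by (simp add: str_mult_def A.m_comm[of "b j" "b i"])
    ultimately show ?thesis by simp
  qed
  ultimately show ?thesis by simp
qed

lemma coord_mult_basis_basis:
  "m < n \<Longrightarrow> \<phi> (b i \<otimes>\<^bsub>A\<^esub> b j \<otimes>\<^bsub>A\<^esub> b l) m = (\<Oplus>\<^bsub>R\<^esub>k\<in>{..<n}. c i j k \<otimes>\<^bsub>R\<^esub> c k l m)"
  using coord_mult_basis[of "b i \<otimes>\<^bsub>A\<^esub> b j" m l]
  by (simp only: str_mult_def[of n R "(A, \<phi>)" i j] fst_conv snd_conv A.m_closed basis_closed)

lemma based_str_rel: "str_rel n R c u"
  unfolding str_rel_def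
proof (intro conjI allI impI)
  have comm: "c i j k = c j i k" for i j k
    by (simp add: str_mult_def A.m_comm[of "b i" "b j"])
  show "c i j k = c j i k" for i j k by (rule comm)
  fix i j l m assume "i < n" "j < n" "l < n" and m: "m < n"
  have "(\<Oplus>\<^bsub>R\<^esub>k\<in>{..<n}. c i j k \<otimes>\<^bsub>R\<^esub> c k l m) = \<phi> (b i \<otimes>\<^bsub>A\<^esub> b j \<otimes>\<^bsub>A\<^esub> b l) m"
    using m by (simp only: coord_mult_basis_basis)
  also have "b i \<otimes>\<^bsub>A\<^esub> b j \<otimes>\<^bsub>A\<^esub> b l = b j \<otimes>\<^bsub>A\<^esub> b l \<otimes>\<^bsub>A\<^esub> b i" by (simp add: A.m_ac)
  also have "\<phi> \<dots> m = (\<Oplus>\<^bsub>R\<^esub>k\<in>{..<n}. c j l k \<otimes>\<^bsub>R\<^esub> c k i m)"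
    using m by (simp only: coord_mult_basis_basis)
  finally show "(\<Oplus>\<^bsub>R\<^esub>k\<in>{..<n}. c i j k \<otimes>\<^bsub>R\<^esub> c k l m) = (\<Oplus>\<^bsub>R\<^esub>k\<in>{..<n}. c j l k \<otimes>\<^bsub>R\<^esub> c i k m)"
    by (simp only: comm[of _ i m])
next
  fix j k assume "j < n" and k: "k < n"
  have "(\<Oplus>\<^bsub>R\<^esub>i\<in>{..<n}. u i \<otimes>\<^bsub>R\<^esub> c i j k) = \<phi> (\<one>\<^bsub>A\<^esub> \<otimes>\<^bsub>A\<^esub> b j) k"
    using k by (simp only: coord_mult_basis[OF A.one_closed] str_unit_def fst_conv snd_conv)
  also have "\<dots> = (if j = k then \<one>\<^bsub>R\<^esub> else \<zero>\<^bsub>R\<^esub>)" using k by (auto simp: coord_basis)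
  finally show "(\<Oplus>\<^bsub>R\<^esub>i\<in>{..<n}. u i \<otimes>\<^bsub>R\<^esub> c i j k) = (if j = k then \<one>\<^bsub>R\<^esub> else \<zero>\<^bsub>R\<^esub>)" .
qed simp_all

end

text \<open>A ring homomorphism compatible with the coordinates carries basis to basis, so it
  transports the structure constants. Conversely the coordinates force the definition of
  \<open>\<psi>\<close>, and the formula for products in coordinates shows that it is
  multiplicative.\<close>

lemma is_base_change_iff:
  fixes R S :: "'r ring"
  assumes p: "p \<in> based_algs n R" and q: "q \<in> based_algs n S" and h: "h \<in> ring_hom R S"
  shows "is_base_change n R S h p q \<longleftrightarrow>
    (\<forall>i<n. \<forall>j<n. \<forall>k<n. str_mult n S q i j k = h (str_mult n R p i j k)) \<and>
    (\<forall>k<n. str_unit n S q k = h (str_unit n R p k))" (is "_ \<longleftrightarrow> ?eq")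
proof -
  obtain A \<phi> where A: "p = (A, \<phi>)" by (cases p)
  obtain B \<chi> where B: "q = (B, \<chi>)" by (cases q)
  note p' = p[unfolded A] and q' = q[unfolded B]
  interpret R: cring R by (rule based_R_cring[OF p'])
  interpret S: cring S by (rule based_R_cring[OF q'])
  interpret A: cring A by (rule based_A_cring[OF p'])
  interpret B: cring B by (rule based_A_cring[OF q'])
  interpret a: algebra R A by (rule based_algebra[OF p'])
  interpret b: algebra S B by (rule based_algebra[OF q'])
  note [simp] = ring_hom_closed[OF h] coord_closed[OF p'] coord_closed[OF q']
    basis_closed[OF p'] basis_closed[OF q'] str_closed[OF p'] str_closed[OF q']
  show ?thesis
  proof
    assume "is_base_change n R S h p q"
    then obtain \<psi> where \<psi>: "\<psi> \<in> ring_hom A B" "\<And>a i. a \<in> carrier A \<Longrightarrow> i < n \<Longrightarrow> \<chi> (\<psi> a) i = h (\<phi> a i)"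
      unfolding is_base_change_def A B prod.case by blast
    have "basis_elt n S q i = \<psi> (basis_elt n R p i)" for i
      unfolding A B
      by (rule basis_eqI[OF q'])
        (auto simp: \<psi>(2) ring_hom_closed[OF \<psi>(1)] coord_basis[OF p'] ring_hom_one[OF h]
          ring_hom_zero_cring[OF R.cring_axioms S.cring_axioms h])
    then show ?eq
      by (simp add: str_mult_def str_unit_def A B \<psi>(2) ring_hom_mult[OF \<psi>(1), symmetric]
          ring_hom_one[OF \<psi>(1), symmetric] del: )
  next
    assume eq: ?eq
    define \<psi> where "\<psi> a = inv_into (carrier B) \<chi> (\<lambda>i\<in>{..<n}. h (\<phi> a i))" for a
    have vec: "(\<lambda>i\<in>{..<n}. h (\<phi> a i)) \<in> {..<n} \<rightarrow>\<^sub>E carrier S" if "a \<in> carrier A" for a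
      using that by (simp add: restrict_PiE_iff)
    have \<psi>: "\<psi> a \<in> carrier B" "i < n \<Longrightarrow> \<chi> (\<psi> a) i = h (\<phi> a i)" if "a \<in> carrier A" for a i
      unfolding \<psi>_def using ex_coord[OF q' vec[OF that]] by simp_all
    have "\<psi> \<in> ring_hom A B"
    proof (rule ring_hom_memI)
      fix x y assume xy: "x \<in> carrier A" "y \<in> carrier A"
      show "\<psi> (x \<otimes>\<^bsub>A\<^esub> y) = \<psi> x \<otimes>\<^bsub>B\<^esub> \<psi> y"
      proof (rule coord_eqI[OF q'])
        fix k assume k: "k < n"
        have inner: "h (\<Oplus>\<^bsub>R\<^esub>j\<in>{..<n}. \<phi> y j \<otimes>\<^bsub>R\<^esub> str_mult n R p i j k) =
            (\<Oplus>\<^bsub>S\<^esub>j\<in>{..<n}. \<chi> (\<psi> y) j \<otimes>\<^bsub>S\<^esub> str_mult n S q i j k)" if "i < n" for i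
          using xy k that eq unfolding A B
          by (subst ring_hom_finsum[OF R.cring_axioms S.cring_axioms h])
            (auto simp: \<psi> ring_hom_mult[OF h] intro!: S.finsum_cong')
        have "\<chi> (\<psi> (x \<otimes>\<^bsub>A\<^esub> y)) k = h (\<Oplus>\<^bsub>R\<^esub>i\<in>{..<n}. \<phi> x i \<otimes>\<^bsub>R\<^esub> (\<Oplus>\<^bsub>R\<^esub>j\<in>{..<n}. \<phi> y j \<otimes>\<^bsub>R\<^esub> str_mult n R p i j k))"
          using xy k by (simp add: \<psi> coord_mult[OF p'] A)
        also have "\<dots> = (\<Oplus>\<^bsub>S\<^esub>i\<in>{..<n}. h (\<phi> x i \<otimes>\<^bsub>R\<^esub> (\<Oplus>\<^bsub>R\<^esub>j\<in>{..<n}. \<phi> y j \<otimes>\<^bsub>R\<^esub> str_mult n R p i j k)))"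
          using xy k unfolding A by (intro ring_hom_finsum[OF R.cring_axioms S.cring_axioms h]) (auto intro!: R.m_closed R.finsum_closed)
        also have "\<dots> = (\<Oplus>\<^bsub>S\<^esub>i\<in>{..<n}. \<chi> (\<psi> x) i \<otimes>\<^bsub>S\<^esub> (\<Oplus>\<^bsub>S\<^esub>j\<in>{..<n}. \<chi> (\<psi> y) j \<otimes>\<^bsub>S\<^esub> str_mult n S q i j k))"
        proof (rule S.finsum_cong'[OF refl])
          fix i assume "i \<in> {..<n}"
          then have i: "i < n" by simp
          have "(\<Oplus>\<^bsub>R\<^esub>j\<in>{..<n}. \<phi> y j \<otimes>\<^bsub>R\<^esub> str_mult n R p i j k) \<in> carrier R"
            using xy k unfolding A by (auto intro!: R.finsum_closed)
          then show "h (\<phi> x i \<otimes>\<^bsub>R\<^esub> (\<Oplus>\<^bsub>R\<^esub>j\<in>{..<n}. \<phi> y j \<otimes>\<^bsub>R\<^esub> str_mult n R p i j k)) =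
            \<chi> (\<psi> x) i \<otimes>\<^bsub>S\<^esub> (\<Oplus>\<^bsub>S\<^esub>j\<in>{..<n}. \<chi> (\<psi> y) j \<otimes>\<^bsub>S\<^esub> str_mult n S q i j k)"
            using xy i by (simp add: ring_hom_mult[OF h] inner \<psi>)
        qed (use xy k \<psi> in \<open>auto simp: B intro!: S.m_closed S.finsum_closed\<close>)
        also have "\<dots> = \<chi> (\<psi> x \<otimes>\<^bsub>B\<^esub> \<psi> y) k"
          using xy k by (simp add: \<psi> coord_mult[OF q'] B)
        finally show "\<chi> (\<psi> (x \<otimes>\<^bsub>A\<^esub> y)) k = \<chi> (\<psi> x \<otimes>\<^bsub>B\<^esub> \<psi> y) k" .
      qed (use xy \<psi> in auto)
      show "\<psi> (x \<oplus>\<^bsub>A\<^esub> y) = \<psi> x \<oplus>\<^bsub>B\<^esub> \<psi> y"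
        by (rule coord_eqI[OF q']) (use xy \<psi> in \<open>auto simp: coord_add[OF p'] coord_add[OF q'] ring_hom_add[OF h]\<close>)
    next
      show "\<psi> \<one>\<^bsub>A\<^esub> = \<one>\<^bsub>B\<^esub>"
        by (rule coord_eqI[OF q']) (use \<psi> eq in \<open>auto simp: str_unit_def A B\<close>)
    qed (rule \<psi>)
    moreover have "\<psi> (r \<odot>\<^bsub>A\<^esub> a) = h r \<odot>\<^bsub>B\<^esub> \<psi> a" if "r \<in> carrier R" "a \<in> carrier A" for r a
      by (rule coord_eqI[OF q'])
        (use that \<psi> in \<open>auto simp: coord_smult[OF p'] coord_smult[OF q'] ring_hom_mult[OF h]\<close>)
    ultimately show "is_base_change n R S h p q"
      unfolding is_base_change_def A B prod.case using \<psi>(2) by blast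
  qed
qed

text \<open>An isomorphism of based algebras is a base change along the identity, and such a map is
  bijective because both coordinate maps are. So an isomorphism class amounts to a family of
  structure constants together with a unit vector.\<close>

lemma based_iso_iff:
  fixes R :: "'r ring"
  assumes p: "p \<in> based_algs n R" and q: "q \<in> based_algs n R"
  shows "(p, q) \<in> based_iso n R \<longleftrightarrow>
    (\<forall>i<n. \<forall>j<n. \<forall>k<n. str_mult n R q i j k = str_mult n R p i j k) \<and>
    (\<forall>k<n. str_unit n R q k = str_unit n R p k)" (is "_ \<longleftrightarrow> ?eq")
proof -
  obtain A \<phi> where A: "p = (A, \<phi>)" by (cases p)
  obtain B \<chi> where B: "q = (B, \<chi>)" by (cases q)
  note p' = p[unfolded A] and q' = q[unfolded B]
  have id: "(\<lambda>r. r) \<in> ring_hom R R" by (rule ring_hom_memI) auto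
  have iff: "?eq \<longleftrightarrow> is_base_change n R R (\<lambda>r. r) p q"
    using is_base_change_iff[OF p q id] by simp
  show ?thesis
  proof
    assume "(p, q) \<in> based_iso n R"
    then obtain \<alpha> where "algebra_iso R A B \<alpha>" "\<forall>a\<in>carrier A. \<chi> (\<alpha> a) = \<phi> a"
      by (auto simp: based_iso_def A B)
    then have "is_base_change n R R (\<lambda>r. r) p q"
      unfolding is_base_change_def A B prod.case
      by (intro exI[of _ \<alpha>]) (auto simp: algebra_iso_def ring_iso_def)
    then show ?eq using iff by simp
  next
    assume ?eq
    then have "is_base_change n R R (\<lambda>r. r) p q" using iff by simp
    then obtain \<psi> where \<psi>: "\<psi> \<in> ring_hom A B"
      "\<And>r a. r \<in> carrier R \<Longrightarrow> a \<in> carrier A \<Longrightarrow> \<psi> (r \<odot>\<^bsub>A\<^esub> a) = r \<odot>\<^bsub>B\<^esub> \<psi> a"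
      "\<And>a i. a \<in> carrier A \<Longrightarrow> i < n \<Longrightarrow> \<chi> (\<psi> a) i = \<phi> a i"
      unfolding is_base_change_def A B prod.case by blast
    have \<chi>\<psi>: "\<chi> (\<psi> a) = \<phi> a" if "a \<in> carrier A" for a
      by (rule vec_eqI[OF based_R_cring[OF p'] coord_vec[OF q'] coord_vec[OF p']])
        (use that \<psi> ring_hom_closed[OF \<psi>(1)] in auto)
    have "bij_betw \<psi> (carrier A) (carrier B)"
    proof (rule bij_betwI')
      fix x y assume xy: "x \<in> carrier A" "y \<in> carrier A"
      show "\<psi> x = \<psi> y \<longleftrightarrow> x = y"
        using coord_eqI[OF p' xy] \<chi>\<psi> xy by metis
    next
      fix y assume y: "y \<in> carrier B"
      let ?x = "inv_into (carrier A) \<phi> (\<chi> y)"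
      note x = ex_coord[OF p' coord_vec[OF q' y]]
      have "y = \<psi> ?x"
        by (rule coord_eqI[OF q' y]) (use x \<chi>\<psi> ring_hom_closed[OF \<psi>(1)] in auto)
      then show "\<exists>x\<in>carrier A. y = \<psi> x" using x by blast
    qed (rule ring_hom_closed[OF \<psi>(1)])
    then have "algebra_iso R A B \<psi>" using \<psi> by (simp add: algebra_iso_def ring_iso_def)
    then show "(p, q) \<in> based_iso n R"
      using p q \<chi>\<psi> unfolding based_iso_def A B by blast
  qed
qed

text \<open>The trace form on basis elements, expressed by structure constants alone, so that it can
  be compared along isomorphisms and base change.\<close>

definition str_trace :: "nat \<Rightarrow> 'r ring \<Rightarrow> (nat \<Rightarrow> nat \<Rightarrow> nat \<Rightarrow> 'r) \<Rightarrow> nat \<times> nat \<Rightarrow> 'r" where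
  "str_trace n R c = (\<lambda>(i, j). \<Oplus>\<^bsub>R\<^esub>m\<in>{..<n}. \<Oplus>\<^bsub>R\<^esub>k\<in>{..<n}. c i j k \<otimes>\<^bsub>R\<^esub> c k m m)"

lemma str_trace_eq:
  assumes p: "(A, \<phi>) \<in> based_algs n R"
  shows "alg_trace n R (A, \<phi>) (basis_elt n R (A, \<phi>) i \<otimes>\<^bsub>A\<^esub> basis_elt n R (A, \<phi>) j) =
    str_trace n R (str_mult n R (A, \<phi>)) (i, j)"
proof -
  interpret R: cring R by (rule based_R_cring[OF p])
  interpret A: cring A by (rule based_A_cring[OF p])
  show ?thesis
    unfolding alg_trace_def str_trace_def prod.case
    by (rule R.finsum_cong'[OF refl])
      (auto simp: coord_mult_basis[OF p] basis_closed[OF p] str_closed[OF p]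
        str_mult_def[of n R "(A, \<phi>)" i j] coord_closed[OF p] intro!: R.finsum_closed)
qed

lemma disc_eq:
  assumes p: "p \<in> based_algs n R"
  shows "disc n R p = mat_det R n (str_trace n R (str_mult n R p))"
proof -
  obtain A \<phi> where A: "p = (A, \<phi>)" by (cases p)
  note p' = p[unfolded A]
  interpret R: cring R by (rule based_R_cring[OF p'])
  show ?thesis
    unfolding disc_def
    by (rule mat_det_cong[OF based_R_cring[OF p']])
      (auto simp: A str_trace_eq[OF p'] str_trace_def str_closed[OF p'] intro!: R.finsum_closed)
qed

section \<open>Change of basis\<close>

text \<open>When the coordinate map is followed by \<open>M\<close>, the new basis elements have the
  columns of the inverse of \<open>M\<close> as old coordinates. Their products are computed in the
  old basis and the result is mapped by \<open>M\<close>.\<close>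

definition basis_change_mult ::
  "nat \<Rightarrow> 'r ring \<Rightarrow> 'r matrix \<Rightarrow> (nat \<Rightarrow> nat \<Rightarrow> nat \<Rightarrow> 'r) \<Rightarrow> nat \<Rightarrow> nat \<Rightarrow> nat \<Rightarrow> 'r" where
  "basis_change_mult n R M c i j k = (\<Oplus>\<^bsub>R\<^esub>k'\<in>{..<n}. M (k, k') \<otimes>\<^bsub>R\<^esub>
     (\<Oplus>\<^bsub>R\<^esub>i'\<in>{..<n}. (inv\<^bsub>mat_monoid R n\<^esub> M) (i', i) \<otimes>\<^bsub>R\<^esub>
       (\<Oplus>\<^bsub>R\<^esub>j'\<in>{..<n}. (inv\<^bsub>mat_monoid R n\<^esub> M) (j', j) \<otimes>\<^bsub>R\<^esub> c i' j' k')))"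

definition basis_change_unit :: "nat \<Rightarrow> 'r ring \<Rightarrow> 'r matrix \<Rightarrow> (nat \<Rightarrow> 'r) \<Rightarrow> nat \<Rightarrow> 'r" where
  "basis_change_unit n R M u k = (\<Oplus>\<^bsub>R\<^esub>k'\<in>{..<n}. M (k, k') \<otimes>\<^bsub>R\<^esub> u k')"

context
  fixes R :: "'r ring" and n :: nat and M :: "'r matrix"
  assumes R: "cring R" and M: "M \<in> Units (mat_monoid R n)"
begin

interpretation R: cring R by (rule R)
interpretation MM: monoid "mat_monoid R n" by (rule mat_monoid_monoid[OF R])

private abbreviation (input) N where "N \<equiv> inv\<^bsub>mat_monoid R n\<^esub> M"

lemma mat_vec_closed:
  assumes "v \<in> {..<n} \<rightarrow>\<^sub>E carrier R" shows "mat_vec R n M v \<in> {..<n} \<rightarrow>\<^sub>E carrier R"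
  using assms by (auto simp: mat_vec_def intro!: R.finsum_closed R.m_closed mat_Units_entries(1)[OF R M])

lemma mat_vec_entry: "i < n \<Longrightarrow> mat_vec R n M v i = (\<Oplus>\<^bsub>R\<^esub>j\<in>{..<n}. M (i, j) \<otimes>\<^bsub>R\<^esub> v j)"
  by (simp add: mat_vec_def)

lemma mat_inverse_entries:
  assumes "i < n" "j < n"
  shows "(\<Oplus>\<^bsub>R\<^esub>k\<in>{..<n}. M (i, k) \<otimes>\<^bsub>R\<^esub> N (k, j)) = (if i = j then \<one>\<^bsub>R\<^esub> else \<zero>\<^bsub>R\<^esub>)"
    "(\<Oplus>\<^bsub>R\<^esub>k\<in>{..<n}. N (i, k) \<otimes>\<^bsub>R\<^esub> M (k, j)) = (if i = j then \<one>\<^bsub>R\<^esub> else \<zero>\<^bsub>R\<^esub>)"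
proof -
  have "M \<otimes>\<^bsub>mat_monoid R n\<^esub> N = \<one>\<^bsub>mat_monoid R n\<^esub>" "N \<otimes>\<^bsub>mat_monoid R n\<^esub> M = \<one>\<^bsub>mat_monoid R n\<^esub>" using M by auto
  from this[THEN arg_cong[of _ _ "\<lambda>C. C (i, j)"]]
  show "(\<Oplus>\<^bsub>R\<^esub>k\<in>{..<n}. M (i, k) \<otimes>\<^bsub>R\<^esub> N (k, j)) = (if i = j then \<one>\<^bsub>R\<^esub> else \<zero>\<^bsub>R\<^esub>)"
    "(\<Oplus>\<^bsub>R\<^esub>k\<in>{..<n}. N (i, k) \<otimes>\<^bsub>R\<^esub> M (k, j)) = (if i = j then \<one>\<^bsub>R\<^esub> else \<zero>\<^bsub>R\<^esub>)"
    using assms by (simp_all add: mat_mult_entry[OF R] mat_one_entry[OF R])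
qed

lemma based_mat_vec:
  assumes p: "(A, \<phi>) \<in> based_algs n R"
  shows "(A, \<lambda>a. mat_vec R n M (\<phi> a)) \<in> based_algs n R"
proof -
  let ?V = "{..<n} \<rightarrow>\<^sub>E carrier R"
  note [simp] = mat_Units_entries[OF R M] vec_entry[OF R] coord_closed[OF p]
  have N: "N \<in> Units (mat_monoid R n)" "inv\<^bsub>mat_monoid R n\<^esub> N = M" using M by auto
  have N_closed: "mat_vec R n N v \<in> ?V" if "v \<in> ?V" for v
    using that by (auto simp: mat_vec_def intro!: R.finsum_closed R.m_closed)
  have "mat_vec R n N (mat_vec R n M v) = v" "mat_vec R n M (mat_vec R n N v) = v" if v: "v \<in> ?V" for v
  proof -
    note ve = vec_entry[OF R v]
    have "mat_vec R n N (mat_vec R n M v) i = v i" "mat_vec R n M (mat_vec R n N v) i = v i" if i: "i < n" for i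
    proof -
      have "mat_vec R n N (mat_vec R n M v) i = (\<Oplus>\<^bsub>R\<^esub>k\<in>{..<n}. N (i, k) \<otimes>\<^bsub>R\<^esub> (\<Oplus>\<^bsub>R\<^esub>m\<in>{..<n}. M (k, m) \<otimes>\<^bsub>R\<^esub> v m))"
        "mat_vec R n M (mat_vec R n N v) i = (\<Oplus>\<^bsub>R\<^esub>k\<in>{..<n}. M (i, k) \<otimes>\<^bsub>R\<^esub> (\<Oplus>\<^bsub>R\<^esub>m\<in>{..<n}. N (k, m) \<otimes>\<^bsub>R\<^esub> v m))"
        using i ve by (auto simp: mat_vec_def intro!: R.finsum_cong' R.finsum_closed R.m_closed)
      then show "mat_vec R n N (mat_vec R n M v) i = v i" "mat_vec R n M (mat_vec R n N v) i = v i"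
        using mat_Units_cancel[OF R M i, of v] ve by simp_all
    qed
    then show "mat_vec R n N (mat_vec R n M v) = v" "mat_vec R n M (mat_vec R n N v) = v"
      using vec_eqI[OF R N_closed[OF mat_vec_closed[OF v]] v] vec_eqI[OF R mat_vec_closed[OF N_closed[OF v]] v]
      by blast+
  qed
  then have "bij_betw (mat_vec R n M) ?V ?V"
    using mat_vec_closed N_closed by (intro bij_betwI[of _ _ _ "mat_vec R n N"]) auto
  then have "bij_betw (\<lambda>a. mat_vec R n M (\<phi> a)) (carrier A) ?V"
    using bij_betw_trans[OF coord_iso[OF p]] by (simp add: o_def)
  moreover have "mat_vec R n M (\<phi> (x \<oplus>\<^bsub>A\<^esub> y)) = mat_vec R n M (\<phi> x) \<oplus>\<^bsub>free_mod R n\<^esub> mat_vec R n M (\<phi> y)"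
    if xy: "x \<in> carrier A" "y \<in> carrier A" for x y
  proof -
    have "(\<Oplus>\<^bsub>R\<^esub>j\<in>{..<n}. M (i, j) \<otimes>\<^bsub>R\<^esub> \<phi> (x \<oplus>\<^bsub>A\<^esub> y) j) =
        (\<Oplus>\<^bsub>R\<^esub>j\<in>{..<n}. M (i, j) \<otimes>\<^bsub>R\<^esub> \<phi> x j) \<oplus>\<^bsub>R\<^esub> (\<Oplus>\<^bsub>R\<^esub>j\<in>{..<n}. M (i, j) \<otimes>\<^bsub>R\<^esub> \<phi> y j)" if "i < n" for i
    proof -
      have "(\<Oplus>\<^bsub>R\<^esub>j\<in>{..<n}. M (i, j) \<otimes>\<^bsub>R\<^esub> \<phi> (x \<oplus>\<^bsub>A\<^esub> y) j) =
          (\<Oplus>\<^bsub>R\<^esub>j\<in>{..<n}. M (i, j) \<otimes>\<^bsub>R\<^esub> \<phi> x j \<oplus>\<^bsub>R\<^esub> M (i, j) \<otimes>\<^bsub>R\<^esub> \<phi> y j)"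
        using that xy by (intro R.finsum_cong') (auto simp: coord_add[OF p] R.r_distr)
      then show ?thesis using that xy by (simp add: Pi_def)
    qed
    then show ?thesis by (auto simp: free_mod_simps[OF R] mat_vec_def intro!: restrict_ext)
  qed
  moreover have "mat_vec R n M (\<phi> (r \<odot>\<^bsub>A\<^esub> x)) = r \<odot>\<^bsub>free_mod R n\<^esub> mat_vec R n M (\<phi> x)"
    if r: "r \<in> carrier R" and x: "x \<in> carrier A" for r x
  proof -
    have "(\<Oplus>\<^bsub>R\<^esub>j\<in>{..<n}. M (i, j) \<otimes>\<^bsub>R\<^esub> \<phi> (r \<odot>\<^bsub>A\<^esub> x) j) = r \<otimes>\<^bsub>R\<^esub> (\<Oplus>\<^bsub>R\<^esub>j\<in>{..<n}. M (i, j) \<otimes>\<^bsub>R\<^esub> \<phi> x j)" if "i < n" for i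
    proof -
      have "(\<Oplus>\<^bsub>R\<^esub>j\<in>{..<n}. M (i, j) \<otimes>\<^bsub>R\<^esub> \<phi> (r \<odot>\<^bsub>A\<^esub> x) j) = (\<Oplus>\<^bsub>R\<^esub>j\<in>{..<n}. r \<otimes>\<^bsub>R\<^esub> (M (i, j) \<otimes>\<^bsub>R\<^esub> \<phi> x j))"
        using that r x by (intro R.finsum_cong') (auto simp: coord_smult[OF p] R.m_lcomm)
      then show ?thesis using that r x by (simp add: R.finsum_rdistr Pi_def)
    qed
    then show ?thesis by (auto simp: free_mod_simps[OF R] mat_vec_def intro!: restrict_ext)
  qed
  ultimately show ?thesis
    using based_algebra[OF p] by (simp add: based_algs_def module_iso_def free_mod_simps(1)[OF R])
qed

lemma basis_change:
  assumes p: "(A, \<phi>) \<in> based_algs n R"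
  shows "i < n \<Longrightarrow> j < n \<Longrightarrow> k < n \<Longrightarrow> str_mult n R (A, \<lambda>a. mat_vec R n M (\<phi> a)) i j k =
      basis_change_mult n R M (str_mult n R (A, \<phi>)) i j k"
    "k < n \<Longrightarrow> str_unit n R (A, \<lambda>a. mat_vec R n M (\<phi> a)) k = basis_change_unit n R M (str_unit n R (A, \<phi>)) k"
proof -
  let ?q = "(A, \<lambda>a. mat_vec R n M (\<phi> a))"
  note q = based_mat_vec[OF p]
  interpret A: cring A by (rule based_A_cring[OF p])
  note [simp] = mat_Units_entries[OF R M] coord_closed[OF p]
  define a where "a i = inv_into (carrier A) \<phi> (\<lambda>i'\<in>{..<n}. N (i', i))" for i
  have a: "a i \<in> carrier A" "\<phi> (a i) = (\<lambda>i'\<in>{..<n}. N (i', i))" if "i < n" for i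
    using ex_coord[OF p, of "\<lambda>i'\<in>{..<n}. N (i', i)"] that
    by (simp_all add: a_def restrict_PiE_iff)
  have b: "basis_elt n R ?q i = a i" if "i < n" for i
  proof (rule basis_eqI[OF q a(1)[OF that]])
    fix m assume m: "m < n"
    have "mat_vec R n M (\<phi> (a i)) m = (\<Oplus>\<^bsub>R\<^esub>j\<in>{..<n}. M (m, j) \<otimes>\<^bsub>R\<^esub> N (j, i))"
      unfolding mat_vec_entry[OF m] using that m by (intro R.finsum_cong') (auto simp: a)
    then show "mat_vec R n M (\<phi> (a i)) m = (if m = i then \<one>\<^bsub>R\<^esub> else \<zero>\<^bsub>R\<^esub>)"
      using that m by (simp add: mat_inverse_entries)
  qed
  show "str_mult n R ?q i j k = basis_change_mult n R M (str_mult n R (A, \<phi>)) i j k"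
    if ijk: "i < n" "j < n" "k < n"
  proof -
    have "\<phi> (a i \<otimes>\<^bsub>A\<^esub> a j) k' = (\<Oplus>\<^bsub>R\<^esub>i'\<in>{..<n}. N (i', i) \<otimes>\<^bsub>R\<^esub>
       (\<Oplus>\<^bsub>R\<^esub>j'\<in>{..<n}. N (j', j) \<otimes>\<^bsub>R\<^esub> str_mult n R (A, \<phi>) i' j' k'))" if k': "k' < n" for k'
    proof -
      have inner: "(\<Oplus>\<^bsub>R\<^esub>j'\<in>{..<n}. \<phi> (a j) j' \<otimes>\<^bsub>R\<^esub> str_mult n R (A, \<phi>) i' j' k') =
         (\<Oplus>\<^bsub>R\<^esub>j'\<in>{..<n}. N (j', j) \<otimes>\<^bsub>R\<^esub> str_mult n R (A, \<phi>) i' j' k')"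
        "(\<Oplus>\<^bsub>R\<^esub>j'\<in>{..<n}. N (j', j) \<otimes>\<^bsub>R\<^esub> str_mult n R (A, \<phi>) i' j' k') \<in> carrier R" for i'
        using ijk k' by (auto intro!: R.finsum_cong' R.finsum_closed simp: a str_closed[OF p])
      show ?thesis
        unfolding coord_mult[OF p a(1)[OF ijk(1)] a(1)[OF ijk(2)] k'] inner(1)
        by (rule R.finsum_cong'[OF refl]) (use ijk k' inner(2) in \<open>auto simp: a\<close>)
    qed
    moreover have "(\<Oplus>\<^bsub>R\<^esub>i'\<in>{..<n}. N (i', i) \<otimes>\<^bsub>R\<^esub>
       (\<Oplus>\<^bsub>R\<^esub>j'\<in>{..<n}. N (j', j) \<otimes>\<^bsub>R\<^esub> str_mult n R (A, \<phi>) i' j' k')) \<in> carrier R" if "k' < n" for k'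
      using ijk that by (auto intro!: R.finsum_closed R.m_closed simp: str_closed[OF p])
    moreover have "str_mult n R ?q i j k = mat_vec R n M (\<phi> (a i \<otimes>\<^bsub>A\<^esub> a j)) k"
      using ijk by (simp add: str_mult_def b)
    ultimately show ?thesis
      unfolding basis_change_mult_def using ijk
      by (simp add: mat_vec_entry) (rule R.finsum_cong', auto)
  qed
  show "str_unit n R ?q k = basis_change_unit n R M (str_unit n R (A, \<phi>)) k" if "k < n"
    using that by (simp add: str_unit_def basis_change_unit_def mat_vec_entry)
qed

end

definition split_alg :: "nat \<Rightarrow> 'r ring \<Rightarrow> ('r, nat \<Rightarrow> 'r) module" where
  "split_alg n R = std_alg n R (\<lambda>i j k. if i = j \<and> j = k then \<one>\<^bsub>R\<^esub> else \<zero>\<^bsub>R\<^esub>) (\<lambda>_. \<one>\<^bsub>R\<^esub>)"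

context
  fixes R :: "'r ring" and n :: nat
  assumes R: "cring R"
begin

interpretation R: cring R by (rule R)
interpretation MM: monoid "mat_monoid R n" by (rule mat_monoid_monoid[OF R])

lemma split_alg_rel:
  "str_rel n R (\<lambda>i j k. if i = j \<and> j = k then \<one>\<^bsub>R\<^esub> else \<zero>\<^bsub>R\<^esub>) (\<lambda>_. \<one>\<^bsub>R\<^esub>)"
  unfolding str_rel_def
proof (intro conjI allI impI)
  let ?c = "\<lambda>i j k. if i = j \<and> j = k then \<one>\<^bsub>R\<^esub> else \<zero>\<^bsub>R\<^esub>"
  have ev: "(\<Oplus>\<^bsub>R\<^esub>k\<in>{..<n}. ?c i j k \<otimes>\<^bsub>R\<^esub> f k) = (if i = j then f j else \<zero>\<^bsub>R\<^esub>)"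
    if "j < n" "\<And>k. k < n \<Longrightarrow> f k \<in> carrier R" for i j :: nat and f
    using that finsum_delta(1)[OF R, of "{..<n}" j f]
    by (cases "i = j") (auto intro!: R.add.finprod_one_eqI)
  fix i j l m assume ijlm: "i < n" "j < n" "l < n" "m < n"
  show "(\<Oplus>\<^bsub>R\<^esub>k\<in>{..<n}. ?c i j k \<otimes>\<^bsub>R\<^esub> ?c k l m) = (\<Oplus>\<^bsub>R\<^esub>k\<in>{..<n}. ?c j l k \<otimes>\<^bsub>R\<^esub> ?c i k m)"
    using ijlm ev[of j "\<lambda>k. ?c k l m" i] ev[of l "\<lambda>k. ?c i k m" j] by simp
next
  let ?c = "\<lambda>i j k. if i = j \<and> j = k then \<one>\<^bsub>R\<^esub> else \<zero>\<^bsub>R\<^esub>"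
  fix j k assume jk: "j < n" "k < n"
  have "(\<Oplus>\<^bsub>R\<^esub>i\<in>{..<n}. \<one>\<^bsub>R\<^esub> \<otimes>\<^bsub>R\<^esub> ?c i j k) =
      (\<Oplus>\<^bsub>R\<^esub>i\<in>{..<n}. (if i = j then \<one>\<^bsub>R\<^esub> else \<zero>\<^bsub>R\<^esub>) \<otimes>\<^bsub>R\<^esub> (if j = k then \<one>\<^bsub>R\<^esub> else \<zero>\<^bsub>R\<^esub>))"
    by (intro R.finsum_cong') auto
  also have "\<dots> = (if j = k then \<one>\<^bsub>R\<^esub> else \<zero>\<^bsub>R\<^esub>)"
    using jk by (intro finsum_delta(2)[OF R]) auto
  finally show "(\<Oplus>\<^bsub>R\<^esub>i\<in>{..<n}. \<one>\<^bsub>R\<^esub> \<otimes>\<^bsub>R\<^esub> ?c i j k) = (if j = k then \<one>\<^bsub>R\<^esub> else \<zero>\<^bsub>R\<^esub>)" .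
qed auto

lemma split_alg_based:
  assumes M: "M \<in> Units (mat_monoid R n)"
  shows "(split_alg n R, \<lambda>v. mat_vec R n M v) \<in> based_algs n R"
    "i < n \<Longrightarrow> j < n \<Longrightarrow> k < n \<Longrightarrow>
      str_mult n R (split_alg n R, \<lambda>v. mat_vec R n M v) i j k = split_mult n R M i j k"
    "k < n \<Longrightarrow> str_unit n R (split_alg n R, \<lambda>v. mat_vec R n M v) k = split_unit n R M k"
proof -
  note std = std_alg_based[OF R split_alg_rel, folded split_alg_def]
  note [simp] = mat_Units_entries[OF R M]
  let ?N = "inv\<^bsub>mat_monoid R n\<^esub> M"
  show "(split_alg n R, \<lambda>v. mat_vec R n M v) \<in> based_algs n R"
    by (rule based_mat_vec[OF R M std(1)])
  show "str_mult n R (split_alg n R, \<lambda>v. mat_vec R n M v) i j k = split_mult n R M i j k"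
    if ijk: "i < n" "j < n" "k < n"
  proof -
    have inner: "(\<Oplus>\<^bsub>R\<^esub>i'\<in>{..<n}. ?N (i', i) \<otimes>\<^bsub>R\<^esub> (\<Oplus>\<^bsub>R\<^esub>j'\<in>{..<n}. ?N (j', j) \<otimes>\<^bsub>R\<^esub>
        str_mult n R (split_alg n R, \<lambda>x. x) i' j' k')) = ?N (k', i) \<otimes>\<^bsub>R\<^esub> ?N (k', j)" if k': "k' < n" for k'
    proof -
      have "(\<Oplus>\<^bsub>R\<^esub>j'\<in>{..<n}. ?N (j', j) \<otimes>\<^bsub>R\<^esub> str_mult n R (split_alg n R, \<lambda>x. x) i' j' k') =
          ?N (k', j) \<otimes>\<^bsub>R\<^esub> (if i' = k' then \<one>\<^bsub>R\<^esub> else \<zero>\<^bsub>R\<^esub>)" if i': "i' < n" for i'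
      proof -
        have "(\<Oplus>\<^bsub>R\<^esub>j'\<in>{..<n}. ?N (j', j) \<otimes>\<^bsub>R\<^esub> str_mult n R (split_alg n R, \<lambda>x. x) i' j' k') =
            (\<Oplus>\<^bsub>R\<^esub>j'\<in>{..<n}. (?N (j', j) \<otimes>\<^bsub>R\<^esub> (if i' = k' then \<one>\<^bsub>R\<^esub> else \<zero>\<^bsub>R\<^esub>)) \<otimes>\<^bsub>R\<^esub> (if k' = j' then \<one>\<^bsub>R\<^esub> else \<zero>\<^bsub>R\<^esub>))"
          using ijk i' k' by (intro R.finsum_cong') (auto simp: std)
        also have "\<dots> = ?N (k', j) \<otimes>\<^bsub>R\<^esub> (if i' = k' then \<one>\<^bsub>R\<^esub> else \<zero>\<^bsub>R\<^esub>)"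
          using ijk k' by (intro finsum_delta(3)[OF R]) auto
        finally show ?thesis .
      qed
      then have "(\<Oplus>\<^bsub>R\<^esub>i'\<in>{..<n}. ?N (i', i) \<otimes>\<^bsub>R\<^esub> (\<Oplus>\<^bsub>R\<^esub>j'\<in>{..<n}. ?N (j', j) \<otimes>\<^bsub>R\<^esub>
        str_mult n R (split_alg n R, \<lambda>x. x) i' j' k')) =
        (\<Oplus>\<^bsub>R\<^esub>i'\<in>{..<n}. (?N (i', i) \<otimes>\<^bsub>R\<^esub> ?N (k', j)) \<otimes>\<^bsub>R\<^esub> (if i' = k' then \<one>\<^bsub>R\<^esub> else \<zero>\<^bsub>R\<^esub>))"
        using ijk k' by (intro R.finsum_cong') (auto simp: R.m_assoc)
      also have "\<dots> = ?N (k', i) \<otimes>\<^bsub>R\<^esub> ?N (k', j)"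
        using ijk k' by (intro finsum_delta(4)[OF R]) auto
      finally show ?thesis .
    qed
    show ?thesis
      unfolding basis_change(1)[OF R M std(1) ijk] basis_change_mult_def split_mult_def
      by (rule R.finsum_cong'[OF refl]) (use ijk in \<open>auto simp: inner\<close>)
  qed
  show "str_unit n R (split_alg n R, \<lambda>v. mat_vec R n M v) k = split_unit n R M k" if k: "k < n"
    unfolding basis_change(2)[OF R M std(1) k] basis_change_unit_def split_unit_def
    by (rule R.finsum_cong'[OF refl]) (use k in \<open>auto simp: std\<close>)
qed

lemma mat_vec_mult:
  assumes Y: "Y \<in> Units (mat_monoid R n)" and X: "X \<in> Units (mat_monoid R n)" and v: "v \<in> {..<n} \<rightarrow>\<^sub>E carrier R"
  shows "mat_vec R n (Y \<otimes>\<^bsub>mat_monoid R n\<^esub> X) v = mat_vec R n Y (mat_vec R n X v)"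
proof (rule vec_eqI[OF R mat_vec_closed[OF R MM.Units_m_closed[OF Y X] v] mat_vec_closed[OF R Y mat_vec_closed[OF R X v]]])
  note [simp] = mat_Units_entries(1)[OF R Y] mat_Units_entries(1)[OF R X] vec_entry[OF R v]
  fix i assume i: "i < n"
  have "mat_vec R n (Y \<otimes>\<^bsub>mat_monoid R n\<^esub> X) v i = (\<Oplus>\<^bsub>R\<^esub>l\<in>{..<n}. (\<Oplus>\<^bsub>R\<^esub>k\<in>{..<n}. Y (i, k) \<otimes>\<^bsub>R\<^esub> X (k, l)) \<otimes>\<^bsub>R\<^esub> v l)"
    unfolding mat_vec_def using i by (auto simp: mat_mult_entry[OF R] intro!: R.finsum_cong')
  also have "\<dots> = (\<Oplus>\<^bsub>R\<^esub>k\<in>{..<n}. Y (i, k) \<otimes>\<^bsub>R\<^esub> (\<Oplus>\<^bsub>R\<^esub>l\<in>{..<n}. X (k, l) \<otimes>\<^bsub>R\<^esub> v l))"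
    using i by (intro finsum_mult_assoc[OF R]) auto
  also have "\<dots> = mat_vec R n Y (mat_vec R n X v) i"
    using i by (simp add: mat_vec_def) (auto intro!: R.finsum_cong')
  finally show "mat_vec R n (Y \<otimes>\<^bsub>mat_monoid R n\<^esub> X) v i = mat_vec R n Y (mat_vec R n X v) i" .
qed

text \<open>Coordinate maps that agree on the carrier may still differ as functions outside it. The
  pairs are then different, but the identity is an isomorphism between them.\<close>

lemma based_cong_iso:
  assumes p: "(A, \<phi>) \<in> based_algs n R" and q: "(A, \<phi>') \<in> based_algs n R"
    and eq: "\<And>a. a \<in> carrier A \<Longrightarrow> \<phi> a = \<phi>' a"
  shows "((A, \<phi>), (A, \<phi>')) \<in> based_iso n R"
  using p q eq unfolding based_iso_def algebra_iso_def ring_iso_def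
  by (auto intro!: exI[of _ "\<lambda>a. a"] ring_hom_memI simp: bij_betw_def)

text \<open>On the carrier, the coordinate map given by the product is the one given by
  \<open>X\<close> followed by the one given by \<open>Y\<close>. Both sides are therefore structure
  constants of isomorphic based algebras.\<close>

lemma split_basis_change:
  assumes Y: "Y \<in> Units (mat_monoid R n)" and X: "X \<in> Units (mat_monoid R n)"
  shows "i < n \<Longrightarrow> j < n \<Longrightarrow> k < n \<Longrightarrow>
      split_mult n R (Y \<otimes>\<^bsub>mat_monoid R n\<^esub> X) i j k = basis_change_mult n R Y (split_mult n R X) i j k"
    "k < n \<Longrightarrow> split_unit n R (Y \<otimes>\<^bsub>mat_monoid R n\<^esub> X) k = basis_change_unit n R Y (split_unit n R X) k"
proof -
  note YX = MM.Units_m_closed[OF Y X]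
  note p = split_alg_based[OF YX] and q = split_alg_based[OF X]
  note r = based_mat_vec[OF R Y q(1)]
  have "((split_alg n R, mat_vec R n (Y \<otimes>\<^bsub>mat_monoid R n\<^esub> X)), (split_alg n R, \<lambda>v. mat_vec R n Y (mat_vec R n X v))) \<in> based_iso n R"
    using p(1) r by (rule based_cong_iso) (rule mat_vec_mult[OF Y X], simp add: split_alg_def std_alg_simps[OF R])
  from this[unfolded based_iso_iff[OF p(1) r]]
  have eq: "i < n \<Longrightarrow> j < n \<Longrightarrow> k < n \<Longrightarrow>
      split_mult n R (Y \<otimes>\<^bsub>mat_monoid R n\<^esub> X) i j k =
      basis_change_mult n R Y (str_mult n R (split_alg n R, \<lambda>v. mat_vec R n X v)) i j k"
    "k < n \<Longrightarrow> split_unit n R (Y \<otimes>\<^bsub>mat_monoid R n\<^esub> X) k =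
      basis_change_unit n R Y (str_unit n R (split_alg n R, \<lambda>v. mat_vec R n X v)) k" for i j k
    by (simp_all add: p(2,3) basis_change[OF R Y q(1)])
  note [simp] = mat_Units_entries[OF R Y] split_closed[OF R X]
  show "split_mult n R (Y \<otimes>\<^bsub>mat_monoid R n\<^esub> X) i j k = basis_change_mult n R Y (split_mult n R X) i j k"
    if ijk: "i < n" "j < n" "k < n"
    unfolding eq(1)[OF ijk] basis_change_mult_def
    using ijk by (intro R.finsum_cong'[OF refl] arg_cong2[of _ _ _ _ "(\<otimes>\<^bsub>R\<^esub>)"] refl)
      (auto simp: q intro!: R.finsum_closed R.m_closed)
  show "split_unit n R (Y \<otimes>\<^bsub>mat_monoid R n\<^esub> X) k = basis_change_unit n R Y (split_unit n R X) k" if k: "k < n"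
    unfolding eq(2)[OF k] basis_change_unit_def
    using k by (intro R.finsum_cong'[OF refl]) (auto simp: q)
qed

section \<open>The trace form and the polarized norm\<close>

section \<open>The trace form\<close>

text \<open>In the split algebra the trace is the sum of the projections, so the trace form has as
  matrix the transpose of \<open>N\<close> times \<open>N\<close>.\<close>

lemma split_trace:
  assumes M: "M \<in> Units (mat_monoid R n)" and ij: "i < n" "j < n"
  defines "N \<equiv> inv\<^bsub>mat_monoid R n\<^esub> M"
  shows "str_trace n R (split_mult n R M) (i, j) = (\<Oplus>\<^bsub>R\<^esub>l\<in>{..<n}. N (l, i) \<otimes>\<^bsub>R\<^esub> N (l, j))"
proof -
  note entries = mat_Units_entries[OF R M, folded N_def]
  note [simp] = entries split_closed[OF R M] ij
  have diag: "(\<Oplus>\<^bsub>R\<^esub>m\<in>{..<n}. split_mult n R M k m m) = (\<Oplus>\<^bsub>R\<^esub>l\<in>{..<n}. N (l, k))" if k: "k < n" for k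
  proof -
    have "(\<Oplus>\<^bsub>R\<^esub>m\<in>{..<n}. split_mult n R M k m m) = (\<Oplus>\<^bsub>R\<^esub>l\<in>{..<n}. \<Oplus>\<^bsub>R\<^esub>m\<in>{..<n}. M (m, l) \<otimes>\<^bsub>R\<^esub> (N (l, k) \<otimes>\<^bsub>R\<^esub> N (l, m)))"
      unfolding split_mult_def N_def[symmetric] using k by (intro finsum_swap[OF R]) auto
    also have "\<dots> = (\<Oplus>\<^bsub>R\<^esub>l\<in>{..<n}. N (l, k))"
    proof (rule R.finsum_cong'[OF refl])
      fix l assume "l \<in> {..<n}"
      then have l: "l < n" by simp
      have "(\<Oplus>\<^bsub>R\<^esub>m\<in>{..<n}. M (m, l) \<otimes>\<^bsub>R\<^esub> (N (l, k) \<otimes>\<^bsub>R\<^esub> N (l, m))) = (\<Oplus>\<^bsub>R\<^esub>m\<in>{..<n}. N (l, k) \<otimes>\<^bsub>R\<^esub> (N (l, m) \<otimes>\<^bsub>R\<^esub> M (m, l)))"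
        using k l by (intro R.finsum_cong') (auto simp: R.m_ac)
      also have "\<dots> = N (l, k) \<otimes>\<^bsub>R\<^esub> (\<Oplus>\<^bsub>R\<^esub>m\<in>{..<n}. N (l, m) \<otimes>\<^bsub>R\<^esub> M (m, l))"
        using k l by (intro R.finsum_rdistr[symmetric]) auto
      also have "(\<Oplus>\<^bsub>R\<^esub>m\<in>{..<n}. N (l, m) \<otimes>\<^bsub>R\<^esub> M (m, l)) = \<one>\<^bsub>R\<^esub>"
        using mat_inverse_entries(2)[OF R M l l] by (simp add: N_def)
      finally show "(\<Oplus>\<^bsub>R\<^esub>m\<in>{..<n}. M (m, l) \<otimes>\<^bsub>R\<^esub> (N (l, k) \<otimes>\<^bsub>R\<^esub> N (l, m))) = N (l, k)"
        using k l by simp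
    qed (use k in auto)
    finally show ?thesis .
  qed
  have "str_trace n R (split_mult n R M) (i, j) =
      (\<Oplus>\<^bsub>R\<^esub>k\<in>{..<n}. \<Oplus>\<^bsub>R\<^esub>m\<in>{..<n}. split_mult n R M i j k \<otimes>\<^bsub>R\<^esub> split_mult n R M k m m)"
    unfolding str_trace_def prod.case by (intro finsum_swap[OF R]) auto
  also have "\<dots> = (\<Oplus>\<^bsub>R\<^esub>k\<in>{..<n}. \<Oplus>\<^bsub>R\<^esub>l\<in>{..<n}. split_mult n R M i j k \<otimes>\<^bsub>R\<^esub> N (l, k))"
  proof (rule R.finsum_cong'[OF refl])
    fix k assume "k \<in> {..<n}"
    then have k: "k < n" by simp
    have "(\<Oplus>\<^bsub>R\<^esub>m\<in>{..<n}. split_mult n R M i j k \<otimes>\<^bsub>R\<^esub> split_mult n R M k m m) =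
        split_mult n R M i j k \<otimes>\<^bsub>R\<^esub> (\<Oplus>\<^bsub>R\<^esub>m\<in>{..<n}. split_mult n R M k m m)"
      using k by (intro R.finsum_rdistr[symmetric]) auto
    also have "\<dots> = (\<Oplus>\<^bsub>R\<^esub>l\<in>{..<n}. split_mult n R M i j k \<otimes>\<^bsub>R\<^esub> N (l, k))"
      unfolding diag[OF k] using k by (intro R.finsum_rdistr) auto
    finally show "(\<Oplus>\<^bsub>R\<^esub>m\<in>{..<n}. split_mult n R M i j k \<otimes>\<^bsub>R\<^esub> split_mult n R M k m m) =
      (\<Oplus>\<^bsub>R\<^esub>l\<in>{..<n}. split_mult n R M i j k \<otimes>\<^bsub>R\<^esub> N (l, k))" .
  qed auto
  also have "\<dots> = (\<Oplus>\<^bsub>R\<^esub>l\<in>{..<n}. \<Oplus>\<^bsub>R\<^esub>k\<in>{..<n}. split_mult n R M i j k \<otimes>\<^bsub>R\<^esub> N (l, k))"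
    by (intro finsum_swap[OF R]) auto
  also have "\<dots> = (\<Oplus>\<^bsub>R\<^esub>l\<in>{..<n}. N (l, i) \<otimes>\<^bsub>R\<^esub> N (l, j))"
    by (rule R.finsum_cong'[OF refl]) (auto simp: split_mult_inverse[OF R M, folded N_def])
  finally show ?thesis .
qed

text \<open>The trace form is the transpose of the inverse of \<open>M\<close> times this inverse,
  while \<open>split_gram\<close> is \<open>M\<close> times its transpose.\<close>

lemma split_gram_trace:
  assumes M: "M \<in> Units (mat_monoid R n)" and ij: "i < n" "j < n"
  shows "(\<Oplus>\<^bsub>R\<^esub>k\<in>{..<n}. split_gram n R M i k \<otimes>\<^bsub>R\<^esub> str_trace n R (split_mult n R M) (k, j)) =
    (if i = j then \<one>\<^bsub>R\<^esub> else \<zero>\<^bsub>R\<^esub>)"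
proof -
  let ?N = "inv\<^bsub>mat_monoid R n\<^esub> M"
  note [simp] = mat_Units_entries[OF R M] split_closed[OF R M] ij
  have "(\<Oplus>\<^bsub>R\<^esub>k\<in>{..<n}. split_gram n R M i k \<otimes>\<^bsub>R\<^esub> str_trace n R (split_mult n R M) (k, j)) =
      (\<Oplus>\<^bsub>R\<^esub>k\<in>{..<n}. split_gram n R M i k \<otimes>\<^bsub>R\<^esub> (\<Oplus>\<^bsub>R\<^esub>l\<in>{..<n}. ?N (l, k) \<otimes>\<^bsub>R\<^esub> ?N (l, j)))"
    by (rule R.finsum_cong'[OF refl]) (auto simp: split_trace[OF M] intro!: R.finsum_closed R.m_closed)
  also have "\<dots> = (\<Oplus>\<^bsub>R\<^esub>l\<in>{..<n}. (\<Oplus>\<^bsub>R\<^esub>k\<in>{..<n}. split_gram n R M i k \<otimes>\<^bsub>R\<^esub> ?N (l, k)) \<otimes>\<^bsub>R\<^esub> ?N (l, j))"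
    by (intro finsum_mult_assoc[OF R, symmetric]) auto
  also have "\<dots> = (\<Oplus>\<^bsub>R\<^esub>l\<in>{..<n}. M (i, l) \<otimes>\<^bsub>R\<^esub> ?N (l, j))"
    by (rule R.finsum_cong'[OF refl]) (auto simp: split_gram_inverse[OF R M])
  also have "\<dots> = (if i = j then \<one>\<^bsub>R\<^esub> else \<zero>\<^bsub>R\<^esub>)" by (rule mat_inverse_entries(1)[OF R M ij])
  finally show ?thesis .
qed

end

section \<open>Mixed discriminants over a commutative ring\<close>

context
  fixes R :: "'r ring" (structure) and n :: nat
  assumes R: "cring R"
begin

interpretation cring R by (rule R)

lemma finsum_permutes_antisym:
  assumes S: "finite S" "k \<in> S" "l \<in> S" "k \<noteq> l"
    and closed: "\<And>\<sigma>. \<sigma> permutes S \<Longrightarrow> g \<sigma> \<in> carrier R"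
    and g: "\<And>\<sigma>. \<sigma> permutes S \<Longrightarrow> g (\<sigma> \<circ> transpose k l) = g \<sigma>"
  shows "(\<Oplus>\<sigma>\<in>{\<sigma>. \<sigma> permutes S}. (if evenperm \<sigma> then \<one> else \<ominus> \<one>) \<otimes> g \<sigma>) = \<zero>"
proof -
  obtain h :: "'r int_mpoly \<Rightarrow> 'r" where "class_ring_hom R h" and h: "\<And>r. r \<in> carrier R \<Longrightarrow> h (mvar r) = r"
    by (rule ex_class_ring_hom[OF R]) blast
  then interpret h: class_ring_hom R h by simp
  have "(\<Oplus>\<sigma>\<in>{\<sigma>. \<sigma> permutes S}. (if evenperm \<sigma> then \<one> else \<ominus> \<one>) \<otimes> g \<sigma>) =
      h (\<Sum>\<sigma> | \<sigma> permutes S. of_int (sign \<sigma>) * mvar (g \<sigma>))"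
    unfolding h.hom_sum by (rule finsum_cong') (auto simp: h.hom_mult h.hom_sign h closed)
  also have "\<dots> = \<zero>"
    using g by (subst sum_permutes_antisym[OF S]) (auto simp: h.hom_zero)
  finally show ?thesis .
qed

lemma mat_mix_insert:
  assumes S: "finite S" "x \<notin> S"
    and a: "\<And>s i j. s \<in> insert x S \<Longrightarrow> i < n \<Longrightarrow> j < n \<Longrightarrow> a s (i, j) \<in> carrier R"
  shows "(\<Oplus>i\<in>{..<n}. a x (i, i)) \<otimes> mat_mix R S n a = mat_mix R (insert x S) n a \<oplus>
    (\<Oplus>s\<in>S. mat_mix R S n (a(s := \<lambda>(i, j). \<Oplus>k\<in>{..<n}. a s (i, k) \<otimes> a x (k, j))))"
proof -
  obtain h :: "'r int_mpoly \<Rightarrow> 'r" where "class_ring_hom R h" and h: "\<And>r. r \<in> carrier R \<Longrightarrow> h (mvar r) = r"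
    by (rule ex_class_ring_hom[OF R]) blast
  then interpret h: class_ring_hom R h by simp
  let ?a = "\<lambda>s ij. mvar (a s ij)"
  have mix: "mat_mix R S' n a = h (cmix S' n ?a)" if "S' \<subseteq> insert x S" for S'
    unfolding h.mat_mix_hom[symmetric] by (rule mat_mix_cong[OF R]) (use that a in \<open>auto simp: h\<close>)
  have upd: "mat_mix R S n (a(s := \<lambda>(i, j). \<Oplus>k\<in>{..<n}. a s (i, k) \<otimes> a x (k, j))) =
      h (cmix S n (?a(s := \<lambda>(i, j). \<Sum>k<n. ?a s (i, k) * ?a x (k, j))))" if s: "s \<in> S" for s
    unfolding h.mat_mix_hom[symmetric]
  proof (rule mat_mix_cong[OF R])
    fix t i j assume t: "t \<in> S" "i < n" "j < n"
    have "(\<Oplus>k\<in>{..<n}. a s (i, k) \<otimes> a x (k, j)) = h (\<Sum>k<n. ?a s (i, k) * ?a x (k, j))"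
      unfolding h.hom_sum by (rule finsum_cong') (use t s a in \<open>auto simp: h.hom_mult h\<close>)
    then show "(a(s := \<lambda>(i, j). \<Oplus>k\<in>{..<n}. a s (i, k) \<otimes> a x (k, j))) t (i, j) =
        h ((?a(s := \<lambda>(i, j). \<Sum>k<n. ?a s (i, k) * ?a x (k, j))) t (i, j))"
      using t a by (simp add: h)
  qed simp
  have tr: "(\<Oplus>i\<in>{..<n}. a x (i, i)) = h (\<Sum>i<n. ?a x (i, i))"
    unfolding h.hom_sum by (rule finsum_cong') (use a in \<open>auto simp: h\<close>)
  have sum: "(\<Oplus>s\<in>S. mat_mix R S n (a(s := \<lambda>(i, j). \<Oplus>k\<in>{..<n}. a s (i, k) \<otimes> a x (k, j)))) =
      h (\<Sum>s\<in>S. cmix S n (?a(s := \<lambda>(i, j). \<Sum>k<n. ?a s (i, k) * ?a x (k, j))))"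
    unfolding h.hom_sum by (rule finsum_cong') (auto simp: upd)
  show ?thesis
    unfolding mix[OF subset_insertI] mix[OF subset_refl] tr sum h.hom_add[symmetric] h.hom_mult[symmetric]
    by (simp add: cmix_insert[OF S])
qed

lemma mat_mix_eq_zero:
  assumes "finite S" "n < card S"
    and a: "\<And>s i j. s \<in> S \<Longrightarrow> i < n \<Longrightarrow> j < n \<Longrightarrow> a s (i, j) \<in> carrier R"
  shows "mat_mix R S n a = \<zero>"
proof -
  obtain h :: "'r int_mpoly \<Rightarrow> 'r" where "class_ring_hom R h" and h: "\<And>r. r \<in> carrier R \<Longrightarrow> h (mvar r) = r"
    by (rule ex_class_ring_hom[OF R]) blast
  then interpret h: class_ring_hom R h by simp
  have "mat_mix R S n a = mat_mix R S n (\<lambda>s ij. h (mvar (a s ij)))"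
    by (rule mat_mix_cong[OF R]) (use a in \<open>auto simp: h\<close>)
  then show ?thesis using assms(1,2) by (simp add: h.mat_mix_hom cmix_eq_zero h.hom_zero)
qed

lemma mat_mix_closed:
  assumes "\<And>s i j. s \<in> S \<Longrightarrow> i < n \<Longrightarrow> j < n \<Longrightarrow> a s (i, j) \<in> carrier R"
  shows "mat_mix R S n a \<in> carrier R"
  by (rule subring_mat_mix[OF R carrier_is_subring]) (use assms in auto)

lemma mat_mix_linear:
  assumes S: "finite S" "s \<in> S" and J: "finite J"
    and a: "\<And>s i j. s \<in> S \<Longrightarrow> i < n \<Longrightarrow> j < n \<Longrightarrow> a s (i, j) \<in> carrier R"
    and r: "\<And>j. j \<in> J \<Longrightarrow> r j \<in> carrier R"
    and y: "\<And>k i j. k \<in> J \<Longrightarrow> i < n \<Longrightarrow> j < n \<Longrightarrow> y k (i, j) \<in> carrier R"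
  shows "mat_mix R S n (a(s := \<lambda>ij. \<Oplus>k\<in>J. r k \<otimes> y k ij)) = (\<Oplus>k\<in>J. r k \<otimes> mat_mix R S n (a(s := y k)))"
proof -
  obtain h :: "'r int_mpoly \<Rightarrow> 'r" where "class_ring_hom R h" and h: "\<And>r. r \<in> carrier R \<Longrightarrow> h (mvar r) = r"
    by (rule ex_class_ring_hom[OF R]) blast
  then interpret h: class_ring_hom R h by simp
  let ?a = "\<lambda>s ij. mvar (a s ij)"
  have "mat_mix R S n (a(s := \<lambda>ij. \<Oplus>k\<in>J. r k \<otimes> y k ij)) =
      mat_mix R S n (\<lambda>t ij. h ((?a(s := \<lambda>ij. \<Sum>k\<in>J. mvar (r k) * mvar (y k ij))) t ij))"
  proof (rule mat_mix_cong[OF R])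
    fix t i j assume t: "t \<in> S" "i < n" "j < n"
    have "(\<Oplus>k\<in>J. r k \<otimes> y k (i, j)) = h (\<Sum>k\<in>J. mvar (r k) * mvar (y k (i, j)))"
      unfolding h.hom_sum by (rule finsum_cong') (use t r y in \<open>auto simp: h.hom_mult h\<close>)
    then show "(a(s := \<lambda>ij. \<Oplus>k\<in>J. r k \<otimes> y k ij)) t (i, j) =
        h ((?a(s := \<lambda>ij. \<Sum>k\<in>J. mvar (r k) * mvar (y k ij))) t (i, j))"
      using t a by (simp add: h)
  qed simp
  also have "\<dots> = h (\<Sum>k\<in>J. mvar (r k) * cmix S n (?a(s := \<lambda>ij. mvar (y k ij))))"
    unfolding h.mat_mix_hom by (subst cmix_linear[OF S]) simp
  also have "\<dots> = (\<Oplus>k\<in>J. r k \<otimes> mat_mix R S n (a(s := y k)))"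
    unfolding h.hom_sum
  proof (rule finsum_cong'[OF refl])
    have c: "mat_mix R S n (a(s := y k)) \<in> carrier R" if "k \<in> J" for k
      by (rule mat_mix_closed) (use that a y in auto)
    then show "(\<lambda>k. r k \<otimes> mat_mix R S n (a(s := y k))) \<in> J \<rightarrow> carrier R" using r by auto
    fix k assume k: "k \<in> J"
    have "h (cmix S n (?a(s := \<lambda>ij. mvar (y k ij)))) = mat_mix R S n (a(s := y k))"
      unfolding h.mat_mix_hom[symmetric]
      by (rule mat_mix_cong[OF R]) (use k a y in \<open>auto simp: h\<close>)
    then show "h (mvar (r k) * cmix S n (?a(s := \<lambda>ij. mvar (y k ij)))) = r k \<otimes> mat_mix R S n (a(s := y k))"
      using k r by (simp add: h.hom_mult h)
  qed
  finally show ?thesis .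
qed

end

lemma mat_mix_empty:
  assumes "cring R" shows "mat_mix R {} n a = \<one>\<^bsub>R\<^esub>"
proof -
  interpret cring R by fact
  show ?thesis by (simp add: mat_mix_def)
qed

section \<open>The polarized norm form of a based algebra\<close>

text \<open>The mixed discriminant of the operators of multiplication by the f s. For
  \<open>S = {..<n}\<close> it is the full polarization of the norm, normalized without
  denominators: if all f s equal a, its value is n! times the norm of a.\<close>

definition alg_mix :: "nat \<Rightarrow> 'r ring \<Rightarrow> 'r based_alg \<Rightarrow> nat set \<Rightarrow> (nat \<Rightarrow> nat \<Rightarrow> 'r) \<Rightarrow> 'r" where
  "alg_mix n R p S f = mat_mix R S n (\<lambda>s (i, j). snd p (f s \<otimes>\<^bsub>fst p\<^esub> basis_elt n R p j) i)"

context
  fixes R :: "'r ring" and A :: "('r, nat \<Rightarrow> 'r) module" and \<phi> :: "(nat \<Rightarrow> 'r) \<Rightarrow> (nat \<Rightarrow> 'r)" and n :: nat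
  assumes based: "(A, \<phi>) \<in> based_algs n R"
begin

interpretation R: cring R by (rule based_R_cring[OF based])
interpretation A: cring A by (rule based_A_cring[OF based])
interpretation alg: algebra R A by (rule based_algebra[OF based])

private abbreviation (input) bas where "bas \<equiv> basis_elt n R (A, \<phi>)"
private abbreviation (input) D where "D \<equiv> alg_mix n R (A, \<phi>)"
private abbreviation (input) Tr where "Tr \<equiv> alg_trace n R (A, \<phi>)"

lemmas [simp] = coord_closed[OF based] basis_closed[OF based]

lemma alg_trace_closed [simp]: "a \<in> carrier A \<Longrightarrow> Tr a \<in> carrier R"
  by (auto simp: alg_trace_def intro!: R.finsum_closed)

lemma alg_mix_closed:
  assumes "\<And>s. s \<in> S \<Longrightarrow> f s \<in> carrier A"
  shows "D S f \<in> carrier R"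
  unfolding alg_mix_def by (rule mat_mix_closed[OF R.is_cring]) (use assms in auto)

lemma alg_mix_cong:
  assumes "\<And>s. s \<in> S \<Longrightarrow> f s = g s" "\<And>s. s \<in> S \<Longrightarrow> g s \<in> carrier A"
  shows "D S f = D S g"
  unfolding alg_mix_def by (rule mat_mix_cong[OF R.is_cring]) (use assms in auto)

lemma mult_matrix:
  assumes a: "a \<in> carrier A" "a' \<in> carrier A" and i: "i < n"
  shows "\<phi> (a \<otimes>\<^bsub>A\<^esub> a' \<otimes>\<^bsub>A\<^esub> bas j) i = (\<Oplus>\<^bsub>R\<^esub>k\<in>{..<n}. \<phi> (a \<otimes>\<^bsub>A\<^esub> bas k) i \<otimes>\<^bsub>R\<^esub> \<phi> (a' \<otimes>\<^bsub>A\<^esub> bas j) k)"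
proof -
  have ab: "a' \<otimes>\<^bsub>A\<^esub> bas j \<in> carrier A" using a by simp
  have "a \<otimes>\<^bsub>A\<^esub> a' \<otimes>\<^bsub>A\<^esub> bas j = (a' \<otimes>\<^bsub>A\<^esub> bas j) \<otimes>\<^bsub>A\<^esub> a" using a by (simp add: A.m_ac)
  also have "\<dots> = (\<Oplus>\<^bsub>A\<^esub>k\<in>{..<n}. \<phi> (a' \<otimes>\<^bsub>A\<^esub> bas j) k \<odot>\<^bsub>A\<^esub> (bas k \<otimes>\<^bsub>A\<^esub> a))"
    by (rule trans[OF arg_cong[of _ _ "\<lambda>x. x \<otimes>\<^bsub>A\<^esub> a", OF basis_expansion[OF based ab]] lincomb_mult[OF based]])
      (use a in auto)
  finally have "\<phi> (a \<otimes>\<^bsub>A\<^esub> a' \<otimes>\<^bsub>A\<^esub> bas j) i =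
      (\<Oplus>\<^bsub>R\<^esub>k\<in>{..<n}. \<phi> (a' \<otimes>\<^bsub>A\<^esub> bas j) k \<otimes>\<^bsub>R\<^esub> \<phi> (bas k \<otimes>\<^bsub>A\<^esub> a) i)"
    using a i coord_lincomb[OF based, of "{..<n}" "\<phi> (a' \<otimes>\<^bsub>A\<^esub> bas j)" "\<lambda>k. bas k \<otimes>\<^bsub>A\<^esub> a" i] by simp
  also have "\<dots> = (\<Oplus>\<^bsub>R\<^esub>k\<in>{..<n}. \<phi> (a \<otimes>\<^bsub>A\<^esub> bas k) i \<otimes>\<^bsub>R\<^esub> \<phi> (a' \<otimes>\<^bsub>A\<^esub> bas j) k)"
    using a i by (intro R.finsum_cong') (auto simp: A.m_comm[of a] R.m_comm)
  finally show ?thesis .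
qed

lemma alg_mix_insert:
  assumes S: "finite S" "x \<notin> S" and f: "\<And>s. s \<in> insert x S \<Longrightarrow> f s \<in> carrier A"
  shows "Tr (f x) \<otimes>\<^bsub>R\<^esub> D S f = D (insert x S) f \<oplus>\<^bsub>R\<^esub> (\<Oplus>\<^bsub>R\<^esub>s\<in>S. D S (f(s := f s \<otimes>\<^bsub>A\<^esub> f x)))"
proof -
  let ?a = "\<lambda>s (i, j). \<phi> (f s \<otimes>\<^bsub>A\<^esub> bas j) i"
  have upd: "mat_mix R S n (?a(s := \<lambda>(i, j). \<Oplus>\<^bsub>R\<^esub>k\<in>{..<n}. ?a s (i, k) \<otimes>\<^bsub>R\<^esub> ?a x (k, j))) =
      D S (f(s := f s \<otimes>\<^bsub>A\<^esub> f x))" if "s \<in> S" for s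
    unfolding alg_mix_def
    by (rule mat_mix_cong[OF R.is_cring]) (use that f in \<open>auto simp: mult_matrix\<close>)
  have "Tr (f x) = (\<Oplus>\<^bsub>R\<^esub>i\<in>{..<n}. ?a x (i, i))" by (simp add: alg_trace_def)
  then have "Tr (f x) \<otimes>\<^bsub>R\<^esub> D S f = D (insert x S) f \<oplus>\<^bsub>R\<^esub>
      (\<Oplus>\<^bsub>R\<^esub>s\<in>S. mat_mix R S n (?a(s := \<lambda>(i, j). \<Oplus>\<^bsub>R\<^esub>k\<in>{..<n}. ?a s (i, k) \<otimes>\<^bsub>R\<^esub> ?a x (k, j))))"
    using mat_mix_insert[OF R.is_cring S, of n ?a] f by (simp add: alg_mix_def)
  also have "(\<Oplus>\<^bsub>R\<^esub>s\<in>S. mat_mix R S n (?a(s := \<lambda>(i, j). \<Oplus>\<^bsub>R\<^esub>k\<in>{..<n}. ?a s (i, k) \<otimes>\<^bsub>R\<^esub> ?a x (k, j)))) =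
      (\<Oplus>\<^bsub>R\<^esub>s\<in>S. D S (f(s := f s \<otimes>\<^bsub>A\<^esub> f x)))"
    by (rule R.finsum_cong'[OF refl _ upd]) (use f in \<open>auto intro!: alg_mix_closed\<close>)
  finally show ?thesis .
qed

lemma alg_mix_eq_zero:
  assumes "finite S" "n < card S" "\<And>s. s \<in> S \<Longrightarrow> f s \<in> carrier A"
  shows "D S f = \<zero>\<^bsub>R\<^esub>"
  unfolding alg_mix_def by (rule mat_mix_eq_zero[OF R.is_cring]) (use assms in auto)

text \<open>The recursion is applied with a as an additional argument. The form in n + 1 arguments
  vanishes, so the trace term equals the sum of the terms in which a has been multiplied into one of
  the arguments.\<close>

lemma alg_mix_trace:
  assumes f: "\<And>s. s < n \<Longrightarrow> f s \<in> carrier A" and a: "a \<in> carrier A"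
  shows "(\<Oplus>\<^bsub>R\<^esub>s\<in>{..<n}. D {..<n} (f(s := f s \<otimes>\<^bsub>A\<^esub> a))) = Tr a \<otimes>\<^bsub>R\<^esub> D {..<n} f"
proof -
  \<comment> \<open>The additional argument sits at the index n, the first one outside
    \<open>{..<n}\<close>.\<close>
  define g where "g = f(n := a)"
  have g: "g s \<in> carrier A" if "s \<in> insert n {..<n}" for s using that f a by (auto simp: g_def)
  have "D (insert n {..<n}) g = \<zero>\<^bsub>R\<^esub>" using g by (intro alg_mix_eq_zero) auto
  moreover have "D {..<n} g = D {..<n} f" by (rule alg_mix_cong) (use f in \<open>auto simp: g_def\<close>)
  moreover have "D {..<n} (g(s := g s \<otimes>\<^bsub>A\<^esub> g n)) = D {..<n} (f(s := f s \<otimes>\<^bsub>A\<^esub> a))" if "s < n" for s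
    by (rule alg_mix_cong) (use that f a in \<open>auto simp: g_def\<close>)
  then have "(\<Oplus>\<^bsub>R\<^esub>s\<in>{..<n}. D {..<n} (g(s := g s \<otimes>\<^bsub>A\<^esub> g n))) = (\<Oplus>\<^bsub>R\<^esub>s\<in>{..<n}. D {..<n} (f(s := f s \<otimes>\<^bsub>A\<^esub> a)))"
    using f a by (intro R.finsum_cong') (auto intro!: alg_mix_closed)
  moreover have "(\<Oplus>\<^bsub>R\<^esub>s\<in>{..<n}. D {..<n} (f(s := f s \<otimes>\<^bsub>A\<^esub> a))) \<in> carrier R"
    using f a by (auto intro!: R.finsum_closed alg_mix_closed)
  ultimately show ?thesis
    using alg_mix_insert[of "{..<n}" n g] g by (simp add: g_def)
qed

lemma alg_mix_linear:
  assumes s: "s < n" and J: "finite J" and f: "\<And>s. s < n \<Longrightarrow> f s \<in> carrier A"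
    and r: "\<And>k. k \<in> J \<Longrightarrow> r k \<in> carrier R" and x: "\<And>k. k \<in> J \<Longrightarrow> x k \<in> carrier A"
  shows "D {..<n} (f(s := \<Oplus>\<^bsub>A\<^esub>k\<in>J. r k \<odot>\<^bsub>A\<^esub> x k)) = (\<Oplus>\<^bsub>R\<^esub>k\<in>J. r k \<otimes>\<^bsub>R\<^esub> D {..<n} (f(s := x k)))"
proof -
  let ?a = "\<lambda>s (i, j). \<phi> (f s \<otimes>\<^bsub>A\<^esub> bas j) i"
  let ?y = "\<lambda>k (i, j). \<phi> (x k \<otimes>\<^bsub>A\<^esub> bas j) i"
  have "D {..<n} (f(s := \<Oplus>\<^bsub>A\<^esub>k\<in>J. r k \<odot>\<^bsub>A\<^esub> x k)) =
      mat_mix R {..<n} n (?a(s := \<lambda>ij. \<Oplus>\<^bsub>R\<^esub>k\<in>J. r k \<otimes>\<^bsub>R\<^esub> ?y k ij))"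
    unfolding alg_mix_def
  proof (rule mat_mix_cong[OF R.is_cring])
    fix t i j assume t: "t \<in> {..<n}" "i < n" "j < n"
    have "\<phi> ((\<Oplus>\<^bsub>A\<^esub>k\<in>J. r k \<odot>\<^bsub>A\<^esub> x k) \<otimes>\<^bsub>A\<^esub> bas j) i = \<phi> (\<Oplus>\<^bsub>A\<^esub>k\<in>J. r k \<odot>\<^bsub>A\<^esub> (x k \<otimes>\<^bsub>A\<^esub> bas j)) i"
      using J r x by (subst lincomb_mult[OF based]) auto
    also have "\<dots> = (\<Oplus>\<^bsub>R\<^esub>k\<in>J. r k \<otimes>\<^bsub>R\<^esub> ?y k (i, j))"
      using r x t coord_lincomb[OF based, of J r "\<lambda>k. x k \<otimes>\<^bsub>A\<^esub> bas j" i] by simp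
    finally show "(case (i, j) of (i, j) \<Rightarrow> snd (A, \<phi>) ((f(s := \<Oplus>\<^bsub>A\<^esub>k\<in>J. r k \<odot>\<^bsub>A\<^esub> x k)) t \<otimes>\<^bsub>fst (A, \<phi>)\<^esub> bas j) i) =
        (?a(s := \<lambda>ij. \<Oplus>\<^bsub>R\<^esub>k\<in>J. r k \<otimes>\<^bsub>R\<^esub> ?y k ij)) t (i, j)"
      by simp
    show "(?a(s := \<lambda>ij. \<Oplus>\<^bsub>R\<^esub>k\<in>J. r k \<otimes>\<^bsub>R\<^esub> ?y k ij)) t (i, j) \<in> carrier R"
      using t f r x by (auto intro!: R.finsum_closed)
  qed
  also have "\<dots> = (\<Oplus>\<^bsub>R\<^esub>k\<in>J. r k \<otimes>\<^bsub>R\<^esub> mat_mix R {..<n} n (?a(s := ?y k)))"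
    by (rule mat_mix_linear[OF R.is_cring]) (use s J f r x in auto)
  also have "\<dots> = (\<Oplus>\<^bsub>R\<^esub>k\<in>J. r k \<otimes>\<^bsub>R\<^esub> D {..<n} (f(s := x k)))"
  proof (rule R.finsum_cong'[OF refl])
    show "(\<lambda>k. r k \<otimes>\<^bsub>R\<^esub> D {..<n} (f(s := x k))) \<in> J \<rightarrow> carrier R"
      using r x f by (auto intro!: R.m_closed alg_mix_closed)
    fix k assume k: "k \<in> J"
    have "mat_mix R {..<n} n (?a(s := ?y k)) = D {..<n} (f(s := x k))"
      unfolding alg_mix_def by (rule mat_mix_cong[OF R.is_cring]) (use k f x in auto)
    then show "r k \<otimes>\<^bsub>R\<^esub> mat_mix R {..<n} n (?a(s := ?y k)) = r k \<otimes>\<^bsub>R\<^esub> D {..<n} (f(s := x k))" by simp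
  qed
  finally show ?thesis .
qed

lemma alg_mix_add:
  assumes "s < n" "\<And>s. s < n \<Longrightarrow> f s \<in> carrier A" "x \<in> carrier A" "y \<in> carrier A"
  shows "D {..<n} (f(s := x \<oplus>\<^bsub>A\<^esub> y)) = D {..<n} (f(s := x)) \<oplus>\<^bsub>R\<^esub> D {..<n} (f(s := y))"
proof -
  have "D {..<n} (f(s := x)) \<in> carrier R" "D {..<n} (f(s := y)) \<in> carrier R"
    using assms by (auto intro!: alg_mix_closed)
  then show ?thesis
    using alg_mix_linear[of s "{0, 1::nat}" f "\<lambda>_. \<one>\<^bsub>R\<^esub>" "\<lambda>k. if k = 0 then x else y"] assms by simp
qed

lemma alg_mix_smult:
  assumes "s < n" "\<And>s. s < n \<Longrightarrow> f s \<in> carrier A" "x \<in> carrier A" "r \<in> carrier R"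
  shows "D {..<n} (f(s := r \<odot>\<^bsub>A\<^esub> x)) = r \<otimes>\<^bsub>R\<^esub> D {..<n} (f(s := x))"
proof -
  have "D {..<n} (f(s := x)) \<in> carrier R" using assms by (auto intro!: alg_mix_closed)
  then show ?thesis
    using alg_mix_linear[of s "{0::nat}" f "\<lambda>_. r" "\<lambda>_. x"] assms by simp
qed

text \<open>
  Expanding one argument after another by the recursion, every term in which two arguments are
  multiplied is invariant under a transposition of \<open>\<tau>\<close> and hence cancels.
\<close>

lemma alg_mix_disc:
  "(\<Oplus>\<^bsub>R\<^esub>\<tau>\<in>{\<tau>. \<tau> permutes {..<n}}. (if evenperm \<tau> then \<one>\<^bsub>R\<^esub> else \<ominus>\<^bsub>R\<^esub> \<one>\<^bsub>R\<^esub>) \<otimes>\<^bsub>R\<^esub>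
      D {..<n} (\<lambda>l. bas l \<otimes>\<^bsub>A\<^esub> bas (\<tau> l))) = disc n R (A, \<phi>)"
proof -
  let ?S = "{\<tau>. \<tau> permutes {..<n}}"
  define sgn where "sgn \<tau> = (if evenperm \<tau> then \<one>\<^bsub>R\<^esub> else \<ominus>\<^bsub>R\<^esub> \<one>\<^bsub>R\<^esub>)" for \<tau> :: "nat \<Rightarrow> nat"
  define g where "g \<tau> l = bas l \<otimes>\<^bsub>A\<^esub> bas (\<tau> l)" for \<tau> l
  define pre where "pre k \<tau> = (\<Otimes>\<^bsub>R\<^esub>l\<in>{..<k}. Tr (g \<tau> l))" for k \<tau>
  \<comment> \<open>In \<open>W k\<close> the arguments below k have been split off as traces, and
    \<open>V k s\<close> is the correction in which argument k has been multiplied into argument s.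
    At k = 0 stands the value of the form in the claim, at k = n the product of traces from the
    Leibniz formula for the discriminant.\<close>
  define W where "W k \<tau> = pre k \<tau> \<otimes>\<^bsub>R\<^esub> D {k..<n} (g \<tau>)" for k \<tau>
  define V where "V k s \<tau> = pre k \<tau> \<otimes>\<^bsub>R\<^esub> D {Suc k..<n} ((g \<tau>)(s := g \<tau> s \<otimes>\<^bsub>A\<^esub> g \<tau> k))" for k s \<tau>
  have sgn[simp]: "sgn \<tau> \<in> carrier R" for \<tau> by (simp add: sgn_def)
  have g[simp]: "g \<tau> l \<in> carrier A" for \<tau> l by (simp add: g_def)
  have pre[simp]: "pre k \<tau> \<in> carrier R" for k \<tau> by (auto simp: pre_def intro!: R.finprod_closed)
  have D[simp]: "D T (g \<tau>) \<in> carrier R" "D T ((g \<tau>)(s := g \<tau> s \<otimes>\<^bsub>A\<^esub> g \<tau> k)) \<in> carrier R" for T \<tau> s k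
    by (auto intro!: alg_mix_closed)
  have WV[simp]: "W k \<tau> \<in> carrier R" "V k s \<tau> \<in> carrier R" for k s \<tau>
    by (simp_all add: W_def V_def)
  have fin: "finite ?S" by (simp add: finite_permutations)
  have step: "W (Suc k) \<tau> = W k \<tau> \<oplus>\<^bsub>R\<^esub> (\<Oplus>\<^bsub>R\<^esub>s\<in>{Suc k..<n}. V k s \<tau>)" if k: "k < n" for k \<tau>
  proof -
    have ins: "insert k {Suc k..<n} = {k..<n}" using k by auto
    have "pre (Suc k) \<tau> = pre k \<tau> \<otimes>\<^bsub>R\<^esub> Tr (g \<tau> k)"
      unfolding pre_def lessThan_Suc by (subst R.finprod_insert) (auto simp: R.m_comm intro!: R.finprod_closed)
    then have "W (Suc k) \<tau> = pre k \<tau> \<otimes>\<^bsub>R\<^esub> (Tr (g \<tau> k) \<otimes>\<^bsub>R\<^esub> D {Suc k..<n} (g \<tau>))"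
      by (simp add: W_def R.m_assoc)
    also have "\<dots> = pre k \<tau> \<otimes>\<^bsub>R\<^esub> (D {k..<n} (g \<tau>) \<oplus>\<^bsub>R\<^esub>
        (\<Oplus>\<^bsub>R\<^esub>s\<in>{Suc k..<n}. D {Suc k..<n} ((g \<tau>)(s := g \<tau> s \<otimes>\<^bsub>A\<^esub> g \<tau> k))))"
      using alg_mix_insert[of "{Suc k..<n}" k "g \<tau>"] by (simp add: ins)
    also have "\<dots> = W k \<tau> \<oplus>\<^bsub>R\<^esub> (\<Oplus>\<^bsub>R\<^esub>s\<in>{Suc k..<n}. V k s \<tau>)"
      by (simp add: W_def V_def R.r_distr R.finsum_rdistr Pi_def)
    finally show ?thesis .
  qed
  \<comment> \<open>The product of the arguments k and s contains the basis elements with indices k,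
    s, \<open>\<tau> k\<close> and \<open>\<tau> s\<close>, so exchanging \<open>\<tau> k\<close>
    and \<open>\<tau> s\<close> does not affect it. The traces split off earlier belong to indices
    below k, hence to neither of the two.\<close>
  have cancel: "(\<Oplus>\<^bsub>R\<^esub>\<tau>\<in>?S. sgn \<tau> \<otimes>\<^bsub>R\<^esub> V k s \<tau>) = \<zero>\<^bsub>R\<^esub>" if k: "k < n" and s: "s \<in> {Suc k..<n}" for k s
    unfolding sgn_def
  proof (rule finsum_permutes_antisym[OF R.is_cring, of _ k s])
    fix \<tau> assume "\<tau> permutes {..<n}"
    let ?t = "\<tau> \<circ> transpose k s"
    have same: "g ?t l = g \<tau> l" if "l \<noteq> k" "l \<noteq> s" for l
      using that by (simp add: g_def transpose_apply_other)
    have "pre k ?t = pre k \<tau>"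
      unfolding pre_def using s by (intro R.finprod_cong') (auto simp: same)
    moreover have "D {Suc k..<n} ((g ?t)(s := g ?t s \<otimes>\<^bsub>A\<^esub> g ?t k)) = D {Suc k..<n} ((g \<tau>)(s := g \<tau> s \<otimes>\<^bsub>A\<^esub> g \<tau> k))"
    proof (rule alg_mix_cong)
      have "g ?t s \<otimes>\<^bsub>A\<^esub> g ?t k = g \<tau> s \<otimes>\<^bsub>A\<^esub> g \<tau> k"
        by (simp add: g_def A.m_ac)
      then show "((g ?t)(s := g ?t s \<otimes>\<^bsub>A\<^esub> g ?t k)) l = ((g \<tau>)(s := g \<tau> s \<otimes>\<^bsub>A\<^esub> g \<tau> k)) l"
        if "l \<in> {Suc k..<n}" for l using that by (auto simp: same)
    qed simp
    ultimately show "V k s ?t = V k s \<tau>" by (simp only: V_def)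
  qed (use k s in auto)
  have "(\<Oplus>\<^bsub>R\<^esub>\<tau>\<in>?S. sgn \<tau> \<otimes>\<^bsub>R\<^esub> W k \<tau>) = (\<Oplus>\<^bsub>R\<^esub>\<tau>\<in>?S. sgn \<tau> \<otimes>\<^bsub>R\<^esub> W 0 \<tau>)" if "k \<le> n" for k
    using that
  proof (induction k)
    case (Suc k)
    then have k: "k < n" by simp
    have "(\<Oplus>\<^bsub>R\<^esub>\<tau>\<in>?S. sgn \<tau> \<otimes>\<^bsub>R\<^esub> W (Suc k) \<tau>) =
        (\<Oplus>\<^bsub>R\<^esub>\<tau>\<in>?S. sgn \<tau> \<otimes>\<^bsub>R\<^esub> W k \<tau> \<oplus>\<^bsub>R\<^esub> (\<Oplus>\<^bsub>R\<^esub>s\<in>{Suc k..<n}. sgn \<tau> \<otimes>\<^bsub>R\<^esub> V k s \<tau>))"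
      by (rule R.finsum_cong'[OF refl]) (auto simp: step[OF k] R.r_distr R.finsum_rdistr Pi_def intro!: R.finsum_closed)
    also have "\<dots> = (\<Oplus>\<^bsub>R\<^esub>\<tau>\<in>?S. sgn \<tau> \<otimes>\<^bsub>R\<^esub> W k \<tau>) \<oplus>\<^bsub>R\<^esub> (\<Oplus>\<^bsub>R\<^esub>\<tau>\<in>?S. \<Oplus>\<^bsub>R\<^esub>s\<in>{Suc k..<n}. sgn \<tau> \<otimes>\<^bsub>R\<^esub> V k s \<tau>)"
      by (rule R.finsum_addf) auto
    also have "(\<Oplus>\<^bsub>R\<^esub>\<tau>\<in>?S. \<Oplus>\<^bsub>R\<^esub>s\<in>{Suc k..<n}. sgn \<tau> \<otimes>\<^bsub>R\<^esub> V k s \<tau>) =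
        (\<Oplus>\<^bsub>R\<^esub>s\<in>{Suc k..<n}. \<Oplus>\<^bsub>R\<^esub>\<tau>\<in>?S. sgn \<tau> \<otimes>\<^bsub>R\<^esub> V k s \<tau>)"
      by (rule finsum_swap[OF R.is_cring]) auto
    also have "\<dots> = \<zero>\<^bsub>R\<^esub>"
      by (rule R.add.finprod_one_eqI) (rule cancel[OF k])
    finally show ?case using Suc.IH k by (simp add: Pi_def)
  qed simp
  from this[of n] have "(\<Oplus>\<^bsub>R\<^esub>\<tau>\<in>?S. sgn \<tau> \<otimes>\<^bsub>R\<^esub> W 0 \<tau>) = (\<Oplus>\<^bsub>R\<^esub>\<tau>\<in>?S. sgn \<tau> \<otimes>\<^bsub>R\<^esub> W n \<tau>)" by simp
  moreover have "W n \<tau> = (\<Otimes>\<^bsub>R\<^esub>l\<in>{..<n}. Tr (bas l \<otimes>\<^bsub>A\<^esub> bas (\<tau> l)))" for \<tau>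
    by (simp add: W_def alg_mix_def mat_mix_empty[OF R.is_cring]) (simp add: pre_def g_def)
  moreover have "W 0 \<tau> = D {..<n} (\<lambda>l. bas l \<otimes>\<^bsub>A\<^esub> bas (\<tau> l))" for \<tau>
    using D(1)[of "{..<n}" \<tau>] by (simp add: W_def pre_def atLeast0LessThan g_def[abs_def])
  moreover have "disc n R (A, \<phi>) = mat_det R n (\<lambda>(i, j). Tr (bas i \<otimes>\<^bsub>A\<^esub> bas j))"
    unfolding disc_def by (rule mat_det_cong[OF R.is_cring]) auto
  ultimately show ?thesis by (simp add: sgn_def mat_det_def)
qed

end

section \<open>An extension over which an algebra with invertible discriminant splits\<close>

section \<open>A ring over which an etale algebra splits\<close>

text \<open>
  The variable \<open>Inl r\<close> stands for the scalar \<open>r\<close> and \<open>Inr (l, a)\<close> for \<open>a\<close> in the \<open>l\<close>-th factor of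
  the \<open>n\<close>-fold tensor power of \<open>A\<close>.  The functional \<open>split_form\<close> is the polarized norm, and the
  splitting ring is the quotient of the tensor power by the radical of this functional.
\<close>

type_synonym 'r split_var = "'r + nat \<times> (nat \<Rightarrow> 'r)"

definition split_scalar :: "'r ring \<Rightarrow> 'r split_var \<Rightarrow> 'r" where
  "split_scalar R v = (case v of Inl r \<Rightarrow> if r \<in> carrier R then r else \<zero>\<^bsub>R\<^esub> | Inr _ \<Rightarrow> \<one>\<^bsub>R\<^esub>)"

text \<open>Scalars, variables of other factors and elements outside the carrier contribute the
  unit, so that a monomial determines one element of \<open>A\<close> in each of the n
  factors.\<close>

definition split_factor :: "('r, nat \<Rightarrow> 'r) module \<Rightarrow> nat \<Rightarrow> 'r split_var \<Rightarrow> (nat \<Rightarrow> 'r)" where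
  "split_factor A l v = (case v of Inl _ \<Rightarrow> \<one>\<^bsub>A\<^esub> | Inr (l', a) \<Rightarrow> if l' = l \<and> a \<in> carrier A then a else \<one>\<^bsub>A\<^esub>)"

definition split_weight :: "nat \<Rightarrow> 'r ring \<Rightarrow> 'r based_alg \<Rightarrow> ('r split_var \<Rightarrow>\<^sub>0 nat) \<Rightarrow> 'r" where
  "split_weight n R p m = mono_eval R (split_scalar R) m \<otimes>\<^bsub>R\<^esub>
     alg_mix n R p {..<n} (\<lambda>l. mono_eval (fst p) (split_factor (fst p) l) m)"

definition split_form :: "nat \<Rightarrow> 'r ring \<Rightarrow> 'r based_alg \<Rightarrow> 'r split_var int_mpoly \<Rightarrow> 'r" where
  "split_form n R p = lin_ext R (split_weight n R p)"

text \<open>The polynomial ring takes the place of the tensor power: since the form is linear in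
  each argument, the defining relations of the tensor power lie in the radical, and no tensor
  product has to be formed. The radical is the largest ideal on which the functional vanishes, so it
  also contains the trace relations, while the functional still detects the scalars.\<close>

definition split_radical :: "nat \<Rightarrow> 'r ring \<Rightarrow> 'r based_alg \<Rightarrow> 'r split_var int_mpoly set" where
  "split_radical n R p = {x. \<forall>y. split_form n R p (x * y) = \<zero>\<^bsub>R\<^esub>}"

definition split_ring :: "nat \<Rightarrow> 'r ring \<Rightarrow> 'r based_alg \<Rightarrow> 'r split_var int_mpoly set ring" where
  "split_ring n R p = zpoly UNIV Quot split_radical n R p"

definition split_cls :: "nat \<Rightarrow> 'r ring \<Rightarrow> 'r based_alg \<Rightarrow> 'r split_var int_mpoly \<Rightarrow> 'r split_var int_mpoly set" where
  "split_cls n R p x = split_radical n R p +>\<^bsub>zpoly UNIV\<^esub> x"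

lemma carrier_zpoly_UNIV [simp]: "x \<in> carrier (zpoly UNIV)"
  by (simp add: carrier_zpoly)

context
  fixes R :: "'r ring" and A :: "('r, nat \<Rightarrow> 'r) module" and \<phi> :: "(nat \<Rightarrow> 'r) \<Rightarrow> (nat \<Rightarrow> 'r)" and n :: nat
  assumes based: "(A, \<phi>) \<in> based_algs n R"
begin

private lemma A: "cring A"
  by (rule based_A_cring[OF based])

interpretation R: cring R by (rule based_R_cring[OF based])
interpretation A: cring A by (rule A)
interpretation alg: algebra R A by (rule based_algebra[OF based])

private abbreviation (input) L where "L \<equiv> split_form n R (A, \<phi>)"
private abbreviation (input) w where "w \<equiv> split_weight n R (A, \<phi>)"
private abbreviation (input) J where "J \<equiv> split_radical n R (A, \<phi>)"
private abbreviation (input) R' where "R' \<equiv> split_ring n R (A, \<phi>)"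
private abbreviation (input) cls where "cls \<equiv> split_cls n R (A, \<phi>)"
private abbreviation (input) Dmix where "Dmix \<equiv> alg_mix n R (A, \<phi>)"

private lemma scalar_closed [simp]: "split_scalar R v \<in> carrier R"
  by (auto simp: split_scalar_def split: sum.split)

private lemma factor_closed [simp]: "split_factor A l v \<in> carrier A"
  by (auto simp: split_factor_def split: sum.split)

private lemma eval_closed [simp]:
  "mono_eval R (split_scalar R) m \<in> carrier R" "mono_eval A (split_factor A l) m \<in> carrier A"
  by (simp_all add: mono_eval_closed[OF R.is_cring] mono_eval_closed[OF A])

private lemma mix_closed [simp]: "Dmix {..<n} (\<lambda>l. mono_eval A (split_factor A l) m) \<in> carrier R"
  by (rule alg_mix_closed[OF based]) simp

private lemma mix_upd_closed [simp]:
  "a \<in> carrier A \<Longrightarrow> Dmix {..<n} ((\<lambda>l. mono_eval A (split_factor A l) m)(s := a)) \<in> carrier R"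
  by (rule alg_mix_closed[OF based]) simp

private lemma w_closed [simp]: "w m \<in> carrier R"
  by (simp add: split_weight_def)

private lemma L_closed [simp]: "L x \<in> carrier R"
  by (simp add: split_form_def lin_ext_closed[OF R.is_cring])

private lemma L_monom: "L (Poly_Mapping.single m 1) = w m"
  by (simp add: split_form_def lin_ext_monom[OF R.is_cring])

private lemma L_zero: "L 0 = \<zero>\<^bsub>R\<^esub>"
  by (simp add: split_form_def lin_ext_zero[OF R.is_cring])

private lemma L_add: "L (x + y) = L x \<oplus>\<^bsub>R\<^esub> L y"
  by (simp add: split_form_def lin_ext_add[OF R.is_cring])

private lemma L_diff: "L (x - y) = L x \<ominus>\<^bsub>R\<^esub> L y"
  by (simp add: split_form_def lin_ext_diff[OF R.is_cring])

private lemma L_sum: "L (\<Sum>i\<in>I. x i) = (\<Oplus>\<^bsub>R\<^esub>i\<in>I. L (x i))"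
  by (simp add: split_form_def lin_ext_sum[OF R.is_cring])

text \<open>Every polynomial is an integral combination of monomials, so pairing with monomials
  decides membership.\<close>

private lemma radicalI:
  assumes "\<And>m. L (x * Poly_Mapping.single m 1) = L (y * Poly_Mapping.single m 1)"
  shows "x - y \<in> J"
proof -
  have "L ((x - y) * z) = \<zero>\<^bsub>R\<^esub>" for z
  proof (induction z rule: poly_mapping_diff_induct)
    case (monom m)
    then show ?case using assms[of m] by (simp add: left_diff_distrib L_diff a_minus_def R.r_neg del: mult_single)
  next
    case (diff a b)
    then show ?case by (simp add: right_diff_distrib[of "x - y"] L_diff[of "(x - y) * a"] a_minus_def)
  qed (simp add: L_zero)
  then show ?thesis by (simp add: split_radical_def)
qed

private lemma radical_ideal: "ideal J (zpoly UNIV)"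
proof (rule idealI)
  interpret Z: cring "zpoly UNIV :: 'r split_var int_mpoly ring" by (rule zpoly_cring)
  show "ring (zpoly UNIV :: 'r split_var int_mpoly ring)" by (rule Z.ring_axioms)
  show "subgroup J (add_monoid (zpoly UNIV))"
  proof (rule Z.add.subgroupI)
    show "J \<noteq> {}" using L_zero by (auto simp: split_radical_def intro: exI[of _ 0])
    fix x assume "x \<in> J"
    then have "L (- x * y) = \<zero>\<^bsub>R\<^esub>" for y
      using L_diff[of 0 "x * y"] by (simp add: split_radical_def L_zero a_minus_def)
    then show "\<ominus>\<^bsub>zpoly UNIV\<^esub> x \<in> J" by (simp add: split_radical_def)
  qed (auto simp: split_radical_def distrib_right L_add)
  fix x a assume x: "x \<in> J"
  have "L (x * a * y) = \<zero>\<^bsub>R\<^esub>" for y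
    using x by (simp add: split_radical_def mult.assoc)
  then show "x \<otimes>\<^bsub>zpoly UNIV\<^esub> a \<in> J" "a \<otimes>\<^bsub>zpoly UNIV\<^esub> x \<in> J"
    by (simp_all add: split_radical_def mult.commute[of a x])
qed

lemma split_ring_cring: "cring R'"
  unfolding split_ring_def by (rule ideal.quotient_is_cring[OF radical_ideal zpoly_cring])

interpretation R': cring R' by (rule split_ring_cring)

private lemma cls_hom: "cls \<in> ring_hom (zpoly UNIV) R'"
  unfolding split_ring_def split_cls_def[abs_def] by (rule ideal.rcos_ring_hom[OF radical_ideal])

private lemma cls_simps:
  "cls x \<in> carrier R'" "cls (x * y) = cls x \<otimes>\<^bsub>R'\<^esub> cls y" "cls (x + y) = cls x \<oplus>\<^bsub>R'\<^esub> cls y"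
  "cls 1 = \<one>\<^bsub>R'\<^esub>"
  using ring_hom_closed[OF cls_hom] ring_hom_mult[OF cls_hom, of x y] ring_hom_add[OF cls_hom, of x y]
    ring_hom_one[OF cls_hom] by simp_all

private lemma cls_eq_iff: "cls x = cls y \<longleftrightarrow> x - y \<in> J"
proof -
  interpret Z: cring "zpoly UNIV :: 'r split_var int_mpoly ring" by (rule zpoly_cring)
  show ?thesis
    using Z.quotient_eq_iff_same_a_r_cos[OF radical_ideal, of x y]
    by (simp add: split_cls_def a_minus_def)
qed

private lemma cls_eqI:
  assumes "\<And>m. L (x * Poly_Mapping.single m 1) = L (y * Poly_Mapping.single m 1)"
  shows "cls x = cls y"
  unfolding cls_eq_iff by (rule radicalI) (rule assms)

private lemma cls_sum: "cls (\<Sum>i\<in>I. x i) = (\<Oplus>\<^bsub>R'\<^esub>i\<in>I. cls (x i))"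
proof -
  have "cls (\<Oplus>\<^bsub>zpoly UNIV\<^esub>i\<in>I. x i) = (\<Oplus>\<^bsub>R'\<^esub>i\<in>I. cls (x i))"
    by (rule ring_hom_finsum[OF zpoly_cring split_ring_cring cls_hom]) simp
  then show ?thesis by (simp add: zpoly_finsum)
qed

private lemma mvar_mult: "mvar v * Poly_Mapping.single m 1 = Poly_Mapping.single (Poly_Mapping.single v (Suc 0) + m) 1"
  by (simp add: mvar_def mult_single One_nat_def)

private lemma w_scalar:
  assumes "r \<in> carrier R"
  shows "w (Poly_Mapping.single (Inl r) (Suc 0) + m) = r \<otimes>\<^bsub>R\<^esub> w m"
proof -
  have "mono_eval R (split_scalar R) (Poly_Mapping.single (Inl r) (Suc 0) + m) = r \<otimes>\<^bsub>R\<^esub> mono_eval R (split_scalar R) m"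
    using assms by (simp add: mono_eval_add[OF R.is_cring] mono_eval_single[OF R.is_cring]) (simp add: split_scalar_def)
  moreover have "mono_eval A (split_factor A l) (Poly_Mapping.single (Inl r) (Suc 0) + m) = mono_eval A (split_factor A l) m" for l
    by (simp add: mono_eval_add[OF A] mono_eval_single[OF A]) (simp add: split_factor_def)
  ultimately show ?thesis using assms by (simp add: split_weight_def R.m_assoc)
qed

private lemma w_factor:
  assumes "a \<in> carrier A" "l < n"
  shows "w (Poly_Mapping.single (Inr (l, a)) (Suc 0) + m) = mono_eval R (split_scalar R) m \<otimes>\<^bsub>R\<^esub>
    Dmix {..<n} ((\<lambda>k. mono_eval A (split_factor A k) m)(l := a \<otimes>\<^bsub>A\<^esub> mono_eval A (split_factor A l) m))"
proof -
  have "mono_eval R (split_scalar R) (Poly_Mapping.single (Inr (l, a)) (Suc 0) + m) = mono_eval R (split_scalar R) m"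
    by (simp add: mono_eval_add[OF R.is_cring] mono_eval_single[OF R.is_cring]) (simp add: split_scalar_def)
  moreover have "mono_eval A (split_factor A k) (Poly_Mapping.single (Inr (l, a)) (Suc 0) + m) =
      ((\<lambda>k. mono_eval A (split_factor A k) m)(l := a \<otimes>\<^bsub>A\<^esub> mono_eval A (split_factor A l) m)) k" for k
    using assms by (simp add: mono_eval_add[OF A] mono_eval_single[OF A]) (simp add: split_factor_def)
  ultimately show ?thesis by (simp add: split_weight_def fun_upd_def)
qed

definition split_incl :: "'r \<Rightarrow> 'r split_var int_mpoly set" where
  "split_incl r = cls (mvar (Inl r))"

definition split_point :: "nat \<Rightarrow> (nat \<Rightarrow> 'r) \<Rightarrow> 'r split_var int_mpoly set" where
  "split_point l a = cls (mvar (Inr (l, a)))"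

lemma split_incl_hom: "split_incl \<in> ring_hom R R'"
proof (rule ring_hom_memI)
  fix r s assume rs: "r \<in> carrier R" "s \<in> carrier R"
  show "split_incl (r \<otimes>\<^bsub>R\<^esub> s) = split_incl r \<otimes>\<^bsub>R'\<^esub> split_incl s"
    unfolding split_incl_def cls_simps(2)[symmetric]
    by (rule cls_eqI) (use rs in \<open>simp only: mult.assoc mvar_mult L_monom w_scalar R.m_closed R.m_assoc w_closed\<close>)
  show "split_incl (r \<oplus>\<^bsub>R\<^esub> s) = split_incl r \<oplus>\<^bsub>R'\<^esub> split_incl s"
    unfolding split_incl_def cls_simps(3)[symmetric]
    by (rule cls_eqI) (use rs in \<open>simp only: distrib_right L_add mvar_mult L_monom w_scalar R.a_closed R.l_distr w_closed\<close>)
next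
  show "split_incl \<one>\<^bsub>R\<^esub> = \<one>\<^bsub>R'\<^esub>"
    unfolding split_incl_def cls_simps(4)[symmetric]
    by (rule cls_eqI) (simp only: mult_1 mvar_mult L_monom w_scalar R.one_closed R.l_one w_closed)
qed (simp add: split_incl_def cls_simps)

text \<open>A variable of the factor l acts on the weight of a monomial by multiplying its element
  into argument l of the form. Multiplicativity is associativity in that argument, additivity is
  linearity of the form, and the unit of \<open>A\<close> leaves the argument unchanged.\<close>

lemma split_point_hom:
  assumes l: "l < n"
  shows "split_point l \<in> ring_hom A R'"
proof (rule ring_hom_memI)
  let ?f = "\<lambda>m k. mono_eval A (split_factor A k) m"
  fix a a' assume a: "a \<in> carrier A" "a' \<in> carrier A"
  show "split_point l (a \<otimes>\<^bsub>A\<^esub> a') = split_point l a \<otimes>\<^bsub>R'\<^esub> split_point l a'"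
    unfolding split_point_def cls_simps(2)[symmetric]
  proof (rule cls_eqI)
    fix m :: "'r split_var \<Rightarrow>\<^sub>0 nat"
    let ?m = "Poly_Mapping.single (Inr (l, a')) (Suc 0) + m"
    have "mono_eval R (split_scalar R) ?m = mono_eval R (split_scalar R) m"
      by (simp add: mono_eval_add[OF R.is_cring] mono_eval_single[OF R.is_cring]) (simp add: split_scalar_def)
    moreover have upd: "?f ?m = (?f m)(l := a' \<otimes>\<^bsub>A\<^esub> ?f m l)"
      using a by (simp add: fun_eq_iff mono_eval_add[OF A] mono_eval_single[OF A]) (simp add: split_factor_def)
    ultimately have "w (Poly_Mapping.single (Inr (l, a)) (Suc 0) + ?m) =
        mono_eval R (split_scalar R) m \<otimes>\<^bsub>R\<^esub> Dmix {..<n} ((?f m)(l := a \<otimes>\<^bsub>A\<^esub> (a' \<otimes>\<^bsub>A\<^esub> ?f m l)))"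
      using w_factor[OF a(1) l, of ?m] fun_cong[OF upd, of l] by simp
    then show "L (mvar (Inr (l, a \<otimes>\<^bsub>A\<^esub> a')) * Poly_Mapping.single m 1) =
        L (mvar (Inr (l, a)) * mvar (Inr (l, a')) * Poly_Mapping.single m 1)"
      using a l by (simp only: mult.assoc mvar_mult L_monom w_factor A.m_closed A.m_assoc eval_closed)
  qed
  show "split_point l (a \<oplus>\<^bsub>A\<^esub> a') = split_point l a \<oplus>\<^bsub>R'\<^esub> split_point l a'"
    unfolding split_point_def cls_simps(3)[symmetric]
  proof (rule cls_eqI)
    fix m
    show "L (mvar (Inr (l, a \<oplus>\<^bsub>A\<^esub> a')) * Poly_Mapping.single m 1) =
        L ((mvar (Inr (l, a)) + mvar (Inr (l, a'))) * Poly_Mapping.single m 1)"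
      using a l by (simp only: distrib_right L_add mvar_mult L_monom w_factor A.a_closed A.l_distr eval_closed
          alg_mix_add[OF based] A.m_closed R.r_distr mix_upd_closed)
  qed
next
  show "split_point l \<one>\<^bsub>A\<^esub> = \<one>\<^bsub>R'\<^esub>"
    unfolding split_point_def cls_simps(4)[symmetric]
    by (rule cls_eqI)
      (use l in \<open>simp only: mult_1 mvar_mult L_monom w_factor A.one_closed A.l_one eval_closed\<close>,
       simp add: split_weight_def fun_upd_idem)
qed (simp add: split_point_def cls_simps)

lemma split_point_smult:
  assumes l: "l < n" and r: "r \<in> carrier R" and a: "a \<in> carrier A"
  shows "split_point l (r \<odot>\<^bsub>A\<^esub> a) = split_incl r \<otimes>\<^bsub>R'\<^esub> split_point l a"
  unfolding split_point_def split_incl_def cls_simps(2)[symmetric]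
proof (rule cls_eqI)
  fix m
  show "L (mvar (Inr (l, r \<odot>\<^bsub>A\<^esub> a)) * Poly_Mapping.single m 1) =
      L (mvar (Inl r) * mvar (Inr (l, a)) * Poly_Mapping.single m 1)"
    using l r a by (simp only: mult.assoc mvar_mult L_monom w_factor w_scalar alg.smult_closed alg.smult_assoc2
        alg_mix_smult[OF based] A.m_closed eval_closed R.m_lcomm mix_upd_closed)
qed

text \<open>Paired with a monomial, the left-hand side multiplies a into each argument of the form
  in turn, and by \<open>alg_mix_trace\<close> this scales the value by the trace of a. It is the
  relation for whose sake the radical is divided out.\<close>

lemma split_point_trace:
  assumes a: "a \<in> carrier A"
  shows "(\<Oplus>\<^bsub>R'\<^esub>l\<in>{..<n}. split_point l a) = split_incl (alg_trace n R (A, \<phi>) a)"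
  unfolding split_point_def split_incl_def cls_sum[symmetric]
proof (rule cls_eqI)
  fix m
  let ?f = "\<lambda>k. mono_eval A (split_factor A k) m" and ?r = "mono_eval R (split_scalar R) m"
  have Tr: "alg_trace n R (A, \<phi>) a \<in> carrier R" by (rule alg_trace_closed[OF based a])
  have "L ((\<Sum>l<n. mvar (Inr (l, a))) * Poly_Mapping.single m 1) =
      (\<Oplus>\<^bsub>R\<^esub>l\<in>{..<n}. ?r \<otimes>\<^bsub>R\<^esub> Dmix {..<n} (?f(l := ?f l \<otimes>\<^bsub>A\<^esub> a)))"
    unfolding sum_distrib_right L_sum
    by (rule R.finsum_cong'[OF refl])
      (use a in \<open>auto simp only: mvar_mult L_monom w_factor lessThan_iff A.m_comm eval_closed
        intro!: R.m_closed mix_upd_closed A.m_closed\<close>)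
  also have "\<dots> = ?r \<otimes>\<^bsub>R\<^esub> (\<Oplus>\<^bsub>R\<^esub>l\<in>{..<n}. Dmix {..<n} (?f(l := ?f l \<otimes>\<^bsub>A\<^esub> a)))"
    using a by (intro R.finsum_rdistr[symmetric]) auto
  also have "\<dots> = ?r \<otimes>\<^bsub>R\<^esub> (alg_trace n R (A, \<phi>) a \<otimes>\<^bsub>R\<^esub> Dmix {..<n} ?f)"
    using a by (subst alg_mix_trace[OF based]) simp_all
  also have "\<dots> = alg_trace n R (A, \<phi>) a \<otimes>\<^bsub>R\<^esub> w m"
    using Tr by (simp add: split_weight_def R.m_lcomm)
  also have "\<dots> = L (mvar (Inl (alg_trace n R (A, \<phi>) a)) * Poly_Mapping.single m 1)"
    using Tr by (simp only: mvar_mult L_monom w_scalar)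
  finally show "L ((\<Sum>l<n. mvar (Inr (l, a))) * Poly_Mapping.single m 1) =
      L (mvar (Inl (alg_trace n R (A, \<phi>) a)) * Poly_Mapping.single m 1)" .
qed

text \<open>The exponent stands for the pure tensor of the g l: its scalar part is 1 and its factors
  are the g l themselves.\<close>

private lemma w_pure_tensor:
  assumes g: "\<And>l. l < n \<Longrightarrow> g l \<in> carrier A"
  shows "w (\<Sum>l<n. Poly_Mapping.single (Inr (l, g l)) (Suc 0)) = Dmix {..<n} g"
proof -
  have sum': "mono_eval A (split_factor A k) (\<Sum>l\<in>I. Poly_Mapping.single (Inr (l, g l)) (Suc 0)) =
      (if k \<in> I then g k else \<one>\<^bsub>A\<^esub>) \<and>
    mono_eval R (split_scalar R) (\<Sum>l\<in>I. Poly_Mapping.single (Inr (l, g l)) (Suc 0)) = \<one>\<^bsub>R\<^esub>"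
    if "finite I" "I \<subseteq> {..<n}" for I k
    using that
  proof (induction I rule: finite_induct)
    case (insert x I)
    have "split_factor A k (Inr (x, g x)) = (if x = k then g k else \<one>\<^bsub>A\<^esub>)"
      "split_scalar R (Inr (x, g x)) = \<one>\<^bsub>R\<^esub>"
      using g[of x] insert.prems by (auto simp: split_factor_def split_scalar_def)
    with insert g[of k] show
      ?case
      by (auto simp: mono_eval_add[OF R.is_cring] mono_eval_single[OF R.is_cring] mono_eval_add[OF A] mono_eval_single[OF A])
  qed (simp add: mono_eval_zero[OF R.is_cring] mono_eval_zero[OF A])
  note sum = sum'[THEN conjunct1] sum'[THEN conjunct2]
  have "Dmix {..<n} (\<lambda>k. mono_eval A (split_factor A k) (\<Sum>l<n. Poly_Mapping.single (Inr (l, g l)) (Suc 0))) = Dmix {..<n} g"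
    by (rule alg_mix_cong[OF based]) (use g in \<open>auto simp: sum\<close>)
  moreover have "Dmix {..<n} g \<in> carrier R" by (rule alg_mix_closed[OF based]) (use g in simp)
  ultimately show ?thesis by (simp add: split_weight_def sum)
qed

text \<open>The difference of two scalars with the same image annihilates every value of the form,
  in particular the combination in \<open>alg_mix_disc\<close>, which is a unit.\<close>

lemma split_incl_inj:
  assumes disc: "disc n R (A, \<phi>) \<in> Units R"
  shows "inj_on split_incl (carrier R)"
proof (rule inj_onI)
  let ?S = "{\<tau>. \<tau> permutes {..<n}}" and ?b = "basis_elt n R (A, \<phi>)"
  let ?sgn = "\<lambda>\<tau>. if evenperm \<tau> then \<one>\<^bsub>R\<^esub> else \<ominus>\<^bsub>R\<^esub> \<one>\<^bsub>R\<^esub>"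
  note [simp] = basis_closed[OF based]
  fix r s assume rs: "r \<in> carrier R" "s \<in> carrier R" and "split_incl r = split_incl s"
  then have "mvar (Inl r) - mvar (Inl s) \<in> J" by (simp add: split_incl_def cls_eq_iff)
  then have J: "L ((mvar (Inl r) - mvar (Inl s)) * Poly_Mapping.single m 1) = \<zero>\<^bsub>R\<^esub>" for m
    unfolding split_radical_def by blast
  have w: "(r \<ominus>\<^bsub>R\<^esub> s) \<otimes>\<^bsub>R\<^esub> w m = \<zero>\<^bsub>R\<^esub>" for m
    using J[of m] rs
    by (simp only: left_diff_distrib L_diff mvar_mult L_monom w_scalar)
      (simp add: a_minus_def R.l_distr R.l_minus)
  have Dmix: "(r \<ominus>\<^bsub>R\<^esub> s) \<otimes>\<^bsub>R\<^esub> Dmix {..<n} (\<lambda>l. ?b l \<otimes>\<^bsub>A\<^esub> ?b (\<tau> l)) = \<zero>\<^bsub>R\<^esub>"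
    "Dmix {..<n} (\<lambda>l. ?b l \<otimes>\<^bsub>A\<^esub> ?b (\<tau> l)) \<in> carrier R" for \<tau>
    using w[of "\<Sum>l<n. Poly_Mapping.single (Inr (l, ?b l \<otimes>\<^bsub>A\<^esub> ?b (\<tau> l))) (Suc 0)"]
    by (simp_all add: w_pure_tensor alg_mix_closed[OF based])
  have "(r \<ominus>\<^bsub>R\<^esub> s) \<otimes>\<^bsub>R\<^esub> disc n R (A, \<phi>) =
      (\<Oplus>\<^bsub>R\<^esub>\<tau>\<in>?S. (r \<ominus>\<^bsub>R\<^esub> s) \<otimes>\<^bsub>R\<^esub> (?sgn \<tau> \<otimes>\<^bsub>R\<^esub> Dmix {..<n} (\<lambda>l. ?b l \<otimes>\<^bsub>A\<^esub> ?b (\<tau> l))))"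
    unfolding alg_mix_disc[OF based, symmetric]
    using rs Dmix(2) by (intro R.finsum_rdistr) (auto simp: finite_permutations)
  also have "\<dots> = \<zero>\<^bsub>R\<^esub>"
  proof (rule R.add.finprod_one_eqI)
    fix \<tau>
    have "(r \<ominus>\<^bsub>R\<^esub> s) \<otimes>\<^bsub>R\<^esub> (?sgn \<tau> \<otimes>\<^bsub>R\<^esub> Dmix {..<n} (\<lambda>l. ?b l \<otimes>\<^bsub>A\<^esub> ?b (\<tau> l))) =
        ?sgn \<tau> \<otimes>\<^bsub>R\<^esub> ((r \<ominus>\<^bsub>R\<^esub> s) \<otimes>\<^bsub>R\<^esub> Dmix {..<n} (\<lambda>l. ?b l \<otimes>\<^bsub>A\<^esub> ?b (\<tau> l)))"
      using rs Dmix(2)[of \<tau>] by (intro R.m_lcomm) auto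
    then show "(r \<ominus>\<^bsub>R\<^esub> s) \<otimes>\<^bsub>R\<^esub> (?sgn \<tau> \<otimes>\<^bsub>R\<^esub> Dmix {..<n} (\<lambda>l. ?b l \<otimes>\<^bsub>A\<^esub> ?b (\<tau> l))) = \<zero>\<^bsub>R\<^esub>"
      by (simp add: Dmix(1))
  qed
  finally have "(r \<ominus>\<^bsub>R\<^esub> s) \<otimes>\<^bsub>R\<^esub> disc n R (A, \<phi>) \<otimes>\<^bsub>R\<^esub> inv\<^bsub>R\<^esub> disc n R (A, \<phi>) = \<zero>\<^bsub>R\<^esub>"
    using disc by simp
  moreover have "r \<ominus>\<^bsub>R\<^esub> s \<in> carrier R" using rs by simp
  ultimately have zero: "r \<ominus>\<^bsub>R\<^esub> s = \<zero>\<^bsub>R\<^esub>" using disc by (simp only: R.m_assoc R.Units_closed R.Units_inv_closed R.Units_r_inv R.r_one)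
  have "r = (r \<ominus>\<^bsub>R\<^esub> s) \<oplus>\<^bsub>R\<^esub> s" using rs by (simp add: a_minus_def R.a_assoc R.l_neg)
  then show "r = s" using rs by (simp only: zero R.l_zero)
qed

end

lemma str_trace_hom:
  fixes R :: "'r ring" and S :: "'s ring"
  assumes R: "cring R" and S: "cring S" and h: "h \<in> ring_hom R S"
    and c: "\<And>i j k. i < n \<Longrightarrow> j < n \<Longrightarrow> k < n \<Longrightarrow> c i j k \<in> carrier R"
    and eq: "\<And>i j k. i < n \<Longrightarrow> j < n \<Longrightarrow> k < n \<Longrightarrow> c' i j k = h (c i j k)"
    and ij: "i < n" "j < n"
  shows "h (str_trace n R c (i, j)) = str_trace n S c' (i, j)" "str_trace n R c (i, j) \<in> carrier R"
proof -
  interpret R: cring R by (rule R)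
  interpret S: cring S by (rule S)
  note [simp] = c ij ring_hom_closed[OF h]
  show "str_trace n R c (i, j) \<in> carrier R"
    by (auto simp: str_trace_def intro!: R.finsum_closed R.m_closed)
  have "h (str_trace n R c (i, j)) = (\<Oplus>\<^bsub>S\<^esub>m\<in>{..<n}. h (\<Oplus>\<^bsub>R\<^esub>k\<in>{..<n}. c i j k \<otimes>\<^bsub>R\<^esub> c k m m))"
    unfolding str_trace_def prod.case
    by (rule ring_hom_finsum[OF R S h]) (auto intro!: R.finsum_closed R.m_closed)
  also have "\<dots> = str_trace n S c' (i, j)"
    unfolding str_trace_def prod.case
  proof (rule S.finsum_cong'[OF refl])
    fix m assume "m \<in> {..<n}"
    then have m: "m < n" by simp
    have "h (\<Oplus>\<^bsub>R\<^esub>k\<in>{..<n}. c i j k \<otimes>\<^bsub>R\<^esub> c k m m) = (\<Oplus>\<^bsub>S\<^esub>k\<in>{..<n}. h (c i j k \<otimes>\<^bsub>R\<^esub> c k m m))"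
      using m by (intro ring_hom_finsum[OF R S h]) auto
    also have "\<dots> = (\<Oplus>\<^bsub>S\<^esub>k\<in>{..<n}. c' i j k \<otimes>\<^bsub>S\<^esub> c' k m m)"
      by (rule S.finsum_cong'[OF refl]) (use m in \<open>auto simp: eq ring_hom_mult[OF h]\<close>)
    finally show "h (\<Oplus>\<^bsub>R\<^esub>k\<in>{..<n}. c i j k \<otimes>\<^bsub>R\<^esub> c k m m) = (\<Oplus>\<^bsub>S\<^esub>k\<in>{..<n}. c' i j k \<otimes>\<^bsub>S\<^esub> c' k m m)" .
  qed (auto simp: eq intro!: S.finsum_closed S.m_closed)
  finally show "h (str_trace n R c (i, j)) = str_trace n S c' (i, j)" .
qed

definition trace_mat :: "nat \<Rightarrow> 'r ring \<Rightarrow> (nat \<Rightarrow> nat \<Rightarrow> nat \<Rightarrow> 'r) \<Rightarrow> 'r matrix" where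
  "trace_mat n R c = (\<lambda>(i, j)\<in>{..<n} \<times> {..<n}. str_trace n R c (i, j))"

lemma trace_mat_hom:
  fixes R :: "'r ring" and S :: "'s ring"
  assumes R: "cring R" and S: "cring S" and h: "h \<in> ring_hom R S"
    and c: "\<And>i j k. i < n \<Longrightarrow> j < n \<Longrightarrow> k < n \<Longrightarrow> c i j k \<in> carrier R"
    and eq: "\<And>i j k. i < n \<Longrightarrow> j < n \<Longrightarrow> k < n \<Longrightarrow> c' i j k = h (c i j k)"
  shows "mat_map n h (trace_mat n R c) = trace_mat n S c'" "trace_mat n R c \<in> carrier (mat_monoid R n)"
proof -
  show "mat_map n h (trace_mat n R c) = trace_mat n S c'"
    unfolding mat_map_def trace_mat_def
    by (rule restrict_ext) (auto simp: str_trace_hom(1)[OF R S h c eq])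
  show "trace_mat n R c \<in> carrier (mat_monoid R n)"
    unfolding trace_mat_def by (rule mat_carrierI[OF R]) (rule str_trace_hom(2)[OF R S h c eq])
qed

lemma ring_hom_id: "(\<lambda>x. x) \<in> ring_hom R R"
  by (rule ring_hom_memI) auto

lemma trace_mat_cong:
  fixes R :: "'r ring"
  assumes R: "cring R" and c: "\<And>i j k. i < n \<Longrightarrow> j < n \<Longrightarrow> k < n \<Longrightarrow> c i j k \<in> carrier R"
    and eq: "\<And>i j k. i < n \<Longrightarrow> j < n \<Longrightarrow> k < n \<Longrightarrow> c' i j k = c i j k"
  shows "trace_mat n R c' = trace_mat n R c"
  unfolding trace_mat_def
  by (rule restrict_ext) (auto simp: str_trace_hom(1)[OF R R ring_hom_id c eq])

lemma disc_trace_mat: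
  fixes R :: "'r ring"
  assumes p: "(A, \<phi>) \<in> based_algs n R"
  shows "disc n R (A, \<phi>) \<in> Units R \<longleftrightarrow> trace_mat n R (str_mult n R (A, \<phi>)) \<in> Units (mat_monoid R n)"
proof -
  note R = based_R_cring[OF p]
  note T = str_trace_hom(2)[OF R R ring_hom_id str_closed(1)[OF p] refl]
  have "mat_det R n (trace_mat n R (str_mult n R (A, \<phi>))) = disc n R (A, \<phi>)"
    unfolding disc_eq[OF p] by (rule mat_det_cong[OF R]) (auto simp: trace_mat_def T)
  moreover have "trace_mat n R (str_mult n R (A, \<phi>)) \<in> carrier (mat_monoid R n)"
    by (rule trace_mat_hom(2)[OF R R ring_hom_id str_closed(1)[OF p] refl])
  ultimately show ?thesis by (simp add: mat_Units_iff[OF R])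
qed

definition gram_mat :: "nat \<Rightarrow> 'r ring \<Rightarrow> 'r matrix \<Rightarrow> 'r matrix" where
  "gram_mat n R M = (\<lambda>(i, j)\<in>{..<n} \<times> {..<n}. split_gram n R M i j)"

lemma gram_mat_trace_mat:
  fixes R :: "'r ring"
  assumes R: "cring R" and M: "M \<in> Units (mat_monoid R n)"
  shows "gram_mat n R M \<in> carrier (mat_monoid R n)"
    "gram_mat n R M \<otimes>\<^bsub>mat_monoid R n\<^esub> trace_mat n R (split_mult n R M) = \<one>\<^bsub>mat_monoid R n\<^esub>"
proof -
  interpret R: cring R by (rule R)
  note c = split_closed[OF R M]
  note T = str_trace_hom(2)[OF R R ring_hom_id c(1) refl]
  show G: "gram_mat n R M \<in> carrier (mat_monoid R n)"
    unfolding gram_mat_def by (rule mat_carrierI[OF R]) (rule c(3))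
  have Tc: "trace_mat n R (split_mult n R M) \<in> carrier (mat_monoid R n)"
    by (rule trace_mat_hom(2)[OF R R ring_hom_id c(1) refl])
  show "gram_mat n R M \<otimes>\<^bsub>mat_monoid R n\<^esub> trace_mat n R (split_mult n R M) = \<one>\<^bsub>mat_monoid R n\<^esub>"
  proof (rule mat_eqI[OF R mat_mult_closed[OF R G Tc] mat_one_closed[OF R]])
    fix i j assume ij: "i < n" "j < n"
    have "(\<Oplus>\<^bsub>R\<^esub>k\<in>{..<n}. gram_mat n R M (i, k) \<otimes>\<^bsub>R\<^esub> trace_mat n R (split_mult n R M) (k, j)) =
        (\<Oplus>\<^bsub>R\<^esub>k\<in>{..<n}. split_gram n R M i k \<otimes>\<^bsub>R\<^esub> str_trace n R (split_mult n R M) (k, j))"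
      by (rule R.finsum_cong'[OF refl]) (use ij c T in \<open>auto simp: gram_mat_def trace_mat_def\<close>)
    then show "(gram_mat n R M \<otimes>\<^bsub>mat_monoid R n\<^esub> trace_mat n R (split_mult n R M)) (i, j) = \<one>\<^bsub>mat_monoid R n\<^esub> (i, j)"
      using ij by (simp add: mat_mult_entry[OF R] mat_one_entry[OF R] split_gram_trace[OF R M])
  qed
qed

text \<open>The values at the basis of the n homomorphisms from \<open>A\<close> form the matrix
  \<open>N\<close>. By the trace relation the transpose of \<open>N\<close> times \<open>N\<close>
  is the trace form, so invertibility of the trace form makes \<open>N\<close> invertible. The
  inverse \<open>X\<close> recovers the coordinates of an element from its n values, whence the
  split algebra with the basis given by \<open>X\<close> has the structure constants of
  \<open>A\<close>.\<close>

lemma etale_split: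
  fixes R :: "'r ring"
  assumes p: "(A, \<phi>) \<in> based_algs n R" and disc: "disc n R (A, \<phi>) \<in> Units R"
  obtains R' :: "'r split_var int_mpoly set ring" and \<iota> X
  where "cring R'" "\<iota> \<in> ring_hom R R'" "inj_on \<iota> (carrier R)" "X \<in> Units (mat_monoid R' n)"
    "\<And>i j k. i < n \<Longrightarrow> j < n \<Longrightarrow> k < n \<Longrightarrow> split_mult n R' X i j k = \<iota> (str_mult n R (A, \<phi>) i j k)"
    "\<And>k. k < n \<Longrightarrow> split_unit n R' X k = \<iota> (str_unit n R (A, \<phi>) k)"
proof -
  note R = based_R_cring[OF p] and A = based_A_cring[OF p]
  define R' where "R' = split_ring n R (A, \<phi>)"
  have R': "cring R'" unfolding R'_def by (rule split_ring_cring[OF p])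
  obtain \<iota> y where \<iota>: "\<iota> \<in> ring_hom R R'" "inj_on \<iota> (carrier R)"
    and y: "\<And>l. l < n \<Longrightarrow> y l \<in> ring_hom A R'"
      "\<And>l r a. l < n \<Longrightarrow> r \<in> carrier R \<Longrightarrow> a \<in> carrier A \<Longrightarrow> y l (r \<odot>\<^bsub>A\<^esub> a) = \<iota> r \<otimes>\<^bsub>R'\<^esub> y l a"
      "\<And>a. a \<in> carrier A \<Longrightarrow> (\<Oplus>\<^bsub>R'\<^esub>l\<in>{..<n}. y l a) = \<iota> (alg_trace n R (A, \<phi>) a)"
    by (rule that[unfolded R'_def, OF split_incl_hom[OF p] split_incl_inj[OF p disc] split_point_hom[OF p]
          split_point_smult[OF p] split_point_trace[OF p]])
  interpret R: cring R by (rule R)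
  interpret A: cring A by (rule A)
  interpret R': cring R' by (rule R')
  interpret alg: algebra R A by (rule based_algebra[OF p])
  interpret MM: monoid "mat_monoid R n" by (rule mat_monoid_monoid[OF R])
  let ?b = "basis_elt n R (A, \<phi>)" and ?c = "str_mult n R (A, \<phi>)"
  define T where "T = trace_mat n R ?c"
  have T: "T \<in> Units (mat_monoid R n)" using disc by (simp add: T_def disc_trace_mat[OF p])
  define S where "S = inv\<^bsub>mat_monoid R n\<^esub> T"
  note entries = mat_Units_entries[OF R T, folded S_def]
  note [simp] = entries basis_closed[OF p] ring_hom_closed[OF \<iota>(1)] coord_closed[OF p] ring_hom_closed[OF y(1)]
  define N where "N = (\<lambda>(l, i)\<in>{..<n} \<times> {..<n}. y l (?b i))"
  \<comment> \<open>The inverse of the trace form times the transpose of \<open>N\<close>.\<close>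
  define X where "X = (\<lambda>(k, l)\<in>{..<n} \<times> {..<n}. \<Oplus>\<^bsub>R'\<^esub>j\<in>{..<n}. \<iota> (S (k, j)) \<otimes>\<^bsub>R'\<^esub> y l (?b j))"
  have Nc: "N \<in> carrier (mat_monoid R' n)"
    unfolding N_def by (rule mat_carrierI[OF R']) simp
  have Xc: "X \<in> carrier (mat_monoid R' n)"
    unfolding X_def by (rule mat_carrierI[OF R']) (auto intro!: R'.finsum_closed R'.m_closed)
  have T_entry: "T (i, j) = alg_trace n R (A, \<phi>) (?b i \<otimes>\<^bsub>A\<^esub> ?b j)" if "i < n" "j < n" for i j
    using that by (simp add: T_def trace_mat_def str_trace_eq[OF p])
  have "X \<otimes>\<^bsub>mat_monoid R' n\<^esub> N = \<one>\<^bsub>mat_monoid R' n\<^esub>"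
  proof (rule mat_eqI[OF R' mat_mult_closed[OF R' Xc Nc] mat_one_closed[OF R']])
    fix k i assume ki: "k < n" "i < n"
    have trace: "(\<Oplus>\<^bsub>R'\<^esub>l\<in>{..<n}. y l (?b j) \<otimes>\<^bsub>R'\<^esub> y l (?b i)) = \<iota> (T (j, i))" if j: "j < n" for j
    proof -
      have "(\<Oplus>\<^bsub>R'\<^esub>l\<in>{..<n}. y l (?b j) \<otimes>\<^bsub>R'\<^esub> y l (?b i)) = (\<Oplus>\<^bsub>R'\<^esub>l\<in>{..<n}. y l (?b j \<otimes>\<^bsub>A\<^esub> ?b i))"
        by (rule R'.finsum_cong'[OF refl]) (auto simp: ring_hom_mult[OF y(1)])
      then show ?thesis using j ki by (simp add: y(3) T_entry)
    qed
    have "(X \<otimes>\<^bsub>mat_monoid R' n\<^esub> N) (k, i) =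
        (\<Oplus>\<^bsub>R'\<^esub>l\<in>{..<n}. (\<Oplus>\<^bsub>R'\<^esub>j\<in>{..<n}. \<iota> (S (k, j)) \<otimes>\<^bsub>R'\<^esub> y l (?b j)) \<otimes>\<^bsub>R'\<^esub> y l (?b i))"
      unfolding mat_mult_entry[OF R' ki]
      by (rule R'.finsum_cong'[OF refl]) (use ki in \<open>auto simp: X_def N_def intro!: R'.finsum_closed R'.m_closed\<close>)
    also have "\<dots> = (\<Oplus>\<^bsub>R'\<^esub>j\<in>{..<n}. \<iota> (S (k, j)) \<otimes>\<^bsub>R'\<^esub> (\<Oplus>\<^bsub>R'\<^esub>l\<in>{..<n}. y l (?b j) \<otimes>\<^bsub>R'\<^esub> y l (?b i)))"
      using ki by (intro finsum_mult_assoc[OF R']) auto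
    also have "\<dots> = (\<Oplus>\<^bsub>R'\<^esub>j\<in>{..<n}. \<iota> (S (k, j) \<otimes>\<^bsub>R\<^esub> T (j, i)))"
      by (rule R'.finsum_cong'[OF refl]) (use ki in \<open>auto simp: trace ring_hom_mult[OF \<iota>(1)]\<close>)
    also have "\<dots> = \<iota> (\<Oplus>\<^bsub>R\<^esub>j\<in>{..<n}. S (k, j) \<otimes>\<^bsub>R\<^esub> T (j, i))"
      using ki by (intro ring_hom_finsum[OF R R' \<iota>(1), symmetric]) auto
    also have "\<dots> = \<one>\<^bsub>mat_monoid R' n\<^esub> (k, i)"
      using ki mat_inverse_entries(2)[OF R T ki]
      by (simp add: S_def mat_one_entry[OF R'] ring_hom_one[OF \<iota>(1)] ring_hom_zero_cring[OF R R' \<iota>(1)])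
    finally show "(X \<otimes>\<^bsub>mat_monoid R' n\<^esub> N) (k, i) = \<one>\<^bsub>mat_monoid R' n\<^esub> (k, i)" .
  qed
  note X = mat_UnitsI[OF R' Xc Nc this]
  have expand: "y l a = (\<Oplus>\<^bsub>R'\<^esub>m\<in>{..<n}. N (l, m) \<otimes>\<^bsub>R'\<^esub> \<iota> (\<phi> a m))" if l: "l < n" and a: "a \<in> carrier A" for l a
  proof -
    have "y l a = y l (\<Oplus>\<^bsub>A\<^esub>m\<in>{..<n}. \<phi> a m \<odot>\<^bsub>A\<^esub> ?b m)"
      by (rule arg_cong[OF basis_expansion[OF p a]])
    also have "\<dots> = (\<Oplus>\<^bsub>R'\<^esub>m\<in>{..<n}. y l (\<phi> a m \<odot>\<^bsub>A\<^esub> ?b m))"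
      using a by (intro ring_hom_finsum[OF A R' y(1)[OF l]]) auto
    also have "\<dots> = (\<Oplus>\<^bsub>R'\<^esub>m\<in>{..<n}. N (l, m) \<otimes>\<^bsub>R'\<^esub> \<iota> (\<phi> a m))"
      by (rule R'.finsum_cong'[OF refl]) (use l a in \<open>auto simp: y(2) N_def R'.m_comm\<close>)
    finally show ?thesis .
  qed
  note cancel = mat_Units_cancel(2)[OF R' X(1), unfolded X(2)]
  note Xe = mat_Units_entries(1)[OF R' X(1)]
  \<comment> \<open>The values of a under the homomorphisms are \<open>N\<close> applied to its
    coordinates, and \<open>X\<close> undoes this.\<close>
  have coord: "(\<Oplus>\<^bsub>R'\<^esub>l\<in>{..<n}. X (k, l) \<otimes>\<^bsub>R'\<^esub> y l a) = \<iota> (\<phi> a k)" if k: "k < n" and a: "a \<in> carrier A" for k a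
  proof -
    have "(\<Oplus>\<^bsub>R'\<^esub>l\<in>{..<n}. X (k, l) \<otimes>\<^bsub>R'\<^esub> y l a) =
        (\<Oplus>\<^bsub>R'\<^esub>l\<in>{..<n}. X (k, l) \<otimes>\<^bsub>R'\<^esub> (\<Oplus>\<^bsub>R'\<^esub>m\<in>{..<n}. N (l, m) \<otimes>\<^bsub>R'\<^esub> \<iota> (\<phi> a m)))"
      by (rule R'.finsum_cong'[OF refl])
        (use k a in \<open>auto simp: expand[symmetric] Xe\<close>)
    also have "\<dots> = \<iota> (\<phi> a k)" using k a by (intro cancel) auto
    finally show ?thesis .
  qed
  have "split_mult n R' X i j k = \<iota> (?c i j k)" if ijk: "i < n" "j < n" "k < n" for i j k
  proof -
    have "split_mult n R' X i j k = (\<Oplus>\<^bsub>R'\<^esub>l\<in>{..<n}. X (k, l) \<otimes>\<^bsub>R'\<^esub> y l (?b i \<otimes>\<^bsub>A\<^esub> ?b j))"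
      unfolding split_mult_def X(2)
      by (rule R'.finsum_cong'[OF refl]) (use ijk in \<open>auto simp: N_def ring_hom_mult[OF y(1)] Xe\<close>)
    also have "\<dots> = \<iota> (?c i j k)" using ijk by (simp add: coord str_mult_def)
    finally show ?thesis .
  qed
  moreover have "split_unit n R' X k = \<iota> (str_unit n R (A, \<phi>) k)" if k: "k < n" for k
  proof -
    have "split_unit n R' X k = (\<Oplus>\<^bsub>R'\<^esub>l\<in>{..<n}. X (k, l) \<otimes>\<^bsub>R'\<^esub> y l \<one>\<^bsub>A\<^esub>)"
      unfolding split_unit_def
      by (rule R'.finsum_cong'[OF refl]) (use k in \<open>auto simp: ring_hom_one[OF y(1)] Xe\<close>)
    also have "\<dots> = \<iota> (str_unit n R (A, \<phi>) k)" using k by (simp add: coord str_unit_def)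
    finally show ?thesis .
  qed
  ultimately show thesis by (intro that[OF R' \<iota> X(1)]) auto
qed

section \<open>Points of the quotient and algebras with invertible discriminant\<close>

section \<open>Points of the quotient and structure constants\<close>

context
  fixes n :: nat
begin

private abbreviation (input) OG where "OG \<equiv> O_GL 1 n"
private abbreviation (input) OQ where "OQ \<equiv> O_quot n"
private abbreviation (input) UX where "UX \<equiv> univ_mat 1 n 0"

definition univ_mult :: "nat \<Rightarrow> nat \<Rightarrow> nat \<Rightarrow> gl_fun" where
  "univ_mult = split_mult n OG UX"

definition univ_unit :: "nat \<Rightarrow> gl_fun" where
  "univ_unit = split_unit n OG UX"

lemma univ_closed:
  "i < n \<Longrightarrow> j < n \<Longrightarrow> k < n \<Longrightarrow> univ_mult i j k \<in> carrier OQ"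
  "k < n \<Longrightarrow> univ_unit k \<in> carrier OQ"
  "i < n \<Longrightarrow> j < n \<Longrightarrow> split_gram n OG UX i j \<in> carrier OQ"
  unfolding univ_mult_def univ_unit_def
  by (rule subsetD[OF quot_gens_invariant], unfold quot_gens_def, blast)+

lemma O_quot_carrier: "g \<in> carrier OQ \<Longrightarrow> g \<in> carrier OG"
  using subringE(1)[OF O_quot_subring] by blast

text \<open>\<open>finsum\<close> depends on the whole ring record, carrier included, so the
  agreement of sums in the subring and in the ring is derived from the inclusion being a
  homomorphism.\<close>

lemma O_quot_finsum:
  assumes "\<And>i. i \<in> I \<Longrightarrow> f i \<in> carrier OQ"
  shows "(\<Oplus>\<^bsub>OQ\<^esub>i\<in>I. f i) = (\<Oplus>\<^bsub>OG\<^esub>i\<in>I. f i)"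
  using ring_hom_finsum[OF O_quot_cring O_GL_cring O_quot_incl, of I f] assms by simp

lemma gl_eval_split:
  fixes R :: "'r ring"
  assumes R: "cring R" and M: "M \<in> Units (mat_monoid R n)"
  shows "i < n \<Longrightarrow> j < n \<Longrightarrow> k < n \<Longrightarrow> gl_eval n R (\<lambda>_. M) (univ_mult i j k) = split_mult n R M i j k"
    "k < n \<Longrightarrow> gl_eval n R (\<lambda>_. M) (univ_unit k) = split_unit n R M k"
    "i < n \<Longrightarrow> j < n \<Longrightarrow> gl_eval n R (\<lambda>_. M) (split_gram n OG UX i j) = split_gram n R M i j"
proof -
  have eq: "mat_map n (gl_eval n R (\<lambda>_. M)) UX = M" by (rule gl_eval_mat_map[OF R M]) simp
  note hom = split_hom[OF O_GL_cring R gl_eval_hom(1)[OF R M, of 1] X_Units, unfolded eq]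
  show "i < n \<Longrightarrow> j < n \<Longrightarrow> k < n \<Longrightarrow> gl_eval n R (\<lambda>_. M) (univ_mult i j k) = split_mult n R M i j k"
    "k < n \<Longrightarrow> gl_eval n R (\<lambda>_. M) (univ_unit k) = split_unit n R M k"
    "i < n \<Longrightarrow> j < n \<Longrightarrow> gl_eval n R (\<lambda>_. M) (split_gram n OG UX i j) = split_gram n R M i j"
    unfolding univ_mult_def univ_unit_def by (simp_all only: hom)
qed

lemma O_quot_generated': "carrier OQ \<subseteq> generate_ring OQ (quot_gens n)"
proof
  fix g assume "g \<in> carrier OQ"
  then have "g \<in> generate_ring OG (quot_gens n)" by (simp add: O_quot_generated)
  then show "g \<in> generate_ring OQ (quot_gens n)"
  proof (induction g)
    case one
    show ?case using generate_ring.one[of OQ] by (simp add: O_quot_simps)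
  next
    case (incl g)
    then show ?case by (rule generate_ring.incl)
  next
    case (a_inv g)
    then have "g \<in> carrier OQ" by (simp add: O_quot_generated)
    then have "\<ominus>\<^bsub>OQ\<^esub> g = \<ominus>\<^bsub>OG\<^esub> g"
      using ring_hom_a_inv_cring[OF O_quot_cring O_GL_cring O_quot_incl, of g] by simp
    then show ?case using generate_ring.a_inv[OF a_inv.IH] by simp
  next
    case (eng_add g g')
    then show ?case using generate_ring.eng_add[OF eng_add.IH] by (simp add: O_quot_simps)
  next
    case (eng_mult g g')
    then show ?case using generate_ring.eng_mult[OF eng_mult.IH] by (simp add: O_quot_simps)
  qed
qed

text \<open>The generators \<open>split_gram\<close> form the inverse of the trace form already over
  the ring of invariants. Applying f shows that its values on them are determined by those on the
  structure constants, and that the trace form of the algebra belonging to f is invertible.\<close>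

lemma univ_trace:
  fixes R :: "'r ring"
  assumes R: "cring R" and f: "f \<in> ring_hom OQ R"
  shows "mat_map n f (gram_mat n OG UX) \<in> Units (mat_monoid R n)"
    "inv\<^bsub>mat_monoid R n\<^esub> (mat_map n f (gram_mat n OG UX)) = trace_mat n R (\<lambda>i j k. f (univ_mult i j k))"
proof -
  let ?T = "trace_mat n OQ univ_mult" and ?G = "gram_mat n OG UX"
  have Tc: "?T \<in> carrier (mat_monoid OQ n)"
    by (rule trace_mat_hom(2)[OF O_quot_cring O_quot_cring ring_hom_id univ_closed(1) refl])
  have T_entry: "str_trace n OQ univ_mult (i, j) = str_trace n OG univ_mult (i, j)" if "i < n" "j < n" for i j
  proof -
    have "id (str_trace n OQ univ_mult (i, j)) = str_trace n OG univ_mult (i, j)"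
      by (rule str_trace_hom(1)[OF O_quot_cring O_GL_cring O_quot_incl univ_closed(1) _ that]) simp_all
    then show ?thesis by simp
  qed
  have TP: "?T = trace_mat n OG univ_mult"
    unfolding trace_mat_def by (rule restrict_ext) (use T_entry in blast)
  have G: "?G \<in> carrier (mat_monoid OQ n)"
    unfolding gram_mat_def by (rule mat_carrierI[OF O_quot_cring]) (rule univ_closed(3))
  note Te = mat_closed[OF O_quot_cring Tc] and Ge = mat_closed[OF O_quot_cring G]
  interpret OQ: cring OQ by (rule O_quot_cring)
  have "?G \<otimes>\<^bsub>mat_monoid OQ n\<^esub> ?T = \<one>\<^bsub>mat_monoid OQ n\<^esub>"
  proof (rule mat_eqI[OF O_quot_cring mat_mult_closed[OF O_quot_cring G Tc] mat_one_closed[OF O_quot_cring]])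
    fix i j assume ij: "i < n" "j < n"
    have "(?G \<otimes>\<^bsub>mat_monoid OQ n\<^esub> ?T) (i, j) = (\<Oplus>\<^bsub>OQ\<^esub>k\<in>{..<n}. ?G (i, k) \<otimes>\<^bsub>OQ\<^esub> ?T (k, j))"
      by (rule mat_mult_entry[OF O_quot_cring ij])
    also have "\<dots> = (\<Oplus>\<^bsub>OG\<^esub>k\<in>{..<n}. ?G (i, k) \<otimes>\<^bsub>OQ\<^esub> ?T (k, j))"
      by (rule O_quot_finsum) (use ij Te Ge in auto)
    also have "\<dots> = (?G \<otimes>\<^bsub>mat_monoid OG n\<^esub> trace_mat n OG (split_mult n OG UX)) (i, j)"
      by (simp only: mat_mult_entry[OF O_GL_cring ij] TP[unfolded univ_mult_def] O_quot_simps univ_mult_def)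
    also have "\<dots> = \<one>\<^bsub>mat_monoid OQ n\<^esub> (i, j)"
      unfolding gram_mat_trace_mat(2)[OF O_GL_cring X_Units]
      by (simp add: mat_one_entry[OF O_GL_cring ij] mat_one_entry[OF O_quot_cring ij] O_quot_simps)
    finally show "(?G \<otimes>\<^bsub>mat_monoid OQ n\<^esub> ?T) (i, j) = \<one>\<^bsub>mat_monoid OQ n\<^esub> (i, j)" .
  qed
  note GT = mat_UnitsI[OF O_quot_cring G Tc this]
  note f' = mat_map_Units[OF O_quot_cring R f GT(1)]
  show "mat_map n f ?G \<in> Units (mat_monoid R n)" by (rule f'(1))
  show "inv\<^bsub>mat_monoid R n\<^esub> (mat_map n f ?G) = trace_mat n R (\<lambda>i j k. f (univ_mult i j k))"
    unfolding f'(2) GT(2) by (rule trace_mat_hom(1)[OF O_quot_cring R f univ_closed(1) refl])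
qed

text \<open>Agreement on the structure constants gives equal trace forms, hence equal inverses, and
  their entries are the values at the remaining generators.\<close>

lemma O_quot_hom_eqI:
  fixes R :: "'r ring"
  assumes R: "cring R" and f: "f \<in> ring_hom OQ R" and f': "f' \<in> ring_hom OQ R"
    and mult: "\<And>i j k. i < n \<Longrightarrow> j < n \<Longrightarrow> k < n \<Longrightarrow> f (univ_mult i j k) = f' (univ_mult i j k)"
    and unit: "\<And>k. k < n \<Longrightarrow> f (univ_unit k) = f' (univ_unit k)"
    and g: "g \<in> carrier OQ"
  shows "f g = f' g"
proof (rule generate_ring_hom_eq[OF _ _ f f' quot_gens_invariant _ subsetD[OF O_quot_generated' g]])
  interpret MM: monoid "mat_monoid R n" by (rule mat_monoid_monoid[OF R])
  have "trace_mat n R (\<lambda>i j k. f (univ_mult i j k)) = trace_mat n R (\<lambda>i j k. f' (univ_mult i j k))"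
    by (rule trace_mat_cong[OF R]) (auto simp: mult univ_closed ring_hom_closed[OF f'])
  then have "inv\<^bsub>mat_monoid R n\<^esub> (mat_map n f (gram_mat n OG UX)) = inv\<^bsub>mat_monoid R n\<^esub> (mat_map n f' (gram_mat n OG UX))"
    by (simp add: univ_trace(2)[OF R f] univ_trace(2)[OF R f'])
  then have "inv\<^bsub>mat_monoid R n\<^esub> (inv\<^bsub>mat_monoid R n\<^esub> (mat_map n f (gram_mat n OG UX))) =
      inv\<^bsub>mat_monoid R n\<^esub> (inv\<^bsub>mat_monoid R n\<^esub> (mat_map n f' (gram_mat n OG UX)))" by (rule arg_cong)
  then have "mat_map n f (gram_mat n OG UX) = mat_map n f' (gram_mat n OG UX)"
    by (simp only: MM.Units_inv_inv[OF univ_trace(1)[OF R f]] MM.Units_inv_inv[OF univ_trace(1)[OF R f']])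
  then have gram: "f (split_gram n OG UX i j) = f' (split_gram n OG UX i j)" if "i < n" "j < n" for i j
    using that by (auto dest!: arg_cong[of _ _ "\<lambda>M. M (i, j)"] simp: gram_mat_def)
  fix x assume "x \<in> quot_gens n"
  then show "f x = f' x"
    unfolding quot_gens_def using mult unit gram by (auto simp: univ_mult_def univ_unit_def)
qed (use R O_quot_cring in \<open>auto intro: cring.axioms(1)\<close>)

text \<open>Over the splitting ring the algebra is given by a matrix \<open>M\<close>. Evaluation at
  \<open>M\<close> sends the generators of the invariants into the image of \<open>R\<close>:
  structure constants and unit by the choice of \<open>M\<close>, the entries of the inverse trace
  form because inversion commutes with base change. As \<open>\<iota>\<close> is injective, the
  evaluation factors through \<open>R\<close>. The extension and \<open>M\<close> are kept in the
  conclusion because the action is computed with them.\<close>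

lemma etale_point:
  fixes R :: "'r ring"
  assumes p: "(A, \<phi>) \<in> based_algs n R" and disc: "disc n R (A, \<phi>) \<in> Units R"
  obtains f and R' :: "'r split_var int_mpoly set ring" and \<iota> M
  where "f \<in> ring_hom OQ R" "f \<in> extensional (carrier OQ)"
    "\<And>i j k. i < n \<Longrightarrow> j < n \<Longrightarrow> k < n \<Longrightarrow> f (univ_mult i j k) = str_mult n R (A, \<phi>) i j k"
    "\<And>k. k < n \<Longrightarrow> f (univ_unit k) = str_unit n R (A, \<phi>) k"
    "cring R'" "\<iota> \<in> ring_hom R R'" "inj_on \<iota> (carrier R)" "M \<in> Units (mat_monoid R' n)"
    "\<And>g. g \<in> carrier OQ \<Longrightarrow> gl_eval n R' (\<lambda>_. M) g = \<iota> (f g)"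
proof -
  note R = based_R_cring[OF p]
  obtain R' :: "'r split_var int_mpoly set ring" and \<iota> M
    where R': "cring R'" and \<iota>: "\<iota> \<in> ring_hom R R'" "inj_on \<iota> (carrier R)" and M: "M \<in> Units (mat_monoid R' n)"
    and mult: "\<And>i j k. i < n \<Longrightarrow> j < n \<Longrightarrow> k < n \<Longrightarrow> split_mult n R' M i j k = \<iota> (str_mult n R (A, \<phi>) i j k)"
    and unit: "\<And>k. k < n \<Longrightarrow> split_unit n R' M k = \<iota> (str_unit n R (A, \<phi>) k)"
    by (rule etale_split[OF p disc]) blast
  interpret R: cring R by (rule R)
  interpret R': cring R' by (rule R')
  interpret MR: monoid "mat_monoid R n" by (rule mat_monoid_monoid[OF R])
  interpret MR': monoid "mat_monoid R' n" by (rule mat_monoid_monoid[OF R'])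
  note [simp] = str_closed[OF p]
  let ?e = "gl_eval n R' (\<lambda>_. M)" and ?T = "trace_mat n R (str_mult n R (A, \<phi>))"
  have e: "?e \<in> ring_hom OG R'" by (rule gl_eval_hom(1)[OF R' M])
  have T: "?T \<in> Units (mat_monoid R n)" using disc by (simp add: disc_trace_mat[OF p])
  have "mat_map n \<iota> ?T = trace_mat n R' (split_mult n R' M)"
    by (rule trace_mat_hom(1)[OF R R' \<iota>(1) _ mult]) auto
  moreover have "inv\<^bsub>mat_monoid R' n\<^esub> (gram_mat n R' M) = trace_mat n R' (split_mult n R' M)"
    "gram_mat n R' M \<in> Units (mat_monoid R' n)"
    using mat_UnitsI[OF R' gram_mat_trace_mat(1)[OF R' M] _ gram_mat_trace_mat(2)[OF R' M]]
      trace_mat_hom(2)[OF R' R' ring_hom_id split_closed(1)[OF R' M] refl] by auto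
  ultimately have "gram_mat n R' M = inv\<^bsub>mat_monoid R' n\<^esub> (mat_map n \<iota> ?T)"
    using MR'.Units_inv_inv[of "gram_mat n R' M"] by simp
  also have "\<dots> = mat_map n \<iota> (inv\<^bsub>mat_monoid R n\<^esub> ?T)" by (rule mat_map_Units(2)[OF R R' \<iota>(1) T])
  finally have gram: "split_gram n R' M i j = \<iota> ((inv\<^bsub>mat_monoid R n\<^esub> ?T) (i, j))" if "i < n" "j < n" for i j
    using that by (auto dest!: arg_cong[of _ _ "\<lambda>M. M (i, j)"] simp: gram_mat_def)
  have img: "subring (\<iota> ` carrier R) R'"
    by (rule ring_hom_ring.img_is_subring[OF _ R.carrier_is_subring])
      (intro ring_hom_ring.intro ring_hom_ring_axioms.intro R.ring_axioms R'.ring_axioms \<iota>)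
  have "?e x \<in> \<iota> ` carrier R" if x: "x \<in> quot_gens n" for x
  proof -
    consider i j k where "x = univ_mult i j k" "i < n" "j < n" "k < n"
      | k where "x = univ_unit k" "k < n"
      | i j where "x = split_gram n OG UX i j" "i < n" "j < n"
      using x unfolding quot_gens_def univ_mult_def univ_unit_def by blast
    then show ?thesis
      by cases (simp_all add: gl_eval_split[OF R' M] mult unit gram mat_Units_entries[OF R T])
  qed
  then have "generate_ring R' (?e ` quot_gens n) \<subseteq> \<iota> ` carrier R"
    using subringE(1)[OF img] by (intro R'.generate_ring_min_subring1 img) auto
  moreover have "?e g \<in> generate_ring R' (?e ` quot_gens n)" if "g \<in> carrier OQ" for g
    using that quot_gens_invariant O_quot_carrier
    by (intro generate_ring_hom_image[OF cring.axioms(1)[OF O_GL_cring] e R'.ring_axioms]) (auto simp: O_quot_generated)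
  ultimately have im: "?e g \<in> \<iota> ` carrier R" if "g \<in> carrier OQ" for g using that by blast
  define f where "f = (\<lambda>g\<in>carrier OQ. inv_into (carrier R) \<iota> (?e g))"
  have f: "f g \<in> carrier R" "\<iota> (f g) = ?e g" if "g \<in> carrier OQ" for g
    using that im[OF that] by (simp_all add: f_def inv_into_into f_inv_into_f)
  \<comment> \<open>Equations for values of f are verified after applying the injective
    \<open>\<iota>\<close>, where f becomes evaluation at \<open>M\<close>.\<close>
  have feq: "f g = r" if "g \<in> carrier OQ" "r \<in> carrier R" "?e g = \<iota> r" for g r
    using f[OF that(1)] that(2,3) inj_onD[OF \<iota>(2)] by metis
  interpret OQ: cring OQ by (rule O_quot_cring)
  have "f \<in> ring_hom OQ R"
  proof (rule ring_hom_memI)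
    fix x y assume xy: "x \<in> carrier OQ" "y \<in> carrier OQ"
    note xyP = xy[THEN O_quot_carrier] and closed = OQ.m_closed[OF xy] OQ.a_closed[OF xy]
    show "f (x \<otimes>\<^bsub>OQ\<^esub> y) = f x \<otimes>\<^bsub>R\<^esub> f y"
      using xy f closed by (intro feq) (simp_all add: ring_hom_mult[OF \<iota>(1)] O_quot_simps(2) ring_hom_mult[OF e xyP])
    show "f (x \<oplus>\<^bsub>OQ\<^esub> y) = f x \<oplus>\<^bsub>R\<^esub> f y"
      using xy f closed by (intro feq) (simp_all add: ring_hom_add[OF \<iota>(1)] O_quot_simps(3) ring_hom_add[OF e xyP])
  next
    show "f \<one>\<^bsub>OQ\<^esub> = \<one>\<^bsub>R\<^esub>"
      using OQ.one_closed by (intro feq) (simp_all add: ring_hom_one[OF \<iota>(1)] O_quot_simps(4) ring_hom_one[OF e])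
  qed (rule f)
  moreover have "f \<in> extensional (carrier OQ)" by (simp add: f_def)
  moreover have "f (univ_mult i j k) = str_mult n R (A, \<phi>) i j k" if "i < n" "j < n" "k < n" for i j k
    using that by (intro feq) (simp_all add: univ_closed gl_eval_split[OF R' M] mult)
  moreover have "f (univ_unit k) = str_unit n R (A, \<phi>) k" if "k < n" for k
    using that by (intro feq) (simp_all add: univ_closed gl_eval_split[OF R' M] unit)
  ultimately show thesis using f(2) by (intro that[OF _ _ _ _ R' \<iota> M]) auto
qed

end

lemma str_rel_cong:
  fixes R :: "'r ring"
  assumes R: "cring R" and rel: "str_rel n R c u"
    and c: "\<And>i j k. i < n \<Longrightarrow> j < n \<Longrightarrow> k < n \<Longrightarrow> c' i j k = c i j k" and u: "\<And>k. k < n \<Longrightarrow> u' k = u k"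
  shows "str_rel n R c' u'"
proof -
  interpret cring R by (rule R)
  note [simp] = str_relD(1,3)[OF rel]
  show ?thesis
    unfolding str_rel_def
  proof (intro conjI allI impI)
    fix i j l m assume ijlm: "i < n" "j < n" "l < n" "m < n"
    have "(\<Oplus>\<^bsub>R\<^esub>k\<in>{..<n}. c' i j k \<otimes>\<^bsub>R\<^esub> c' k l m) = (\<Oplus>\<^bsub>R\<^esub>k\<in>{..<n}. c i j k \<otimes>\<^bsub>R\<^esub> c k l m)"
      "(\<Oplus>\<^bsub>R\<^esub>k\<in>{..<n}. c' j l k \<otimes>\<^bsub>R\<^esub> c' i k m) = (\<Oplus>\<^bsub>R\<^esub>k\<in>{..<n}. c j l k \<otimes>\<^bsub>R\<^esub> c i k m)"
      using ijlm by (auto intro!: finsum_cong' simp: c)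
    then show "(\<Oplus>\<^bsub>R\<^esub>k\<in>{..<n}. c' i j k \<otimes>\<^bsub>R\<^esub> c' k l m) = (\<Oplus>\<^bsub>R\<^esub>k\<in>{..<n}. c' j l k \<otimes>\<^bsub>R\<^esub> c' i k m)"
      using str_relD(4)[OF rel ijlm] by simp
  next
    fix j k assume jk: "j < n" "k < n"
    have "(\<Oplus>\<^bsub>R\<^esub>i\<in>{..<n}. u' i \<otimes>\<^bsub>R\<^esub> c' i j k) = (\<Oplus>\<^bsub>R\<^esub>i\<in>{..<n}. u i \<otimes>\<^bsub>R\<^esub> c i j k)"
      using jk by (auto intro!: finsum_cong' simp: c u)
    then show "(\<Oplus>\<^bsub>R\<^esub>i\<in>{..<n}. u' i \<otimes>\<^bsub>R\<^esub> c' i j k) = (if j = k then \<one>\<^bsub>R\<^esub> else \<zero>\<^bsub>R\<^esub>)"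
      using str_relD(5)[OF rel jk] by simp
  qed (use str_relD(2)[OF rel] in \<open>auto simp: c u\<close>)
qed

lemma str_rel_hom:
  fixes R :: "'r ring" and S :: "'s ring"
  assumes R: "cring R" and S: "cring S" and h: "h \<in> ring_hom R S" and rel: "str_rel n R c u"
  shows "str_rel n S (\<lambda>i j k. h (c i j k)) (\<lambda>k. h (u k))"
proof -
  interpret R: cring R by (rule R)
  interpret S: cring S by (rule S)
  note closed = str_relD(1,3)[OF rel]
  note [simp] = closed ring_hom_closed[OF h]
  have sum: "(\<Oplus>\<^bsub>S\<^esub>k\<in>{..<n}. h (a k) \<otimes>\<^bsub>S\<^esub> h (b k)) = h (\<Oplus>\<^bsub>R\<^esub>k\<in>{..<n}. a k \<otimes>\<^bsub>R\<^esub> b k)"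
    if "\<And>k. k < n \<Longrightarrow> a k \<in> carrier R" "\<And>k. k < n \<Longrightarrow> b k \<in> carrier R" for a b
  proof -
    have "h (\<Oplus>\<^bsub>R\<^esub>k\<in>{..<n}. a k \<otimes>\<^bsub>R\<^esub> b k) = (\<Oplus>\<^bsub>S\<^esub>k\<in>{..<n}. h (a k \<otimes>\<^bsub>R\<^esub> b k))"
      using that by (intro ring_hom_finsum[OF R S h]) auto
    also have "\<dots> = (\<Oplus>\<^bsub>S\<^esub>k\<in>{..<n}. h (a k) \<otimes>\<^bsub>S\<^esub> h (b k))"
      using that by (intro S.finsum_cong') (auto simp: ring_hom_mult[OF h])
    finally show ?thesis by simp
  qed
  show ?thesis
    unfolding str_rel_def
  proof (intro conjI allI impI)
    fix i j l m assume ijlm: "i < n" "j < n" "l < n" "m < n"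
    show "(\<Oplus>\<^bsub>S\<^esub>k\<in>{..<n}. h (c i j k) \<otimes>\<^bsub>S\<^esub> h (c k l m)) = (\<Oplus>\<^bsub>S\<^esub>k\<in>{..<n}. h (c j l k) \<otimes>\<^bsub>S\<^esub> h (c i k m))"
      using ijlm str_relD(4)[OF rel ijlm] sum[of "\<lambda>k. c i j k" "\<lambda>k. c k l m"] sum[of "\<lambda>k. c j l k" "\<lambda>k. c i k m"] by simp
  next
    fix j k assume jk: "j < n" "k < n"
    show "(\<Oplus>\<^bsub>S\<^esub>i\<in>{..<n}. h (u i) \<otimes>\<^bsub>S\<^esub> h (c i j k)) = (if j = k then \<one>\<^bsub>S\<^esub> else \<zero>\<^bsub>S\<^esub>)"
      using jk str_relD(5)[OF rel jk] sum[of u "\<lambda>i. c i j k"]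
      by (simp add: ring_hom_one[OF h] ring_hom_zero_cring[OF R S h])
  next
    show "h (c i j k) = h (c j i k)" if "i < n" "j < n" "k < n" for i j k
      by (rule arg_cong[OF str_relD(2)[OF rel that]])
  qed simp_all
qed

lemma basis_change_hom:
  fixes R :: "'r ring" and S :: "'s ring"
  assumes R: "cring R" and S: "cring S" and h: "h \<in> ring_hom R S" and M: "M \<in> Units (mat_monoid R n)"
    and c: "\<And>i j k. i < n \<Longrightarrow> j < n \<Longrightarrow> k < n \<Longrightarrow> c i j k \<in> carrier R"
    and c': "\<And>i j k. i < n \<Longrightarrow> j < n \<Longrightarrow> k < n \<Longrightarrow> c' i j k = h (c i j k)"
    and u: "\<And>k. k < n \<Longrightarrow> u k \<in> carrier R" and u': "\<And>k. k < n \<Longrightarrow> u' k = h (u k)"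
  shows "i < n \<Longrightarrow> j < n \<Longrightarrow> k < n \<Longrightarrow> h (basis_change_mult n R M c i j k) = basis_change_mult n S (mat_map n h M) c' i j k"
    "k < n \<Longrightarrow> h (basis_change_unit n R M u k) = basis_change_unit n S (mat_map n h M) u' k"
    "i < n \<Longrightarrow> j < n \<Longrightarrow> k < n \<Longrightarrow> basis_change_mult n R M c i j k \<in> carrier R"
    "k < n \<Longrightarrow> basis_change_unit n R M u k \<in> carrier R"
proof -
  interpret R: cring R by (rule R)
  interpret S: cring S by (rule S)
  note [simp] = mat_Units_entries[OF R M] c u ring_hom_closed[OF h]
  have sum: "h (\<Oplus>\<^bsub>R\<^esub>l\<in>{..<n}. a l \<otimes>\<^bsub>R\<^esub> b l) = (\<Oplus>\<^bsub>S\<^esub>l\<in>{..<n}. a' l \<otimes>\<^bsub>S\<^esub> b' l)"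
    if "\<And>l. l < n \<Longrightarrow> a l \<in> carrier R \<and> a' l = h (a l)" "\<And>l. l < n \<Longrightarrow> b l \<in> carrier R \<and> b' l = h (b l)" for a b a' b'
  proof -
    have "h (\<Oplus>\<^bsub>R\<^esub>k\<in>{..<n}. a k \<otimes>\<^bsub>R\<^esub> b k) = (\<Oplus>\<^bsub>S\<^esub>k\<in>{..<n}. h (a k \<otimes>\<^bsub>R\<^esub> b k))"
      using that by (intro ring_hom_finsum[OF R S h]) auto
    also have "\<dots> = (\<Oplus>\<^bsub>S\<^esub>l\<in>{..<n}. a' l \<otimes>\<^bsub>S\<^esub> b' l)"
      using that by (intro S.finsum_cong') (auto simp: ring_hom_mult[OF h])
    finally show ?thesis .
  qed
  have closed: "(\<Oplus>\<^bsub>R\<^esub>l\<in>{..<n}. a l \<otimes>\<^bsub>R\<^esub> b l) \<in> carrier R"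
    if "\<And>l. l < n \<Longrightarrow> a l \<in> carrier R" "\<And>l. l < n \<Longrightarrow> b l \<in> carrier R" for a b
    using that by (auto intro!: R.finsum_closed)
  show "basis_change_mult n R M c i j k \<in> carrier R" if "i < n" "j < n" "k < n"
    unfolding basis_change_mult_def using that by (intro closed) simp_all
  show "basis_change_unit n R M u k \<in> carrier R" if "k < n"
    unfolding basis_change_unit_def using that by (intro closed) simp_all
  show "h (basis_change_mult n R M c i j k) = basis_change_mult n S (mat_map n h M) c' i j k" if "i < n" "j < n" "k < n"
    unfolding basis_change_mult_def mat_map_Units(2)[OF R S h M]
    using that by (intro sum conjI closed sum[symmetric]) (simp_all add: c')
  show "h (basis_change_unit n R M u k) = basis_change_unit n S (mat_map n h M) u' k" if "k < n"
    unfolding basis_change_unit_def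
    using that by (intro sum) (simp_all add: u')
qed

context
  fixes n :: nat
begin

private abbreviation (input) P1 where "P1 \<equiv> O_GL 1 n"
private abbreviation (input) P2 where "P2 \<equiv> O_GL 2 n"
private abbreviation (input) Q1 where "Q1 \<equiv> O_quot n"
private abbreviation (input) X1 where "X1 \<equiv> univ_mat 1 n 0"

text \<open>The split algebra over \<open>O_GL 1 n\<close> with the basis given by the universal
  matrix has the universal structure constants, so the relations hold there. They descend to the
  invariants, whose sums and products are the same.\<close>

lemma univ_rel: "str_rel n Q1 (univ_mult n) (univ_unit n)"
proof -
  note based = split_alg_based[OF O_GL_cring X_Units]
  have P1: "str_rel n P1 (univ_mult n) (univ_unit n)"
    by (rule str_rel_cong[OF O_GL_cring based_str_rel[OF based(1)]])
      (simp_all add: based univ_mult_def univ_unit_def)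
  interpret Q1: cring Q1 by (rule O_quot_cring)
  note closed = univ_closed(1,2)[of _ n] univ_closed(1)[of _ n]
  have sum: "(\<Oplus>\<^bsub>Q1\<^esub>k\<in>{..<n}. a k \<otimes>\<^bsub>Q1\<^esub> b k) = (\<Oplus>\<^bsub>P1\<^esub>k\<in>{..<n}. a k \<otimes>\<^bsub>P1\<^esub> b k)"
    if "\<And>k. k < n \<Longrightarrow> a k \<in> carrier Q1" "\<And>k. k < n \<Longrightarrow> b k \<in> carrier Q1" for a b
    using O_quot_finsum[of "{..<n}" "\<lambda>k. a k \<otimes>\<^bsub>Q1\<^esub> b k" n] that Q1.m_closed unfolding O_quot_simps(2) by simp
  show ?thesis
    unfolding str_rel_def
  proof (intro conjI allI impI)
    fix i j l m assume ijlm: "i < n" "j < n" "l < n" "m < n"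
    have "(\<Oplus>\<^bsub>Q1\<^esub>k\<in>{..<n}. univ_mult n i j k \<otimes>\<^bsub>Q1\<^esub> univ_mult n k l m) = (\<Oplus>\<^bsub>P1\<^esub>k\<in>{..<n}. univ_mult n i j k \<otimes>\<^bsub>P1\<^esub> univ_mult n k l m)"
      "(\<Oplus>\<^bsub>Q1\<^esub>k\<in>{..<n}. univ_mult n j l k \<otimes>\<^bsub>Q1\<^esub> univ_mult n i k m) = (\<Oplus>\<^bsub>P1\<^esub>k\<in>{..<n}. univ_mult n j l k \<otimes>\<^bsub>P1\<^esub> univ_mult n i k m)"
      by (intro sum univ_closed(1) ijlm; assumption)+
    then show "(\<Oplus>\<^bsub>Q1\<^esub>k\<in>{..<n}. univ_mult n i j k \<otimes>\<^bsub>Q1\<^esub> univ_mult n k l m) = (\<Oplus>\<^bsub>Q1\<^esub>k\<in>{..<n}. univ_mult n j l k \<otimes>\<^bsub>Q1\<^esub> univ_mult n i k m)"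
      using str_relD(4)[OF P1 ijlm] by simp
  next
    fix j k assume jk: "j < n" "k < n"
    have "(\<Oplus>\<^bsub>Q1\<^esub>i\<in>{..<n}. univ_unit n i \<otimes>\<^bsub>Q1\<^esub> univ_mult n i j k) = (\<Oplus>\<^bsub>P1\<^esub>i\<in>{..<n}. univ_unit n i \<otimes>\<^bsub>P1\<^esub> univ_mult n i j k)"
      by (rule sum) (simp_all add: univ_closed jk)
    then show "(\<Oplus>\<^bsub>Q1\<^esub>i\<in>{..<n}. univ_unit n i \<otimes>\<^bsub>Q1\<^esub> univ_mult n i j k) = (if j = k then \<one>\<^bsub>Q1\<^esub> else \<zero>\<^bsub>Q1\<^esub>)"
      using str_relD(5)[OF P1 jk] by (simp add: O_quot_simps(4,5))
  next
    show "univ_mult n i j k = univ_mult n j i k" if "i < n" "j < n" "k < n" for i j k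
      by (rule str_relD(2)[OF P1 that])
  qed (simp_all add: univ_closed)
qed

text \<open>Defined for an arbitrary function f, since only its values at the structure constants
  and at the unit enter; it is also applied to \<open>quot_act\<close>.\<close>

definition point_alg :: "'r ring \<Rightarrow> (gl_fun \<Rightarrow> 'r) \<Rightarrow> 'r based_alg" where
  "point_alg R f = (std_alg n R (\<lambda>i j k. f (univ_mult n i j k)) (\<lambda>k. f (univ_unit n k)), \<lambda>x. x)"

lemma point_alg_based:
  fixes R :: "'r ring"
  assumes R: "cring R" and f: "f \<in> ring_hom Q1 R"
  shows "point_alg R f \<in> based_algs n R"
    "\<And>i j k. i < n \<Longrightarrow> j < n \<Longrightarrow> k < n \<Longrightarrow> str_mult n R (point_alg R f) i j k = f (univ_mult n i j k)"
    "\<And>k. k < n \<Longrightarrow> str_unit n R (point_alg R f) k = f (univ_unit n k)"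
    "disc n R (point_alg R f) \<in> Units R"
proof -
  note std = std_alg_based[OF R str_rel_hom[OF O_quot_cring R f univ_rel], folded point_alg_def]
  show p: "point_alg R f \<in> based_algs n R" by (rule std)
  show c: "\<And>i j k. i < n \<Longrightarrow> j < n \<Longrightarrow> k < n \<Longrightarrow> str_mult n R (point_alg R f) i j k = f (univ_mult n i j k)"
    and "\<And>k. k < n \<Longrightarrow> str_unit n R (point_alg R f) k = f (univ_unit n k)"
    by (rule std, assumption+)+
  have "trace_mat n R (str_mult n R (point_alg R f)) = trace_mat n R (\<lambda>i j k. f (univ_mult n i j k))"
    by (rule trace_mat_cong[OF R]) (simp_all add: c ring_hom_closed[OF f] univ_closed)
  also have "\<dots> \<in> Units (mat_monoid R n)"
  proof -
    interpret MM: monoid "mat_monoid R n" by (rule mat_monoid_monoid[OF R])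
    show ?thesis using univ_trace[OF R f] MM.Units_inv_Units by metis
  qed
  finally show "disc n R (point_alg R f) \<in> Units R"
    using p by (cases "point_alg R f") (simp add: disc_trace_mat)
qed

text \<open>The algebra belonging to f has invertible discriminant, so \<open>etale_point\<close>
  yields a point with a lift; that point is f because the structure constants determine it. In
  geometric terms, every point of the quotient comes from a matrix after an extension of the
  ring.\<close>

lemma point_lift:
  fixes R :: "'r ring"
  assumes R: "cring R" and f: "f \<in> ring_hom Q1 R"
  obtains R' :: "'r split_var int_mpoly set ring" and \<iota> M
  where "cring R'" "\<iota> \<in> ring_hom R R'" "inj_on \<iota> (carrier R)" "M \<in> Units (mat_monoid R' n)"
    "\<And>g. g \<in> carrier Q1 \<Longrightarrow> gl_eval n R' (\<lambda>_. M) g = \<iota> (f g)"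
proof -
  note p = point_alg_based[OF R f]
  obtain A \<phi> where A: "point_alg R f = (A, \<phi>)" by (cases "point_alg R f")
  obtain f' and R' :: "'r split_var int_mpoly set ring" and \<iota> M
    where f': "f' \<in> ring_hom Q1 R"
      "\<And>i j k. i < n \<Longrightarrow> j < n \<Longrightarrow> k < n \<Longrightarrow> f' (univ_mult n i j k) = str_mult n R (A, \<phi>) i j k"
      "\<And>k. k < n \<Longrightarrow> f' (univ_unit n k) = str_unit n R (A, \<phi>) k"
    and *: "cring R'" "\<iota> \<in> ring_hom R R'" "inj_on \<iota> (carrier R)" "M \<in> Units (mat_monoid R' n)"
      "\<And>g. g \<in> carrier Q1 \<Longrightarrow> gl_eval n R' (\<lambda>_. M) g = \<iota> (f' g)"
    by (rule etale_point[OF p(1,4)[unfolded A]]) blast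
  have "f g = f' g" if "g \<in> carrier Q1" for g
    by (rule O_quot_hom_eqI[OF R f f'(1) _ _ that]) (simp_all add: f' p[unfolded A])
  then show thesis using * by (intro that) auto
qed

section \<open>The coaction on the generators and its values at points\<close>

section \<open>The action on the quotient\<close>

private abbreviation (input) p1 where "p1 \<equiv> gl_eval n P2 (\<lambda>_. univ_mat 2 n 0)"
private abbreviation (input) p2 where "p2 \<equiv> gl_eval n P2 (\<lambda>_. univ_mat 2 n 1)"

text \<open>The image of \<open>O_GL 1 n \<otimes> O_quot n\<close> in \<open>O_GL 2 n\<close>. It
  is closed under sums and under multiplication by functions of the first matrix, so it contains
  every expression that is linear in invariants of the second matrix.\<close>

definition coact_span :: "gl_fun set" where
  "coact_span = {x. \<exists>K a c. (\<forall>k<K. a k \<in> carrier P1 \<and> c k \<in> carrier Q1) \<and>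
     x = (\<Oplus>\<^bsub>P2\<^esub>k\<in>{..<K::nat}. p1 (a k) \<otimes>\<^bsub>P2\<^esub> p2 (c k))}"

lemma proj_Units: "univ_mat 2 n 0 \<in> Units (mat_monoid P2 n)" "univ_mat 2 n 1 \<in> Units (mat_monoid P2 n)"
  by (rule univ_mat_Units, simp)+

lemma proj_hom: "p1 \<in> ring_hom P1 P2" "p2 \<in> ring_hom P1 P2"
  by (rule gl_eval_hom(1)[OF O_GL_cring], rule proj_Units)+

lemma proj_closed: "a \<in> carrier P1 \<Longrightarrow> p1 a \<in> carrier P2" "c \<in> carrier Q1 \<Longrightarrow> p2 c \<in> carrier P2"
  using ring_hom_closed[OF proj_hom(1)] ring_hom_closed[OF proj_hom(2)] O_quot_carrier by blast+

interpretation P2: cring P2 by (rule O_GL_cring)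

lemma coact_span_closed:
  assumes "x \<in> coact_span" shows "x \<in> carrier P2"
  using assms by (auto simp: coact_span_def proj_closed intro!: P2.finsum_closed)

lemma coact_span_zero: "\<zero>\<^bsub>P2\<^esub> \<in> coact_span"
  unfolding coact_span_def by (intro CollectI exI[of _ 0]) auto

lemma coact_span_proj:
  assumes c: "c \<in> carrier Q1" shows "p2 c \<in> coact_span"
proof -
  interpret P1: cring P1 by (rule O_GL_cring)
  have "p2 c = (\<Oplus>\<^bsub>P2\<^esub>k\<in>{0::nat}. p1 \<one>\<^bsub>P1\<^esub> \<otimes>\<^bsub>P2\<^esub> p2 c)"
    by (simp add: proj_closed(2)[OF c] ring_hom_one[OF proj_hom(1)])
  moreover have "{..<1::nat} = {0}" by auto
  ultimately have "(\<forall>k<1::nat. \<one>\<^bsub>P1\<^esub> \<in> carrier P1 \<and> c \<in> carrier Q1) \<and>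
      p2 c = (\<Oplus>\<^bsub>P2\<^esub>k\<in>{..<1::nat}. p1 \<one>\<^bsub>P1\<^esub> \<otimes>\<^bsub>P2\<^esub> p2 c)"
    using c by simp
  then show ?thesis
    unfolding coact_span_def
    by (intro CollectI exI[of _ "1::nat"] exI[of _ "\<lambda>_. \<one>\<^bsub>P1\<^esub>"] exI[of _ "\<lambda>_. c"])
qed

text \<open>The two decompositions are concatenated, the indices of the second being shifted by
  K.\<close>

lemma coact_span_add:
  assumes "x \<in> coact_span" "y \<in> coact_span"
  shows "x \<oplus>\<^bsub>P2\<^esub> y \<in> coact_span"
proof -
  obtain K a c where x: "\<forall>k<K. a k \<in> carrier P1 \<and> c k \<in> carrier Q1"
    "x = (\<Oplus>\<^bsub>P2\<^esub>k\<in>{..<K::nat}. p1 (a k) \<otimes>\<^bsub>P2\<^esub> p2 (c k))" using assms(1) by (auto simp: coact_span_def)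
  obtain K' a' c' where y: "\<forall>k<K'. a' k \<in> carrier P1 \<and> c' k \<in> carrier Q1"
    "y = (\<Oplus>\<^bsub>P2\<^esub>k\<in>{..<K'::nat}. p1 (a' k) \<otimes>\<^bsub>P2\<^esub> p2 (c' k))" using assms(2) by (auto simp: coact_span_def)
  let ?a = "\<lambda>k. if k < K then a k else a' (k - K)" and ?c = "\<lambda>k. if k < K then c k else c' (k - K)"
  let ?t = "\<lambda>k. p1 (?a k) \<otimes>\<^bsub>P2\<^esub> p2 (?c k)"
  have closed: "?a k \<in> carrier P1 \<and> ?c k \<in> carrier Q1" if "k < K + K'" for k
    using that x(1) y(1) by auto
  have t: "?t k \<in> carrier P2" if "k < K + K'" for k
    using closed[OF that] by (intro P2.m_closed proj_closed) auto
  have "{..<K + K'} = {..<K} \<union> (\<lambda>k. k + K) ` {..<K'}"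
  proof (intro Set.set_eqI iffI)
    fix x assume "x \<in> {..<K + K'}"
    then have "x < K \<or> (x = (x - K) + K \<and> x - K \<in> {..<K'})" by auto
    then show "x \<in> {..<K} \<union> (\<lambda>k. k + K) ` {..<K'}" by (metis UnI1 UnI2 image_eqI lessThan_iff)
  qed auto
  then have "(\<Oplus>\<^bsub>P2\<^esub>k\<in>{..<K + K'}. ?t k) = (\<Oplus>\<^bsub>P2\<^esub>k\<in>{..<K}. ?t k) \<oplus>\<^bsub>P2\<^esub> (\<Oplus>\<^bsub>P2\<^esub>k\<in>(\<lambda>k. k + K) ` {..<K'}. ?t k)"
    using t by (simp only:) (intro P2.finsum_Un_disjoint, auto)
  also have "(\<Oplus>\<^bsub>P2\<^esub>k\<in>(\<lambda>k. k + K) ` {..<K'}. ?t k) = (\<Oplus>\<^bsub>P2\<^esub>k\<in>{..<K'}. ?t (k + K))"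
  proof (rule P2.finsum_reindex)
    show "?t \<in> (\<lambda>k. k + K) ` {..<K'} \<rightarrow> carrier P2"
    proof
      fix k assume "k \<in> (\<lambda>k. k + K) ` {..<K'}"
      then have "k < K + K'" by auto
      then show "?t k \<in> carrier P2" by (rule t)
    qed
  qed (simp add: inj_on_def)
  also have "\<dots> = y" unfolding y(2) by simp
  also have "(\<Oplus>\<^bsub>P2\<^esub>k\<in>{..<K}. ?t k) = x"
    unfolding x(2) using x(1) by (intro P2.finsum_cong') (auto intro!: P2.m_closed proj_closed)
  finally show ?thesis
    unfolding coact_span_def using closed by (intro CollectI exI[of _ "K + K'"] exI[of _ ?a] exI[of _ ?c]) auto
qed

lemma coact_span_scale:
  assumes b: "b \<in> carrier P1" and "x \<in> coact_span"
  shows "p1 b \<otimes>\<^bsub>P2\<^esub> x \<in> coact_span"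
proof -
  interpret P1: cring P1 by (rule O_GL_cring)
  obtain K a c where x: "\<forall>k<K. a k \<in> carrier P1 \<and> c k \<in> carrier Q1"
    "x = (\<Oplus>\<^bsub>P2\<^esub>k\<in>{..<K::nat}. p1 (a k) \<otimes>\<^bsub>P2\<^esub> p2 (c k))" using assms(2) by (auto simp: coact_span_def)
  have "p1 b \<otimes>\<^bsub>P2\<^esub> x = (\<Oplus>\<^bsub>P2\<^esub>k\<in>{..<K}. p1 b \<otimes>\<^bsub>P2\<^esub> (p1 (a k) \<otimes>\<^bsub>P2\<^esub> p2 (c k)))"
    unfolding x(2) using x(1) b by (intro P2.finsum_rdistr) (auto intro!: P2.m_closed proj_closed)
  also have "\<dots> = (\<Oplus>\<^bsub>P2\<^esub>k\<in>{..<K}. p1 (b \<otimes>\<^bsub>P1\<^esub> a k) \<otimes>\<^bsub>P2\<^esub> p2 (c k))"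
    using x(1) b
    by (intro P2.finsum_cong' refl)
      (simp_all add: ring_hom_mult[OF proj_hom(1)] P2.m_assoc proj_closed Pi_iff)
  finally show ?thesis
    unfolding coact_span_def using x(1) b
    by (intro CollectI exI[of _ K] exI[of _ "\<lambda>k. b \<otimes>\<^bsub>P1\<^esub> a k"] exI[of _ c]) auto
qed

lemma coact_span_finsum:
  assumes "\<And>i. i \<in> I \<Longrightarrow> x i \<in> coact_span"
  shows "(\<Oplus>\<^bsub>P2\<^esub>i\<in>I. x i) \<in> coact_span"
  using assms
proof (induction I rule: infinite_finite_induct)
  case (insert i I)
  then have "(\<Oplus>\<^bsub>P2\<^esub>i\<in>insert i I. x i) = x i \<oplus>\<^bsub>P2\<^esub> (\<Oplus>\<^bsub>P2\<^esub>i\<in>I. x i)"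
    by (intro P2.finsum_insert) (auto intro: coact_span_closed)
  then show ?case using insert by (simp only:) (intro coact_span_add, auto)
qed (simp_all add: coact_span_zero)

lemma coact_span_decomp:
  assumes "gl_eval n P2 (\<lambda>_. univ_mat 2 n 0 \<otimes>\<^bsub>mat_monoid P2 n\<^esub> univ_mat 2 n 1) g \<in> coact_span"
  shows "\<exists>K a c. coaction_decomp n g K a c"
  using assms unfolding coact_span_def coaction_decomp_def lessThan_atLeast0 by blast

text \<open>By \<open>split_basis_change\<close> the structure constants at a product of two
  matrices are linear in those at the second factor, with coefficients polynomial in the entries of
  the first factor and of its inverse. The same holds for the unit.\<close>

lemma univ_decomp:
  "i < n \<Longrightarrow> j < n \<Longrightarrow> k < n \<Longrightarrow> \<exists>K a c. coaction_decomp n (univ_mult n i j k) K a c"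
  "k < n \<Longrightarrow> \<exists>K a c. coaction_decomp n (univ_unit n k) K a c"
proof -
  let ?U = "univ_mat 2 n 0" and ?V = "univ_mat 2 n 1"
  interpret MM: monoid "mat_monoid P2 n" by (rule mat_monoid_monoid[OF O_GL_cring])
  note UV = MM.Units_m_closed[OF proj_Units]
  have map: "mat_map n p1 X1 = ?U" by (rule gl_eval_mat_map[OF O_GL_cring]) (auto simp: proj_Units)
  have U: "?U (i, j) = p1 (X1 (i, j))" if "i < n" "j < n" for i j
    using arg_cong[OF map, of "\<lambda>M. M (i, j)"] that by simp
  have inv: "inv\<^bsub>mat_monoid P2 n\<^esub> ?U = mat_map n p1 (inv\<^bsub>mat_monoid P1 n\<^esub> X1)"
    using mat_map_Units(2)[OF O_GL_cring O_GL_cring proj_hom(1) X_Units] by (simp only: map)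
  note Xe = X_entries
  note V = gl_eval_split(1,2)[OF O_GL_cring proj_Units(2)]
  show "\<exists>K a c. coaction_decomp n (univ_mult n i j k) K a c" if ijk: "i < n" "j < n" "k < n"
  proof (rule coact_span_decomp)
    have "basis_change_mult n P2 ?U (split_mult n P2 ?V) i j k \<in> coact_span"
      unfolding basis_change_mult_def inv
    proof (rule coact_span_finsum)
      fix k' assume "k' \<in> {..<n}"
      then have k': "k' < n" by simp
      have s: "split_mult n P2 ?V i' j' k' \<in> coact_span" if "i' < n" "j' < n" for i' j'
        unfolding V(1)[OF that k', symmetric] by (rule coact_span_proj[OF univ_closed(1)[OF that k']])
      let ?W = "\<lambda>i' i. mat_map n p1 (inv\<^bsub>mat_monoid P1 n\<^esub> X1) (i', i)"
      have scale: "?W i' i \<otimes>\<^bsub>P2\<^esub> y \<in> coact_span" if "i' < n" "i < n" "y \<in> coact_span" for i' i y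
        using coact_span_scale[OF Xe(2)[OF that(1,2)] that(3)] that(1,2) by simp
      have "(\<Oplus>\<^bsub>P2\<^esub>i'\<in>{..<n}. ?W i' i \<otimes>\<^bsub>P2\<^esub>
          (\<Oplus>\<^bsub>P2\<^esub>j'\<in>{..<n}. ?W j' j \<otimes>\<^bsub>P2\<^esub> split_mult n P2 ?V i' j' k')) \<in> coact_span"
        by (intro coact_span_finsum scale s; use ijk in simp)
      then show "?U (k, k') \<otimes>\<^bsub>P2\<^esub> (\<Oplus>\<^bsub>P2\<^esub>i'\<in>{..<n}. ?W i' i \<otimes>\<^bsub>P2\<^esub>
          (\<Oplus>\<^bsub>P2\<^esub>j'\<in>{..<n}. ?W j' j \<otimes>\<^bsub>P2\<^esub> split_mult n P2 ?V i' j' k')) \<in> coact_span"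
        unfolding U[OF ijk(3) k'] by (rule coact_span_scale[OF Xe(1)[OF ijk(3) k']])
    qed
    then show "gl_eval n P2 (\<lambda>_. ?U \<otimes>\<^bsub>mat_monoid P2 n\<^esub> ?V) (univ_mult n i j k) \<in> coact_span"
      by (simp only: gl_eval_split(1)[OF O_GL_cring UV ijk] split_basis_change(1)[OF O_GL_cring proj_Units ijk])
  qed
  show "\<exists>K a c. coaction_decomp n (univ_unit n k) K a c" if k: "k < n"
  proof (rule coact_span_decomp)
    have "basis_change_unit n P2 ?U (split_unit n P2 ?V) k \<in> coact_span"
      unfolding basis_change_unit_def
    proof (intro coact_span_finsum)
      fix k' assume "k' \<in> {..<n}"
      then have k': "k' < n" by simp
      show "?U (k, k') \<otimes>\<^bsub>P2\<^esub> split_unit n P2 ?V k' \<in> coact_span"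
        unfolding U[OF k k'] V(2)[OF k', symmetric]
        by (rule coact_span_scale[OF Xe(1)[OF k k'] coact_span_proj[OF univ_closed(2)[OF k']]])
    qed
    then show "gl_eval n P2 (\<lambda>_. ?U \<otimes>\<^bsub>mat_monoid P2 n\<^esub> ?V) (univ_unit n k) \<in> coact_span"
      by (simp only: gl_eval_split(2)[OF O_GL_cring UV k] split_basis_change(2)[OF O_GL_cring proj_Units k])
  qed
qed

text \<open>
  Over a ring \<open>R'\<close> containing \<open>R\<close> to which the point \<open>f\<close> lifts as a matrix \<open>Y\<close>, every decomposition
  evaluates to the function \<open>g\<close> at \<open>M Y\<close>; hence the value does not depend on the decomposition.
\<close>

lemma coaction_value:
  fixes R :: "'r ring" and R' :: "'s ring"
  assumes R: "cring R" and f: "f \<in> ring_hom Q1 R" and M: "M \<in> Units (mat_monoid R n)"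
    and R': "cring R'" and \<iota>: "\<iota> \<in> ring_hom R R'" and Y: "Y \<in> Units (mat_monoid R' n)"
    and lift: "\<And>g. g \<in> carrier Q1 \<Longrightarrow> gl_eval n R' (\<lambda>_. Y) g = \<iota> (f g)"
    and g: "g \<in> carrier Q1" and dec: "coaction_decomp n g K a c"
  shows "\<iota> (\<Oplus>\<^bsub>R\<^esub>k\<in>{..<K}. gl_eval n R (\<lambda>_. M) (a k) \<otimes>\<^bsub>R\<^esub> f (c k)) =
      gl_eval n R' (\<lambda>_. mat_map n \<iota> M \<otimes>\<^bsub>mat_monoid R' n\<^esub> Y) g"
    "(\<Oplus>\<^bsub>R\<^esub>k\<in>{..<K}. gl_eval n R (\<lambda>_. M) (a k) \<otimes>\<^bsub>R\<^esub> f (c k)) \<in> carrier R"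
proof -
  interpret R: cring R by (rule R)
  interpret R': cring R' by (rule R')
  interpret MM: monoid "mat_monoid R' n" by (rule mat_monoid_monoid[OF R'])
  interpret M2: monoid "mat_monoid P2 n" by (rule mat_monoid_monoid[OF O_GL_cring])
  let ?U = "univ_mat 2 n 0" and ?V = "univ_mat 2 n 1"
  let ?M = "mat_map n \<iota> M"
  have M': "?M \<in> Units (mat_monoid R' n)" by (rule mat_map_Units(1)[OF R R' \<iota> M])
  \<comment> \<open>\<open>E\<close> evaluates functions of two matrices: the first at the image of
    \<open>M\<close>, the second at the lift \<open>Y\<close> of the point f.\<close>
  define E where "E = gl_eval n R' (\<lambda>l. if l = 0 then ?M else Y)"
  have E: "E \<in> ring_hom P2 R'" unfolding E_def by (rule gl_eval_hom(1)[OF R']) (simp add: M' Y)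
  have EU: "mat_map n E ?U = ?M" "mat_map n E ?V = Y"
    unfolding E_def by (subst gl_eval_mat_map[OF R']; simp add: M' Y)+
  \<comment> \<open>A homomorphism from \<open>O_GL 1 n\<close> is determined by the image of the
    universal matrix, so evaluation at W followed by \<open>E\<close> is evaluation at the image of
    W.\<close>
  have comp: "E (gl_eval n P2 (\<lambda>_. W) x) = gl_eval n R' (\<lambda>_. W') x"
    if W: "W \<in> Units (mat_monoid P2 n)" and W': "W' \<in> Units (mat_monoid R' n)" "mat_map n E W = W'" and x: "x \<in> carrier P1" for W W' x
  proof -
    have "(E \<circ> gl_eval n P2 (\<lambda>_. W)) x = gl_eval n R' (\<lambda>_. W') x"
    proof (rule O_GL_hom_eqI[OF R' ring_hom_trans[OF gl_eval_hom(1)[OF O_GL_cring W] E] gl_eval_hom(1)[OF R' W'(1)] _ x])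
      fix l :: nat assume l: "l < 1"
      have e: "gl_eval n P2 (\<lambda>_. W) (univ_mat 1 n l (i, j)) = W (i, j)" if "i < n" "j < n" for i j
        by (rule gl_eval_hom(2)[OF O_GL_cring W l that])
      have "mat_map n (E \<circ> gl_eval n P2 (\<lambda>_. W)) (univ_mat 1 n l) = mat_map n E W"
        unfolding mat_map_def by (rule restrict_ext) (auto simp: e)
      also have "\<dots> = mat_map n (gl_eval n R' (\<lambda>_. W')) (univ_mat 1 n l)"
        using gl_eval_mat_map[OF R' W'(1) l] W'(2) by simp
      finally show "mat_map n (E \<circ> gl_eval n P2 (\<lambda>_. W)) (univ_mat 1 n l) = mat_map n (gl_eval n R' (\<lambda>_. W')) (univ_mat 1 n l)" .
    qed
    then show ?thesis by simp
  qed
  have base: "\<iota> (gl_eval n R (\<lambda>_. M) x) = gl_eval n R' (\<lambda>_. ?M) x" if x: "x \<in> carrier P1" for x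
  proof -
    have "(\<iota> \<circ> gl_eval n R (\<lambda>_. M)) x = gl_eval n R' (\<lambda>_. ?M) x"
    proof (rule O_GL_hom_eqI[OF R' ring_hom_trans[OF gl_eval_hom(1)[OF R M] \<iota>] gl_eval_hom(1)[OF R' M'] _ x])
      fix l :: nat assume l: "l < 1"
      have e: "gl_eval n R (\<lambda>_. M) (univ_mat 1 n l (i, j)) = M (i, j)" if "i < n" "j < n" for i j
        by (rule gl_eval_hom(2)[OF R M l that])
      have "mat_map n (\<iota> \<circ> gl_eval n R (\<lambda>_. M)) (univ_mat 1 n l) = ?M"
        unfolding mat_map_def by (rule restrict_ext) (auto simp: e)
      then show "mat_map n (\<iota> \<circ> gl_eval n R (\<lambda>_. M)) (univ_mat 1 n l) = mat_map n (gl_eval n R' (\<lambda>_. ?M)) (univ_mat 1 n l)"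
        using gl_eval_mat_map[OF R' M' l] by simp
    qed
    then show ?thesis by simp
  qed
  have ac: "a k \<in> carrier P1" "c k \<in> carrier Q1" if "k < K" for k
    using dec that by (auto simp: coaction_decomp_def)
  have ev: "gl_eval n R (\<lambda>_. M) (a k) \<in> carrier R" "f (c k) \<in> carrier R" if "k < K" for k
    using ring_hom_closed[OF gl_eval_hom(1)[OF R M]] ring_hom_closed[OF f] ac[OF that] by auto
  then show "(\<Oplus>\<^bsub>R\<^esub>k\<in>{..<K}. gl_eval n R (\<lambda>_. M) (a k) \<otimes>\<^bsub>R\<^esub> f (c k)) \<in> carrier R"
    by (auto intro!: R.finsum_closed)
  have "\<iota> (\<Oplus>\<^bsub>R\<^esub>k\<in>{..<K}. gl_eval n R (\<lambda>_. M) (a k) \<otimes>\<^bsub>R\<^esub> f (c k)) =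
      (\<Oplus>\<^bsub>R'\<^esub>k\<in>{..<K}. \<iota> (gl_eval n R (\<lambda>_. M) (a k) \<otimes>\<^bsub>R\<^esub> f (c k)))"
    using ev by (intro ring_hom_finsum[OF R R' \<iota>]) auto
  also have "\<dots> = (\<Oplus>\<^bsub>R'\<^esub>k\<in>{..<K}. E (p1 (a k) \<otimes>\<^bsub>P2\<^esub> p2 (c k)))"
  proof (rule R'.finsum_cong'[OF refl])
    fix k assume "k \<in> {..<K}"
    then have k: "k < K" by simp
    have "E (p1 (a k) \<otimes>\<^bsub>P2\<^esub> p2 (c k)) = E (p1 (a k)) \<otimes>\<^bsub>R'\<^esub> E (p2 (c k))"
      by (rule ring_hom_mult[OF E proj_closed(1)[OF ac(1)[OF k]] proj_closed(2)[OF ac(2)[OF k]]])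
    then show "\<iota> (gl_eval n R (\<lambda>_. M) (a k) \<otimes>\<^bsub>R\<^esub> f (c k)) = E (p1 (a k) \<otimes>\<^bsub>P2\<^esub> p2 (c k))"
      using k by (simp only: comp[OF proj_Units(1) M' EU(1) ac(1)] comp[OF proj_Units(2) Y EU(2) O_quot_carrier[OF ac(2)]]
        ring_hom_mult[OF \<iota> ev] base[OF ac(1)] lift[OF ac(2)])
  qed (use ac in \<open>auto intro!: ring_hom_closed[OF E] P2.m_closed proj_closed\<close>)
  also have "\<dots> = E (\<Oplus>\<^bsub>P2\<^esub>k\<in>{..<K}. p1 (a k) \<otimes>\<^bsub>P2\<^esub> p2 (c k))"
    using ac by (intro ring_hom_finsum[OF O_GL_cring R' E, symmetric]) (auto intro!: P2.m_closed proj_closed)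
  also have "(\<Oplus>\<^bsub>P2\<^esub>k\<in>{..<K}. p1 (a k) \<otimes>\<^bsub>P2\<^esub> p2 (c k)) = gl_eval n P2 (\<lambda>_. ?U \<otimes>\<^bsub>mat_monoid P2 n\<^esub> ?V) g"
    using dec by (simp add: coaction_decomp_def lessThan_atLeast0)
  also have "E \<dots> = gl_eval n R' (\<lambda>_. ?M \<otimes>\<^bsub>mat_monoid R' n\<^esub> Y) g"
  proof (rule comp[OF M2.Units_m_closed[OF proj_Units] MM.Units_m_closed[OF M' Y] _ O_quot_carrier[OF g]])
    show "mat_map n E (?U \<otimes>\<^bsub>mat_monoid P2 n\<^esub> ?V) = ?M \<otimes>\<^bsub>mat_monoid R' n\<^esub> Y"
      using mat_map_mult[OF O_GL_cring R' E M2.Units_closed[OF proj_Units(1)] M2.Units_closed[OF proj_Units(2)]]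
      by (simp only: EU)
  qed
  finally show "\<iota> (\<Oplus>\<^bsub>R\<^esub>k\<in>{..<K}. gl_eval n R (\<lambda>_. M) (a k) \<otimes>\<^bsub>R\<^esub> f (c k)) =
      gl_eval n R' (\<lambda>_. ?M \<otimes>\<^bsub>mat_monoid R' n\<^esub> Y) g" .
qed

text \<open>The action is a definite description over all decompositions. A value exists by
  \<open>univ_decomp\<close> and is unique because by \<open>coaction_value\<close> all
  decompositions have the same image under the injective \<open>\<iota>\<close>. That image is a
  structure constant at a product of matrices, hence given by the change of basis.\<close>

lemma quot_act_univ:
  fixes R :: "'r ring"
  assumes R: "cring R" and f: "f \<in> ring_hom Q1 R" and M: "M \<in> Units (mat_monoid R n)"
  shows "i < n \<Longrightarrow> j < n \<Longrightarrow> k < n \<Longrightarrow> quot_act n R M f (univ_mult n i j k) =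
      basis_change_mult n R M (\<lambda>i j k. f (univ_mult n i j k)) i j k"
    "k < n \<Longrightarrow> quot_act n R M f (univ_unit n k) = basis_change_unit n R M (\<lambda>k. f (univ_unit n k)) k"
proof -
  obtain R' :: "'r split_var int_mpoly set ring" and \<iota> Y
    where R': "cring R'" and \<iota>: "\<iota> \<in> ring_hom R R'" "inj_on \<iota> (carrier R)" and Y: "Y \<in> Units (mat_monoid R' n)"
    and lift: "\<And>g. g \<in> carrier Q1 \<Longrightarrow> gl_eval n R' (\<lambda>_. Y) g = \<iota> (f g)"
    by (rule point_lift[OF R f]) blast
  interpret MM: monoid "mat_monoid R' n" by (rule mat_monoid_monoid[OF R'])
  let ?M = "mat_map n \<iota> M"
  have M': "?M \<in> Units (mat_monoid R' n)" by (rule mat_map_Units(1)[OF R R' \<iota>(1) M])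
  have act: "quot_act n R M f g = r"
    if g: "g \<in> carrier Q1" and dec: "\<exists>K a c. coaction_decomp n g K a c" and r: "r \<in> carrier R"
      "\<iota> r = gl_eval n R' (\<lambda>_. ?M \<otimes>\<^bsub>mat_monoid R' n\<^esub> Y) g" for g r
  proof -
    have eq: "(\<Oplus>\<^bsub>R\<^esub>k\<in>{..<K}. gl_eval n R (\<lambda>_. M) (a k) \<otimes>\<^bsub>R\<^esub> f (c k)) = r"
      if "coaction_decomp n g K a c" for K a c
    proof (rule inj_onD[OF \<iota>(2) _ _ r(1)])
      show "(\<Oplus>\<^bsub>R\<^esub>k\<in>{..<K}. gl_eval n R (\<lambda>_. M) (a k) \<otimes>\<^bsub>R\<^esub> f (c k)) \<in> carrier R"
        by (rule coaction_value(2)[OF R f M R' \<iota>(1) Y _ g that], erule lift)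
      show "\<iota> (\<Oplus>\<^bsub>R\<^esub>k\<in>{..<K}. gl_eval n R (\<lambda>_. M) (a k) \<otimes>\<^bsub>R\<^esub> f (c k)) = \<iota> r"
        unfolding r(2) by (rule coaction_value(1)[OF R f M R' \<iota>(1) Y _ g that], erule lift)
    qed
    have "quot_act n R M f g = (THE r. \<exists>K a c. coaction_decomp n g K a c \<and>
        r = (\<Oplus>\<^bsub>R\<^esub>k\<in>{..<K}. gl_eval n R (\<lambda>_. M) (a k) \<otimes>\<^bsub>R\<^esub> f (c k)))"
      using g by (simp add: quot_act_def)
    also have "\<dots> = r"
    proof (rule the_equality)
      obtain K a c where "coaction_decomp n g K a c" using dec by blast
      then show "\<exists>K a c. coaction_decomp n g K a c \<and> r = (\<Oplus>\<^bsub>R\<^esub>k\<in>{..<K}. gl_eval n R (\<lambda>_. M) (a k) \<otimes>\<^bsub>R\<^esub> f (c k))"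
        using eq by blast
    qed (use eq in blast)
    finally show ?thesis .
  qed
  note bc = basis_change_hom[OF R R' \<iota>(1) M, where c = "\<lambda>i j k. f (univ_mult n i j k)" and u = "\<lambda>k. f (univ_unit n k)"
      and c' = "split_mult n R' Y" and u' = "split_unit n R' Y"]
  have c: "split_mult n R' Y i j k = \<iota> (f (univ_mult n i j k))" if "i < n" "j < n" "k < n" for i j k
    using lift[OF univ_closed(1)[OF that]] gl_eval_split(1)[OF R' Y that] by simp
  have u: "split_unit n R' Y k = \<iota> (f (univ_unit n k))" if "k < n" for k
    using lift[OF univ_closed(2)[OF that]] gl_eval_split(2)[OF R' Y that] by simp
  note closed = ring_hom_closed[OF f univ_closed(1)] ring_hom_closed[OF f univ_closed(2)]
  note MY = MM.Units_m_closed[OF M' Y]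
  show "quot_act n R M f (univ_mult n i j k) = basis_change_mult n R M (\<lambda>i j k. f (univ_mult n i j k)) i j k"
    if ijk: "i < n" "j < n" "k < n"
  proof (rule act[OF univ_closed(1)[OF ijk] univ_decomp(1)[OF ijk]])
    show "basis_change_mult n R M (\<lambda>i j k. f (univ_mult n i j k)) i j k \<in> carrier R"
      by (rule bc(3)) (simp_all add: closed c u ijk)
    show "\<iota> (basis_change_mult n R M (\<lambda>i j k. f (univ_mult n i j k)) i j k) =
        gl_eval n R' (\<lambda>_. ?M \<otimes>\<^bsub>mat_monoid R' n\<^esub> Y) (univ_mult n i j k)"
      unfolding gl_eval_split(1)[OF R' MY ijk] split_basis_change(1)[OF R' M' Y ijk]
      by (rule bc(1)) (simp_all add: closed c u ijk)
  qed
  show "quot_act n R M f (univ_unit n k) = basis_change_unit n R M (\<lambda>k. f (univ_unit n k)) k" if k: "k < n"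
  proof (rule act[OF univ_closed(2)[OF k] univ_decomp(2)[OF k]])
    show "basis_change_unit n R M (\<lambda>k. f (univ_unit n k)) k \<in> carrier R"
      by (rule bc(4)) (simp_all add: closed c u k)
    show "\<iota> (basis_change_unit n R M (\<lambda>k. f (univ_unit n k)) k) =
        gl_eval n R' (\<lambda>_. ?M \<otimes>\<^bsub>mat_monoid R' n\<^esub> Y) (univ_unit n k)"
      unfolding gl_eval_split(2)[OF R' MY k] split_basis_change(2)[OF R' M' Y k]
      by (rule bc(2)) (simp_all add: closed c u k)
  qed
qed

section \<open>The equivariant isomorphism of functors of points\<close>

section \<open>The isomorphism\<close>

definition quot_iso :: "'r ring \<Rightarrow> (gl_fun \<Rightarrow> 'r) \<Rightarrow> 'r based_alg set" where
  "quot_iso R f = based_iso n R `` {point_alg R f}"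

lemma based_class:
  assumes "p \<in> based_algs n R"
  shows "q \<in> based_iso n R `` {p} \<longleftrightarrow> q \<in> based_algs n R \<and>
    (\<forall>i<n. \<forall>j<n. \<forall>k<n. str_mult n R q i j k = str_mult n R p i j k) \<and>
    (\<forall>k<n. str_unit n R q k = str_unit n R p k)"
proof (cases "q \<in> based_algs n R")
  case True
  then show ?thesis using based_iso_iff[OF assms True] by simp
next
  case False
  then show ?thesis by (auto simp: based_iso_def)
qed

text \<open>Membership in the class is a condition on structure constants and unit only; classes are
  compared through this criterion below.\<close>

lemma quot_iso_iff:
  fixes R :: "'r ring"
  assumes R: "cring R" and f: "f \<in> ring_hom Q1 R"
  shows "q \<in> quot_iso R f \<longleftrightarrow> q \<in> based_algs n R \<and>
    (\<forall>i<n. \<forall>j<n. \<forall>k<n. str_mult n R q i j k = f (univ_mult n i j k)) \<and>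
    (\<forall>k<n. str_unit n R q k = f (univ_unit n k))"
  unfolding quot_iso_def based_class[OF point_alg_based(1)[OF R f]]
  using point_alg_based(2,3)[OF R f] by auto

text \<open>The discriminant is a function of the structure constants, so it takes one value on the
  class and \<open>the_elem\<close> returns it.\<close>

lemma Delta_class:
  fixes R :: "'r ring"
  assumes p: "p \<in> based_algs n R"
  shows "Delta n R (based_iso n R `` {p}) = disc n R p"
proof -
  obtain A \<phi> where A: "p = (A, \<phi>)" by (cases p)
  note R = based_R_cring[OF p[unfolded A]]
  have "disc n R q = disc n R p" if q: "q \<in> based_iso n R `` {p}" for q
  proof -
    note q' = q[unfolded based_class[OF p]]
    then have qb: "q \<in> based_algs n R" by simp
    have c: "str_mult n R p i j k \<in> carrier R" if "k < n" for i j k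
      unfolding A by (rule str_closed(1)[OF p[unfolded A] that])
    note tr = str_trace_hom[OF R R ring_hom_id, where c = "str_mult n R p" and c' = "str_mult n R q" and n = n]
    show ?thesis
      unfolding disc_eq[OF p] disc_eq[OF qb]
      by (rule mat_det_cong[OF R]) (use q' c tr in auto)
  qed
  moreover have "p \<in> based_iso n R `` {p}" unfolding based_class[OF p] using p by simp
  ultimately have "disc n R ` (based_iso n R `` {p}) = {disc n R p}" by blast
  then show ?thesis by (simp add: Delta_def)
qed

text \<open>Injectivity holds because a point is determined by its structure constants, surjectivity
  because \<open>etale_point\<close> produces a point with prescribed ones. The image lies in the
  etale locus since the trace form of a point is invertible.\<close>

lemma quot_iso_bij:
  fixes R :: "'r ring"
  assumes R: "cring R"
  shows "bij_betw (quot_iso R) (pts (GL_mod_S n) R) (pts (B_et n) R)"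
proof (rule bij_betw_imageI)
  show "inj_on (quot_iso R) (pts (GL_mod_S n) R)"
  proof (rule inj_onI)
    fix f f' assume "f \<in> pts (GL_mod_S n) R" "f' \<in> pts (GL_mod_S n) R" and eq: "quot_iso R f = quot_iso R f'"
    then have f: "f \<in> ring_hom Q1 R" "f' \<in> ring_hom Q1 R" "f \<in> extensional (carrier Q1)" "f' \<in> extensional (carrier Q1)"
      by (auto simp: GL_mod_S_def)
    have "point_alg R f \<in> quot_iso R f"
      using point_alg_based[OF R f(1)] by (simp add: quot_iso_iff[OF R f(1)])
    then have "point_alg R f \<in> quot_iso R f'" by (simp add: eq)
    then have "f g = f' g" if "g \<in> carrier Q1" for g
      using point_alg_based(2,3)[OF R f(1)]
      by (intro O_quot_hom_eqI[OF R f(1,2) _ _ that]) (auto simp: quot_iso_iff[OF R f(2)])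
    then show "f = f'" using f(3,4) by (intro extensionalityI[of f "carrier Q1"]) auto
  qed
  show "quot_iso R ` pts (GL_mod_S n) R = pts (B_et n) R"
  proof
    show "quot_iso R ` pts (GL_mod_S n) R \<subseteq> pts (B_et n) R"
    proof
      fix C assume "C \<in> quot_iso R ` pts (GL_mod_S n) R"
      then obtain f where f: "f \<in> ring_hom Q1 R" "C = quot_iso R f" by (auto simp: GL_mod_S_def)
      note p = point_alg_based[OF R f(1)]
      show "C \<in> pts (B_et n) R"
        using p(1,4) Delta_class[OF p(1)]
        by (auto simp: f(2) B_et_def B_pts_def quot_iso_def intro!: quotientI)
    qed
    show "pts (B_et n) R \<subseteq> quot_iso R ` pts (GL_mod_S n) R"
    proof
      fix C assume "C \<in> pts (B_et n) R"
      then obtain A \<phi> where p: "(A, \<phi>) \<in> based_algs n R" and C: "C = based_iso n R `` {(A, \<phi>)}"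
        and "Delta n R C \<in> Units R"
        by (auto simp: B_et_def B_pts_def elim!: quotientE)
      then have disc: "disc n R (A, \<phi>) \<in> Units R" by (simp add: Delta_class)
      obtain f where f: "f \<in> ring_hom Q1 R" "f \<in> extensional (carrier Q1)"
        "\<And>i j k. i < n \<Longrightarrow> j < n \<Longrightarrow> k < n \<Longrightarrow> f (univ_mult n i j k) = str_mult n R (A, \<phi>) i j k"
        "\<And>k. k < n \<Longrightarrow> f (univ_unit n k) = str_unit n R (A, \<phi>) k"
        by (rule etale_point[OF p disc]) blast
      have "quot_iso R f = C"
      proof (rule Set.set_eqI)
        fix q show "q \<in> quot_iso R f \<longleftrightarrow> q \<in> C"
          unfolding C based_class[OF p] quot_iso_iff[OF R f(1)] by (simp add: f(3,4))
      qed
      moreover have "f \<in> pts (GL_mod_S n) R" using f by (simp add: GL_mod_S_def)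
      ultimately show "C \<in> quot_iso R ` pts (GL_mod_S n) R" by blast
    qed
  qed
qed

text \<open>\<open>B_tr\<close> collects the base changes of all representatives of a class. By
  \<open>is_base_change_iff\<close> the representative does not matter, and both sides consist of
  the based algebras whose structure constants and unit are the images under h of those of
  f.\<close>

lemma quot_iso_natural:
  fixes R S :: "'r ring"
  assumes R: "cring R" and S: "cring S" and h: "h \<in> ring_hom R S" and f: "f \<in> ring_hom Q1 R"
  shows "quot_iso S (compose (carrier Q1) h f) = B_tr n R S h (quot_iso R f)"
proof (rule Set.set_eqI)
  let ?f = "compose (carrier Q1) h f"
  interpret Q1: cring Q1 by (rule O_quot_cring)
  have f': "?f \<in> ring_hom Q1 S"
    by (rule ring_hom_memI)
      (simp_all add: compose_def ring_hom_closed[OF h] ring_hom_closed[OF f] ring_hom_mult[OF f] ring_hom_mult[OF h]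
        ring_hom_add[OF f] ring_hom_add[OF h] ring_hom_one[OF f] ring_hom_one[OF h])
  note p = point_alg_based[OF R f]
  fix q
  show "q \<in> quot_iso S ?f \<longleftrightarrow> q \<in> B_tr n R S h (quot_iso R f)"
  proof (cases "q \<in> based_algs n S")
    case q: True
    have "is_base_change n R S h p' q \<longleftrightarrow>
        (\<forall>i<n. \<forall>j<n. \<forall>k<n. str_mult n S q i j k = h (f (univ_mult n i j k))) \<and>
        (\<forall>k<n. str_unit n S q k = h (f (univ_unit n k)))" if "p' \<in> quot_iso R f" for p'
      using that is_base_change_iff[OF _ q h, of p'] by (simp add: quot_iso_iff[OF R f])
    moreover have "point_alg R f \<in> quot_iso R f" using p by (simp add: quot_iso_iff[OF R f])
    ultimately have "q \<in> B_tr n R S h (quot_iso R f) \<longleftrightarrow>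
        (\<forall>i<n. \<forall>j<n. \<forall>k<n. str_mult n S q i j k = h (f (univ_mult n i j k))) \<and>
        (\<forall>k<n. str_unit n S q k = h (f (univ_unit n k)))"
      using q unfolding B_tr_def by blast
    then show ?thesis
      using q unfolding quot_iso_iff[OF S f'] by (simp add: compose_eq univ_closed)
  next
    case False
    then show ?thesis by (simp add: quot_iso_iff[OF S f'] B_tr_def)
  qed
qed

text \<open>Following the coordinate map by \<open>M\<close> changes structure constants and unit by
  the very formula that \<open>quot_act_univ\<close> gives for the action on the point, whichever
  representative of the class is taken.\<close>

lemma quot_iso_equivariant:
  fixes R :: "'r ring"
  assumes R: "cring R" and M: "M \<in> Units (mat_monoid R n)" and f: "f \<in> ring_hom Q1 R"
  shows "quot_iso R (quot_act n R M f) = B_act n R M (quot_iso R f)"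
proof (rule Set.set_eqI)
  interpret Rc: cring R by (rule R)
  define c where "c i j k = basis_change_mult n R M (\<lambda>i j k. f (univ_mult n i j k)) i j k" for i j k
  define u where "u k = basis_change_unit n R M (\<lambda>k. f (univ_unit n k)) k" for k
  have change: "(A, \<lambda>a. mat_vec R n M (\<phi> a)) \<in> based_algs n R"
    "\<And>i j k. i < n \<Longrightarrow> j < n \<Longrightarrow> k < n \<Longrightarrow> str_mult n R (A, \<lambda>a. mat_vec R n M (\<phi> a)) i j k = c i j k"
    "\<And>k. k < n \<Longrightarrow> str_unit n R (A, \<lambda>a. mat_vec R n M (\<phi> a)) k = u k"
    if "(A, \<phi>) \<in> quot_iso R f" for A \<phi>
  proof -
    note q = that[unfolded quot_iso_iff[OF R f]]
    then have p: "(A, \<phi>) \<in> based_algs n R" by simp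
    note bc = basis_change_hom[OF R R ring_hom_id M, where c = "\<lambda>i j k. f (univ_mult n i j k)" and u = "\<lambda>k. f (univ_unit n k)"
      and c' = "str_mult n R (A, \<phi>)" and u' = "str_unit n R (A, \<phi>)"]
    have M_map: "mat_map n (\<lambda>x. x) M = M"
      using M by (intro mat_eqI[OF R mat_map_closed[OF R R ring_hom_id]]) (simp_all add: mat_Units_iff[OF R])
    note closed = ring_hom_closed[OF f univ_closed(1)] ring_hom_closed[OF f univ_closed(2)]
    show "(A, \<lambda>a. mat_vec R n M (\<phi> a)) \<in> based_algs n R" by (rule based_mat_vec[OF R M p])
    show "str_mult n R (A, \<lambda>a. mat_vec R n M (\<phi> a)) i j k = c i j k" if ijk: "i < n" "j < n" "k < n" for i j k
    proof -
      have "basis_change_mult n R M (\<lambda>i j k. f (univ_mult n i j k)) i j k =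
          basis_change_mult n R (mat_map n (\<lambda>x. x) M) (str_mult n R (A, \<phi>)) i j k"
        by (rule bc(1)) (use q ijk closed in simp_all)
      then show ?thesis using basis_change(1)[OF R M p ijk] by (simp only: c_def M_map)
    qed
    show "str_unit n R (A, \<lambda>a. mat_vec R n M (\<phi> a)) k = u k" if k: "k < n" for k
    proof -
      have "basis_change_unit n R M (\<lambda>k. f (univ_unit n k)) k =
          basis_change_unit n R (mat_map n (\<lambda>x. x) M) (str_unit n R (A, \<phi>)) k"
        by (rule bc(2)) (use q k closed in simp_all)
      then show ?thesis using basis_change(2)[OF R M p k] by (simp only: u_def M_map)
    qed
  qed
  note p = point_alg_based[OF R f]
  obtain A \<phi> where A: "point_alg R f = (A, \<phi>)" by (cases "point_alg R f")
  have A': "(A, \<phi>) \<in> quot_iso R f" using p by (simp add: quot_iso_iff[OF R f] A)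
  have cu: "\<And>i j k. i < n \<Longrightarrow> j < n \<Longrightarrow> k < n \<Longrightarrow> quot_act n R M f (univ_mult n i j k) = c i j k"
    "\<And>k. k < n \<Longrightarrow> quot_act n R M f (univ_unit n k) = u k"
    by (simp_all add: quot_act_univ[OF R f M] c_def u_def)
  \<comment> \<open>The moved values satisfy the relations because they are the structure constants
    of the algebra of f with the changed coordinate map. This suffices for \<open>point_alg\<close>,
    so multiplicativity of \<open>quot_act n R M f\<close> does not enter.\<close>
  have "str_rel n R c u"
    by (rule str_rel_cong[OF R based_str_rel[OF change(1)[OF A']]]) (simp_all add: change(2,3)[OF A'])
  then have rel: "str_rel n R (\<lambda>i j k. quot_act n R M f (univ_mult n i j k)) (\<lambda>k. quot_act n R M f (univ_unit n k))"
    by (rule str_rel_cong[OF R]) (simp_all add: cu)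
  note std = std_alg_based[OF R rel, folded point_alg_def]
  fix q
  have "q \<in> quot_iso R (quot_act n R M f) \<longleftrightarrow> q \<in> based_algs n R \<and>
      (\<forall>i<n. \<forall>j<n. \<forall>k<n. str_mult n R q i j k = c i j k) \<and> (\<forall>k<n. str_unit n R q k = u k)"
    unfolding quot_iso_def based_class[OF std(1)] by (simp add: std(2,3) cu)
  moreover have "q \<in> B_act n R M (quot_iso R f) \<longleftrightarrow> q \<in> based_algs n R \<and>
      (\<forall>i<n. \<forall>j<n. \<forall>k<n. str_mult n R q i j k = c i j k) \<and> (\<forall>k<n. str_unit n R q k = u k)" (is "_ \<longleftrightarrow> ?rhs")
  proof -
    have cl: "q \<in> based_iso n R `` {(B, \<lambda>a. mat_vec R n M (\<psi> a))} \<longleftrightarrow> ?rhs" if "(B, \<psi>) \<in> quot_iso R f" for B \<psi>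
      unfolding based_class[OF change(1)[OF that]] by (simp add: change(2,3)[OF that])
    show ?thesis
    proof
      assume "q \<in> B_act n R M (quot_iso R f)"
      then obtain B \<psi> where B: "(B, \<psi>) \<in> quot_iso R f" "q \<in> based_iso n R `` {(B, \<lambda>a. mat_vec R n M (\<psi> a))}"
        unfolding B_act_def by (elim UN_E) (simp split: prod.splits)
      show ?rhs by (rule iffD1[OF cl[OF B(1)] B(2)])
    next
      assume ?rhs
      then have "q \<in> based_iso n R `` {(A, \<lambda>a. mat_vec R n M (\<phi> a))}" by (rule iffD2[OF cl[OF A']])
      then show "q \<in> B_act n R M (quot_iso R f)"
        unfolding B_act_def by (intro UN_I[OF A']) simp
    qed
  qed
  ultimately show "q \<in> quot_iso R (quot_act n R M f) \<longleftrightarrow> q \<in> B_act n R M (quot_iso R f)" by (simp only:)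
qed

end

theorem theorem6p3:
  fixes n :: nat
  shows "\<exists>\<eta> :: 'r ring \<Rightarrow> (gl_fun \<Rightarrow> 'r) \<Rightarrow> 'r based_alg set.
           natural_iso (GL_mod_S n) (B_et n) \<eta> \<and> equivariant n (GL_mod_S n) (B_et n) \<eta>"
proof (intro exI conjI)
  show "natural_iso (GL_mod_S n) (B_et n) (quot_iso n :: 'r ring \<Rightarrow> _)"
    unfolding natural_iso_def
  proof (intro conjI allI impI)
    fix R S :: "'r ring" and h x
    assume *: "cring R" "cring S" "h \<in> ring_hom R S" "x \<in> pts (GL_mod_S n) R"
    then show "quot_iso n S (tr (GL_mod_S n) R S h x) = tr (B_et n) R S h (quot_iso n R x)"
      using quot_iso_natural[OF *(1-3)] by (simp add: GL_mod_S_def B_et_def)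
  qed (rule quot_iso_bij)
  show "equivariant n (GL_mod_S n) (B_et n) (quot_iso n :: 'r ring \<Rightarrow> _)"
    unfolding equivariant_def
  proof (intro allI impI)
    fix R :: "'r ring" and M x
    assume *: "cring R" "M \<in> carrier (GL n R)" "x \<in> pts (GL_mod_S n) R"
    then show "quot_iso n R (act (GL_mod_S n) R M x) = act (B_et n) R M (quot_iso n R x)"
      using quot_iso_equivariant[OF *(1)] by (simp add: GL_mod_S_def B_et_def GL_def units_of_def)
  qed
qed

end
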